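(* Let $\mathbb{K}$ be an arbitrary field, $\ell\ge 2$, and let $\mathcal{A}$ be a central $\ell$-arrangement in $V=\mathbb{K}^\ell$. Suppose there is a flag $V=X_0\supset X_1\supset\cdots\supset X_{\ell-2}$ such that $X_i\in L_i(\mathcal{A})$ for $i=0,\dots,\ell-2$ and $\chi(\mathcal{A}^{X_{i+1}};t)$ divides $\chi(\mathcal{A}^{X_i};t)$ for $i=0,\dots,\ell-3$. Then $\mathcal{A}$ is free.
   Context: A (central) $\ell$-arrangement $\mathcal{A}$ is a finite set of linear hyperplanes in an $\ell$-dimensional vector space $V$ over a field $\mathbb{K}$; for $H\in\mathcal{A}$ fix $\alpha_H\in V^*$ with $\ker\alpha_H=H$. $L(\mathcal{A})$ is the set of all intersections of subsets of $\mathcal{A}$ (with $V$ the empty intersection), and $L_i(\mathcal{A})=\{X\in L(\mathcal{A})\mid\mathrm{codim}_VX=i\}$. For $X\in L(\mathcal{A})$ put $\mathcal{A}_X=\{H\in\mathcal{A}\mid H\supset X\}$; the restriction $\mathcal{A}^X=\{H\cap X\mid H\in\mathcal{A}\setminus\mathcal{A}_X\}$ is an arrangement in the vector space $X$. The Möbius function $\mu:L(\mathcal{A})\to\mathbb{Z}$ is given by $\mu(V)=1$ and $\mu(X)=-\sum_{Y\in L(\mathcal{A}),\,X\subsetneq Y}\mu(Y)$ for $X\ne V$; the characteristic polynomial is $\chi(\mathcal{A};t)=\sum_{X\in L(\mathcal{A})}\mu(X)t^{\dim X}$. Divisibility is divisibility of polynomials in $t$. Let $S=\mathrm{Sym}(V^*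 )=\mathbb{K}[x_1,\dots,x_\ell]$ and $\mathrm{Der}\,S=\bigoplus_{i}S\partial_{x_i}$. The logarithmic derivation module is $D(\mathcal{A})=\{\theta\in\mathrm{Der}\,S\mid\theta(\alpha_H)\in S\alpha_H\ \forall H\in\mathcal{A}\}$. $\mathcal{A}$ is free if $D(\mathcal{A})$ has an $S$-basis of homogeneous derivations $\theta_1,\dots,\theta_\ell$. *)

theory Defs
  imports "HOL-Analysis.Analysis" "HOL-Library.Poly_Mapping"
begin

section \<open>Arrangements and their characteristic polynomials\<close>

text \<open>
  The vector space \<open>V = K\<^sup>\<ell>\<close> is the type \<open>'k ^ 'n\<close> with \<open>\<ell> = CARD('n)\<close>. Restrictions are
  arrangements in proper subspaces of \<open>V\<close>, so every notion below takes the ambient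
  subspace \<open>W\<close> as an argument.
\<close>

definition central_arrangement :: "('k::field ^ 'n) set \<Rightarrow> ('k ^ 'n) set set \<Rightarrow> bool" where
  "central_arrangement W A \<longleftrightarrow>
     vec.subspace W \<and> finite A \<and>
     (\<forall>H\<in>A. vec.subspace H \<and> H \<subseteq> W \<and> vec.dim H + 1 = vec.dim W)"

text \<open>Intersecting with \<open>W\<close> makes the empty intersection equal to \<open>W\<close>.\<close>

definition int_lattice :: "('k::field ^ 'n) set \<Rightarrow> ('k ^ 'n) set set \<Rightarrow> ('k ^ 'n) set set" where
  "int_lattice W A = {W \<inter> \<Inter>B |B. B \<subseteq> A}"

definition int_lattice_codim ::
  "('k::field ^ 'n) set \<Rightarrow> ('k ^ 'n) set set \<Rightarrow> nat \<Rightarrow> ('k ^ 'n) set set" where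
  "int_lattice_codim W A i = {X \<in> int_lattice W A. vec.dim X + i = vec.dim W}"

definition localization :: "('k::field ^ 'n) set set \<Rightarrow> ('k ^ 'n) set \<Rightarrow> ('k ^ 'n) set set" where
  "localization A X = {H \<in> A. X \<subseteq> H}"

definition restriction :: "('k::field ^ 'n) set set \<Rightarrow> ('k ^ 'n) set \<Rightarrow> ('k ^ 'n) set set" where
  "restriction A X = (\<lambda>H. H \<inter> X) ` (A - localization A X)"

lemma finite_int_lattice: "finite A \<Longrightarrow> finite (int_lattice W A)"
proof -
  assume "finite A"
  moreover have "int_lattice W A = (\<lambda>B. W \<inter> \<Inter>B) ` Pow A"
    by (auto simp: int_lattice_def)
  ultimately show ?thesis by simp
qed

text \<open>The guard \<open>finite A\<close> is there only for termination; arrangements are finite.\<close>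

function moebius :: "('k::field ^ 'n) set \<Rightarrow> ('k ^ 'n) set set \<Rightarrow> ('k ^ 'n) set \<Rightarrow> int" where
  "moebius W A X =
     (if X = W then 1
      else if finite A then - (\<Sum>Y\<in>{Y \<in> int_lattice W A. X \<subset> Y}. moebius W A Y)
      else 0)"
  by pat_completeness auto
termination
proof (relation "Wellfounded.measure (\<lambda>(W, A, X). card {Y \<in> int_lattice W A. X \<subset> Y})", goal_cases)
  case 1
  show ?case by simp
next
  case (2 W A X Y)
  have "{Z \<in> int_lattice W A. Y \<subset> Z} \<subset> {Z \<in> int_lattice W A. X \<subset> Z}"
    using 2 by auto
  with 2 show ?case
    by (auto intro!: psubset_card_mono simp: finite_int_lattice)
qed

declare moebius.simps [simp del]

definition arr_charpoly :: "('k::field ^ 'n) set \<Rightarrow> ('k ^ 'n) set set \<Rightarrow> int poly" where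
  "arr_charpoly W A = (\<Sum>X\<in>int_lattice W A. monom (moebius W A X) (vec.dim X))"

section \<open>Logarithmic derivations and freeness\<close>

text \<open>
  \<open>S = K[x\<^sub>i | i :: 'n]\<close>: a polynomial maps a monomial, given by its exponents \<open>'n \<Rightarrow>\<^sub>0 nat\<close>,
  to its coefficient.
\<close>

type_synonym ('k, 'n) mpoly = "('n \<Rightarrow>\<^sub>0 nat) \<Rightarrow>\<^sub>0 'k"

definition mvar_deriv :: "'n \<Rightarrow> ('k::field, 'n) mpoly \<Rightarrow> ('k, 'n) mpoly" where
  "mvar_deriv i f =
     (\<Sum>m\<in>Poly_Mapping.keys f.
        Poly_Mapping.single (m - Poly_Mapping.single i 1)
          (of_nat (Poly_Mapping.lookup m i) * Poly_Mapping.lookup f m))"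

definition mhomogeneous :: "nat \<Rightarrow> ('k::field, 'n::finite) mpoly \<Rightarrow> bool" where
  "mhomogeneous d f \<longleftrightarrow>
     (\<forall>m\<in>Poly_Mapping.keys f. (\<Sum>i\<in>UNIV. Poly_Mapping.lookup m i) = d)"

text \<open>
  The covector with coordinates \<open>a\<close>, as an element of \<open>S\<close> of degree one and as a kernel in \<open>V\<close>.
\<close>

definition linear_form :: "'k::field ^ 'n \<Rightarrow> ('k, 'n::finite) mpoly" where
  "linear_form a = (\<Sum>i\<in>UNIV. Poly_Mapping.single (Poly_Mapping.single i 1) (a $ i))"

definition covector_kernel :: "'k::field ^ 'n \<Rightarrow> ('k ^ 'n) set" where
  "covector_kernel a = {v. (\<Sum>i\<in>UNIV. a $ i * v $ i) = 0}"

text \<open>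
  An element \<open>\<theta> :: S ^ 'n\<close> of \<open>Der S\<close> stands for the derivation \<open>\<Sum>\<^sub>i \<theta>\<^sub>i \<partial>/\<partial>x\<^sub>i\<close>.
\<close>

type_synonym ('k, 'n) der = "('k, 'n) mpoly ^ 'n"

definition der_apply :: "('k::field, 'n::finite) der \<Rightarrow> ('k, 'n) mpoly \<Rightarrow> ('k, 'n) mpoly" where
  "der_apply \<theta> f = (\<Sum>i\<in>UNIV. \<theta> $ i * mvar_deriv i f)"

definition der_homogeneous :: "('k::field, 'n::finite) der \<Rightarrow> bool" where
  "der_homogeneous \<theta> \<longleftrightarrow> (\<exists>d. \<forall>i. mhomogeneous d (\<theta> $ i))"

text \<open>
  The form \<open>\<alpha>\<^sub>H\<close> with kernel \<open>H\<close> is unique up to a nonzero scalar, so instead of fixing a choice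
  the condition is imposed for every such form.
\<close>

definition log_der :: "('k::field ^ 'n) set set \<Rightarrow> ('k, 'n::finite) der set" where
  "log_der A =
     {\<theta>. \<forall>H\<in>A. \<forall>a. covector_kernel a = H \<longrightarrow>
            linear_form a dvd der_apply \<theta> (linear_form a)}"

lemma module_vec: "module ((*s) :: 'a::comm_ring_1 \<Rightarrow> 'a ^ 'n \<Rightarrow> 'a ^ 'n)"
  by unfold_locales (vector algebra_simps)+

definition free_arrangement :: "('k::field ^ 'n::finite) set set \<Rightarrow> bool" where
  "free_arrangement A \<longleftrightarrow>
     (\<exists>B :: ('k, 'n) der set.
        card B = CARD('n) \<and>
        (\<forall>\<theta>\<in>B. der_homogeneous \<theta>) \<and>
        \<not> module.dependent (*s) B \<and>
        module.span (*s) B = log_der A)"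

end

theory Submission
  imports Defs
begin

text \<open>
  Freeness is carried up the flag, from \<open>A\<^sup>H\<close> to \<open>A\<close> for a hyperplane \<open>H = ker z\<close> of \<open>A\<close>. A
  homogeneous basis of \<open>D(A\<^sup>H)\<close> consists of the Euler derivation and further elements \<open>\<phi>\<close>; it
  yields a basis of \<open>D(A)\<close> once every \<open>\<phi>\<close> can be lifted, up to multiples of the Euler derivation,
  to a derivation which kills \<open>z\<close> and is logarithmic for the other hyperplanes.

  The quotient of \<open>\<chi>(A)\<close> by \<open>\<chi>(A\<^sup>H)\<close> is monic and linear, so divisibility says that
  \<open>b\<^sub>2(A) = b\<^sub>2(A\<^sup>H) + |A\<^sup>H| (|A| - |A\<^sup>H|)\<close>. Both sides are sums over the flats \<open>Y\<close> of codimension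
  two in \<open>H\<close>. Counting dimensions of homogeneous parts in the rank three arrangement \<open>A\<^sub>Y\<close> gives
  an inequality between the summands at each \<open>Y\<close>. Hence every one of them is an equality, and then the
  count shows that the lifts exist for \<open>A\<^sub>Y\<close>.

  So the obstruction to lifting \<open>\<phi>\<close> is killed, for every \<open>Y\<close>, by the product of the hyperplanes of
  \<open>A\<close> that do not contain \<open>Y\<close>. These products generate an ideal of depth at least three. By the
  resulting vanishing, which for products of ideals of linear forms follows from Koszul complexes, the
  local lifts glue: first to a correction of \<open>\<phi>\<close> by a multiple of the Euler derivation, then to a lift
  modulo each power of \<open>z\<close>, which is exact when the power exceeds the degree.
\<close>

section \<open>Polynomials, substitution and linear forms\<close>

text \<open>Members of \<open>D0\<close> kill \<open>z\<close>. The Euler derivation maps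
  \<open>z\<close> to itself, so in every characteristic \<open>D(A)\<close> is the direct sum of
  the Euler multiples and \<open>D0\<close>, and only \<open>D0\<close> has to be studied. The
  obstacle is that a multiple \<open>f *s E\<close> restricted from \<open>D0\<close> must satisfy
  \<open>B dvd f\<close>. Lifts therefore exist only after an Euler correction, and
  \<open>B *s E\<close> itself has to be lifted too; the candidate for the image of
  \<open>D0\<close> is the free module \<open>G\<close> on \<open>B *s E\<close> and the corrected
  basis elements. Depth three is what gluing needs: a homomorphism from an ideal to
  \<open>M / G\<close> comes from an element once Ext^1 into \<open>M\<close> and Ext^2 into
  \<open>G\<close> vanish, with \<open>M\<close> and \<open>G\<close> free. In rank three the
  homogeneous parts of \<open>D0\<close> are estimated twice: from above through the restriction to
  the hyperplane, from below by adding the other hyperplanes one at a time. In large degrees both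
  estimates grow alike and differ by a constant. Its sign is the local inequality, and if it is 0
  nothing can fail to lift.\<close>

definition mconst :: "'k::field \<Rightarrow> ('k, 'n::finite) mpoly" where
  "mconst c = Poly_Mapping.single 0 c"

definition mono_deg :: "('n::finite \<Rightarrow>\<^sub>0 nat) \<Rightarrow> nat" where
  "mono_deg m = (\<Sum>i\<in>UNIV. Poly_Mapping.lookup m i)"

lemma mconst_0 [simp]: "mconst 0 = 0" and mconst_1 [simp]: "mconst 1 = 1"
  by (simp_all add: mconst_def)

lemma mconst_add: "mconst (a + b) = mconst a + mconst b"
  and mconst_diff: "mconst (a - b) = mconst a - mconst b"
  and mconst_minus: "mconst (- a) = - mconst a"
  and mconst_mult: "mconst (a * b) = mconst a * mconst b"
  by (simp_all add: mconst_def single_add single_diff single_uminus mult_single)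

lemma mconst_sum: "mconst (sum f A) = (\<Sum>x\<in>A. mconst (f x))"
  by (induction A rule: infinite_finite_induct) (simp_all add: mconst_add)

lemma mpoly_sum_monomials:
  "(\<Sum>m\<in>Poly_Mapping.keys f. Poly_Mapping.single m (Poly_Mapping.lookup f m)) = f"
proof (rule poly_mapping_eqI)
  fix k
  have "(\<Sum>m\<in>Poly_Mapping.keys f. Poly_Mapping.lookup (Poly_Mapping.single m (Poly_Mapping.lookup f m)) k)
      = (\<Sum>m\<in>Poly_Mapping.keys f. if m = k then Poly_Mapping.lookup f m else 0)"
    by (intro sum.cong) (auto simp: lookup_single when_def)
  then show "Poly_Mapping.lookup (\<Sum>m\<in>Poly_Mapping.keys f. Poly_Mapping.single m (Poly_Mapping.lookup f m)) k
      = Poly_Mapping.lookup f k"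
    by (auto simp: lookup_sum in_keys_iff)
qed

lemma mpoly_induct [case_names single add]:
  fixes f :: "'a \<Rightarrow>\<^sub>0 'b::comm_monoid_add"
  assumes "\<And>m c. P (Poly_Mapping.single m c)"
    and "\<And>f g. P f \<Longrightarrow> P g \<Longrightarrow> P (f + g)"
  shows "P f"
proof -
  have "P 0" using assms(1)[of undefined 0] by simp
  have "finite S \<Longrightarrow> P (\<Sum>m\<in>S. Poly_Mapping.single m (Poly_Mapping.lookup f m))" for S
    by (induction S rule: finite_induct) (use assms \<open>P 0\<close> in auto)
  from this[of "Poly_Mapping.keys f"] show ?thesis by (simp add: mpoly_sum_monomials)
qed

text \<open>The library has this only for linearly ordered monoids of exponents; the index type
  \<open>'n\<close> is embedded into \<open>nat\<close> to reduce to that case.\<close>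

lemma mpoly_mult_eq_0:
  fixes f g :: "('k::field, 'n::finite) mpoly"
  assumes "f * g = 0"
  shows "f = 0 \<or> g = 0"
proof -
  obtain e :: "'n \<Rightarrow> nat" where e: "inj e"
    using finite_imp_inj_to_nat_seg[of "UNIV :: 'n set"] by auto
  define E :: "('n \<Rightarrow>\<^sub>0 nat) \<Rightarrow> (nat \<Rightarrow>\<^sub>0 nat)" where
    "E m = (\<Sum>i\<in>UNIV. Poly_Mapping.single (e i) (Poly_Mapping.lookup m i))" for m
  have lookup_E: "Poly_Mapping.lookup (E m) (e i) = Poly_Mapping.lookup m i" for m i
  proof -
    have "Poly_Mapping.lookup (E m) (e i)
        = (\<Sum>j\<in>UNIV. if j = i then Poly_Mapping.lookup m j else 0)"
      unfolding E_def lookup_sum lookup_single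
      by (intro sum.cong) (auto simp: when_def dest: injD[OF e])
    then show ?thesis by simp
  qed
  have E_add: "E (m + m') = E m + E m'" for m m'
    by (simp add: E_def lookup_add single_add sum.distrib)
  have inj_E: "inj E"
    by (rule injI, rule poly_mapping_eqI) (metis lookup_E)
  define T :: "('k, 'n) mpoly \<Rightarrow> ((nat \<Rightarrow>\<^sub>0 nat) \<Rightarrow>\<^sub>0 'k)" where
    "T f = (\<Sum>m\<in>Poly_Mapping.keys f. Poly_Mapping.single (E m) (Poly_Mapping.lookup f m))" for f
  have T_sup: "T f = (\<Sum>m\<in>S. Poly_Mapping.single (E m) (Poly_Mapping.lookup f m))"
    if "finite S" "Poly_Mapping.keys f \<subseteq> S" for f S
    unfolding T_def using that by (intro sum.mono_neutral_left) (auto simp: in_keys_iff)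
  have T_add: "T (f + g) = T f + T g" for f g
    using T_sup[of "Poly_Mapping.keys f \<union> Poly_Mapping.keys g" f]
      T_sup[of "Poly_Mapping.keys f \<union> Poly_Mapping.keys g" g]
      T_sup[of "Poly_Mapping.keys f \<union> Poly_Mapping.keys g" "f + g"] keys_add[of f g]
    by (simp add: lookup_add single_add sum.distrib)
  have T_single: "T (Poly_Mapping.single m c) = Poly_Mapping.single (E m) c" for m c
    using T_sup[of "{m}" "Poly_Mapping.single m c"] by simp
  have T_mult: "T (f * g) = T f * T g" for f g
  proof (induction f rule: mpoly_induct)
    case (single m c)
    show ?case
      by (induction g rule: mpoly_induct)
        (simp_all add: T_single mult_single E_add distrib_left T_add)
  qed (simp add: distrib_right T_add)
  have T_lookup: "Poly_Mapping.lookup (T f) (E m) = Poly_Mapping.lookup f m" for f m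
  proof -
    have "Poly_Mapping.lookup (T f) (E m)
        = (\<Sum>m'\<in>Poly_Mapping.keys f. if m' = m then Poly_Mapping.lookup f m' else 0)"
      unfolding T_def lookup_sum lookup_single
      by (intro sum.cong) (auto simp: when_def dest: injD[OF inj_E])
    then show ?thesis by (auto simp: in_keys_iff)
  qed
  have "T f * T g = 0" using assms T_mult[of f g] T_single[of 0 0] by simp
  then have "T f = 0 \<or> T g = 0" by (rule mult_eq_0_iff[THEN iffD1])
  then show ?thesis
    by (metis T_lookup lookup_zero poly_mapping_eqI)
qed

lemma mpoly_mult_left_cancel:
  fixes d f g :: "('k::field, 'n::finite) mpoly"
  shows "d \<noteq> 0 \<Longrightarrow> d * f = d * g \<Longrightarrow> f = g"
  using mpoly_mult_eq_0[of d "f - g"] by (simp add: right_diff_distrib)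

lemma mpoly_prod_nonzero:
  fixes f :: "'a \<Rightarrow> ('k::field, 'n::finite) mpoly"
  shows "finite S \<Longrightarrow> (\<And>a. a \<in> S \<Longrightarrow> f a \<noteq> 0) \<Longrightarrow> prod f S \<noteq> 0"
  by (induction S rule: finite_induct) (auto dest: mpoly_mult_eq_0)

lemma mpoly_dvd_mult_cancel_left:
  fixes d f g :: "('k::field, 'n::finite) mpoly"
  shows "d \<noteq> 0 \<Longrightarrow> d * f dvd d * g \<Longrightarrow> f dvd g"
  by (auto simp: dvd_def mult.assoc dest: mpoly_mult_left_cancel)

definition msubst :: "('n::finite \<Rightarrow> ('k::field, 'n) mpoly) \<Rightarrow> ('k, 'n) mpoly \<Rightarrow> ('k, 'n) mpoly" where
  "msubst p f = (\<Sum>m\<in>Poly_Mapping.keys f.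
     mconst (Poly_Mapping.lookup f m) * (\<Prod>i\<in>UNIV. p i ^ Poly_Mapping.lookup m i))"

lemma msubst_superset:
  assumes "finite S" "Poly_Mapping.keys f \<subseteq> S"
  shows "msubst p f = (\<Sum>m\<in>S.
     mconst (Poly_Mapping.lookup f m) * (\<Prod>i\<in>UNIV. p i ^ Poly_Mapping.lookup m i))"
  unfolding msubst_def using assms
  by (intro sum.mono_neutral_left) (auto simp: in_keys_iff)

lemma msubst_single:
  "msubst p (Poly_Mapping.single m c) = mconst c * (\<Prod>i\<in>UNIV. p i ^ Poly_Mapping.lookup m i)"
  using msubst_superset[of "{m}" "Poly_Mapping.single m c" p] by simp

lemma msubst_0 [simp]: "msubst p 0 = 0"
  by (simp add: msubst_def)

lemma msubst_mconst [simp]: "msubst p (mconst c) = mconst c"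
  by (simp add: mconst_def msubst_single)

lemma msubst_1 [simp]: "msubst p 1 = 1"
  by (metis mconst_1 msubst_mconst)

lemma msubst_add [simp]: "msubst p (f + g) = msubst p f + msubst p g"
  using msubst_superset[of "Poly_Mapping.keys f \<union> Poly_Mapping.keys g" f]
    msubst_superset[of "Poly_Mapping.keys f \<union> Poly_Mapping.keys g" g]
    msubst_superset[of "Poly_Mapping.keys f \<union> Poly_Mapping.keys g" "f + g"] keys_add[of f g]
  by (simp add: lookup_add mconst_add sum.distrib distrib_right)

lemma msubst_mult [simp]: "msubst p (f * g) = msubst p f * msubst p g"
proof (induction f rule: mpoly_induct)
  case (single m c)
  show ?case
    by (induction g rule: mpoly_induct)
      (simp_all add: msubst_single mult_single lookup_add power_add prod.distrib mconst_mult
        distrib_left distrib_right mult_ac)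
qed (simp add: distrib_right)

lemma msubst_minus [simp]: "msubst p (- f) = - msubst p f"
  using msubst_add[of p f "- f"] by (simp add: eq_neg_iff_add_eq_0 add.commute)

lemma msubst_diff [simp]: "msubst p (f - g) = msubst p f - msubst p g"
  using msubst_add[of p f "- g"] by simp

lemma msubst_sum: "msubst p (sum f A) = (\<Sum>x\<in>A. msubst p (f x))"
  by (induction A rule: infinite_finite_induct) simp_all

lemma msubst_prod: "msubst p (prod f A) = (\<Prod>x\<in>A. msubst p (f x))"
  by (induction A rule: infinite_finite_induct) simp_all

lemma msubst_power: "msubst p (f ^ n) = msubst p f ^ n"
  by (induction n) simp_all

lemma msubst_dvd: "f dvd g \<Longrightarrow> msubst p f dvd msubst p g"
  by (auto simp: dvd_def)

lemma msubst_msubst: "msubst p (msubst q f) = msubst (\<lambda>i. msubst p (q i)) f"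
  by (induction f rule: mpoly_induct)
    (simp_all add: msubst_single msubst_prod msubst_power)

lemma dvd_power_diff: "(d::'a::comm_ring_1) dvd a - b \<Longrightarrow> d dvd a ^ n - b ^ n"
proof (induction n)
  case (Suc n)
  have "a ^ Suc n - b ^ Suc n = a * (a ^ n - b ^ n) + (a - b) * b ^ n"
    by (simp add: algebra_simps)
  then show ?case using Suc by simp
qed simp

lemma dvd_prod_diff:
  fixes a b :: "'i \<Rightarrow> 'a::comm_ring_1"
  shows "finite S \<Longrightarrow> (\<And>i. i \<in> S \<Longrightarrow> d dvd a i - b i) \<Longrightarrow> d dvd prod a S - prod b S"
proof (induction S rule: finite_induct)
  case (insert x S)
  have "prod a (insert x S) - prod b (insert x S)
      = a x * (prod a S - prod b S) + (a x - b x) * prod b S"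
    using insert by (simp add: algebra_simps)
  then show ?case using insert by simp
qed simp

lemma msubst_diff_dvd:
  assumes "\<And>i. d dvd p i - q i"
  shows "d dvd msubst p f - msubst q f"
proof (induction f rule: mpoly_induct)
  case (single m c)
  have "d dvd (\<Prod>i\<in>UNIV. p i ^ Poly_Mapping.lookup m i) - (\<Prod>i\<in>UNIV. q i ^ Poly_Mapping.lookup m i)"
    by (intro dvd_prod_diff dvd_power_diff assms) simp
  then show ?case
    by (simp add: msubst_single flip: right_diff_distrib)
next
  case (add f g)
  then have "d dvd (msubst p f - msubst q f) + (msubst p g - msubst q g)" by (rule dvd_add)
  then show ?case by (simp add: algebra_simps)
qed

subsection \<open>Homogeneous components\<close>

lemma mhomogeneous_alt: "mhomogeneous d f \<longleftrightarrow> (\<forall>m. Poly_Mapping.lookup f m \<noteq> 0 \<longrightarrow> mono_deg m = d)"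
  by (auto simp: mhomogeneous_def mono_deg_def in_keys_iff)

lemma mono_deg_0 [simp]: "mono_deg 0 = 0"
  by (simp add: mono_deg_def)

definition hcomp :: "nat \<Rightarrow> ('k::field, 'n::finite) mpoly \<Rightarrow> ('k, 'n) mpoly" where
  "hcomp d f = (\<Sum>m\<in>{m\<in>Poly_Mapping.keys f. mono_deg m = d}.
     Poly_Mapping.single m (Poly_Mapping.lookup f m))"

lemma lookup_hcomp:
  "Poly_Mapping.lookup (hcomp d f) m = (if mono_deg m = d then Poly_Mapping.lookup f m else 0)"
proof -
  have "Poly_Mapping.lookup (hcomp d f) m
      = (\<Sum>m'\<in>{m\<in>Poly_Mapping.keys f. mono_deg m = d}. if m' = m then Poly_Mapping.lookup f m' else 0)"
    unfolding hcomp_def lookup_sum lookup_single by (intro sum.cong) (auto simp: when_def)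
  then show ?thesis by (auto simp: in_keys_iff)
qed

lemma hcomp_add [simp]: "hcomp d (f + g) = hcomp d f + hcomp d g"
  and hcomp_diff [simp]: "hcomp d (f - g) = hcomp d f - hcomp d g"
  and hcomp_0 [simp]: "hcomp d 0 = 0"
  by (auto intro!: poly_mapping_eqI simp: lookup_hcomp lookup_add lookup_minus)

lemma hcomp_sum: "hcomp d (sum f A) = (\<Sum>x\<in>A. hcomp d (f x))"
  by (induction A rule: infinite_finite_induct) simp_all

lemma mhomogeneous_hcomp [simp]: "mhomogeneous d (hcomp d f)"
  by (simp add: mhomogeneous_alt lookup_hcomp)

lemma hcomp_homogeneous: "mhomogeneous e f \<Longrightarrow> hcomp d f = (if d = e then f else 0)"
  by (auto intro!: poly_mapping_eqI simp: lookup_hcomp mhomogeneous_alt)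

lemma mhomogeneous_iff_hcomp: "mhomogeneous d f \<longleftrightarrow> hcomp d f = f"
  by (metis hcomp_homogeneous mhomogeneous_hcomp)

lemma mhomogeneous_0 [simp]: "mhomogeneous d 0"
  by (simp add: mhomogeneous_alt)

lemma mhomogeneous_add: "mhomogeneous d f \<Longrightarrow> mhomogeneous d g \<Longrightarrow> mhomogeneous d (f + g)"
  and mhomogeneous_diff: "mhomogeneous d f \<Longrightarrow> mhomogeneous d g \<Longrightarrow> mhomogeneous d (f - g)"
  by (simp_all add: mhomogeneous_iff_hcomp)

lemma mhomogeneous_sum: "(\<And>x. x \<in> A \<Longrightarrow> mhomogeneous d (f x)) \<Longrightarrow> mhomogeneous d (sum f A)"
  by (simp add: mhomogeneous_iff_hcomp hcomp_sum)

lemma mhomogeneous_single: "mhomogeneous (mono_deg m) (Poly_Mapping.single m c)"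
  by (auto simp: mhomogeneous_alt lookup_single when_def)

lemma mhomogeneous_mconst [simp]: "mhomogeneous 0 (mconst c)"
  using mhomogeneous_single[of 0 c] by (simp add: mconst_def)

lemma mhomogeneous_1 [simp]: "mhomogeneous 0 1"
  by (metis mconst_1 mhomogeneous_mconst)

lemma mhomogeneous_mult:
  assumes "mhomogeneous d f" "mhomogeneous e g"
  shows "mhomogeneous (d + e) (f * g)"
  unfolding mhomogeneous_def
proof
  fix m assume "m \<in> Poly_Mapping.keys (f * g)"
  then obtain a b where "a \<in> Poly_Mapping.keys f" "b \<in> Poly_Mapping.keys g" "m = a + b"
    using keys_mult[of f g] by blast
  then show "(\<Sum>i\<in>UNIV. Poly_Mapping.lookup m i) = d + e"
    using assms by (simp add: mhomogeneous_def lookup_add sum.distrib)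
qed

lemma mhomogeneous_mconst_mult: "mhomogeneous d f \<Longrightarrow> mhomogeneous d (mconst c * f)"
  using mhomogeneous_mult[of 0 "mconst c" d f] by simp

lemma mhomogeneous_power: "mhomogeneous d f \<Longrightarrow> mhomogeneous (n * d) (f ^ n)"
  by (induction n) (auto intro: mhomogeneous_mult)

lemma mhomogeneous_prod:
  "finite A \<Longrightarrow> (\<And>x. x \<in> A \<Longrightarrow> mhomogeneous (d x) (f x)) \<Longrightarrow> mhomogeneous (sum d A) (prod f A)"
  by (induction A rule: finite_induct) (auto intro: mhomogeneous_mult)

lemma hcomp_single: "hcomp d (Poly_Mapping.single m c) = (if mono_deg m = d then Poly_Mapping.single m c else 0)"
  using hcomp_homogeneous[OF mhomogeneous_single[of m c], of d] by auto

lemma mpoly_bounded_degree: "\<exists>D. \<forall>d>D. hcomp d f = 0"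
proof -
  define D where "D = Max (insert 0 (mono_deg ` Poly_Mapping.keys f))"
  have "hcomp d f = 0" if "d > D" for d
  proof -
    have "mono_deg m \<noteq> d" if "m \<in> Poly_Mapping.keys f" for m
    proof -
      have "mono_deg m \<le> D" using that by (simp add: D_def)
      with \<open>d > D\<close> show ?thesis by simp
    qed
    then have "{m\<in>Poly_Mapping.keys f. mono_deg m = d} = {}" by auto
    then show ?thesis by (simp only: hcomp_def sum.empty)
  qed
  then show ?thesis by blast
qed

lemma sum_hcomp: "(\<And>d. d > D \<Longrightarrow> hcomp d f = 0) \<Longrightarrow> (\<Sum>d\<le>D. hcomp d f) = f"
proof (rule poly_mapping_eqI)
  fix m assume *: "\<And>d. d > D \<Longrightarrow> hcomp d f = 0"
  have "(\<Sum>d\<le>D. Poly_Mapping.lookup (hcomp d f) m) = (if mono_deg m \<le> D then Poly_Mapping.lookup f m else 0)"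
    by (simp add: lookup_hcomp)
  also have "\<dots> = Poly_Mapping.lookup f m"
    using *[of "mono_deg m"] lookup_hcomp[of "mono_deg m" f m] by (auto simp: not_le)
  finally show "Poly_Mapping.lookup (\<Sum>d\<le>D. hcomp d f) m = Poly_Mapping.lookup f m"
    by (simp add: lookup_sum)
qed

lemma hcomp_mult:
  assumes "mhomogeneous e g"
  shows "hcomp d (g * f) = (if e \<le> d then g * hcomp (d - e) f else 0)"
proof (induction f rule: mpoly_induct)
  case (single m c)
  have "mhomogeneous (e + mono_deg m) (g * Poly_Mapping.single m c)"
    by (intro mhomogeneous_mult assms mhomogeneous_single)
  then show ?case by (auto simp: hcomp_homogeneous hcomp_single)
qed (auto simp: distrib_left)

text \<open>Compare \<open>g * f\<close> with its component of degree \<open>d\<close>. The case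
  \<open>d < e\<close> is stated separately because truncated subtraction would hide that
  \<open>f\<close> vanishes.\<close>

lemma mhomogeneous_cancel:
  fixes f g :: "('k::field, 'n::finite) mpoly"
  assumes "mhomogeneous e g" "g \<noteq> 0" "mhomogeneous d (g * f)"
  shows "(e \<le> d \<longrightarrow> mhomogeneous (d - e) f) \<and> (d < e \<longrightarrow> f = 0)"
proof -
  have *: "g * f = (if e \<le> d then g * hcomp (d - e) f else 0)"
    using assms hcomp_mult[OF assms(1), of d f] by (simp add: mhomogeneous_iff_hcomp)
  show ?thesis
  proof (cases "e \<le> d")
    case True
    with * have "f = hcomp (d - e) f" using mpoly_mult_left_cancel[OF assms(2)] by simp
    with True show ?thesis by (metis mhomogeneous_hcomp not_le)
  next
    case False
    with * show ?thesis using mpoly_mult_eq_0[of g f] assms(2) by simp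
  qed
qed

lemma mhomogeneous_unique: "mhomogeneous d f \<Longrightarrow> mhomogeneous e f \<Longrightarrow> f \<noteq> 0 \<Longrightarrow> d = e"
  using hcomp_homogeneous[of d f d] hcomp_homogeneous[of e f d] by (auto split: if_splits)

lemma mhomogeneous_msubst:
  assumes "\<And>i. mhomogeneous 1 (p i)"
  shows "mhomogeneous d f \<Longrightarrow> mhomogeneous d (msubst p f)"
proof -
  have "mhomogeneous (mono_deg m) (\<Prod>i\<in>UNIV. p i ^ Poly_Mapping.lookup m i)" for m
    unfolding mono_deg_def using mhomogeneous_power[OF assms] by (intro mhomogeneous_prod) auto
  then show "mhomogeneous d f \<Longrightarrow> mhomogeneous d (msubst p f)"
    unfolding msubst_def
    by (intro mhomogeneous_sum mhomogeneous_mconst_mult) (auto simp: mhomogeneous_def mono_deg_def)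
qed

lemma hcomp_msubst:
  assumes "\<And>i. mhomogeneous 1 (p i)"
  shows "hcomp d (msubst p f) = msubst p (hcomp d f)"
proof (induction f rule: mpoly_induct)
  case (single m c)
  have "mhomogeneous (mono_deg m) (msubst p (Poly_Mapping.single m c))"
    by (intro mhomogeneous_msubst assms mhomogeneous_single)
  then show ?case by (auto simp: hcomp_homogeneous hcomp_single)
qed simp

subsection \<open>Covectors and linear forms\<close>

definition dot :: "'k::field ^ 'n::finite \<Rightarrow> 'k ^ 'n \<Rightarrow> 'k" where
  "dot a v = (\<Sum>i\<in>UNIV. a $ i * v $ i)"

lemma dot_add_left [simp]: "dot (a + b) v = dot a v + dot b v"
  and dot_add_right [simp]: "dot a (v + w) = dot a v + dot a w"
  and dot_diff_left [simp]: "dot (a - b) v = dot a v - dot b v"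
  and dot_diff_right [simp]: "dot a (v - w) = dot a v - dot a w"
  and dot_scale_left [simp]: "dot (c *s a) v = c * dot a v"
  and dot_scale_right [simp]: "dot a (c *s v) = c * dot a v"
  and dot_zero_left [simp]: "dot 0 v = 0"
  and dot_zero_right [simp]: "dot a 0 = 0"
  by (simp_all add: dot_def sum.distrib sum_subtractf sum_distrib_left algebra_simps)

lemma dot_axis [simp]: "dot a (axis i 1) = a $ i" "dot (axis i 1) v = v $ i"
  by (simp_all add: dot_def axis_def if_distrib if_distribR cong: if_cong)

lemma dot_vector_matrix: "dot (a v* P) v = dot a (P *v v)"
proof -
  have "dot (a v* P) v = (\<Sum>j\<in>UNIV. \<Sum>i\<in>UNIV. P $ i $ j * a $ i * v $ j)"
    by (simp add: dot_def vector_matrix_mult_def sum_distrib_left sum_distrib_right mult_ac)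
  also have "\<dots> = (\<Sum>i\<in>UNIV. \<Sum>j\<in>UNIV. P $ i $ j * a $ i * v $ j)" by (rule sum.swap)
  also have "\<dots> = dot a (P *v v)"
    by (simp add: dot_def matrix_vector_mult_def sum_distrib_left mult_ac)
  finally show ?thesis .
qed

lemma covector_eqI: "(\<And>v. dot a v = dot b v) \<Longrightarrow> a = b"
  by (metis dot_axis(1) vec_eq_iff)

lemma vector_eqI: "(\<And>a. dot a v = dot a w) \<Longrightarrow> v = w"
  by (metis dot_axis(2) vec_eq_iff)

lemma exists_dual_vector: "a \<noteq> 0 \<Longrightarrow> \<exists>u. dot a u = 1"
proof -
  assume "a \<noteq> 0"
  then obtain i where "a $ i \<noteq> 0" by (auto simp: vec_eq_iff)
  then have "dot a (inverse (a $ i) *s axis i 1) = 1" by simp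
  then show ?thesis by blast
qed

lemma exists_dual_covector: "v \<noteq> 0 \<Longrightarrow> \<exists>a. dot a v = 1"
proof -
  assume "v \<noteq> 0"
  then obtain i where "v $ i \<noteq> 0" by (auto simp: vec_eq_iff)
  then have "dot (inverse (v $ i) *s axis i 1) v = 1" by simp
  then show ?thesis by blast
qed

definition proportional :: "'k::field ^ 'n::finite \<Rightarrow> 'k ^ 'n \<Rightarrow> bool" where
  "proportional a b \<longleftrightarrow> (\<exists>c. c \<noteq> 0 \<and> b = c *s a)"

lemma proportional_refl [simp]: "proportional a a"
  unfolding proportional_def by (rule exI[of _ 1]) simp

lemma proportional_sym: "proportional a b \<Longrightarrow> proportional b a"
  unfolding proportional_def
proof (elim exE conjE)
  fix c assume "c \<noteq> 0" "b = c *s a"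
  then show "\<exists>c. c \<noteq> 0 \<and> a = c *s b" by (intro exI[of _ "inverse c"]) (simp add: vector_smult_assoc)
qed

lemma proportional_trans: "proportional a b \<Longrightarrow> proportional b c \<Longrightarrow> proportional a c"
  unfolding proportional_def by (metis mult_eq_0_iff vector_smult_assoc)

lemma linear_form_axis:
  "linear_form (axis i 1 :: 'k::field ^ 'n::finite) = Poly_Mapping.single (Poly_Mapping.single i 1) 1"
proof -
  have "linear_form (axis i 1 :: 'k ^ 'n)
      = (\<Sum>j\<in>UNIV. if j = i then Poly_Mapping.single (Poly_Mapping.single i 1) 1 else 0)"
    unfolding linear_form_def by (intro sum.cong) (auto simp: axis_def)
  then show ?thesis by simp
qed

lemma linear_form_alt: "linear_form a = (\<Sum>i\<in>UNIV. mconst (a $ i) * linear_form (axis i 1))"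
  unfolding linear_form_axis by (simp add: linear_form_def mconst_def mult_single)

lemma linear_form_add: "linear_form (a + b) = linear_form a + linear_form b"
  and linear_form_diff: "linear_form (a - b) = linear_form a - linear_form b"
  and linear_form_0 [simp]: "linear_form 0 = 0"
  by (simp_all add: linear_form_def single_add single_diff sum.distrib sum_subtractf)

lemma linear_form_scale: "linear_form (c *s a) = mconst c * linear_form a"
  by (subst (1 2) linear_form_alt) (simp add: mconst_mult sum_distrib_left mult_ac)

lemma single_key_inj: "Poly_Mapping.single i (Suc 0) = Poly_Mapping.single j (Suc 0) \<Longrightarrow> i = j"
  by (metis Zero_not_Suc lookup_single_eq lookup_single_not_eq)

lemma lookup_linear_form: "Poly_Mapping.lookup (linear_form a) (Poly_Mapping.single i 1) = a $ i"
proof -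
  have "Poly_Mapping.lookup (linear_form a) (Poly_Mapping.single i 1) = (\<Sum>j\<in>UNIV. if j = i then a $ j else 0)"
    unfolding linear_form_def lookup_sum lookup_single
    by (intro sum.cong) (auto simp: when_def dest: single_key_inj)
  then show ?thesis by simp
qed

lemma linear_form_eq_0_iff [simp]: "linear_form a = 0 \<longleftrightarrow> a = 0"
  by (metis linear_form_0 lookup_linear_form lookup_zero vec_eq_iff zero_index)

lemma mono_deg_single: "mono_deg (Poly_Mapping.single i n) = n"
  by (simp add: mono_deg_def lookup_single when_def)

lemma mhomogeneous_linear_form [simp]: "mhomogeneous 1 (linear_form a)"
  unfolding linear_form_def
  by (intro mhomogeneous_sum) (metis mhomogeneous_single mono_deg_single)

lemma mhomogeneous_linear_form' [simp]: "mhomogeneous (Suc 0) (linear_form a)"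
  using mhomogeneous_linear_form[of a] by simp

text \<open>Pullback of functions along the linear map \<open>v\<close> to \<open>P *v v\<close>:
  the coordinate \<open>i\<close> goes to row \<open>i\<close> of \<open>P\<close>, hence a covector
  \<open>a\<close> goes to \<open>a v* P\<close> and composition reverses the order of
  factors.\<close>

definition subst :: "'k::field ^ 'n ^ 'n \<Rightarrow> ('k, 'n::finite) mpoly \<Rightarrow> ('k, 'n) mpoly" where
  "subst P = msubst (\<lambda>i. linear_form (P $ i))"

lemma subst_simps [simp]:
  "subst P 0 = 0" "subst P 1 = 1" "subst P (mconst c) = mconst c"
  "subst P (f + g) = subst P f + subst P g" "subst P (f - g) = subst P f - subst P g"
  "subst P (- f) = - subst P f" "subst P (f * g) = subst P f * subst P g"
  by (simp_all add: subst_def)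

lemma subst_sum: "subst P (sum f A) = (\<Sum>x\<in>A. subst P (f x))"
  and subst_prod: "subst P (prod f A) = (\<Prod>x\<in>A. subst P (f x))"
  by (simp_all add: subst_def msubst_sum msubst_prod)

lemma subst_power: "subst P (f ^ n) = subst P f ^ n"
  and subst_dvd: "f dvd g \<Longrightarrow> subst P f dvd subst P g"
  and hcomp_subst: "hcomp d (subst P f) = subst P (hcomp d f)"
  and mhomogeneous_subst: "mhomogeneous d f \<Longrightarrow> mhomogeneous d (subst P f)"
  by (simp_all add: subst_def msubst_power msubst_dvd hcomp_msubst
      mhomogeneous_msubst)

lemma linear_form_sum: "linear_form (sum f A) = (\<Sum>x\<in>A. linear_form (f x))"
  by (induction A rule: infinite_finite_induct) (simp_all add: linear_form_add)

lemma msubst_linear_form: "msubst p (linear_form a) = (\<Sum>i\<in>UNIV. mconst (a $ i) * p i)"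
proof -
  have *: "(\<Prod>j\<in>UNIV. p j ^ Poly_Mapping.lookup (Poly_Mapping.single i (Suc 0)) j) = p i" for i
  proof -
    have "(\<Prod>j\<in>UNIV. p j ^ Poly_Mapping.lookup (Poly_Mapping.single i (Suc 0)) j)
        = (\<Prod>j\<in>UNIV. if j = i then p i else 1)"
      by (intro prod.cong) (auto simp: lookup_single when_def)
    then show ?thesis by simp
  qed
  show ?thesis by (simp add: linear_form_def msubst_sum msubst_single *)
qed

lemma vector_matrix_as_sum: "a v* P = (\<Sum>i\<in>UNIV. a $ i *s (P $ i))"
  by (simp add: vec_eq_iff vector_matrix_mult_def mult.commute)

lemma subst_linear_form [simp]: "subst P (linear_form a) = linear_form (a v* P)"
  by (simp add: subst_def msubst_linear_form vector_matrix_as_sum linear_form_sum linear_form_scale)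

lemma row_matrix_mult: "(Q ** P) $ i = (Q $ i) v* P"
  by (simp add: vec_eq_iff matrix_matrix_mult_def vector_matrix_mult_def mult.commute)

lemma subst_subst: "subst P (subst Q f) = subst (Q ** P) f"
  unfolding subst_def[of "Q ** P"] row_matrix_mult subst_linear_form[symmetric]
  by (simp add: subst_def msubst_msubst)

lemma subst_mat_1 [simp]: "subst (mat 1) f = (f :: ('k::field, 'n::finite) mpoly)"
proof (induction f rule: mpoly_induct)
  case (single m c)
  have row: "(mat 1 :: 'k ^ 'n ^ 'n) $ i = axis i 1" for i
    by (auto simp: mat_def axis_def vec_eq_iff)
  have pow: "(Poly_Mapping.single (Poly_Mapping.single i (1::nat)) (1::'k)) ^ k
      = Poly_Mapping.single (Poly_Mapping.single i k) 1" for i :: 'n and k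
    by (induction k) (simp_all add: mult_single flip: single_add single_one)
  have prod: "finite S \<Longrightarrow> (\<Prod>i\<in>S. Poly_Mapping.single (F i) (1::'k))
      = Poly_Mapping.single (sum F S) 1" for S and F :: "'n \<Rightarrow> 'n \<Rightarrow>\<^sub>0 nat"
    by (induction S rule: finite_induct) (simp_all add: mult_single flip: single_one)
  have m: "(\<Sum>i\<in>UNIV. Poly_Mapping.single i (Poly_Mapping.lookup m i)) = m"
    by (rule poly_mapping_eqI) (simp add: lookup_sum lookup_single when_def)
  show ?case
    by (simp add: subst_def msubst_single row linear_form_axis pow[simplified] prod m mconst_def mult_single)
qed simp

text \<open>If \<open>P\<close> is a projection fixing \<open>w\<close> and \<open>z\<close> with
  \<open>dot z w = 1\<close>, then \<open>P - tens w z\<close> is the projection onto the kernel of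
  \<open>z\<close> in the range of \<open>P\<close>, along \<open>w\<close>. Restrictions to
  hyperplanes are encoded by substituting such matrices.\<close>

definition tens :: "'k::field ^ 'n \<Rightarrow> 'k ^ 'n \<Rightarrow> 'k ^ 'n ^ 'n::finite" where
  "tens w z = (\<chi> i j. w $ i * z $ j)"

lemma vector_matrix_tens: "a v* tens w z = dot a w *s z"
  by (simp add: vec_eq_iff vector_matrix_mult_def tens_def dot_def sum_distrib_left mult_ac)

lemma tens_mult_vector: "tens w z *v v = dot z v *s w"
  by (simp add: vec_eq_iff matrix_vector_mult_def tens_def dot_def sum_distrib_left mult_ac)

lemma vector_matrix_diff: "a v* (P - Q) = a v* P - (a::'k::field^'n::finite) v* Q"
  by (simp add: vec_eq_iff vector_matrix_mult_def algebra_simps sum_subtractf)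

lemma vector_matrix_plus: "a v* (P + Q) = a v* P + (a::'k::field^'n::finite) v* Q"
  by (simp add: vec_eq_iff vector_matrix_mult_def algebra_simps sum.distrib)

lemma add_vector_matrix: "(a + b) v* P = a v* P + (b::'k::field^'n::finite) v* P"
  and diff_vector_matrix: "(a - b) v* P = a v* P - (b::'k::field^'n::finite) v* P"
  and scale_vector_matrix: "(c *s a) v* P = c *s (a v* P)"
  by (simp_all add: vec_eq_iff vector_matrix_mult_def algebra_simps sum_subtractf sum.distrib sum_distrib_left)

lemma matrix_vector_diff: "(P - Q) *v v = P *v v - Q *v (v::'k::field^'n::finite)"
  by (simp add: vec_eq_iff matrix_vector_mult_def algebra_simps sum_subtractf)

lemma matrix_vector_plus: "(P + Q) *v v = P *v v + Q *v (v::'k::field^'n::finite)"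
  by (simp add: vec_eq_iff matrix_vector_mult_def algebra_simps sum.distrib)

lemma vector_matrix_assoc: "(a v* P) v* Q = a v* (P ** (Q::'k::field^'n::finite^'n))"
  by (rule covector_eqI) (simp add: dot_vector_matrix matrix_vector_mul_assoc)

lemma matrix_eqI_covector: "(\<And>a. a v* P = a v* Q) \<Longrightarrow> P = (Q::'k::field^'n::finite^'n)"
  by (rule matrix_eq[THEN iffD2]) (metis dot_vector_matrix vector_eqI)

lemma matrix_eqI_dot: "(\<And>a v. dot a (P *v v) = dot a (Q *v v)) \<Longrightarrow> P = (Q::'k::field^'n::finite^'n)"
  by (rule matrix_eq[THEN iffD2]) (metis vector_eqI)

text \<open>Row \<open>i\<close> of the two matrices differs by \<open>u $ i *s a\<close>, so both
  substitutions agree on coordinates modulo \<open>linear_form a\<close>.\<close>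

lemma subst_diff_tens_dvd: "linear_form a dvd subst P f - subst (P - tens u a) f"
  unfolding subst_def
proof (rule msubst_diff_dvd)
  fix i
  have "P $ i - (P - tens u a) $ i = u $ i *s a"
    by (simp add: vec_eq_iff tens_def)
  then have "linear_form (P $ i) - linear_form ((P - tens u a) $ i) = mconst (u $ i) * linear_form a"
    by (metis linear_form_diff linear_form_scale)
  then show "linear_form a dvd linear_form (P $ i) - linear_form ((P - tens u a) $ i)" by simp
qed

lemma subst_tens_kills:
  assumes "a v* P = a" "dot a u = 1" "linear_form a dvd f"
  shows "subst (P - tens u a) f = 0"
  using assms by (auto simp: dvd_def vector_matrix_diff vector_matrix_tens)

text \<open>The right-hand side restricts \<open>f\<close> to the kernel of \<open>a\<close>. This
  restriction kills \<open>linear_form a\<close> and changes \<open>f\<close> only by a multiple of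
  it, so divisibility turns into vanishing under a ring homomorphism.\<close>

lemma linear_form_dvd_iff:
  assumes "a v* P = a" "dot a u = 1" "subst P f = f"
  shows "linear_form a dvd f \<longleftrightarrow> subst (P - tens u a) f = 0"
  using subst_tens_kills[OF assms(1,2)] subst_diff_tens_dvd[of a P f u] assms(3) by auto

text \<open>Restriction to the kernel of \<open>a\<close> is multiplicative with values in an
  integral domain.\<close>

lemma linear_form_prime:
  assumes "a \<noteq> 0" "linear_form a dvd f * g"
  shows "linear_form a dvd f \<or> linear_form a dvd g"
proof -
  obtain u where "dot a u = 1" using exists_dual_vector[OF assms(1)] by blast
  then show ?thesis
    using assms(2) linear_form_dvd_iff[of a "mat 1" u] mpoly_mult_eq_0 by simp
qed

lemma linear_form_dvd_linear_form:
  assumes "a \<noteq> 0" "b \<noteq> 0" "linear_form a dvd linear_form b"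
  shows "proportional a b"
proof -
  obtain u where u: "dot a u = 1" using exists_dual_vector[OF assms(1)] by blast
  have "linear_form (b - dot b u *s a) = 0"
    using assms(3) linear_form_dvd_iff[of a "mat 1" u "linear_form b"] u
    by (simp add: vector_matrix_diff vector_matrix_tens)
  then have "b = dot b u *s a" by simp
  with assms(2) show ?thesis
    unfolding proportional_def by (metis vector_smult_lzero)
qed

lemma proportional_dvd: "proportional a b \<Longrightarrow> linear_form a dvd linear_form b"
  unfolding proportional_def by (auto simp: linear_form_scale)

lemma linear_form_not_dvd_1: "a \<noteq> 0 \<Longrightarrow> \<not> linear_form a dvd 1"
proof
  assume a: "a \<noteq> 0" "linear_form a dvd 1"
  obtain u where "dot a u = 1" using exists_dual_vector[OF a(1)] by blast
  then show False using linear_form_dvd_iff[of a "mat 1" u 1] a(2) by simp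
qed

lemma linear_form_power_dvd_cancel:
  assumes "a \<noteq> 0" "linear_form a ^ n dvd d * f" "\<not> linear_form a dvd d"
  shows "linear_form a ^ n dvd f"
  using assms(2)
proof (induction n arbitrary: f)
  case (Suc n)
  then have "linear_form a dvd d * f" using dvd_mult_left by fastforce
  then have "linear_form a dvd f" using linear_form_prime[OF assms(1)] assms(3) by blast
  then obtain g where g: "f = linear_form a * g" by (auto elim: dvdE)
  have "linear_form a * linear_form a ^ n dvd linear_form a * (d * g)"
    using Suc.prems g by (simp add: mult_ac)
  then have "linear_form a ^ n dvd d * g"
    by (rule mpoly_dvd_mult_cancel_left[rotated]) (simp add: assms(1))
  then have "linear_form a ^ n dvd g" by (rule Suc.IH)
  then show ?case unfolding g power_Suc by (intro mult_dvd_mono dvd_refl)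
qed simp

text \<open>A substitute for unique factorisation. The exponent counts the factors proportional to
  \<open>\<phi> s\<close>; splitting off \<open>\<phi> x\<close> lowers exactly the exponents of its
  own class, and the other powers stay coprime to it.\<close>

lemma prod_linear_forms_dvd:
  fixes \<phi> :: "'i \<Rightarrow> 'k::field ^ 'n::finite"
  assumes "finite S" "\<And>s. s \<in> S \<Longrightarrow> \<phi> s \<noteq> 0"
    and "\<And>s. s \<in> S \<Longrightarrow> linear_form (\<phi> s) ^ card {t \<in> S. proportional (\<phi> s) (\<phi> t)} dvd f"
  shows "(\<Prod>s\<in>S. linear_form (\<phi> s)) dvd f"
  using assms
proof (induction S arbitrary: f rule: finite_induct)
  case (insert x S)
  let ?C = "\<lambda>T s. {t \<in> T. proportional (\<phi> s) (\<phi> t)}"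
  have "card (?C (insert x S) x) \<noteq> 0" using insert(1) by auto
  then have "linear_form (\<phi> x) dvd linear_form (\<phi> x) ^ card (?C (insert x S) x)"
    by (simp add: dvd_power)
  also have "\<dots> dvd f" using insert.prems(2)[of x] by simp
  finally obtain g where g: "f = linear_form (\<phi> x) * g" by (auto elim: dvdE)
  have nz: "linear_form (\<phi> x) \<noteq> 0" using insert.prems(1) by simp
  have "linear_form (\<phi> s) ^ card (?C S s) dvd g" if s: "s \<in> S" for s
  proof (cases "proportional (\<phi> s) (\<phi> x)")
    case True
    then have "?C (insert x S) s = insert x (?C S s)" by auto
    then have "linear_form (\<phi> s) * linear_form (\<phi> s) ^ card (?C S s) dvd linear_form (\<phi> x) * g"
      using insert.prems(2)[of s] s insert.hyps g by simp
    moreover obtain c where "c \<noteq> 0" "\<phi> x = c *s \<phi> s" using True by (auto simp: proportional_def)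
    ultimately have "linear_form (\<phi> s) * linear_form (\<phi> s) ^ card (?C S s)
        dvd linear_form (\<phi> s) * (mconst c * g)"
      by (simp add: linear_form_scale mult_ac)
    then have "linear_form (\<phi> s) ^ card (?C S s) dvd mconst c * g"
      by (rule mpoly_dvd_mult_cancel_left[rotated]) (simp add: insert.prems(1) s)
    then have "linear_form (\<phi> s) ^ card (?C S s) dvd mconst (inverse c) * (mconst c * g)"
      by (rule dvd_mult)
    then show ?thesis using \<open>c \<noteq> 0\<close> by (simp flip: mconst_mult mult.assoc)
  next
    case False
    then have "?C (insert x S) s = ?C S s" by auto
    then have "linear_form (\<phi> s) ^ card (?C S s) dvd linear_form (\<phi> x) * g"
      using insert.prems(2)[of s] s g by simp
    moreover have "\<not> linear_form (\<phi> s) dvd linear_form (\<phi> x)"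
      using False linear_form_dvd_linear_form insert.prems(1) s by blast
    ultimately show ?thesis
      using linear_form_power_dvd_cancel insert.prems(1)[of s] s by blast
  qed
  then have "(\<Prod>s\<in>S. linear_form (\<phi> s)) dvd g" using insert by blast
  then show ?case unfolding g prod.insert[OF insert.hyps] by (intro mult_dvd_mono dvd_refl)
qed simp

lemma prod_distinct_linear_forms_dvd:
  fixes \<phi> :: "'i \<Rightarrow> 'k::field ^ 'n::finite"
  assumes "finite S" "\<And>s. s \<in> S \<Longrightarrow> \<phi> s \<noteq> 0"
    and "\<And>s t. s \<in> S \<Longrightarrow> t \<in> S \<Longrightarrow> proportional (\<phi> s) (\<phi> t) \<Longrightarrow> s = t"
    and "\<And>s. s \<in> S \<Longrightarrow> linear_form (\<phi> s) dvd f"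
  shows "(\<Prod>s\<in>S. linear_form (\<phi> s)) dvd f"
proof (rule prod_linear_forms_dvd[OF assms(1,2)])
  fix s assume "s \<in> S"
  then have "{t \<in> S. proportional (\<phi> s) (\<phi> t)} = {s}" using assms(3) by auto
  then show "linear_form (\<phi> s) ^ card {t \<in> S. proportional (\<phi> s) (\<phi> t)} dvd f"
    using assms(4) \<open>s \<in> S\<close> by simp
qed

section \<open>Independent linear forms and their syzygies\<close>

definition indep2 :: "'k::field ^ 'n::finite \<Rightarrow> 'k ^ 'n \<Rightarrow> bool" where
  "indep2 u v \<longleftrightarrow> (\<forall>c d. c *s u + d *s v = 0 \<longrightarrow> c = 0 \<and> d = 0)"

definition indep3 :: "'k::field ^ 'n::finite \<Rightarrow> 'k ^ 'n \<Rightarrow> 'k ^ 'n \<Rightarrow> bool" where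
  "indep3 u v w \<longleftrightarrow> (\<forall>c d e. c *s u + d *s v + e *s w = 0 \<longrightarrow> c = 0 \<and> d = 0 \<and> e = 0)"

lemma indep2_nonzero:
  assumes "indep2 u v"
  shows "u \<noteq> 0" "v \<noteq> 0"
proof -
  show "u \<noteq> 0"
  proof
    assume "u = 0"
    then have "1 *s u + 0 *s v = 0" by simp
    then show False using assms unfolding indep2_def by (metis zero_neq_one)
  qed
  show "v \<noteq> 0"
  proof
    assume "v = 0"
    then have "0 *s u + 1 *s v = 0" by simp
    then show False using assms unfolding indep2_def by (metis zero_neq_one)
  qed
qed

lemma indep2_not_proportional: "indep2 u v \<Longrightarrow> \<not> proportional u v"
proof
  assume uv: "indep2 u v" "proportional u v"
  then obtain c where "c *s u + (-1) *s v = 0" by (auto simp: proportional_def)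
  with uv(1) show False unfolding indep2_def by (metis neg_equal_0_iff_equal zero_neq_one)
qed

lemma indep2I:
  assumes "u \<noteq> 0" "v \<noteq> 0" "\<not> proportional u v"
  shows "indep2 u v"
  unfolding indep2_def
proof (intro allI impI)
  fix c d assume *: "c *s u + d *s v = 0"
  show "c = 0 \<and> d = 0"
  proof (cases "d = 0")
    case True
    then show ?thesis using * assms(1) by simp
  next
    case False
    have "v = (- inverse d * c) *s u"
      unfolding vec_eq_iff
    proof
      fix i
      have "c * u $ i + d * v $ i = 0" using * by (simp add: vec_eq_iff)
      then have "d * v $ i = - (c * u $ i)" by (simp add: eq_neg_iff_add_eq_0 add.commute)
      then show "v $ i = ((- inverse d * c) *s u) $ i" using False by (simp add: field_simps)
    qed
    note v = this
    with assms(2) have "- inverse d * c \<noteq> 0" by auto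
    with v assms(3) show ?thesis unfolding proportional_def by blast
  qed
qed

lemma indep3_indep2:
  assumes "indep3 u v w"
  shows "indep2 u v" "indep2 u w" "indep2 v w"
proof -
  have *: "c = 0 \<and> d = 0 \<and> e = 0" if "c *s u + d *s v + e *s w = 0" for c d e
    using assms that unfolding indep3_def by blast
  show "indep2 u v" "indep2 u w" "indep2 v w"
    unfolding indep2_def using *[of _ _ 0] *[of _ 0] *[of 0] by auto
qed

text \<open>\<open>linear_form u\<close> is prime and does not divide \<open>linear_form v\<close>,
  so it divides \<open>a\<close>. This is exactness of the Koszul complex on two forms.\<close>

lemma linear_form_syzygy2:
  assumes "indep2 u v" "linear_form v * a = linear_form u * b"
  shows "\<exists>c. a = linear_form u * c \<and> b = linear_form v * c"
proof -
  have nz: "u \<noteq> 0" "v \<noteq> 0" using indep2_nonzero[OF assms(1)] by auto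
  have "\<not> linear_form u dvd linear_form v"
    using linear_form_dvd_linear_form[OF nz] indep2_not_proportional[OF assms(1)] by blast
  moreover have "linear_form u dvd linear_form v * a" using assms(2) by simp
  ultimately have "linear_form u dvd a" using linear_form_prime[OF nz(1)] by blast
  then obtain c where c: "a = linear_form u * c" by (auto elim: dvdE)
  then have "linear_form u * (linear_form v * c) = linear_form u * b"
    using assms(2) by (simp add: mult_ac)
  then have "linear_form v * c = b" by (rule mpoly_mult_left_cancel[rotated]) (simp add: nz)
  with c show ?thesis by auto
qed

text \<open>Restriction to the kernel of \<open>u\<close> leaves two independent forms and turns the
  relation into one for \<open>linear_form_syzygy2\<close>. The multiple of
  \<open>linear_form u\<close> lost in restricting \<open>a\<close> is put back through
  \<open>q\<close>.\<close>

lemma linear_form_regular3: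
  assumes "indep3 u v w" "linear_form w * a = linear_form v * b - linear_form u * c"
  shows "\<exists>p q. a = linear_form v * p - linear_form u * q"
proof -
  have nz: "u \<noteq> 0" using indep2_nonzero indep3_indep2(1)[OF assms(1)] by blast
  obtain t where t: "dot u t = 1" using exists_dual_vector[OF nz] by blast
  let ?s = "subst (mat 1 - tens t u)"
  have s: "?s (linear_form x) = linear_form (x - dot x t *s u)" for x
    by (simp add: vector_matrix_diff vector_matrix_tens)
  let ?v = "v - dot v t *s u" and ?w = "w - dot w t *s u"
  have "indep2 ?v ?w"
    unfolding indep2_def
  proof (intro allI impI)
    fix c d assume "c *s ?v + d *s ?w = 0"
    then have "(- c * dot v t - d * dot w t) *s u + c *s v + d *s w = 0"
      by (simp add: vec_eq_iff algebra_simps)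
    then show "c = 0 \<and> d = 0" using assms(1) unfolding indep3_def by blast
  qed
  moreover have "linear_form ?w * ?s a = linear_form ?v * ?s b"
    using arg_cong[OF assms(2), of ?s] s[of u] t by (simp add: s del: subst_linear_form)
  ultimately obtain e where e: "?s a = linear_form ?v * e"
    using linear_form_syzygy2 by blast
  obtain q where q: "a - ?s a = linear_form u * q"
    using subst_diff_tens_dvd[of u "mat 1" a t] by (auto elim: dvdE)
  have "a = ?s a + linear_form u * q" using q by (simp add: diff_eq_eq add.commute)
  then have "a = linear_form v * e - linear_form u * (mconst (dot v t) * e - q)"
    unfolding e by (simp add: linear_form_diff linear_form_scale algebra_simps)
  then show ?thesis by blast
qed

text \<open>A vector dual to \<open>x1\<close> is found first, then one dual to the part of
  \<open>x2\<close> that vanishes on it; two subtractions make the pair biorthogonal.\<close>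

lemma exists_dual_pair:
  assumes "indep2 x1 x2"
  shows "\<exists>e1 e2. dot x1 e1 = 1 \<and> dot x1 e2 = 0 \<and> dot x2 e1 = 0 \<and> dot x2 e2 = 1"
proof -
  obtain u where u: "dot x1 u = 1" using exists_dual_vector indep2_nonzero[OF assms] by blast
  have "x2 - dot x2 u *s x1 \<noteq> 0"
  proof
    assume "x2 - dot x2 u *s x1 = 0"
    then have "(- dot x2 u) *s x1 + 1 *s x2 = 0" by (simp add: vec_eq_iff)
    then show False using assms unfolding indep2_def by (metis zero_neq_one)
  qed
  then obtain t where t: "dot (x2 - dot x2 u *s x1) t = 1" using exists_dual_vector by blast
  define e2 where "e2 = t - dot x1 t *s u"
  define e1 where "e1 = u - dot x2 u *s e2"
  have "dot x1 e2 = 0" "dot x2 e2 = 1" using u t by (simp_all add: e2_def algebra_simps)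
  moreover have "dot x1 e1 = 1" "dot x2 e1 = 0" using calculation u by (simp_all add: e1_def)
  ultimately show ?thesis by blast
qed

subsection \<open>Derivations\<close>

text \<open>The value of the derivation on the linear form with coefficients \<open>a\<close>, see
  \<open>der_apply_linear_form\<close>. Testing against all \<open>a\<close> replaces work in
  coordinates.\<close>

definition pair :: "'k::field ^ 'n::finite \<Rightarrow> ('k, 'n) der \<Rightarrow> ('k, 'n) mpoly" where
  "pair a \<theta> = (\<Sum>i\<in>UNIV. mconst (a $ i) * \<theta> $ i)"

lemma pair_simps [simp]:
  "pair a (\<theta> + \<eta>) = pair a \<theta> + pair a \<eta>"
  "pair a (\<theta> - \<eta>) = pair a \<theta> - pair a \<eta>"
  "pair a (- \<theta>) = - pair a \<theta>"
  "pair a (f *s \<theta>) = f * pair a \<theta>"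
  "pair a 0 = 0" "pair 0 \<theta> = 0"
  "pair (a + b) \<theta> = pair a \<theta> + pair b \<theta>"
  "pair (a - b) \<theta> = pair a \<theta> - pair b \<theta>"
  "pair (c *s a) \<theta> = mconst c * pair a \<theta>"
  by (simp_all add: pair_def sum.distrib sum_subtractf sum_negf sum_distrib_left algebra_simps
      mconst_add mconst_diff mconst_mult)

lemma pair_sum: "pair a (sum f A) = (\<Sum>x\<in>A. pair a (f x))"
  by (induction A rule: infinite_finite_induct) simp_all

lemma pair_axis [simp]: "pair (axis i 1) \<theta> = \<theta> $ i"
proof -
  have "pair (axis i 1) \<theta> = (\<Sum>j\<in>UNIV. if j = i then \<theta> $ i else 0)"
    unfolding pair_def by (intro sum.cong) (auto simp: axis_def)
  then show ?thesis by simp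
qed

lemma der_eqI: "(\<And>a. pair a \<theta> = pair a \<eta>) \<Longrightarrow> \<theta> = \<eta>"
  by (metis pair_axis vec_eq_iff)

lemma der_eq_0I: "(\<And>a. pair a \<theta> = 0) \<Longrightarrow> \<theta> = 0"
  by (rule der_eqI) simp

definition cvec :: "'k::field ^ 'n::finite \<Rightarrow> ('k, 'n) der" where
  "cvec v = (\<chi> i. mconst (v $ i))"

lemma pair_cvec [simp]: "pair a (cvec v) = mconst (dot a v)"
  by (simp add: pair_def cvec_def dot_def mconst_sum mconst_mult)

definition vsubst :: "'k::field ^ 'n ^ 'n \<Rightarrow> ('k, 'n::finite) der \<Rightarrow> ('k, 'n) der" where
  "vsubst P \<theta> = (\<chi> i. subst P (\<theta> $ i))"

lemma pair_vsubst [simp]: "pair a (vsubst P \<theta>) = subst P (pair a \<theta>)"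
  by (simp add: pair_def vsubst_def subst_sum)

lemma vsubst_simps [simp]:
  "vsubst P (\<theta> + \<eta>) = vsubst P \<theta> + vsubst P \<eta>"
  "vsubst P (\<theta> - \<eta>) = vsubst P \<theta> - vsubst P \<eta>"
  "vsubst P (f *s \<theta>) = subst P f *s vsubst P \<theta>"
  "vsubst P 0 = 0"
  by (rule der_eqI, simp)+

lemma vsubst_sum: "vsubst P (sum f A) = (\<Sum>x\<in>A. vsubst P (f x))"
  by (induction A rule: infinite_finite_induct) simp_all

definition pmul :: "'k::field ^ 'n ^ 'n \<Rightarrow> ('k, 'n::finite) der \<Rightarrow> ('k, 'n) der" where
  "pmul P \<theta> = (\<chi> i. pair (P $ i) \<theta>)"

lemma sum_pair: "pair (sum f A) \<theta> = (\<Sum>x\<in>A. pair (f x) \<theta>)"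
  by (induction A rule: infinite_finite_induct) simp_all

lemma pair_pmul [simp]: "pair a (pmul P \<theta>) = pair (a v* P) \<theta>"
  by (simp add: vector_matrix_as_sum sum_pair) (simp add: pair_def pmul_def)

definition vhcomp :: "nat \<Rightarrow> ('k::field, 'n::finite) der \<Rightarrow> ('k, 'n) der" where
  "vhcomp d \<theta> = (\<chi> i. hcomp d (\<theta> $ i))"

lemma pair_vhcomp [simp]: "pair a (vhcomp d \<theta>) = hcomp d (pair a \<theta>)"
  by (simp add: pair_def vhcomp_def hcomp_sum hcomp_mult[OF mhomogeneous_mconst])

definition vhom :: "nat \<Rightarrow> ('k::field, 'n::finite) der \<Rightarrow> bool" where
  "vhom d \<theta> \<longleftrightarrow> vhcomp d \<theta> = \<theta>"

lemma vhom_pair: "vhom d \<theta> \<Longrightarrow> mhomogeneous d (pair a \<theta>)"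
  unfolding vhom_def by (metis mhomogeneous_hcomp pair_vhcomp)

lemma vhomI: "(\<And>a. mhomogeneous d (pair a \<theta>)) \<Longrightarrow> vhom d \<theta>"
  unfolding vhom_def by (rule der_eqI) (simp add: mhomogeneous_iff_hcomp)

lemma vhom_vhcomp [simp]: "vhom d (vhcomp d \<theta>)"
  by (rule vhomI) simp

lemma vhcomp_simps [simp]:
  "vhcomp d (\<theta> + \<eta>) = vhcomp d \<theta> + vhcomp d \<eta>"
  "vhcomp d (\<theta> - \<eta>) = vhcomp d \<theta> - vhcomp d \<eta>"
  "vhcomp d 0 = 0"
  "vhcomp d (vsubst P \<theta>) = vsubst P (vhcomp d \<theta>)"
  by (rule der_eqI, simp add: hcomp_subst)+

lemma vhcomp_sum: "vhcomp d (sum f A) = (\<Sum>x\<in>A. vhcomp d (f x))"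
  by (induction A rule: infinite_finite_induct) simp_all

lemma vhcomp_scale_left:
  "mhomogeneous e g \<Longrightarrow> vhcomp d (g *s \<theta>) = (if e \<le> d then g *s vhcomp (d - e) \<theta> else 0)"
  by (intro der_eqI) (simp add: hcomp_mult)

lemma vhcomp_scale_right:
  assumes "vhom e \<theta>"
  shows "vhcomp d (g *s \<theta>) = (if e \<le> d then hcomp (d - e) g *s \<theta> else 0)"
  using hcomp_mult[OF vhom_pair[OF assms], of d _ g] by (intro der_eqI) (simp add: mult.commute)

lemma vhom_add: "vhom d \<theta> \<Longrightarrow> vhom d \<eta> \<Longrightarrow> vhom d (\<theta> + \<eta>)"
  and vhom_diff: "vhom d \<theta> \<Longrightarrow> vhom d \<eta> \<Longrightarrow> vhom d (\<theta> - \<eta>)"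
  and vhom_0 [simp]: "vhom d 0"
  by (simp_all add: vhom_def)

lemma vhom_scale: "mhomogeneous e f \<Longrightarrow> vhom d \<theta> \<Longrightarrow> vhom (e + d) (f *s \<theta>)"
  by (intro vhomI) (simp add: mhomogeneous_mult vhom_pair)

lemma vhom_cvec [simp]: "vhom 0 (cvec v)"
  by (rule vhomI) simp

lemma der_bounded_degree: "\<exists>D. \<forall>d>D. vhcomp d \<theta> = 0"
proof -
  have "\<forall>i. \<exists>D. \<forall>d>D. hcomp d (\<theta> $ i) = 0" using mpoly_bounded_degree by blast
  from choice[OF this] obtain D where D: "\<And>i d. d > D i \<Longrightarrow> hcomp d (\<theta> $ i) = 0" by blast
  have "vhcomp d \<theta> = 0" if "d > Max (range D)" for d
  proof -
    have "d > D i" for i using that by (meson Max_ge finite finite_imageI le_less_trans rangeI)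
    then show ?thesis by (simp add: vec_eq_iff vhcomp_def D)
  qed
  then show ?thesis by blast
qed

lemma sum_vhcomp: "(\<And>d. d > D \<Longrightarrow> vhcomp d \<theta> = 0) \<Longrightarrow> (\<Sum>d\<le>D. vhcomp d \<theta>) = \<theta>"
proof (rule der_eqI)
  fix a assume "\<And>d. d > D \<Longrightarrow> vhcomp d \<theta> = 0"
  then have "hcomp d (pair a \<theta>) = 0" if "d > D" for d using that by (metis pair_vhcomp pair_simps(5))
  then show "pair a (\<Sum>d\<le>D. vhcomp d \<theta>) = pair a \<theta>" by (simp add: pair_sum sum_hcomp)
qed

lemma mvar_deriv_add: "mvar_deriv i (f + g) = mvar_deriv i f + mvar_deriv i g"
proof -
  have sup: "mvar_deriv i f = (\<Sum>m\<in>S. Poly_Mapping.single (m - Poly_Mapping.single i 1)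
      (of_nat (Poly_Mapping.lookup m i) * Poly_Mapping.lookup f m))"
    if "finite S" "Poly_Mapping.keys f \<subseteq> S" for f S
    unfolding mvar_deriv_def using that by (intro sum.mono_neutral_left) (auto simp: in_keys_iff)
  show ?thesis
    using sup[of "Poly_Mapping.keys f \<union> Poly_Mapping.keys g" f]
      sup[of "Poly_Mapping.keys f \<union> Poly_Mapping.keys g" g]
      sup[of "Poly_Mapping.keys f \<union> Poly_Mapping.keys g" "f + g"] keys_add[of f g]
    by (simp add: lookup_add distrib_left single_add sum.distrib)
qed

lemma mvar_deriv_single: "mvar_deriv i (Poly_Mapping.single m c)
    = Poly_Mapping.single (m - Poly_Mapping.single i 1) (of_nat (Poly_Mapping.lookup m i) * c)"
  by (cases "c = 0") (simp_all add: mvar_deriv_def)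

lemma mvar_deriv_linear_form:
  fixes a :: "'k::field ^ 'n::finite"
  shows "mvar_deriv i (linear_form a) = mconst (a $ i)"
proof -
  have zero: "mvar_deriv i 0 = (0 :: ('k, 'n) mpoly)" by (simp add: mvar_deriv_def)
  have sum: "mvar_deriv i (sum f A) = (\<Sum>x\<in>A. mvar_deriv i (f x))" for f :: "'n \<Rightarrow> ('k, 'n) mpoly" and A
    by (induction A rule: infinite_finite_induct) (simp_all add: mvar_deriv_add zero)
  have "mvar_deriv i (linear_form a) = (\<Sum>j\<in>UNIV. if j = i then mconst (a $ i) else 0)"
    unfolding linear_form_def sum mvar_deriv_single
    by (intro sum.cong) (auto simp: lookup_single when_def mconst_def)
  then show ?thesis by simp
qed

lemma der_apply_linear_form: "der_apply \<theta> (linear_form a) = pair a \<theta>"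
  by (simp add: der_apply_def pair_def mvar_deriv_linear_form mult.commute)

subsection \<open>Derivations of the coordinate ring of a subspace\<close>

text \<open>A subspace is given by an idempotent matrix \<open>P\<close> with that range. Its coordinate ring is
  realised as the ring of polynomials fixed by \<open>subst P\<close>, and its derivations are the vectors over
  this ring that are also fixed by \<open>P\<close>.\<close>

definition Der :: "'k::field ^ 'n ^ 'n \<Rightarrow> ('k, 'n::finite) der set" where
  "Der P = {\<theta>. \<forall>a. pair (a v* P) \<theta> = pair a \<theta> \<and> subst P (pair a \<theta>) = pair a \<theta>}"

lemma Der_pair: "\<theta> \<in> Der P \<Longrightarrow> pair (a v* P) \<theta> = pair a \<theta>"
  and Der_subst: "\<theta> \<in> Der P \<Longrightarrow> subst P (pair a \<theta>) = pair a \<theta>"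
  by (simp_all add: Der_def)

lemma Der_0 [simp]: "0 \<in> Der P"
  and Der_add: "\<theta> \<in> Der P \<Longrightarrow> \<eta> \<in> Der P \<Longrightarrow> \<theta> + \<eta> \<in> Der P"
  and Der_diff: "\<theta> \<in> Der P \<Longrightarrow> \<eta> \<in> Der P \<Longrightarrow> \<theta> - \<eta> \<in> Der P"
  and Der_scale: "subst P f = f \<Longrightarrow> \<theta> \<in> Der P \<Longrightarrow> f *s \<theta> \<in> Der P"
  by (simp_all add: Der_def)

lemma Der_sum: "(\<And>x. x \<in> A \<Longrightarrow> f x \<in> Der P) \<Longrightarrow> sum f A \<in> Der P"
  by (induction A rule: infinite_finite_induct) (auto intro: Der_add)

lemma Der_vhcomp: "\<theta> \<in> Der P \<Longrightarrow> vhcomp d \<theta> \<in> Der P"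
  unfolding Der_def by (auto simp flip: hcomp_subst)

lemma Der_cvec: "P *v e = e \<Longrightarrow> cvec e \<in> Der P"
  by (simp add: Der_def dot_vector_matrix)

lemma Der_mat_1 [simp]: "Der (mat 1) = UNIV"
  by (simp add: Der_def)

lemma Der_vsubst: "\<theta> \<in> Der P \<Longrightarrow> vsubst P \<theta> = \<theta>"
  by (rule der_eqI) (simp add: Der_subst)

definition Euler :: "'k::field ^ 'n ^ 'n \<Rightarrow> ('k, 'n::finite) der" where
  "Euler P = (\<chi> i. linear_form (P $ i))"

lemma pair_Euler [simp]: "pair a (Euler P) = linear_form (a v* P)"
  by (simp add: pair_def Euler_def vector_matrix_as_sum linear_form_sum linear_form_scale)

lemma Euler_Der: "P ** P = P \<Longrightarrow> Euler P \<in> Der P"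
  by (simp add: Der_def vector_matrix_assoc)

lemma vhom_Euler [simp]: "vhom 1 (Euler P)"
  by (rule vhomI) simp

lemma Der_scale_cancel:
  fixes f :: "('k::field, 'n::finite) mpoly"
  assumes "f *s \<theta> \<in> Der P" "subst P f = f" "f \<noteq> 0"
  shows "\<theta> \<in> Der P"
proof -
  have "f * pair (a v* P) \<theta> = f * pair a \<theta>" "f * subst P (pair a \<theta>) = f * pair a \<theta>" for a
    using Der_pair[OF assms(1), of a] Der_subst[OF assms(1), of a] assms(2) by auto
  then show ?thesis unfolding Der_def using mpoly_mult_left_cancel[OF assms(3)] by blast
qed

lemma subst_cancel:
  fixes f :: "('k::field, 'n::finite) mpoly"
  shows "subst P (f * g) = f * g \<Longrightarrow> subst P f = f \<Longrightarrow> f \<noteq> 0 \<Longrightarrow> subst P g = g"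
  using mpoly_mult_left_cancel[of f "subst P g" g] by simp

lemma der_scale_left_cancel:
  fixes f :: "('k::field, 'n::finite) mpoly" and \<theta> \<eta> :: "('k, 'n) der"
  assumes "f *s \<theta> = f *s \<eta>" "f \<noteq> 0"
  shows "\<theta> = \<eta>"
proof (rule der_eqI)
  fix a
  have "f * pair a \<theta> = f * pair a \<eta>" using assms(1) by (metis pair_simps(4))
  then show "pair a \<theta> = pair a \<eta>" using mpoly_mult_left_cancel[OF assms(2)] by blast
qed

lemma der_dvdE:
  fixes \<theta> :: "('k::field, 'n::finite) der"
  assumes "\<And>a. d dvd pair a \<theta>"
  shows "\<exists>\<eta>. \<theta> = d *s \<eta>"
proof -
  have "\<forall>i. \<exists>g. \<theta> $ i = d * g" using assms[of "axis _ 1"] by (auto elim: dvdE)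
  then obtain g where "\<And>i. \<theta> $ i = d * g i" by metis
  then have "\<theta> = d *s (\<chi> i. g i)" by (simp add: vec_eq_iff)
  then show ?thesis by blast
qed

section \<open>Finite-dimensional subspaces\<close>

context vector_space begin

text \<open>The polynomial ring is infinite-dimensional, so finiteness enters through a finite set
  whose span contains the larger space; such a set exists for each homogeneous degree.\<close>

lemma dim_mono_finite:
  assumes "X \<subseteq> Y" "Y \<subseteq> span B" "finite B"
  shows "dim X \<le> dim Y"
proof -
  obtain C where C: "C \<subseteq> X" "independent C" "X \<subseteq> span C" "card C = dim X" using basis_exists by blast
  obtain D where D: "D \<subseteq> Y" "independent D" "Y \<subseteq> span D" "card D = dim Y" using basis_exists by blast
  have "finite D" using independent_span_bound[OF assms(3) D(2)] D(1) assms(2) by auto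
  then have "card C \<le> card D" using independent_span_bound[OF _ C(2), of D] C(1) D(3) assms(1) by auto
  then show ?thesis using C D by simp
qed

lemma subspace_eq_finite:
  assumes "X \<subseteq> Y" "subspace X" "Y \<subseteq> span B" "finite B" "dim Y \<le> dim X"
  shows "X = Y"
proof -
  obtain C where C: "C \<subseteq> X" "independent C" "X \<subseteq> span C" "card C = dim X" using basis_exists by blast
  obtain D where D: "C \<subseteq> D" "D \<subseteq> Y" "independent D" "Y \<subseteq> span D"
    using maximal_independent_subset_extend[of C Y] C assms(1) by blast
  have fD: "finite D" using independent_span_bound[OF assms(4) D(3)] D(2) assms(3) by auto
  have "card D = dim Y" using basis_card_eq_dim D by blast
  then have "D = C" using fD D(1) C(4) assms(5) card_seteq by metis
  then have "Y \<subseteq> span X" using D(4) C(1) span_mono by blast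
  then show ?thesis using assms(1,2) span_eq_iff by blast
qed

end

context vector_space_pair begin

text \<open>A basis \<open>C\<close> of the kernel extends to a basis \<open>D\<close> of
  \<open>X\<close>, and \<open>f\<close> maps \<open>D - C\<close> injectively onto a basis of the
  image.\<close>

lemma rank_nullity_finite:
  assumes lin: "Vector_Spaces.linear s1 s2 f" and X: "vs1.subspace X" "X \<subseteq> vs1.span B" "finite B"
  shows "vs1.dim X = vs1.dim {x\<in>X. f x = 0} + vs2.dim (f ` X)"
proof -
  interpret f: Vector_Spaces.linear s1 s2 f by (rule lin)
  let ?K = "{x\<in>X. f x = 0}"
  have K: "vs1.subspace ?K"
    using X(1) unfolding vs1.subspace_def by (auto simp: f.add f.scale f.zero)
  obtain C where C: "C \<subseteq> ?K" "vs1.independent C" "?K \<subseteq> vs1.span C" "card C = vs1.dim ?K"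
    using vs1.basis_exists by blast
  obtain D where D: "C \<subseteq> D" "D \<subseteq> X" "vs1.independent D" "X \<subseteq> vs1.span D"
    using vs1.maximal_independent_subset_extend[of C X] C by blast
  have fD: "finite D" using vs1.independent_span_bound[OF X(3) D(3)] D(2) X(2) by auto
  have indE: "vs1.independent (D - C)" using D(3) vs1.independent_mono by blast
  have zero: "x = 0" if x: "x \<in> vs1.span (D - C)" "f x = 0" for x
  proof -
    have "x \<in> X" using x(1) D(2) X(1) vs1.span_minimal[of "D - C" X] by blast
    then have "x \<in> vs1.span C" using x(2) C(3) by auto
    then obtain u where u: "x = (\<Sum>v\<in>C. s1 (u v) v)"
      using vs1.span_finite[of C] fD D(1) finite_subset by auto
    obtain w where w: "x = (\<Sum>v\<in>D - C. s1 (w v) v)"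
      using x(1) vs1.span_finite[of "D - C"] fD by auto
    \<comment> \<open>Expansions of the same vector in \<open>C\<close> and in \<open>D - C\<close>
      combine to a single relation on the basis \<open>D\<close>.\<close>
    define r where "r v = (if v \<in> C then - u v else w v)" for v
    have "(\<Sum>v\<in>D. s1 (r v) v) = (\<Sum>v\<in>D - C. s1 (r v) v) + (\<Sum>v\<in>C. s1 (r v) v)"
      using sum.subset_diff[OF D(1) fD] .
    also have "(\<Sum>v\<in>D - C. s1 (r v) v) = x"
      unfolding w by (intro sum.cong) (auto simp: r_def)
    also have "(\<Sum>v\<in>C. s1 (r v) v) = - x"
      unfolding u sum_negf[symmetric] by (intro sum.cong) (auto simp: r_def vs1.scale_minus_left)
    finally have "(\<Sum>v\<in>D. s1 (r v) v) = 0" by simp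
    then have "\<forall>v\<in>D. r v = 0"
      using D(3) fD vs1.dependent_finite by blast
    then have "\<forall>v\<in>D - C. w v = 0" by (auto simp: r_def)
    then show "x = 0" unfolding w by (intro sum.neutral) simp
  qed
  have inj: "inj_on f (vs1.span (D - C))"
    using linear_inj_on_iff_eq_0[OF lin vs1.subspace_span] zero by blast
  have "vs2.independent (f ` (D - C))"
    using linear_independent_injective_image[OF lin indE inj] .
  moreover have "f ` (D - C) \<subseteq> f ` X" using D(2) by blast
  moreover have "f ` X \<subseteq> vs2.span (f ` (D - C))"
  proof
    fix y assume "y \<in> f ` X"
    then have "y \<in> f ` vs1.span D" using D(4) by blast
    then have "y \<in> vs2.span (f ` D)" using f.span_image by metis
    moreover have "f ` D \<subseteq> insert 0 (f ` (D - C))" using C(1) by auto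
    ultimately have "y \<in> vs2.span (insert 0 (f ` (D - C)))" using vs2.span_mono by blast
    then show "y \<in> vs2.span (f ` (D - C))" by simp
  qed
  ultimately have "vs2.dim (f ` X) = card (f ` (D - C))"
    using vs2.basis_card_eq_dim by metis
  also have "\<dots> = card (D - C)"
    using inj inj_on_subset vs1.span_superset card_image by metis
  finally have "vs2.dim (f ` X) = card D - card C"
    using D(1) fD by (simp add: card_Diff_subset finite_subset)
  moreover have "card C \<le> card D" using D(1) fD by (simp add: card_mono)
  moreover have "vs1.dim X = card D" using vs1.basis_card_eq_dim D by metis
  ultimately show ?thesis using C(4) by simp
qed

end

section \<open>Sets of depth three\<close>

definition fix_ring :: "'k::field ^ 'n ^ 'n \<Rightarrow> ('k, 'n::finite) mpoly set" where
  "fix_ring P = {f. subst P f = f}"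

lemma fix_ring_0 [simp]: "0 \<in> fix_ring P"
  and fix_ring_1 [simp]: "1 \<in> fix_ring P"
  and fix_ring_mconst [simp]: "mconst c \<in> fix_ring P"
  and fix_ring_add: "f \<in> fix_ring P \<Longrightarrow> g \<in> fix_ring P \<Longrightarrow> f + g \<in> fix_ring P"
  and fix_ring_diff: "f \<in> fix_ring P \<Longrightarrow> g \<in> fix_ring P \<Longrightarrow> f - g \<in> fix_ring P"
  and fix_ring_mult: "f \<in> fix_ring P \<Longrightarrow> g \<in> fix_ring P \<Longrightarrow> f * g \<in> fix_ring P"
  and fix_ring_uminus: "f \<in> fix_ring P \<Longrightarrow> - f \<in> fix_ring P"
  by (simp_all add: fix_ring_def)

lemma fix_ring_linear_form: "a v* P = a \<Longrightarrow> linear_form a \<in> fix_ring P"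
  by (simp add: fix_ring_def)

lemma fix_ring_prod: "(\<And>x. x \<in> A \<Longrightarrow> f x \<in> fix_ring P) \<Longrightarrow> prod f A \<in> fix_ring P"
  by (induction A rule: infinite_finite_induct) (auto intro: fix_ring_mult)

lemma fix_ring_sum: "(\<And>x. x \<in> A \<Longrightarrow> f x \<in> fix_ring P) \<Longrightarrow> sum f A \<in> fix_ring P"
  by (induction A rule: infinite_finite_induct) (auto intro: fix_ring_add)

lemma fix_ring_hcomp: "f \<in> fix_ring P \<Longrightarrow> hcomp d f \<in> fix_ring P"
  by (simp add: fix_ring_def flip: hcomp_subst)

lemma fix_ring_cancel:
  "f * g \<in> fix_ring P \<Longrightarrow> f \<in> fix_ring P \<Longrightarrow> f \<noteq> 0 \<Longrightarrow> g \<in> fix_ring P"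
  using subst_cancel unfolding fix_ring_def by blast

lemma fix_ring_subst: "P ** P = P \<Longrightarrow> subst P f \<in> fix_ring P"
  by (simp add: fix_ring_def subst_subst)

lemma Der_scale': "f \<in> fix_ring P \<Longrightarrow> \<theta> \<in> Der P \<Longrightarrow> f *s \<theta> \<in> Der P"
  by (simp add: fix_ring_def Der_scale)

section \<open>Submodules generated by finite families\<close>

definition gspan :: "'k::field ^ 'n ^ 'n \<Rightarrow> nat \<Rightarrow> (nat \<Rightarrow> ('k, 'n::finite) der) \<Rightarrow> ('k, 'n) der set" where
  "gspan P m \<gamma> = {(\<Sum>j<m. c j *s \<gamma> j) | c. \<forall>j<m. c j \<in> fix_ring P}"

text \<open>Coefficients range over the coordinate ring of the range of \<open>P\<close> only.
  Families are indexed by numbers so that a further generator can be prepended with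
  \<open>case_nat\<close>.\<close>

definition gindep :: "'k::field ^ 'n ^ 'n \<Rightarrow> nat \<Rightarrow> (nat \<Rightarrow> ('k, 'n::finite) der) \<Rightarrow> bool" where
  "gindep P m \<gamma> \<longleftrightarrow>
     (\<forall>c. (\<forall>j<m. c j \<in> fix_ring P) \<and> (\<Sum>j<m. c j *s \<gamma> j) = 0 \<longrightarrow> (\<forall>j<m. c j = 0))"

lemma gspanI: "(\<And>j. j < m \<Longrightarrow> c j \<in> fix_ring P) \<Longrightarrow> (\<Sum>j<m. c j *s \<gamma> j) \<in> gspan P m \<gamma>"
  unfolding gspan_def by blast

lemma gspanE:
  assumes "\<theta> \<in> gspan P m \<gamma>"
  obtains c where "\<And>j. j < m \<Longrightarrow> c j \<in> fix_ring P" "\<theta> = (\<Sum>j<m. c j *s \<gamma> j)"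
  using assms unfolding gspan_def by blast

lemma gspanD:
  "\<theta> \<in> gspan P m \<gamma> \<Longrightarrow> \<exists>c. (\<forall>j<m. c j \<in> fix_ring P) \<and> \<theta> = (\<Sum>j<m. c j *s \<gamma> j)"
  unfolding gspan_def by blast

lemma gspan_add: "\<theta> \<in> gspan P m \<gamma> \<Longrightarrow> \<eta> \<in> gspan P m \<gamma> \<Longrightarrow> \<theta> + \<eta> \<in> gspan P m \<gamma>"
proof (elim gspanE)
  fix c d assume *: "\<And>j. j < m \<Longrightarrow> c j \<in> fix_ring P" "\<theta> = (\<Sum>j<m. c j *s \<gamma> j)"
    "\<And>j. j < m \<Longrightarrow> d j \<in> fix_ring P" "\<eta> = (\<Sum>j<m. d j *s \<gamma> j)"
  then have "\<theta> + \<eta> = (\<Sum>j<m. (c j + d j) *s \<gamma> j)"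
    by (simp add: sum.distrib vector_sadd_rdistrib)
  then show ?thesis using gspanI[of m "\<lambda>j. c j + d j" P \<gamma>] *(1,3) fix_ring_add by metis
qed

lemma gspan_scale: "f \<in> fix_ring P \<Longrightarrow> \<theta> \<in> gspan P m \<gamma> \<Longrightarrow> f *s \<theta> \<in> gspan P m \<gamma>"
proof (elim gspanE)
  fix c assume *: "f \<in> fix_ring P" "\<And>j. j < m \<Longrightarrow> c j \<in> fix_ring P" "\<theta> = (\<Sum>j<m. c j *s \<gamma> j)"
  then have "f *s \<theta> = (\<Sum>j<m. (f * c j) *s \<gamma> j)"
    by (intro der_eqI) (simp add: pair_sum sum_distrib_left mult.assoc)
  then show ?thesis using gspanI[of m "\<lambda>j. f * c j" P \<gamma>] *(1,2) fix_ring_mult by metis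
qed

lemma gspan_diff: "\<theta> \<in> gspan P m \<gamma> \<Longrightarrow> \<eta> \<in> gspan P m \<gamma> \<Longrightarrow> \<theta> - \<eta> \<in> gspan P m \<gamma>"
  using gspan_add[of \<theta> P m \<gamma> "(- 1) *s \<eta>"] gspan_scale[of "- 1" P \<eta> m \<gamma>]
  by (simp add: fix_ring_uminus vector_sneg_minus1[symmetric])

lemma gspan_0: "0 \<in> gspan P m \<gamma>"
  using gspanI[of m "\<lambda>_. 0" P \<gamma>] by simp

lemma gspan_base: "j < m \<Longrightarrow> \<gamma> j \<in> gspan P m \<gamma>"
proof -
  assume "j < m"
  then have "(\<Sum>i<m. (if i = j then 1 else 0) *s \<gamma> i) = \<gamma> j"
    by (subst sum.remove[of _ j]) (auto intro!: sum.neutral)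
  then show ?thesis
    using gspanI[of m "\<lambda>i. if i = j then 1 else 0" P \<gamma>] by simp
qed

lemma gspan_subset_Der: "(\<And>j. j < m \<Longrightarrow> \<gamma> j \<in> Der P) \<Longrightarrow> gspan P m \<gamma> \<subseteq> Der P"
  by (auto elim!: gspanE intro!: Der_sum Der_scale')

text \<open>Stated for the coset representatives of a module \<open>M / G\<close>: no element of \<open>M / G\<close> is killed
  by \<open>I\<close>, and every homomorphism from the ideal generated by \<open>I\<close> to \<open>M / G\<close> is the multiplication
  by an element. For an ideal \<open>I\<close> both hold whenever \<open>M\<close> and \<open>G\<close> are free and \<open>I\<close> has depth at
  least three.\<close>

definition torsion_free ::
    "('k::field, 'n::finite) mpoly set \<Rightarrow> ('k, 'n) der set \<Rightarrow> ('k, 'n) der set \<Rightarrow> bool" where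
  "torsion_free I M G \<longleftrightarrow> (\<forall>\<theta>\<in>M. (\<forall>g\<in>I. g *s \<theta> \<in> G) \<longrightarrow> \<theta> \<in> G)"

definition gluing ::
    "('k::field, 'n::finite) mpoly set \<Rightarrow> ('k, 'n) der set \<Rightarrow> ('k, 'n) der set \<Rightarrow> bool" where
  "gluing I M G \<longleftrightarrow> (\<forall>\<kappa>. (\<forall>g\<in>I. \<kappa> g \<in> M) \<and> (\<forall>g\<in>I. \<forall>h\<in>I. h *s \<kappa> g - g *s \<kappa> h \<in> G) \<longrightarrow>
     (\<exists>\<omega>\<in>M. \<forall>g\<in>I. \<kappa> g - g *s \<omega> \<in> G))"

text \<open>\<open>I\<close> plays the role of generators of an ideal of depth at least three,
  tested on the quotients of \<open>Der P\<close> by free submodules. The clause on linear forms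
  serves \<open>lift_G\<close>, where lifts are examined on one hyperplane at a time.\<close>

definition deep :: "'k::field ^ 'n ^ 'n \<Rightarrow> ('k, 'n::finite) mpoly set \<Rightarrow> bool" where
  "deep P I \<longleftrightarrow> I \<subseteq> fix_ring P \<and> (\<forall>a. a \<noteq> 0 \<longrightarrow> (\<exists>g\<in>I. \<not> linear_form a dvd g)) \<and>
     (\<forall>m \<gamma>. (\<forall>j<m. \<gamma> j \<in> Der P) \<and> gindep P m \<gamma> \<longrightarrow>
        torsion_free I (Der P) (gspan P m \<gamma>) \<and> gluing I (Der P) (gspan P m \<gamma>))"

lemma deep_subset: "deep P I \<Longrightarrow> I \<subseteq> fix_ring P"
  and deep_not_dvd: "deep P I \<Longrightarrow> a \<noteq> 0 \<Longrightarrow> \<exists>g\<in>I. \<not> linear_form a dvd g"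
  by (auto simp: deep_def)

lemma deepD:
  assumes "deep P I" "(\<forall>j<m. \<gamma> j \<in> Der P) \<and> gindep P m \<gamma>"
  shows "torsion_free I (Der P) (gspan P m \<gamma>)" "gluing I (Der P) (gspan P m \<gamma>)"
  using assms by (simp_all add: deep_def)

lemma deep_torsion_free:
  assumes "deep P I" "\<And>j. j < m \<Longrightarrow> \<gamma> j \<in> Der P" "gindep P m \<gamma>" "\<theta> \<in> Der P"
    "\<And>g. g \<in> I \<Longrightarrow> g *s \<theta> \<in> gspan P m \<gamma>"
  shows "\<theta> \<in> gspan P m \<gamma>"
  using deepD(1)[OF assms(1), of m \<gamma>] assms(2-) unfolding torsion_free_def by blast

lemma deep_gluing:
  assumes "deep P I" "\<And>j. j < m \<Longrightarrow> \<gamma> j \<in> Der P" "gindep P m \<gamma>" "\<And>g. g \<in> I \<Longrightarrow> \<kappa> g \<in> Der P"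
    "\<And>g h. g \<in> I \<Longrightarrow> h \<in> I \<Longrightarrow> h *s \<kappa> g - g *s \<kappa> h \<in> gspan P m \<gamma>"
  shows "\<exists>\<omega>\<in>Der P. \<forall>g\<in>I. \<kappa> g - g *s \<omega> \<in> gspan P m \<gamma>"
proof -
  have "gluing I (Der P) (gspan P m \<gamma>)" using deepD(2)[OF assms(1)] assms(2,3) by blast
  then show ?thesis using assms(4,5) unfolding gluing_def by blast
qed

lemma deep_one: "deep P {1}"
  unfolding deep_def
proof (intro conjI allI impI)
  fix a :: "'a ^ 'b" assume "a \<noteq> 0"
  then show "\<exists>g\<in>{1}. \<not> linear_form a dvd g" using linear_form_not_dvd_1 by blast
next
  fix m and \<gamma> :: "nat \<Rightarrow> ('a, 'b) der"
  show "gluing {1} (Der P) (gspan P m \<gamma>)"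
    unfolding gluing_def
  proof (intro allI impI)
    fix \<kappa> assume "(\<forall>g\<in>{1}. \<kappa> g \<in> Der P) \<and> (\<forall>g\<in>{1}. \<forall>h\<in>{1}. h *s \<kappa> g - g *s \<kappa> h \<in> gspan P m \<gamma>)"
    then show "\<exists>\<omega>\<in>Der P. \<forall>g\<in>{1}. \<kappa> g - g *s \<omega> \<in> gspan P m \<gamma>"
      by (intro bexI[of _ "\<kappa> 1"]) (auto simp: gspan_0)
  qed
qed (simp_all add: torsion_free_def)

text \<open>The factors are removed one after the other: first \<open>g\<close> with
  \<open>h *s \<theta>\<close> as the element, then \<open>h\<close>.\<close>

lemma torsion_free_mult:
  assumes "torsion_free I M G" "torsion_free J M G" "\<And>h \<theta>. h \<in> J \<Longrightarrow> \<theta> \<in> M \<Longrightarrow> h *s \<theta> \<in> M"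
  shows "torsion_free {g * h | g h. g \<in> I \<and> h \<in> J} M G"
  unfolding torsion_free_def
proof (intro ballI impI)
  fix \<theta> assume \<theta>: "\<theta> \<in> M" "\<forall>g\<in>{g * h | g h. g \<in> I \<and> h \<in> J}. g *s \<theta> \<in> G"
  have "h *s \<theta> \<in> G" if "h \<in> J" for h
  proof -
    have "g *s (h *s \<theta>) \<in> G" if "g \<in> I" for g
      using \<theta>(2) \<open>h \<in> J\<close> that by (auto simp: vector_smult_assoc)
    then show ?thesis using assms(1,3) \<theta>(1) that unfolding torsion_free_def by blast
  qed
  then show "\<theta> \<in> G" using assms(2) \<theta>(1) unfolding torsion_free_def by blast
qed

text \<open>Gluing over \<open>I\<close> with \<open>h\<close> fixed gives
  \<open>\<omega> h\<close>, and gluing these over \<open>J\<close> gives the result. Since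
  \<open>\<kappa>\<close> is known on products only, each compatibility is first shown after
  multiplication by an arbitrary \<open>k\<close> of the product set, and
  \<open>torsion_free_mult\<close> then removes \<open>k\<close>.\<close>

lemma gluing_mult:
  fixes I J :: "('k::field, 'n::finite) mpoly set"
  assumes "gluing I M G" "gluing J M G" "torsion_free I M G" "torsion_free J M G"
    and M: "\<And>f \<theta>. f \<in> I \<union> J \<Longrightarrow> \<theta> \<in> M \<Longrightarrow> f *s \<theta> \<in> M"
      "\<And>\<theta> \<eta>. \<theta> \<in> M \<Longrightarrow> \<eta> \<in> M \<Longrightarrow> \<theta> - \<eta> \<in> M"
    and G: "\<And>f \<theta>. f \<in> I \<union> J \<Longrightarrow> \<theta> \<in> G \<Longrightarrow> f *s \<theta> \<in> G"
      "\<And>\<theta> \<eta>. \<theta> \<in> G \<Longrightarrow> \<eta> \<in> G \<Longrightarrow> \<theta> - \<eta> \<in> G" "\<And>\<theta> \<eta>. \<theta> \<in> G \<Longrightarrow> \<eta> \<in> G \<Longrightarrow> \<theta> + \<eta> \<in> G"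
  shows "gluing {g * h | g h. g \<in> I \<and> h \<in> J} M G"
  unfolding gluing_def
proof (intro allI impI, elim conjE)
  let ?K = "{g * h | g h. g \<in> I \<and> h \<in> J}"
  fix \<kappa> assume \<kappa>: "\<forall>g\<in>?K. \<kappa> g \<in> M" and comp: "\<forall>g\<in>?K. \<forall>h\<in>?K. h *s \<kappa> g - g *s \<kappa> h \<in> G"
  have TK: "torsion_free ?K M G" using torsion_free_mult[OF assms(3,4)] M(1) by blast
  have \<kappa>M: "\<kappa> (g * h) \<in> M" if "g \<in> I" "h \<in> J" for g h using \<kappa> that by blast
  have step: "g' *s \<kappa> (g * h) - g *s \<kappa> (g' * h) \<in> G" if g: "g \<in> I" "g' \<in> I" "h \<in> J" for g g' h
  proof -
    have "k *s (g' *s \<kappa> (g * h) - g *s \<kappa> (g' * h)) \<in> G" if "k \<in> ?K" for k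
    proof -
      have "g' *s (k *s \<kappa> (g * h) - (g * h) *s \<kappa> k) \<in> G" "g *s (k *s \<kappa> (g' * h) - (g' * h) *s \<kappa> k) \<in> G"
        using comp that g G(1) by blast+
      then have "g' *s (k *s \<kappa> (g * h) - (g * h) *s \<kappa> k) - g *s (k *s \<kappa> (g' * h) - (g' * h) *s \<kappa> k) \<in> G"
        by (rule G(2))
      also have "g' *s (k *s \<kappa> (g * h) - (g * h) *s \<kappa> k) - g *s (k *s \<kappa> (g' * h) - (g' * h) *s \<kappa> k)
          = k *s (g' *s \<kappa> (g * h) - g *s \<kappa> (g' * h))"
        by (rule der_eqI) (simp add: algebra_simps)
      finally show ?thesis .
    qed
    moreover have "g' *s \<kappa> (g * h) - g *s \<kappa> (g' * h) \<in> M"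
      using \<kappa>M g M by blast
    ultimately show ?thesis using TK unfolding torsion_free_def by blast
  qed
  have "\<exists>\<omega>\<in>M. \<forall>g\<in>I. \<kappa> (g * h) - g *s \<omega> \<in> G" if h: "h \<in> J" for h
    using assms(1)[unfolded gluing_def, rule_format, of "\<lambda>g. \<kappa> (g * h)"] \<kappa>M step h by blast
  then obtain \<omega> where \<omega>: "\<And>h. h \<in> J \<Longrightarrow> \<omega> h \<in> M" "\<And>h g. h \<in> J \<Longrightarrow> g \<in> I \<Longrightarrow> \<kappa> (g * h) - g *s \<omega> h \<in> G"
    by metis
  have "h' *s \<omega> h - h *s \<omega> h' \<in> G" if h: "h \<in> J" "h' \<in> J" for h h'
  proof -
    have "g *s (h' *s \<omega> h - h *s \<omega> h') \<in> G" if g: "g \<in> I" for g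
    proof -
      have A: "h' *s \<kappa> (g * h) - h *s \<kappa> (g * h') \<in> G"
      proof -
        have "k *s (h' *s \<kappa> (g * h) - h *s \<kappa> (g * h')) \<in> G" if "k \<in> ?K" for k
        proof -
          have "h' *s (k *s \<kappa> (g * h) - (g * h) *s \<kappa> k) \<in> G" "h *s (k *s \<kappa> (g * h') - (g * h') *s \<kappa> k) \<in> G"
            using comp that g h G(1) by blast+
          then have "h' *s (k *s \<kappa> (g * h) - (g * h) *s \<kappa> k) - h *s (k *s \<kappa> (g * h') - (g * h') *s \<kappa> k) \<in> G"
            by (rule G(2))
          also have "h' *s (k *s \<kappa> (g * h) - (g * h) *s \<kappa> k) - h *s (k *s \<kappa> (g * h') - (g * h') *s \<kappa> k)
              = k *s (h' *s \<kappa> (g * h) - h *s \<kappa> (g * h'))"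
            by (rule der_eqI) (simp add: algebra_simps)
          finally show ?thesis .
        qed
        moreover have "h' *s \<kappa> (g * h) - h *s \<kappa> (g * h') \<in> M"
          using \<kappa>M g h M by blast
        ultimately show ?thesis using TK unfolding torsion_free_def by blast
      qed
      have "h' *s (\<kappa> (g * h) - g *s \<omega> h) \<in> G" "h *s (\<kappa> (g * h') - g *s \<omega> h') \<in> G"
        using \<omega>(2) g h G(1) by blast+
      then have "(h' *s \<kappa> (g * h) - h *s \<kappa> (g * h')) - (h' *s (\<kappa> (g * h) - g *s \<omega> h) - h *s (\<kappa> (g * h') - g *s \<omega> h')) \<in> G"
        using A G(2) by blast
      also have "(h' *s \<kappa> (g * h) - h *s \<kappa> (g * h')) - (h' *s (\<kappa> (g * h) - g *s \<omega> h) - h *s (\<kappa> (g * h') - g *s \<omega> h'))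
          = g *s (h' *s \<omega> h - h *s \<omega> h')"
        by (rule der_eqI) (simp add: algebra_simps)
      finally show ?thesis .
    qed
    moreover have "h' *s \<omega> h - h *s \<omega> h' \<in> M" using \<omega>(1) h M by blast
    ultimately show ?thesis using assms(3) unfolding torsion_free_def by blast
  qed
  then obtain \<omega>' where \<omega>': "\<omega>' \<in> M" "\<And>h. h \<in> J \<Longrightarrow> \<omega> h - h *s \<omega>' \<in> G"
    using assms(2)[unfolded gluing_def, rule_format, of \<omega>] \<omega>(1) by blast
  have "\<kappa> (g * h) - (g * h) *s \<omega>' \<in> G" if "g \<in> I" "h \<in> J" for g h
  proof -
    have "(\<kappa> (g * h) - g *s \<omega> h) + g *s (\<omega> h - h *s \<omega>') \<in> G"
      using \<omega>(2) \<omega>'(2) that G by blast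
    also have "(\<kappa> (g * h) - g *s \<omega> h) + g *s (\<omega> h - h *s \<omega>') = \<kappa> (g * h) - (g * h) *s \<omega>'"
      by (rule der_eqI) (simp add: algebra_simps)
    finally show ?thesis .
  qed
  then show "\<exists>\<omega>\<in>M. \<forall>g\<in>?K. \<kappa> g - g *s \<omega> \<in> G" using \<omega>'(1) by blast
qed

lemma deep_mult:
  assumes I: "deep P I" and J: "deep P J"
  shows "deep P {g * h | g h. g \<in> I \<and> h \<in> J}"
  unfolding deep_def
proof (intro conjI allI impI)
  have sub: "I \<union> J \<subseteq> fix_ring P" using I J deep_subset by blast
  then show "{g * h | g h. g \<in> I \<and> h \<in> J} \<subseteq> fix_ring P" by (auto intro: fix_ring_mult)
  fix a :: "'a ^ 'b" assume "a \<noteq> 0"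
  then obtain g h where "g \<in> I" "h \<in> J" "\<not> linear_form a dvd g" "\<not> linear_form a dvd h"
    using deep_not_dvd I J by metis
  then show "\<exists>g\<in>{g * h | g h. g \<in> I \<and> h \<in> J}. \<not> linear_form a dvd g"
    using linear_form_prime[OF \<open>a \<noteq> 0\<close>] by blast
next
  fix m \<gamma>
  assume *: "(\<forall>j<m. \<gamma> j \<in> Der P) \<and> gindep P m \<gamma>"
  have sub: "I \<union> J \<subseteq> fix_ring P" using I J deep_subset by blast
  have T: "torsion_free I (Der P) (gspan P m \<gamma>)" "torsion_free J (Der P) (gspan P m \<gamma>)"
    "gluing I (Der P) (gspan P m \<gamma>)" "gluing J (Der P) (gspan P m \<gamma>)"
    using deepD[OF I *] deepD[OF J *] by auto
  show "torsion_free {g * h | g h. g \<in> I \<and> h \<in> J} (Der P) (gspan P m \<gamma>)"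
    using torsion_free_mult[OF T(1,2)] sub Der_scale' by blast
  show "gluing {g * h | g h. g \<in> I \<and> h \<in> J} (Der P) (gspan P m \<gamma>)"
    using sub by (intro gluing_mult T) (auto intro: Der_scale' Der_diff gspan_scale gspan_diff gspan_add)
qed

text \<open>An \<open>\<omega>\<close> found for \<open>J\<close> serves for \<open>I\<close>: every
  \<open>h\<close> in \<open>J\<close> carries \<open>\<kappa> g - g *s \<omega>\<close> into the
  submodule, so it lies there by torsion-freeness.\<close>

lemma deep_superset:
  assumes J: "deep P J" and "J \<subseteq> I" "I \<subseteq> fix_ring P"
  shows "deep P I"
  unfolding deep_def
proof (intro conjI allI impI)
  show "I \<subseteq> fix_ring P" by fact
  fix a :: "'a ^ 'b" assume "a \<noteq> 0"
  then show "\<exists>g\<in>I. \<not> linear_form a dvd g" using deep_not_dvd[OF J] assms(2) by blast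
next
  fix m \<gamma>
  assume *: "(\<forall>j<m. \<gamma> j \<in> Der P) \<and> gindep P m \<gamma>"
  let ?G = "gspan P m \<gamma>"
  have T: "torsion_free J (Der P) ?G" "gluing J (Der P) ?G"
    using deepD[OF J *] by auto
  then show "torsion_free I (Der P) ?G" using assms(2) unfolding torsion_free_def by blast
  show "gluing I (Der P) ?G"
    unfolding gluing_def
  proof (intro allI impI, elim conjE)
    fix \<kappa> assume \<kappa>: "\<forall>g\<in>I. \<kappa> g \<in> Der P" and comp: "\<forall>g\<in>I. \<forall>h\<in>I. h *s \<kappa> g - g *s \<kappa> h \<in> ?G"
    obtain \<omega> where \<omega>: "\<omega> \<in> Der P" "\<And>g. g \<in> J \<Longrightarrow> \<kappa> g - g *s \<omega> \<in> ?G"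
      using T(2)[unfolded gluing_def, rule_format, of \<kappa>] \<kappa> comp assms(2) by blast
    have "\<kappa> g - g *s \<omega> \<in> ?G" if g: "g \<in> I" for g
    proof -
      have "h *s (\<kappa> g - g *s \<omega>) \<in> ?G" if h: "h \<in> J" for h
      proof -
        have "(h *s \<kappa> g - g *s \<kappa> h) + g *s (\<kappa> h - h *s \<omega>) \<in> ?G"
          using comp g h \<omega>(2) assms(2,3) by (intro gspan_add gspan_scale) auto
        also have "(h *s \<kappa> g - g *s \<kappa> h) + g *s (\<kappa> h - h *s \<omega>) = h *s (\<kappa> g - g *s \<omega>)"
          by (rule der_eqI) (simp add: algebra_simps)
        finally show ?thesis .
      qed
      moreover have "\<kappa> g - g *s \<omega> \<in> Der P"
        using \<kappa> g \<omega>(1) assms(3) by (auto intro: Der_diff Der_scale')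
      ultimately show ?thesis using T(1) unfolding torsion_free_def by blast
    qed
    then show "\<exists>\<omega>\<in>Der P. \<forall>g\<in>I. \<kappa> g - g *s \<omega> \<in> ?G" using \<omega>(1) by blast
  qed
qed

lemma gindep_eq:
  assumes "gindep P m \<gamma>" "\<And>j. j < m \<Longrightarrow> c j \<in> fix_ring P" "\<And>j. j < m \<Longrightarrow> d j \<in> fix_ring P"
    "(\<Sum>j<m. c j *s \<gamma> j) = (\<Sum>j<m. d j *s \<gamma> j)" "j < m"
  shows "c j = d j"
proof -
  have "(\<Sum>j<m. (c j - d j) *s \<gamma> j) = 0"
    using assms(4) by (simp add: vector_sub_rdistrib sum_subtractf)
  moreover have "c j - d j \<in> fix_ring P" if "j < m" for j
    using assms(2,3) that by (intro fix_ring_diff)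
  ultimately have "\<forall>j<m. c j - d j = 0"
    by (intro assms(1)[unfolded gindep_def, THEN spec, THEN mp]) auto
  then show ?thesis using assms(5) by auto
qed

lemma gsum_scale: "f *s (\<Sum>j<m. c j *s \<gamma> j) = (\<Sum>j<m. (f * c j) *s (\<gamma> j :: ('k::field, 'n::finite) der))"
  by (rule der_eqI) (simp add: pair_sum sum_distrib_left mult.assoc)

lemma gsum_diff: "(\<Sum>j<m. c j *s \<gamma> j) - (\<Sum>j<m. d j *s \<gamma> j) = (\<Sum>j<m. (c j - d j) *s (\<gamma> j :: ('k::field, 'n::finite) der))"
  by (rule der_eqI) (simp add: pair_sum sum_subtractf left_diff_distrib)

lemma gsum_add: "(\<Sum>j<m. c j *s \<gamma> j) + (\<Sum>j<m. d j *s \<gamma> j) = (\<Sum>j<m. (c j + d j) *s (\<gamma> j :: ('k::field, 'n::finite) der))"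
  by (rule der_eqI) (simp add: pair_sum sum.distrib distrib_right)


text \<open>Exactness of the Koszul complex of three linear forms in its middle terms.\<close>

lemma deep_triple:
  assumes ind: "indep3 u v w" and inv: "u v* P = u" "v v* P = v" "w v* P = w" and P: "P ** P = P"
  shows "deep P {linear_form u, linear_form v, linear_form w}"
  unfolding deep_def
proof (intro conjI allI impI)
  let ?u = "linear_form u" and ?v = "linear_form v" and ?w = "linear_form w"
  have R: "?u \<in> fix_ring P" "?v \<in> fix_ring P" "?w \<in> fix_ring P"
    using inv by (auto intro: fix_ring_linear_form)
  then show "{?u, ?v, ?w} \<subseteq> fix_ring P" by simp
  note ind2 = indep3_indep2[OF ind]
  have nz: "u \<noteq> 0" "v \<noteq> 0" "w \<noteq> 0" using indep2_nonzero ind2 by blast+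
  fix a :: "'a ^ 'b" assume a: "a \<noteq> 0"
  have "\<not> (linear_form a dvd ?u \<and> linear_form a dvd ?v)"
    using linear_form_dvd_linear_form[OF a] nz proportional_sym proportional_trans
      indep2_not_proportional[OF ind2(1)] by blast
  then show "\<exists>g\<in>{?u, ?v, ?w}. \<not> linear_form a dvd g" by blast
next
  let ?u = "linear_form u" and ?v = "linear_form v" and ?w = "linear_form w"
  note ind2 = indep3_indep2[OF ind]
  have nz: "u \<noteq> 0" "v \<noteq> 0" "w \<noteq> 0" using indep2_nonzero ind2 by blast+
  have R: "?u \<in> fix_ring P" "?v \<in> fix_ring P" "?w \<in> fix_ring P"
    using inv by (auto intro: fix_ring_linear_form)
  have sR: "subst P f \<in> fix_ring P" for f :: "('a, 'b) mpoly" using fix_ring_subst[OF P] .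
  fix m and \<gamma> :: "nat \<Rightarrow> ('a, 'b) der"
  assume *: "(\<forall>j<m. \<gamma> j \<in> Der P) \<and> gindep P m \<gamma>"
  then have \<gamma>: "\<And>j. j < m \<Longrightarrow> \<gamma> j \<in> Der P" and gi: "gindep P m \<gamma>" by auto
  let ?G = "gspan P m \<gamma>"
  show "torsion_free {?u, ?v, ?w} (Der P) ?G"
    unfolding torsion_free_def
  proof (intro ballI impI)
    fix \<theta> assume \<theta>: "\<theta> \<in> Der P" "\<forall>g\<in>{?u, ?v, ?w}. g *s \<theta> \<in> ?G"
    obtain a where a: "\<And>j. j < m \<Longrightarrow> a j \<in> fix_ring P" "?u *s \<theta> = (\<Sum>j<m. a j *s \<gamma> j)"
      using \<theta>(2) gspanE[of "?u *s \<theta>" P m \<gamma> thesis] by blast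
    obtain b where b: "\<And>j. j < m \<Longrightarrow> b j \<in> fix_ring P" "?v *s \<theta> = (\<Sum>j<m. b j *s \<gamma> j)"
      using \<theta>(2) gspanE[of "?v *s \<theta>" P m \<gamma> thesis] by blast
    have "(\<Sum>j<m. (?v * a j) *s \<gamma> j) = (\<Sum>j<m. (?u * b j) *s \<gamma> j)"
      unfolding gsum_scale[symmetric] a(2)[symmetric] b(2)[symmetric]
      by (simp add: vector_smult_assoc mult.commute)
    then have "?v * a j = ?u * b j" if "j < m" for j
      by (rule gindep_eq[OF gi _ _ _ that, rotated 2]) (auto intro!: fix_ring_mult a(1) b(1) R)
    then have "\<exists>c. a j = ?u * c" if "j < m" for j
      using linear_form_syzygy2[OF ind2(1)] that by blast
    then obtain c where c: "\<And>j. j < m \<Longrightarrow> a j = ?u * c j" by metis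
    then have cR: "c j \<in> fix_ring P" if "j < m" for j
      using fix_ring_cancel[OF _ R(1)] a(1) that nz by (metis linear_form_eq_0_iff)
    have "?u *s \<theta> = ?u *s (\<Sum>j<m. c j *s \<gamma> j)"
      unfolding a(2) gsum_scale using c by (intro sum.cong) auto
    then have \<theta>_eq: "\<theta> = (\<Sum>j<m. c j *s \<gamma> j)" by (rule der_scale_left_cancel) (simp add: nz)
    show "\<theta> \<in> ?G" unfolding \<theta>_eq by (rule gspanI) (rule cR)
  qed
  show "gluing {?u, ?v, ?w} (Der P) ?G"
    unfolding gluing_def
  proof (intro allI impI, elim conjE)
    fix \<kappa> assume \<kappa>: "\<forall>g\<in>{?u, ?v, ?w}. \<kappa> g \<in> Der P"
      and comp: "\<forall>g\<in>{?u, ?v, ?w}. \<forall>h\<in>{?u, ?v, ?w}. h *s \<kappa> g - g *s \<kappa> h \<in> ?G"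
    define U V W where "U = \<kappa> ?u" and "V = \<kappa> ?v" and "W = \<kappa> ?w"
    have UVW: "U \<in> Der P" "V \<in> Der P" "W \<in> Der P" using \<kappa> by (auto simp: U_def V_def W_def)
    have "?v *s U - ?u *s V \<in> ?G" using comp by (auto simp: U_def V_def W_def)
    then obtain a where a: "\<And>j. j < m \<Longrightarrow> a j \<in> fix_ring P" "?v *s U - ?u *s V = (\<Sum>j<m. a j *s \<gamma> j)"
      unfolding gspan_def by blast
    have "?w *s U - ?u *s W \<in> ?G" using comp by (auto simp: U_def V_def W_def)
    then obtain b where b: "\<And>j. j < m \<Longrightarrow> b j \<in> fix_ring P" "?w *s U - ?u *s W = (\<Sum>j<m. b j *s \<gamma> j)"
      unfolding gspan_def by blast
    have "?w *s V - ?v *s W \<in> ?G" using comp by (auto simp: U_def V_def W_def)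
    then obtain c where c: "\<And>j. j < m \<Longrightarrow> c j \<in> fix_ring P" "?w *s V - ?v *s W = (\<Sum>j<m. c j *s \<gamma> j)"
      unfolding gspan_def by blast
    have "(\<Sum>j<m. (?w * a j) *s \<gamma> j) = (\<Sum>j<m. (?v * b j - ?u * c j) *s \<gamma> j)"
      unfolding gsum_scale[symmetric] gsum_diff[symmetric] a(2)[symmetric] b(2)[symmetric] c(2)[symmetric]
      by (rule der_eqI) (simp add: algebra_simps)
    then have rel: "?w * a j = ?v * b j - ?u * c j" if "j < m" for j
      by (rule gindep_eq[OF gi _ _ _ that, rotated 2])
        (auto intro!: fix_ring_mult fix_ring_diff a(1) b(1) c(1) R)
    have ex: "\<exists>p q r. p \<in> fix_ring P \<and> q \<in> fix_ring P \<and> r \<in> fix_ring P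
        \<and> a j = ?v * p - ?u * q \<and> b j = ?w * p + ?u * r \<and> c j = ?w * q + ?v * r" if j: "j < m" for j
    proof -
      obtain p0 q0 where "a j = ?v * p0 - ?u * q0"
        using linear_form_regular3[OF ind rel[OF j]] by blast
      \<comment> \<open>The coefficients \<open>p0\<close> and \<open>q0\<close> come from the full
        polynomial ring. \<open>subst P\<close> retracts onto the coordinate ring and fixes the
        other terms of the relation.\<close>
      from arg_cong[OF this, of "subst P"] have aj: "a j = ?v * subst P p0 - ?u * subst P q0"
        using a(1)[OF j] inv by (simp add: fix_ring_def)
      define p q where "p = subst P p0" and "q = subst P q0"
      have pq: "p \<in> fix_ring P" "q \<in> fix_ring P" by (simp_all add: p_def q_def sR)
      have "?v * (b j - ?w * p) = ?u * (c j - ?w * q)"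
        using rel[OF j] aj by (simp add: p_def q_def algebra_simps)
      then obtain r where r: "b j - ?w * p = ?u * r" "c j - ?w * q = ?v * r"
        using linear_form_syzygy2[OF ind2(1)] by blast
      have "?u * r \<in> fix_ring P"
        unfolding r(1)[symmetric] using b(1) j pq R by (intro fix_ring_diff fix_ring_mult) auto
      then have "r \<in> fix_ring P" using fix_ring_cancel R(1) nz by (metis linear_form_eq_0_iff)
      moreover have "b j = ?w * p + ?u * r" "c j = ?w * q + ?v * r"
        using r by (simp_all add: algebra_simps)
      ultimately show ?thesis using pq aj p_def q_def by blast
    qed
    from ex have "\<forall>j. \<exists>p q r. j < m \<longrightarrow> (p \<in> fix_ring P \<and> q \<in> fix_ring P \<and> r \<in> fix_ring P
        \<and> a j = ?v * p - ?u * q \<and> b j = ?w * p + ?u * r \<and> c j = ?w * q + ?v * r)"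
      by blast
    then obtain p q r where pqr': "\<forall>j. j < m \<longrightarrow> (p j \<in> fix_ring P \<and> q j \<in> fix_ring P \<and> r j \<in> fix_ring P
        \<and> a j = ?v * p j - ?u * q j \<and> b j = ?w * p j + ?u * r j \<and> c j = ?w * q j + ?v * r j)"
      unfolding choice_iff by (elim exE)
    then have pqr: "\<And>j. j < m \<Longrightarrow> p j \<in> fix_ring P" "\<And>j. j < m \<Longrightarrow> q j \<in> fix_ring P"
      "\<And>j. j < m \<Longrightarrow> r j \<in> fix_ring P" "\<And>j. j < m \<Longrightarrow> a j = ?v * p j - ?u * q j"
      "\<And>j. j < m \<Longrightarrow> b j = ?w * p j + ?u * r j" "\<And>j. j < m \<Longrightarrow> c j = ?w * q j + ?v * r j"
      by simp_all
    define p' q' r' where "p' = (\<Sum>j<m. p j *s \<gamma> j)" and "q' = (\<Sum>j<m. q j *s \<gamma> j)"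
      and "r' = (\<Sum>j<m. r j *s \<gamma> j)"
    have G: "p' \<in> ?G" "q' \<in> ?G" "r' \<in> ?G"
      unfolding p'_def q'_def r'_def using pqr by (auto intro: gspanI)
    have GD: "?G \<subseteq> Der P" using gspan_subset_Der \<gamma> by blast
    have 1: "?v *s (U - p') = ?u *s (V - q')"
    proof -
      have "?v *s U - ?u *s V = ?v *s p' - ?u *s q'"
        unfolding a(2) p'_def q'_def gsum_scale gsum_diff using pqr(4) by (intro sum.cong) auto
      then show ?thesis by (simp add: algebra_simps vector_ssub_ldistrib)
    qed
    have 2: "?w *s (U - p') = ?u *s (W + r')"
    proof -
      have "?w *s U - ?u *s W = ?w *s p' + ?u *s r'"
        unfolding b(2) p'_def r'_def gsum_scale gsum_add using pqr(5) by (intro sum.cong) auto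
      then show ?thesis by (simp add: algebra_simps vector_ssub_ldistrib vector_add_ldistrib)
    qed
    have "?u dvd pair x (U - p')" for x
    proof -
      have "?v * pair x (U - p') = ?u * pair x (V - q')"
        using arg_cong[OF 1, of "pair x"] by (simp only: pair_simps)
      then show ?thesis using linear_form_syzygy2[OF ind2(1)] by (metis dvd_triv_left)
    qed
    then obtain \<omega> where \<omega>: "U - p' = ?u *s \<omega>" using der_dvdE by blast
    have "?u *s \<omega> \<in> Der P" unfolding \<omega>[symmetric] using UVW G GD by (auto intro: Der_diff)
    then have \<omega>D: "\<omega> \<in> Der P"
      by (rule Der_scale_cancel) (use R nz in \<open>auto simp: fix_ring_def\<close>)
    have "?u *s (?v *s \<omega>) = ?u *s (V - q')"
      using 1 \<omega> by (simp add: vector_smult_assoc mult.commute)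
    then have V: "?v *s \<omega> = V - q'" by (rule der_scale_left_cancel) (simp add: nz)
    have "?u *s (?w *s \<omega>) = ?u *s (W + r')"
      using 2 \<omega> by (simp add: vector_smult_assoc mult.commute)
    then have W: "?w *s \<omega> = W + r'" by (rule der_scale_left_cancel) (simp add: nz)
    have "U - ?u *s \<omega> = p'" "V - ?v *s \<omega> = q'" "W - ?w *s \<omega> = 0 - r'"
      using \<omega> V W by (simp_all add: algebra_simps)
    then have "\<forall>g\<in>{?u, ?v, ?w}. \<kappa> g - g *s \<omega> \<in> ?G"
      using G gspan_diff[OF gspan_0 G(3)] by (auto simp: U_def V_def W_def)
    then show "\<exists>\<omega>\<in>Der P. \<forall>g\<in>{?u, ?v, ?w}. \<kappa> g - g *s \<omega> \<in> ?G" using \<omega>D by blast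
  qed
qed

text \<open>Iterates \<open>deep_mult\<close>, starting from the empty product 1 and
  \<open>deep_one\<close>. A member is a product of one chosen element from each
  \<open>J c\<close>.\<close>

lemma deep_prod:
  assumes "finite C" "P ** P = P" "\<And>c. c \<in> C \<Longrightarrow> deep P (J c)"
  shows "deep P {(\<Prod>c\<in>C. s c) | s. \<forall>c\<in>C. s c \<in> J c}"
  using assms(1,3)
proof (induction C rule: finite_induct)
  case empty
  then show ?case using deep_one by simp
next
  case (insert x C)
  have "{(\<Prod>c\<in>insert x C. s c) | s. \<forall>c\<in>insert x C. s c \<in> J c}
      = {g * h | g h. g \<in> J x \<and> h \<in> {(\<Prod>c\<in>C. s c) | s. \<forall>c\<in>C. s c \<in> J c}}" (is "?L = ?R")
  proof (intro set_eqI iffI)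
    fix f assume "f \<in> ?L"
    then show "f \<in> ?R" using insert.hyps by auto
  next
    fix f assume "f \<in> ?R"
    then obtain g s where *: "f = g * (\<Prod>c\<in>C. s c)" "g \<in> J x" "\<forall>c\<in>C. s c \<in> J c" by blast
    have "(\<Prod>c\<in>C. (s(x := g)) c) = (\<Prod>c\<in>C. s c)"
      using insert.hyps by (intro prod.cong) auto
    then have "f = (\<Prod>c\<in>insert x C. (s(x := g)) c)" using insert.hyps * by simp
    moreover have "\<forall>c\<in>insert x C. (s(x := g)) c \<in> J c" using * by simp
    ultimately show "f \<in> ?L" by blast
  qed
  moreover have "deep P ?R" using insert by (intro deep_mult) simp_all
  ultimately show ?case by metis
qed

section \<open>Restriction to a hyperplane\<close>

text \<open>In the subspace \<open>range P\<close>, the hyperplane \<open>H\<close> is the kernel of \<open>z\<close> and \<open>\<Lambda>\<close> consists of one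
  form for each of the other hyperplanes; \<open>Q\<close> is the projection onto \<open>H\<close> along \<open>w\<close>.\<close>

locale arr_setup =
  fixes P :: "'k::field ^ 'n ^ 'n::finite" and w z :: "'k ^ 'n" and \<Lambda> :: "('k ^ 'n) set"
  assumes P: "P ** P = P" and Pw: "P *v w = w" and zP: "z v* P = z" and zw: "dot z w = 1"
    and fin: "finite \<Lambda>" and \<Lambda>P: "\<And>a. a \<in> \<Lambda> \<Longrightarrow> a v* P = a"
    and \<Lambda>z: "\<And>a c. a \<in> \<Lambda> \<Longrightarrow> a \<noteq> c *s z"
    and \<Lambda>_distinct: "\<And>a b. a \<in> \<Lambda> \<Longrightarrow> b \<in> \<Lambda> \<Longrightarrow> proportional a b \<Longrightarrow> a = b"
begin

definition Q :: "'k ^ 'n ^ 'n" where "Q = P - tens w z"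

text \<open>The restriction of \<open>a\<close> to the hyperplane, continued by 0 on
  \<open>w\<close>; for invariant \<open>a\<close> it equals \<open>a v* Q\<close>.\<close>

definition res :: "'k ^ 'n \<Rightarrow> 'k ^ 'n" where "res a = a - dot a w *s z"

definition Der0 :: "('k, 'n) der set" where "Der0 = {\<theta> \<in> Der P. pair z \<theta> = 0}"

text \<open>A complement of the Euler multiples among the logarithmic derivations: subtracting a
  suitable multiple of the Euler derivation, which maps \<open>z\<close> to itself, makes any of
  them kill \<open>z\<close>.\<close>

definition D0 :: "('k, 'n) der set" where
  "D0 = {\<theta> \<in> Der0. \<forall>a\<in>\<Lambda>. linear_form a dvd pair a \<theta>}"

definition DQ :: "('k, 'n) der set" where
  "DQ = {\<theta> \<in> Der Q. \<forall>a\<in>\<Lambda>. linear_form (res a) dvd pair (res a) \<theta>}"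

lemma vector_matrix_Q: "a v* Q = a v* P - dot a w *s z"
  by (simp add: Q_def vector_matrix_diff vector_matrix_tens)

lemma vector_matrix_Q': "a v* P = a \<Longrightarrow> a v* Q = res a"
  by (simp add: vector_matrix_Q res_def)

lemma zQ [simp]: "z v* Q = 0"
  by (simp add: vector_matrix_Q zP zw)

lemma dot_P_w: "dot (a v* P) w = dot a w"
  by (simp add: dot_vector_matrix Pw)

lemma PQ: "P ** Q = Q" and QP: "Q ** P = Q" and QQ: "Q ** Q = Q"
proof -
  have 0: "(a v* P) v* P = a v* P" for a by (simp only: vector_matrix_assoc P)
  have 1: "(a v* P) v* Q = a v* Q" for a by (simp only: vector_matrix_Q 0 dot_P_w)
  have 2: "(a v* Q) v* P = a v* Q" for a
    by (simp only: vector_matrix_Q diff_vector_matrix scale_vector_matrix 0 zP)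
  have "(a v* P - dot a w *s z) v* Q = a v* Q" for a
    by (simp only: diff_vector_matrix scale_vector_matrix 1 zQ) simp
  then have 3: "(a v* Q) v* Q = a v* Q" for a by (simp only: vector_matrix_Q[of a])
  show "P ** Q = Q" "Q ** P = Q" "Q ** Q = Q"
    by (rule matrix_eqI_covector, simp only: vector_matrix_assoc[symmetric] 1 2 3)+
qed

lemma z_nonzero: "z \<noteq> 0"
  using zw by auto

lemma res_Q: "a v* P = a \<Longrightarrow> res a v* Q = res a"
  by (metis QQ vector_matrix_Q' vector_matrix_assoc)

lemma \<Lambda>_nonzero: "a \<in> \<Lambda> \<Longrightarrow> a \<noteq> 0"
  using \<Lambda>z[of a 0] by auto

lemma res_nonzero: "a \<in> \<Lambda> \<Longrightarrow> res a \<noteq> 0"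
  using \<Lambda>z[of a "dot a w"] by (auto simp: res_def)

lemma \<Lambda>_not_dvd_z:
  assumes a: "a \<in> \<Lambda>"
  shows "\<not> linear_form a dvd linear_form z"
proof
  assume "linear_form a dvd linear_form z"
  then have "proportional z a"
    using linear_form_dvd_linear_form[of a z] \<Lambda>_nonzero[OF a] z_nonzero proportional_sym by blast
  then show False using \<Lambda>z[OF a] unfolding proportional_def by blast
qed

lemma fix_ring_Q_P:
  assumes "f \<in> fix_ring Q"
  shows "f \<in> fix_ring P"
proof -
  have "subst P (subst Q f) = subst Q f" by (simp add: subst_subst QP)
  then show ?thesis using assms by (simp add: fix_ring_def)
qed

lemma subst_Q_fix: "subst Q f \<in> fix_ring Q"
  by (simp add: fix_ring_subst QQ)

lemma z_dvd_iff: "f \<in> fix_ring P \<Longrightarrow> linear_form z dvd f \<longleftrightarrow> subst Q f = 0"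
  using linear_form_dvd_iff[OF zP zw] by (simp add: fix_ring_def Q_def)

lemma Der_fix_ring: "\<theta> \<in> Der R \<Longrightarrow> pair a \<theta> \<in> fix_ring R"
  by (simp add: Der_def fix_ring_def)

lemma Der_Q_Der0: "\<theta> \<in> Der Q \<Longrightarrow> \<theta> \<in> Der0"
proof -
  assume \<theta>: "\<theta> \<in> Der Q"
  have "pair (a v* P) \<theta> = pair a \<theta>" for a
  proof -
    have "pair (a v* P) \<theta> = pair ((a v* P) v* Q) \<theta>" by (rule Der_pair[OF \<theta>, symmetric])
    also have "\<dots> = pair a \<theta>" by (simp only: vector_matrix_assoc PQ Der_pair[OF \<theta>])
    finally show ?thesis .
  qed
  moreover have "subst P (pair a \<theta>) = pair a \<theta>" for a
    using fix_ring_Q_P[of "pair a \<theta>"] Der_subst[OF \<theta>] by (simp add: fix_ring_def)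
  moreover have "pair z \<theta> = 0" using Der_pair[OF \<theta>, of z] by simp
  ultimately show ?thesis by (simp add: Der0_def Der_def)
qed

lemma vsubst_Q_Der: "\<theta> \<in> Der0 \<Longrightarrow> vsubst Q \<theta> \<in> Der Q"
proof -
  assume \<theta>: "\<theta> \<in> Der0"
  have "pair (a v* Q) \<theta> = pair a \<theta>" for a
    using \<theta> Der_pair[of \<theta> P a] by (simp add: Der0_def vector_matrix_Q)
  then show ?thesis by (simp add: Der_def subst_subst QQ)
qed

lemma vsubst_Q_id: "\<theta> \<in> Der Q \<Longrightarrow> vsubst Q \<theta> = \<theta>"
  by (rule Der_vsubst)

lemma Der0_add: "\<theta> \<in> Der0 \<Longrightarrow> \<eta> \<in> Der0 \<Longrightarrow> \<theta> + \<eta> \<in> Der0"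
  and Der0_diff: "\<theta> \<in> Der0 \<Longrightarrow> \<eta> \<in> Der0 \<Longrightarrow> \<theta> - \<eta> \<in> Der0"
  and Der0_scale: "f \<in> fix_ring P \<Longrightarrow> \<theta> \<in> Der0 \<Longrightarrow> f *s \<theta> \<in> Der0"
  and Der0_vhcomp: "\<theta> \<in> Der0 \<Longrightarrow> vhcomp d \<theta> \<in> Der0"
  by (auto simp: Der0_def Der_vhcomp intro: Der_add Der_diff Der_scale')

lemma D0_Der0: "\<theta> \<in> D0 \<Longrightarrow> \<theta> \<in> Der0"
  and D0_dvd: "\<theta> \<in> D0 \<Longrightarrow> a \<in> \<Lambda> \<Longrightarrow> linear_form a dvd pair a \<theta>"
  by (auto simp: D0_def)

lemma D0_0 [simp]: "0 \<in> D0"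
  and D0_add: "\<theta> \<in> D0 \<Longrightarrow> \<eta> \<in> D0 \<Longrightarrow> \<theta> + \<eta> \<in> D0"
  and D0_diff: "\<theta> \<in> D0 \<Longrightarrow> \<eta> \<in> D0 \<Longrightarrow> \<theta> - \<eta> \<in> D0"
  and D0_scale: "f \<in> fix_ring P \<Longrightarrow> \<theta> \<in> D0 \<Longrightarrow> f *s \<theta> \<in> D0"
  by (auto simp: D0_def Der0_def intro: Der_add Der_diff Der_scale')

lemma D0_sum: "(\<And>x. x \<in> A \<Longrightarrow> f x \<in> D0) \<Longrightarrow> sum f A \<in> D0"
  by (induction A rule: infinite_finite_induct) (auto intro: D0_add)

lemma linear_form_dvd_hcomp: "linear_form a dvd f \<Longrightarrow> linear_form a dvd hcomp d f"
  by (elim dvdE) (simp add: hcomp_mult[OF mhomogeneous_linear_form])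

lemma D0_vhcomp: "\<theta> \<in> D0 \<Longrightarrow> vhcomp d \<theta> \<in> D0"
  by (simp add: D0_def Der0_vhcomp linear_form_dvd_hcomp)

text \<open>As \<open>\<theta>\<close> kills \<open>z\<close>, it takes the same value on
  \<open>a\<close> and \<open>res a\<close>, while restriction to the hyperplane turns the divisor
  \<open>a\<close> into \<open>res a\<close>.\<close>

lemma D0_restrict: "\<theta> \<in> D0 \<Longrightarrow> vsubst Q \<theta> \<in> DQ"
proof -
  assume \<theta>: "\<theta> \<in> D0"
  have "linear_form (res a) dvd pair (res a) (vsubst Q \<theta>)" if a: "a \<in> \<Lambda>" for a
  proof -
    have "pair (res a) \<theta> = pair a \<theta>" using \<theta> by (simp add: res_def D0_def Der0_def)
    moreover have "subst Q (linear_form a) = linear_form (res a)"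
      by (simp add: vector_matrix_Q' \<Lambda>P a)
    ultimately show ?thesis using subst_dvd[OF D0_dvd[OF \<theta> a], of Q] by simp
  qed
  then show ?thesis using \<theta> vsubst_Q_Der by (simp add: DQ_def D0_Der0)
qed

lemma Der0_z_quotient:
  assumes "\<theta> \<in> Der0" "vsubst Q \<theta> = 0"
  obtains \<eta> where "\<eta> \<in> Der0" "\<theta> = linear_form z *s \<eta>"
proof -
  have "linear_form z dvd pair a \<theta>" for a
  proof -
    have "pair a \<theta> \<in> fix_ring P" using assms(1) by (auto simp: Der0_def Der_fix_ring)
    moreover have "subst Q (pair a \<theta>) = 0" by (metis assms(2) pair_vsubst pair_simps(5))
    ultimately show ?thesis using z_dvd_iff by blast
  qed
  then obtain \<eta> where \<eta>: "\<theta> = linear_form z *s \<eta>" using der_dvdE by blast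
  have \<theta>: "\<theta> \<in> Der P" "pair z \<theta> = 0" using assms(1) by (simp_all add: Der0_def)
  have "linear_form z *s \<eta> \<in> Der P" using \<theta>(1) \<eta> by simp
  then have "\<eta> \<in> Der P"
    by (rule Der_scale_cancel) (simp_all add: zP z_nonzero)
  moreover have "linear_form z * pair z \<eta> = 0" using \<theta>(2) \<eta> by simp
  then have "pair z \<eta> = 0" using mpoly_mult_eq_0[of "linear_form z" "pair z \<eta>"] z_nonzero by simp
  ultimately show ?thesis using that \<eta> by (simp add: Der0_def)
qed

lemma D0_z_quotient:
  assumes "linear_form z *s \<eta> \<in> D0" "\<eta> \<in> Der0"
  shows "\<eta> \<in> D0"
proof -
  have "linear_form a dvd pair a \<eta>" if a: "a \<in> \<Lambda>" for a
  proof -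
    have "linear_form a dvd linear_form z * pair a \<eta>" using D0_dvd[OF assms(1) a] by simp
    then show ?thesis using linear_form_prime[OF \<Lambda>_nonzero[OF a]] \<Lambda>_not_dvd_z[OF a] by blast
  qed
  then show ?thesis using assms(2) by (simp add: D0_def)
qed

lemma fix_ring_lf_z: "linear_form z \<in> fix_ring P"
  by (simp add: fix_ring_linear_form zP)

lemma D0_zpow_quotient: "linear_form z ^ N *s \<eta> \<in> D0 \<Longrightarrow> \<eta> \<in> Der0 \<Longrightarrow> \<eta> \<in> D0"
proof (induction N arbitrary: \<eta>)
  case (Suc N)
  have "linear_form z ^ N *s (linear_form z *s \<eta>) \<in> D0"
    using Suc.prems(1) by (simp add: vector_smult_assoc mult.commute)
  then have "linear_form z *s \<eta> \<in> D0"
    using Suc.IH Suc.prems(2) Der0_scale fix_ring_lf_z by blast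
  then show ?case using D0_z_quotient Suc.prems(2) by blast
qed simp

text \<open>Exactness of multiplication by \<open>z\<close> followed by restriction. Division by
  \<open>z\<close> keeps the logarithmic conditions because no form of \<open>\<Lambda>\<close>
  divides \<open>z\<close>.\<close>

lemma D0_ker_restrict:
  assumes "\<theta> \<in> D0" "vsubst Q \<theta> = 0"
  obtains \<eta> where "\<eta> \<in> D0" "\<theta> = linear_form z *s \<eta>"
proof -
  obtain \<eta> where "\<eta> \<in> Der0" "\<theta> = linear_form z *s \<eta>"
    using Der0_z_quotient[OF D0_Der0[OF assms(1)] assms(2)] .
  then show ?thesis using that assms(1) D0_z_quotient by blast
qed

lemma proportional_res:
  assumes "proportional (res a) (res b)"
  shows "\<exists>c d. c \<noteq> 0 \<and> b = c *s a + d *s z \<and> res b = c *s res a"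
proof -
  obtain c where c: "c \<noteq> 0" "res b = c *s res a" using assms by (auto simp: proportional_def)
  then have "b = c *s a + (dot b w - c * dot a w) *s z"
    unfolding res_def vec_eq_iff by (simp add: algebra_simps)
  then show ?thesis using c by blast
qed

end

text \<open>\<open>N\<close> contains one form for each hyperplane of the restricted arrangement, so
  \<open>card N\<close> is the size of the restriction while \<open>card \<Lambda>\<close> is one
  less than that of the whole arrangement.\<close>

locale arr_reps = arr_setup +
  fixes N :: "('a ^ 'b) set"
  assumes N_sub: "N \<subseteq> \<Lambda>"
    and N_rep: "\<And>a. a \<in> \<Lambda> \<Longrightarrow> \<exists>b\<in>N. proportional (res a) (res b)"
    and N_distinct: "\<And>a b. a \<in> N \<Longrightarrow> b \<in> N \<Longrightarrow> proportional (res a) (res b) \<Longrightarrow> a = b"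
begin

text \<open>Up to a scalar, the restriction of the product over \<open>\<Lambda>\<close> divided by
  the reduced product defining the restricted arrangement; known as Terao's polynomial B.\<close>

definition B :: "('a, 'b) mpoly" where "B = (\<Prod>a\<in>\<Lambda> - N. linear_form (res a))"

lemma B_fix: "B \<in> fix_ring Q"
  unfolding B_def by (intro fix_ring_prod fix_ring_linear_form res_Q \<Lambda>P) auto

lemma B_nonzero: "B \<noteq> 0"
  unfolding B_def using fin res_nonzero by (intro mpoly_prod_nonzero) auto

lemma B_hom: "mhomogeneous (card \<Lambda> - card N) B"
proof -
  have "mhomogeneous (\<Sum>a\<in>\<Lambda> - N. 1) B"
    unfolding B_def using fin by (intro mhomogeneous_prod) auto
  then show ?thesis using N_sub fin by (simp add: card_Diff_subset finite_subset)
qed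

text \<open>All \<open>t\<close> in \<open>\<Lambda>\<close> with restriction proportional to
  \<open>res s\<close> divide \<open>pair s \<theta>\<close>, because \<open>\<theta>\<close> kills
  \<open>z\<close> and so has proportional values on them. On the hyperplane this yields the power
  \<open>card ?T\<close> of \<open>res s\<close>. One factor belongs to the Euler derivation, and
  correspondingly one member of the class lies in \<open>N\<close> and is absent from
  \<open>B\<close>.\<close>

lemma Euler_multiple:
  assumes \<theta>: "\<theta> \<in> D0" and eq: "vsubst Q \<theta> = f *s Euler Q"
  shows "B dvd f"
  unfolding B_def
proof (rule prod_linear_forms_dvd)
  show "finite (\<Lambda> - N)" using fin by simp
  show "res s \<noteq> 0" if "s \<in> \<Lambda> - N" for s using that res_nonzero by blast
  fix s assume s: "s \<in> \<Lambda> - N"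
  let ?T = "{t \<in> \<Lambda>. proportional (res s) (res t)}"
  have finT: "finite ?T" using fin by simp
  have "(\<Prod>t\<in>?T. linear_form t) dvd pair s \<theta>"
  proof (rule prod_distinct_linear_forms_dvd[OF finT])
    fix t assume t: "t \<in> ?T"
    then obtain c d where c: "c \<noteq> 0" "t = c *s s + d *s z" using proportional_res[of s t] by auto
    have "pair s \<theta> = mconst (inverse c) * pair t \<theta>"
      using c \<theta> by (simp add: D0_def Der0_def flip: mult.assoc mconst_mult)
    then show "linear_form t dvd pair s \<theta>" using D0_dvd[OF \<theta>, of t] t by simp
  qed (use \<Lambda>_nonzero \<Lambda>_distinct in auto)
  then have "subst Q (\<Prod>t\<in>?T. linear_form t) dvd subst Q (pair s \<theta>)" by (rule subst_dvd)
  moreover have "subst Q (\<Prod>t\<in>?T. linear_form t) = (\<Prod>t\<in>?T. linear_form (res t))"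
    unfolding subst_prod by (intro prod.cong) (auto simp: vector_matrix_Q' \<Lambda>P)
  moreover have "subst Q (pair s \<theta>) = f * linear_form (res s)"
    using arg_cong[OF eq, of "pair s"] s by (simp add: vector_matrix_Q' \<Lambda>P)
  moreover have "linear_form (res s) ^ card ?T dvd (\<Prod>t\<in>?T. linear_form (res t))"
    unfolding prod_constant[symmetric] by (intro prod_dvd_prod) (auto intro: proportional_dvd)
  ultimately have dvd: "linear_form (res s) ^ card ?T dvd linear_form (res s) * f"
    by (auto simp: mult.commute intro: dvd_trans)
  obtain b where b: "b \<in> N" "proportional (res s) (res b)" using N_rep s by blast
  have "{t \<in> \<Lambda> - N. proportional (res s) (res t)} \<subseteq> ?T - {b}" using b by auto
  then have "card {t \<in> \<Lambda> - N. proportional (res s) (res t)} \<le> card (?T - {b})"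
    using finT by (intro card_mono) auto
  also have "\<dots> = card ?T - 1" using b N_sub by (intro card_Diff_singleton) auto
  finally have le: "card {t \<in> \<Lambda> - N. proportional (res s) (res t)} \<le> card ?T - 1" .
  have "card ?T \<noteq> 0" using s finT by auto
  then obtain k where k: "card ?T = Suc k" using not0_implies_Suc by blast
  have nz: "linear_form (res s) \<noteq> 0" using res_nonzero s by simp
  have "linear_form (res s) * linear_form (res s) ^ k dvd linear_form (res s) * f"
    using dvd unfolding k by simp
  then have "linear_form (res s) ^ k dvd f" by (rule mpoly_dvd_mult_cancel_left[OF nz])
  then have "linear_form (res s) ^ (card ?T - 1) dvd f" by (simp add: k)
  then show "linear_form (res s) ^ card {t \<in> \<Lambda> - N. proportional (res s) (res t)} dvd f"
    by (rule dvd_trans[OF le_imp_power_dvd[OF le]])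
qed

end

section \<open>Lifting logarithmic derivations from the hyperplane\<close>

text \<open>A homogeneous basis over the coordinate ring of the range of \<open>P\<close> with the
  Euler derivation in position 0, so \<open>m\<close> is one less than the rank.\<close>

definition euler_basis ::
    "'k::field ^ 'n ^ 'n \<Rightarrow> ('k, 'n::finite) der set \<Rightarrow> nat \<Rightarrow> (nat \<Rightarrow> ('k, 'n) der) \<Rightarrow> bool" where
  "euler_basis P D m b \<longleftrightarrow> (\<forall>j<m. b j \<in> D \<and> (\<exists>d. vhom d (b j))) \<and>
     D \<subseteq> gspan P (Suc m) (case_nat (Euler P) b) \<and> gindep P (Suc m) (case_nat (Euler P) b)"

lemma gspan_sum: "(\<And>x. x \<in> A \<Longrightarrow> f x \<in> gspan P m \<gamma>) \<Longrightarrow> sum f A \<in> gspan P m \<gamma>"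
  by (induction A rule: infinite_finite_induct) (auto intro: gspan_add gspan_0)

lemma gsum_case_nat:
  "(\<Sum>j<Suc m. c j *s case_nat x b j) = c 0 *s x + (\<Sum>j<m. c (Suc j) *s (b j :: ('k::field, 'n::finite) der))"
  by (simp only: sum.lessThan_Suc_shift) simp

lemma gspan_case_natD:
  assumes "\<theta> \<in> gspan P (Suc m) (case_nat x b)"
  shows "\<exists>f c. f \<in> fix_ring P \<and> (\<forall>j<m. c j \<in> fix_ring P) \<and> \<theta> = f *s x + (\<Sum>j<m. c j *s b j)"
proof -
  obtain c where c: "\<And>j. j < Suc m \<Longrightarrow> c j \<in> fix_ring P" "\<theta> = (\<Sum>j<Suc m. c j *s case_nat x b j)"
    using assms unfolding gspan_def by blast
  show ?thesis
    by (rule exI[of _ "c 0"], rule exI[of _ "\<lambda>j. c (Suc j)"])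
      (use c in \<open>simp add: gsum_case_nat del: sum.lessThan_Suc\<close>)
qed

lemma gspan_case_natI:
  assumes "f \<in> fix_ring P" "\<And>j. j < m \<Longrightarrow> c j \<in> fix_ring P"
  shows "f *s x + (\<Sum>j<m. c j *s b j) \<in> gspan P (Suc m) (case_nat x b)"
proof -
  have "(\<Sum>j<Suc m. case_nat f c j *s case_nat x b j) \<in> gspan P (Suc m) (case_nat x b)"
    by (rule gspanI) (use assms in \<open>auto split: nat.split\<close>)
  then show ?thesis by (simp only: gsum_case_nat) simp
qed

lemma gindep_case_natI:
  assumes "\<And>f c. f \<in> fix_ring P \<Longrightarrow> (\<And>j. j < m \<Longrightarrow> c j \<in> fix_ring P) \<Longrightarrow>
      f *s x + (\<Sum>j<m. c j *s b j) = 0 \<Longrightarrow> f = 0 \<and> (\<forall>j<m. c j = 0)"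
  shows "gindep P (Suc m) (case_nat x b)"
  unfolding gindep_def gsum_case_nat
proof (intro allI impI, elim conjE)
  fix c j assume *: "\<forall>j<Suc m. c j \<in> fix_ring P" "c 0 *s x + (\<Sum>j<m. c (Suc j) *s b j) = 0" "j < Suc m"
  then have "c 0 = 0 \<and> (\<forall>j<m. c (Suc j) = 0)" by (intro assms) auto
  then show "c j = 0" using *(3) by (cases j) auto
qed

lemma gindep_case_natD:
  assumes "gindep P (Suc m) (case_nat x b)" "f \<in> fix_ring P" "\<And>j. j < m \<Longrightarrow> c j \<in> fix_ring P"
    "f *s x + (\<Sum>j<m. c j *s b j) = 0"
  shows "f = 0 \<and> (\<forall>j<m. c j = 0)"
proof -
  have "(\<Sum>j<Suc m. case_nat f c j *s case_nat x b j) = 0"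
    using assms(4) by (simp only: gsum_case_nat) simp
  moreover have "\<forall>j<Suc m. case_nat f c j \<in> fix_ring P" using assms(2,3) by (auto split: nat.split)
  ultimately have *: "\<forall>j<Suc m. case_nat f c j = 0" using assms(1)[unfolded gindep_def] by blast
  show ?thesis using *[rule_format, of 0] *[rule_format, of "Suc _"] by auto
qed

section \<open>Gluing lifts with an ideal of depth three\<close>

context arr_reps
begin

definition DP :: "('a, 'b) der set" where
  "DP = {\<theta> \<in> Der P. linear_form z dvd pair z \<theta> \<and> (\<forall>a\<in>\<Lambda>. linear_form a dvd pair a \<theta>)}"

abbreviation E :: "('a, 'b) der" where "E \<equiv> Euler Q"

lemma E_Der: "E \<in> Der Q"
  by (simp add: Euler_Der QQ)

lemma vsubst_scale_Q: "f \<in> fix_ring Q \<Longrightarrow> vsubst Q (f *s \<theta>) = f *s vsubst Q \<theta>"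
  by (simp add: fix_ring_def)

text \<open>The data of the lifting argument: a basis of the logarithmic derivations on the hyperplane,
  and a set of depth three which kills the obstructions to lifting them.\<close>

context
  fixes m :: nat and b :: "nat \<Rightarrow> ('a, 'b) der" and I :: "('a, 'b) mpoly set"
  assumes ne: "\<Lambda> \<noteq> {}" and basis: "euler_basis Q DQ m b" and I: "deep Q I"
    and I_lift: "\<And>g \<phi>. g \<in> I \<Longrightarrow> \<phi> \<in> DQ \<Longrightarrow> \<exists>f\<in>fix_ring Q. \<exists>\<theta>\<in>D0. vsubst Q \<theta> = g *s \<phi> + f *s E"
    and I_lift_B: "\<And>g. g \<in> I \<Longrightarrow> \<exists>\<theta>\<in>D0. vsubst Q \<theta> = g *s (B *s E)"
begin

lemma scale_E_eq_0: "f *s E = 0 \<Longrightarrow> f = 0"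
proof -
  assume f: "f *s E = 0"
  obtain a where a: "a \<in> \<Lambda>" using ne by blast
  have "f * linear_form (res a) = 0"
    using arg_cong[OF f, of "pair a"] by (simp add: vector_matrix_Q' \<Lambda>P a)
  then show ?thesis using mpoly_mult_eq_0[of f "linear_form (res a)"] res_nonzero[OF a] by simp
qed

lemma gindep_E: "gindep Q (Suc 0) (\<lambda>_. E)"
  using scale_E_eq_0 by (simp add: gindep_def)

lemma gindep_BE: "gindep Q (Suc 0) (\<lambda>_. B *s E)"
  using scale_E_eq_0 mpoly_mult_eq_0[of _ B] B_nonzero
  by (auto simp: gindep_def vector_smult_assoc)

lemma BE_Der: "B *s E \<in> Der Q"
  using Der_scale'[OF B_fix E_Der] .

lemma gspan_single: "\<theta> \<in> gspan Q (Suc 0) (\<lambda>_. x) \<longleftrightarrow> (\<exists>f\<in>fix_ring Q. \<theta> = f *s x)"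
proof
  assume "\<theta> \<in> gspan Q (Suc 0) (\<lambda>_. x)"
  then show "\<exists>f\<in>fix_ring Q. \<theta> = f *s x" by (auto simp: gspan_def)
next
  assume "\<exists>f\<in>fix_ring Q. \<theta> = f *s x"
  then obtain f where "f \<in> fix_ring Q" "\<theta> = f *s x" by blast
  then show "\<theta> \<in> gspan Q (Suc 0) (\<lambda>_. x)" using gspanI[of "Suc 0" "\<lambda>_. f" Q "\<lambda>_. x"] by simp
qed

lemma Euler_multiple_gspan:
  assumes "\<theta> \<in> D0" "vsubst Q \<theta> = f *s E" "f \<in> fix_ring Q"
  shows "f *s E \<in> gspan Q (Suc 0) (\<lambda>_. B *s E)"
proof -
  obtain q where q: "f = B * q" using Euler_multiple[OF assms(1,2)] by (auto elim: dvdE)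
  then have "q \<in> fix_ring Q" using fix_ring_cancel[of B q Q] assms(3) B_fix B_nonzero by simp
  moreover have "f *s E = q *s (B *s E)" by (simp add: q vector_smult_assoc mult.commute)
  ultimately show ?thesis unfolding gspan_single by blast
qed

text \<open>For \<open>g\<close> in \<open>I\<close> some \<open>T g\<close> lifts
  \<open>g *s \<phi> + F g *s E\<close>. Cross differences of the \<open>T g\<close> restrict to
  Euler multiples, hence to multiples of \<open>B *s E\<close>, so the \<open>F g *s E\<close> glue
  modulo \<open>B *s E\<close> to an element which torsion-freeness shows to be
  \<open>f *s E\<close>. The remaining error is a multiple of \<open>B *s E\<close>; the second
  factor \<open>h\<close> makes it liftable.\<close>

lemma correct_by_Euler:
  assumes \<phi>: "\<phi> \<in> DQ"
  obtains f where "f \<in> fix_ring Q"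
    "\<And>g h. g \<in> I \<Longrightarrow> h \<in> I \<Longrightarrow> \<exists>\<theta>\<in>D0. vsubst Q \<theta> = (g * h) *s (\<phi> + f *s E)"
proof -
  have IQ: "g \<in> fix_ring Q" "g \<in> fix_ring P" if "g \<in> I" for g
    using deep_subset[OF I] that fix_ring_Q_P by auto
  have "\<forall>g. \<exists>f \<theta>. g \<in> I \<longrightarrow> f \<in> fix_ring Q \<and> \<theta> \<in> D0 \<and> vsubst Q \<theta> = g *s \<phi> + f *s E"
    using I_lift \<phi> by blast
  then obtain F T where FT: "\<forall>g. g \<in> I \<longrightarrow> F g \<in> fix_ring Q \<and> T g \<in> D0 \<and> vsubst Q (T g) = g *s \<phi> + F g *s E"
    unfolding choice_iff by (elim exE)
  have "\<exists>\<omega>\<in>Der Q. \<forall>g\<in>I. F g *s E - g *s \<omega> \<in> gspan Q (Suc 0) (\<lambda>_. B *s E)"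
  proof (rule deep_gluing[OF I BE_Der gindep_BE])
    fix g assume g: "g \<in> I"
    show "F g *s E \<in> Der Q" using FT g E_Der Der_scale' by blast
    fix h assume h: "h \<in> I"
    have D: "h *s T g - g *s T h \<in> D0" using FT g h IQ by (auto intro!: D0_diff D0_scale)
    have r: "vsubst Q (h *s T g - g *s T h) = (h * F g - g * F h) *s E"
    proof -
      have "vsubst Q (h *s T g - g *s T h) = h *s (g *s \<phi> + F g *s E) - g *s (h *s \<phi> + F h *s E)"
        using FT g h IQ by (simp add: vsubst_scale_Q del: vsubst_simps(3))
      also have "\<dots> = (h * F g - g * F h) *s E" by (rule der_eqI) (simp add: algebra_simps)
      finally show ?thesis .
    qed
    have "(h * F g - g * F h) *s E \<in> gspan Q (Suc 0) (\<lambda>_. B *s E)"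
      by (rule Euler_multiple_gspan[OF D r]) (use FT g h IQ in \<open>auto intro!: fix_ring_diff fix_ring_mult\<close>)
    then show "h *s (F g *s E) - g *s (F h *s E) \<in> gspan Q (Suc 0) (\<lambda>_. B *s E)"
      by (simp add: vector_smult_assoc vector_sub_rdistrib)
  qed
  then obtain \<omega> where \<omega>: "\<omega> \<in> Der Q" "\<And>g. g \<in> I \<Longrightarrow> F g *s E - g *s \<omega> \<in> gspan Q (Suc 0) (\<lambda>_. B *s E)"
    by blast
  have "\<omega> \<in> gspan Q (Suc 0) (\<lambda>_. E)"
  proof (rule deep_torsion_free[OF I E_Der gindep_E \<omega>(1)])
    fix g assume g: "g \<in> I"
    obtain q where q: "q \<in> fix_ring Q" "F g *s E - g *s \<omega> = q *s (B *s E)"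
      using \<omega>(2)[OF g] unfolding gspan_single by blast
    then have "g *s \<omega> = (F g - q * B) *s E"
      by (simp add: vector_smult_assoc vector_sub_rdistrib algebra_simps)
    moreover have "F g - q * B \<in> fix_ring Q" using FT g q B_fix by (auto intro!: fix_ring_diff fix_ring_mult)
    ultimately show "g *s \<omega> \<in> gspan Q (Suc 0) (\<lambda>_. E)" unfolding gspan_single by blast
  qed
  then obtain f where f: "f \<in> fix_ring Q" "\<omega> = f *s E" unfolding gspan_single by blast
  have "\<exists>\<theta>\<in>D0. vsubst Q \<theta> = (g * h) *s (\<phi> + f *s E)" if g: "g \<in> I" and h: "h \<in> I" for g h
  proof -
    obtain q where q: "q \<in> fix_ring Q" "F g *s E - g *s \<omega> = q *s (B *s E)"
      using \<omega>(2)[OF g] unfolding gspan_single by blast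
    obtain \<theta>h where \<theta>h: "\<theta>h \<in> D0" "vsubst Q \<theta>h = h *s (B *s E)" using I_lift_B[OF h] by blast
    have "vsubst Q (h *s T g - q *s \<theta>h) = h *s (g *s \<phi> + F g *s E) - q *s (h *s (B *s E))"
      using FT g h IQ q \<theta>h by (simp add: vsubst_scale_Q del: vsubst_simps(3))
    also have "q *s (h *s (B *s E)) = h *s (q *s (B *s E))"
      by (simp add: vector_smult_assoc mult.left_commute)
    also have "q *s (B *s E) = F g *s E - g *s (f *s E)" using q(2) f(2) by simp
    also have "h *s (g *s \<phi> + F g *s E) - h *s (F g *s E - g *s (f *s E)) = (g * h) *s (\<phi> + f *s E)"
      by (rule der_eqI) (simp add: algebra_simps)
    finally have "vsubst Q (h *s T g - q *s \<theta>h) = (g * h) *s (\<phi> + f *s E)" .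
    moreover have "h *s T g - q *s \<theta>h \<in> D0"
      using FT g h IQ q \<theta>h fix_ring_Q_P by (auto intro!: D0_diff D0_scale)
    ultimately show ?thesis by blast
  qed
  then show ?thesis using that f(1) by blast
qed

definition corr :: "nat \<Rightarrow> ('a, 'b) mpoly" where
  "corr j = (SOME f. f \<in> fix_ring Q \<and>
     (\<forall>g\<in>I. \<forall>h\<in>I. \<exists>\<theta>\<in>D0. vsubst Q \<theta> = (g * h) *s (b j + f *s E)))"

text \<open>Generators for the image of \<open>D0\<close> under restriction: among the Euler
  multiples only those of \<open>B *s E\<close> can occur, and each basis element is shifted so that
  it can lift exactly. That their span \<open>G\<close> is the image is the content of
  \<open>D0_restrict_G\<close> and \<open>lift_G\<close>.\<close>

definition \<gamma> :: "nat \<Rightarrow> ('a, 'b) der" where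
  "\<gamma> = case_nat (B *s E) (\<lambda>j. b j + corr j *s E)"

definition G :: "('a, 'b) der set" where "G = gspan Q (Suc m) \<gamma>"

definition I2 :: "('a, 'b) mpoly set" where "I2 = {g * h | g h. g \<in> I \<and> h \<in> I}"

lemma I2: "deep Q I2"
  unfolding I2_def by (rule deep_mult[OF I I])

lemma I2_fix: "g \<in> I2 \<Longrightarrow> g \<in> fix_ring Q" "g \<in> I2 \<Longrightarrow> g \<in> fix_ring P"
  using deep_subset[OF I2] fix_ring_Q_P by auto

lemma b_DQ: "j < m \<Longrightarrow> b j \<in> DQ" and b_Der: "j < m \<Longrightarrow> b j \<in> Der Q"
  using basis by (auto simp: euler_basis_def DQ_def)

lemma corr:
  assumes "j < m"
  shows "corr j \<in> fix_ring Q"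
    "g \<in> I \<Longrightarrow> h \<in> I \<Longrightarrow> \<exists>\<theta>\<in>D0. vsubst Q \<theta> = (g * h) *s (b j + corr j *s E)"
proof -
  obtain f where "f \<in> fix_ring Q"
    "\<And>g h. g \<in> I \<Longrightarrow> h \<in> I \<Longrightarrow> \<exists>\<theta>\<in>D0. vsubst Q \<theta> = (g * h) *s (b j + f *s E)"
    using correct_by_Euler[OF b_DQ[OF assms]] by blast
  then have "\<exists>f. f \<in> fix_ring Q \<and> (\<forall>g\<in>I. \<forall>h\<in>I. \<exists>\<theta>\<in>D0. vsubst Q \<theta> = (g * h) *s (b j + f *s E))"
    by blast
  from someI_ex[OF this] show "corr j \<in> fix_ring Q"
    "g \<in> I \<Longrightarrow> h \<in> I \<Longrightarrow> \<exists>\<theta>\<in>D0. vsubst Q \<theta> = (g * h) *s (b j + corr j *s E)"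
    unfolding corr_def[symmetric] by blast+
qed

lemma \<gamma>_Der: "j < Suc m \<Longrightarrow> \<gamma> j \<in> Der Q"
  unfolding \<gamma>_def using BE_Der b_Der corr(1) E_Der
  by (auto split: nat.split intro!: Der_add Der_scale')

lemma correction_sum:
  "f *s E + (\<Sum>j<m. c j *s (b j + d j *s E)) = (f + (\<Sum>j<m. c j * d j)) *s E + (\<Sum>j<m. c j *s b j)"
  by (rule der_eqI) (simp add: pair_sum sum.distrib algebra_simps sum_distrib_left)

lemma gindep_\<gamma>: "gindep Q (Suc m) \<gamma>"
  unfolding \<gamma>_def
proof (rule gindep_case_natI)
  fix f c assume f: "f \<in> fix_ring Q" and c: "\<And>j. j < m \<Longrightarrow> c j \<in> fix_ring Q"
    and eq: "f *s (B *s E) + (\<Sum>j<m. c j *s (b j + corr j *s E)) = 0"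
  have "(f * B + (\<Sum>j<m. c j * corr j)) *s E + (\<Sum>j<m. c j *s b j) = 0"
    using eq correction_sum[of "f * B" c corr] by (simp add: vector_smult_assoc)
  moreover have "f * B + (\<Sum>j<m. c j * corr j) \<in> fix_ring Q"
    using f c B_fix corr(1) by (auto intro!: fix_ring_add fix_ring_mult fix_ring_sum)
  ultimately have *: "f * B + (\<Sum>j<m. c j * corr j) = 0" "\<forall>j<m. c j = 0"
    using gindep_case_natD[of Q m E b] basis c unfolding euler_basis_def by blast+
  then have "f * B = 0" by simp
  then show "f = 0 \<and> (\<forall>j<m. c j = 0)" using mpoly_mult_eq_0[of f B] B_nonzero *(2) by simp
qed

lemma I2_lifts_\<gamma>: "g \<in> I2 \<Longrightarrow> j < Suc m \<Longrightarrow> \<exists>\<theta>\<in>D0. vsubst Q \<theta> = g *s \<gamma> j"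
proof -
  assume "g \<in> I2" and j: "j < Suc m"
  then obtain g1 g2 where g: "g = g1 * g2" "g1 \<in> I" "g2 \<in> I" by (auto simp: I2_def)
  show ?thesis
  proof (cases j)
    case 0
    obtain \<theta> where \<theta>: "\<theta> \<in> D0" "vsubst Q \<theta> = g2 *s (B *s E)" using I_lift_B[OF g(3)] by blast
    have "g1 \<in> fix_ring Q" using g(2) deep_subset[OF I] by blast
    then have "g1 *s \<theta> \<in> D0" "vsubst Q (g1 *s \<theta>) = g *s \<gamma> j"
      using \<theta> fix_ring_Q_P D0_scale by (simp_all add: vsubst_scale_Q \<gamma>_def 0 g(1) vector_smult_assoc mult.assoc del: vsubst_simps(3))
    then show ?thesis by blast
  next
    case (Suc i)
    then show ?thesis using corr(2)[of i g1 g2] g j by (simp add: \<gamma>_def)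
  qed
qed

lemma I2_lifts_G: "g \<in> I2 \<Longrightarrow> \<eta> \<in> G \<Longrightarrow> \<exists>\<theta>\<in>D0. vsubst Q \<theta> = g *s \<eta>"
proof -
  assume g: "g \<in> I2" and "\<eta> \<in> G"
  then obtain c where c: "\<And>j. j < Suc m \<Longrightarrow> c j \<in> fix_ring Q" "\<eta> = (\<Sum>j<Suc m. c j *s \<gamma> j)"
    unfolding G_def gspan_def by blast
  have "\<forall>j. \<exists>\<theta>. j < Suc m \<longrightarrow> \<theta> \<in> D0 \<and> vsubst Q \<theta> = g *s \<gamma> j" using I2_lifts_\<gamma>[OF g] by blast
  then obtain T where T: "\<forall>j. j < Suc m \<longrightarrow> T j \<in> D0 \<and> vsubst Q (T j) = g *s \<gamma> j"
    unfolding choice_iff by (elim exE)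
  have "vsubst Q (\<Sum>j<Suc m. c j *s T j) = (\<Sum>j<Suc m. c j *s (g *s \<gamma> j))"
    unfolding vsubst_sum using c T by (intro sum.cong refl) (simp add: vsubst_scale_Q del: vsubst_simps(3))
  also have "\<dots> = g *s \<eta>"
    unfolding c(2) gsum_scale by (simp add: vector_smult_assoc mult.commute del: sum.lessThan_Suc)
  finally have "vsubst Q (\<Sum>j<Suc m. c j *s T j) = g *s \<eta>" .
  moreover have "(\<Sum>j<Suc m. c j *s T j) \<in> D0"
    by (intro D0_sum D0_scale) (use c T fix_ring_Q_P in auto)
  ultimately show ?thesis by blast
qed

text \<open>Expanding in the corrected basis leaves a term \<open>f' *s E\<close>. After
  multiplication by any \<open>g\<close> in \<open>I2\<close> the rest lifts, so
  \<open>(g * f') *s E\<close> is itself a restriction from \<open>D0\<close> and a multiple of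
  \<open>B *s E\<close>; torsion-freeness removes \<open>g\<close>.\<close>

lemma D0_restrict_G: "\<theta> \<in> D0 \<Longrightarrow> vsubst Q \<theta> \<in> G"
proof -
  assume \<theta>: "\<theta> \<in> D0"
  have "vsubst Q \<theta> \<in> gspan Q (Suc m) (case_nat E b)"
    using D0_restrict[OF \<theta>] basis unfolding euler_basis_def by blast
  then obtain f c where f: "f \<in> fix_ring Q" and c: "\<And>j. j < m \<Longrightarrow> c j \<in> fix_ring Q"
    and eq: "vsubst Q \<theta> = f *s E + (\<Sum>j<m. c j *s b j)"
    using gspan_case_natD[of "vsubst Q \<theta>" Q m E b] by blast
  define f' where "f' = f - (\<Sum>j<m. c j * corr j)"
  define \<eta> where "\<eta> = (\<Sum>j<m. c j *s (b j + corr j *s E))"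
  have f': "f' \<in> fix_ring Q"
    unfolding f'_def using f c corr(1) by (auto intro!: fix_ring_diff fix_ring_mult fix_ring_sum)
  have eq': "vsubst Q \<theta> = f' *s E + \<eta>"
    unfolding eq \<eta>_def correction_sum by (simp add: f'_def)
  have \<eta>: "\<eta> \<in> G"
    using gspan_case_natI[of 0 Q m c "B *s E" "\<lambda>j. b j + corr j *s E"] c by (simp add: G_def \<gamma>_def \<eta>_def)
  have "f' *s E \<in> gspan Q (Suc 0) (\<lambda>_. B *s E)"
  proof (rule deep_torsion_free[OF I2 BE_Der gindep_BE Der_scale'[OF f' E_Der]])
    fix g assume g: "g \<in> I2"
    obtain \<theta>' where \<theta>': "\<theta>' \<in> D0" "vsubst Q \<theta>' = g *s \<eta>" using I2_lifts_G[OF g \<eta>] by blast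
    have "vsubst Q (g *s \<theta> - \<theta>') = g *s (f' *s E + \<eta>) - g *s \<eta>"
      using \<theta>' eq' g by (simp add: vsubst_scale_Q I2_fix del: vsubst_simps(3))
    also have "\<dots> = (g * f') *s E" by (rule der_eqI) (simp add: algebra_simps)
    finally have "(g * f') *s E \<in> gspan Q (Suc 0) (\<lambda>_. B *s E)"
      by (rule Euler_multiple_gspan[rotated])
        (use \<theta> \<theta>' g f' I2_fix in \<open>auto intro!: D0_diff D0_scale fix_ring_mult\<close>)
    then show "g *s (f' *s E) \<in> gspan Q (Suc 0) (\<lambda>_. B *s E)" by (simp add: vector_smult_assoc)
  qed
  then obtain q where q: "q \<in> fix_ring Q" "f' *s E = q *s (B *s E)" unfolding gspan_single by blast
  have "q *s (B *s E) \<in> G"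
    using gspan_scale[OF q(1) gspan_base[of 0 "Suc m" \<gamma> Q]] by (simp add: G_def \<gamma>_def)
  then show ?thesis using \<eta> eq' q(2) gspan_add unfolding G_def by metis
qed

text \<open>The errors satisfy \<open>h *s \<Psi> g - g *s \<Psi> h \<in> D0\<close>, since the
  power of \<open>z\<close> in front of them can be cancelled. Their restrictions are thus
  compatible modulo \<open>G\<close> and glue to \<open>\<omega>\<close>. Once
  \<open>linear_form z ^ Suc k *s \<omega>\<close> is subtracted, the new errors restrict into
  \<open>G\<close>; a further factor from \<open>I2\<close> lifts these restrictions and leaves the
  next power of \<open>z\<close>. This is why \<open>J\<close> acquires a factor \<open>I2\<close>
  in every step.\<close>

lemma lift_mod_power:
  assumes \<phi>: "\<phi> \<in> G"
  shows "\<exists>\<theta> J. \<theta> \<in> Der0 \<and> vsubst Q \<theta> = \<phi> \<and> deep Q J \<and>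
     (\<forall>g\<in>J. \<exists>\<eta>\<in>D0. \<exists>\<psi>\<in>Der0. g *s \<theta> = \<eta> + linear_form z ^ Suc k *s \<psi>)"
proof (induction k)
  case 0
  have \<phi>D: "\<phi> \<in> Der Q" using \<phi> gspan_subset_Der[of "Suc m" \<gamma> Q] \<gamma>_Der by (auto simp: G_def)
  have "\<exists>\<eta>\<in>D0. \<exists>\<psi>\<in>Der0. g *s \<phi> = \<eta> + linear_form z ^ Suc 0 *s \<psi>" if g: "g \<in> I2" for g
  proof -
    obtain \<eta> where \<eta>: "\<eta> \<in> D0" "vsubst Q \<eta> = g *s \<phi>" using I2_lifts_G[OF g \<phi>] by blast
    have "g *s \<phi> - \<eta> \<in> Der0"
      using \<eta> g \<phi>D Der_Q_Der0 D0_Der0 I2_fix by (auto intro!: Der0_diff Der0_scale)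
    moreover have "vsubst Q (g *s \<phi> - \<eta>) = 0"
      using \<eta> g \<phi>D by (simp add: vsubst_scale_Q I2_fix vsubst_Q_id del: vsubst_simps(3))
    ultimately obtain \<psi> where "\<psi> \<in> Der0" "g *s \<phi> - \<eta> = linear_form z *s \<psi>" using Der0_z_quotient by blast
    then show ?thesis using \<eta>(1) by (intro bexI[of _ \<eta>] bexI[of _ \<psi>]) (simp_all add: algebra_simps)
  qed
  then show ?case using \<phi>D Der_Q_Der0 vsubst_Q_id I2 by blast
next
  case (Suc k)
  define Z where "Z = linear_form z ^ Suc k"
  have Z: "Z \<in> fix_ring P" "subst Q Z = 0"
    unfolding Z_def using fix_ring_lf_z by (auto simp: fix_ring_def subst_power)
  obtain \<theta> J where \<theta>: "\<theta> \<in> Der0" "vsubst Q \<theta> = \<phi>" and J: "deep Q J"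
    and ex: "\<forall>g\<in>J. \<exists>\<eta>\<in>D0. \<exists>\<psi>\<in>Der0. g *s \<theta> = \<eta> + Z *s \<psi>"
    using Suc unfolding Z_def by blast
  have JQ: "g \<in> fix_ring Q" "g \<in> fix_ring P" if "g \<in> J" for g
    using deep_subset[OF J] that fix_ring_Q_P by auto
  have "\<forall>g. \<exists>\<eta> \<psi>. g \<in> J \<longrightarrow> \<eta> \<in> D0 \<and> \<psi> \<in> Der0 \<and> g *s \<theta> = \<eta> + Z *s \<psi>" using ex by blast
  then obtain H \<Psi> where H': "\<forall>g. g \<in> J \<longrightarrow> H g \<in> D0 \<and> \<Psi> g \<in> Der0 \<and> g *s \<theta> = H g + Z *s \<Psi> g"
    unfolding choice_iff by (elim exE)
  then have H: "\<And>g. g \<in> J \<Longrightarrow> H g \<in> D0" "\<And>g. g \<in> J \<Longrightarrow> \<Psi> g \<in> Der0"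
    "\<And>g. g \<in> J \<Longrightarrow> g *s \<theta> = H g + Z *s \<Psi> g" by blast+
  have "\<exists>\<omega>\<in>Der Q. \<forall>g\<in>J. vsubst Q (\<Psi> g) - g *s \<omega> \<in> G"
    unfolding G_def
  proof (rule deep_gluing[OF J \<gamma>_Der gindep_\<gamma>])
    fix g assume g: "g \<in> J"
    show "vsubst Q (\<Psi> g) \<in> Der Q" using vsubst_Q_Der H(2) g by blast
    fix h assume h: "h \<in> J"
    have "Z *s (h *s \<Psi> g - g *s \<Psi> h) = g *s H h - h *s H g"
    proof -
      have "h *s (H g + Z *s \<Psi> g) = g *s (H h + Z *s \<Psi> h)"
        unfolding H(3)[OF g, symmetric] H(3)[OF h, symmetric] by (simp add: vector_smult_assoc mult.commute)
      then have "h * (pair a (H g) + Z * pair a (\<Psi> g)) = g * (pair a (H h) + Z * pair a (\<Psi> h))" for a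
        by (metis pair_simps(1,4))
      then show ?thesis by (intro der_eqI) (simp add: algebra_simps)
    qed
    moreover have "g *s H h - h *s H g \<in> D0" using H g h JQ by (auto intro!: D0_diff D0_scale)
    moreover have "h *s \<Psi> g - g *s \<Psi> h \<in> Der0" using H g h JQ by (auto intro!: Der0_diff Der0_scale)
    ultimately have "h *s \<Psi> g - g *s \<Psi> h \<in> D0" using D0_zpow_quotient[of "Suc k"] unfolding Z_def by simp
    from D0_restrict_G[OF this]
    show "h *s vsubst Q (\<Psi> g) - g *s vsubst Q (\<Psi> h) \<in> gspan Q (Suc m) \<gamma>"
      using g h JQ by (simp add: vsubst_scale_Q G_def del: vsubst_simps(3))
  qed
  then obtain \<omega> where \<omega>: "\<omega> \<in> Der Q" "\<And>g. g \<in> J \<Longrightarrow> vsubst Q (\<Psi> g) - g *s \<omega> \<in> G" by blast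
  \<comment> \<open>\<open>Z\<close> vanishes on the hyperplane, so the correction leaves the
    restriction \<open>\<phi>\<close> unchanged.\<close>
  define \<theta>' where "\<theta>' = \<theta> - Z *s \<omega>"
  have \<omega>0: "\<omega> \<in> Der0" using \<omega>(1) Der_Q_Der0 by blast
  have \<theta>': "\<theta>' \<in> Der0" "vsubst Q \<theta>' = \<phi>"
    unfolding \<theta>'_def using \<theta> Z \<omega>0 by (auto intro!: Der0_diff Der0_scale)
  have "\<exists>\<eta>\<in>D0. \<exists>\<psi>\<in>Der0. (g' * g) *s \<theta>' = \<eta> + linear_form z ^ Suc (Suc k) *s \<psi>"
    if g': "g' \<in> I2" and g: "g \<in> J" for g' g
  proof -
    obtain \<delta> where \<delta>: "\<delta> \<in> D0" "vsubst Q \<delta> = g' *s (vsubst Q (\<Psi> g) - g *s \<omega>)"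
      using I2_lifts_G[OF g' \<omega>(2)[OF g]] by blast
    let ?x = "g' *s (\<Psi> g - g *s \<omega>) - \<delta>"
    have "?x \<in> Der0"
      using H(2)[OF g] \<omega>0 \<delta> g g' JQ I2_fix D0_Der0 by (auto intro!: Der0_diff Der0_scale fix_ring_mult)
    moreover have "vsubst Q ?x = 0"
      using \<delta> g g' JQ I2_fix \<omega>(1) by (simp add: vsubst_scale_Q fix_ring_mult vsubst_Q_id del: vsubst_simps(3))
    ultimately obtain \<psi> where \<psi>: "\<psi> \<in> Der0" "?x = linear_form z *s \<psi>" using Der0_z_quotient by blast
    have "(g' * g) *s \<theta>' = g' *s (g *s \<theta>) - g' *s (g *s (Z *s \<omega>))"
      unfolding \<theta>'_def by (rule der_eqI) (simp add: algebra_simps)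
    also have "\<dots> = g' *s (H g + Z *s \<Psi> g) - g' *s (g *s (Z *s \<omega>))" by (simp only: H(3)[OF g])
    also have "\<dots> = (g' *s H g + Z *s \<delta>) + Z *s ?x" by (rule der_eqI) (simp add: algebra_simps)
    also have "\<dots> = (g' *s H g + Z *s \<delta>) + linear_form z ^ Suc (Suc k) *s \<psi>"
      unfolding \<psi>(2) by (simp add: Z_def vector_smult_assoc mult_ac)
    finally have "(g' * g) *s \<theta>' = (g' *s H g + Z *s \<delta>) + linear_form z ^ Suc (Suc k) *s \<psi>" .
    moreover have "g' *s H g + Z *s \<delta> \<in> D0"
      using H(1)[OF g] \<delta> Z g' I2_fix by (auto intro!: D0_add D0_scale)
    ultimately show ?thesis using \<psi>(1) by blast
  qed
  then have "\<forall>x\<in>{g' * g | g' g. g' \<in> I2 \<and> g \<in> J}. \<exists>\<eta>\<in>D0. \<exists>\<psi>\<in>Der0. x *s \<theta>' = \<eta> + linear_form z ^ Suc (Suc k) *s \<psi>"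
    by blast
  then show ?case using \<theta>' deep_mult[OF I2 J] by blast
qed

text \<open>A lift modulo \<open>linear_form z ^ Suc D\<close>, with \<open>D\<close> bounding the
  degree of \<open>\<phi>\<close>, is truncated above degree \<open>D\<close>. On the kernel of a
  form \<open>a\<close> the product of some \<open>g\<close> with \<open>pair a \<theta>\<close> is
  divisible by that power of \<open>z\<close>. If \<open>z\<close> does not divide \<open>g\<close>
  there, the power divides \<open>pair a \<theta>\<close>, so no component of degree at most
  \<open>D\<close> survives.\<close>

lemma lift_G:
  assumes \<phi>: "\<phi> \<in> G"
  shows "\<exists>\<theta>\<in>D0. vsubst Q \<theta> = \<phi>"
proof -
  obtain D where D: "\<And>d. d > D \<Longrightarrow> vhcomp d \<phi> = 0" using der_bounded_degree by blast
  obtain \<theta> J where \<theta>: "\<theta> \<in> Der0" "vsubst Q \<theta> = \<phi>" and J: "deep Q J"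
    and ex: "\<And>g. g \<in> J \<Longrightarrow> \<exists>\<eta>\<in>D0. \<exists>\<psi>\<in>Der0. g *s \<theta> = \<eta> + linear_form z ^ Suc D *s \<psi>"
    using lift_mod_power[OF \<phi>, of D] by blast
  define \<theta>' where "\<theta>' = (\<Sum>d\<le>D. vhcomp d \<theta>)"
  have "vsubst Q \<theta>' = (\<Sum>d\<le>D. vhcomp d \<phi>)"
    unfolding \<theta>'_def vsubst_sum \<theta>(2)[symmetric] by simp
  also have "\<dots> = \<phi>" using D by (rule sum_vhcomp)
  finally have eq: "vsubst Q \<theta>' = \<phi>" .
  have "linear_form a dvd hcomp d (pair a \<theta>)" if a: "a \<in> \<Lambda>" and d: "d \<le> D" for a d
  proof -
    obtain u where u: "dot a u = 1" using exists_dual_vector[OF \<Lambda>_nonzero[OF a]] by blast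
    let ?A = "mat 1 - tens u a"
    let ?za = "z - dot z u *s a"
    have za: "subst ?A (linear_form z) = linear_form ?za"
      by (simp add: vector_matrix_diff vector_matrix_tens)
    have za0: "?za \<noteq> 0"
    proof
      assume "?za = 0"
      then have za: "z = dot z u *s a" by simp
      then have "proportional a z" using z_nonzero unfolding proportional_def by (metis vector_smult_lzero)
      then show False using \<Lambda>_not_dvd_z[OF a] proportional_dvd by blast
    qed
    have a1: "a v* mat 1 = a" by simp
    obtain g where g: "g \<in> J" "\<not> linear_form (res a) dvd g" using deep_not_dvd[OF J res_nonzero[OF a]] by blast
    have gQ: "subst Q g = g" using g(1) deep_subset[OF J] by (auto simp: fix_ring_def)
    \<comment> \<open>Both \<open>res a\<close> on the hyperplane of \<open>z\<close> and
      \<open>?za\<close> on the kernel of \<open>a\<close> cut out the intersection of the two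
      hyperplanes, and \<open>g\<close> was chosen not to vanish on it.\<close>
    have "\<not> linear_form ?za dvd subst ?A g"
    proof
      assume "linear_form ?za dvd subst ?A g"
      then have "subst Q (linear_form ?za) dvd subst Q (subst ?A g)" by (rule subst_dvd)
      moreover have "subst Q (linear_form ?za) = mconst (- dot z u) * linear_form (res a)"
        by (simp add: diff_vector_matrix scale_vector_matrix vector_matrix_Q' \<Lambda>P a flip: linear_form_scale)
      ultimately have 1: "linear_form (res a) dvd subst Q (subst ?A g)" by (metis dvd_mult_right)
      have "linear_form a dvd g - subst ?A g" using subst_diff_tens_dvd[of a "mat 1" g u] by simp
      then have "subst Q (linear_form a) dvd subst Q (g - subst ?A g)" by (rule subst_dvd)
      then have "linear_form (res a) dvd g - subst Q (subst ?A g)"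
        using gQ by (simp add: vector_matrix_Q' \<Lambda>P a)
      from dvd_add[OF this 1] show False using g(2) by simp
    qed
    moreover obtain \<eta> \<psi> where \<eta>: "\<eta> \<in> D0" "g *s \<theta> = \<eta> + linear_form z ^ Suc D *s \<psi>" using ex[OF g(1)] by blast
    have "g * pair a \<theta> = pair a \<eta> + linear_form z ^ Suc D * pair a \<psi>"
      using arg_cong[OF \<eta>(2), of "pair a"] by (simp only: pair_simps)
    from arg_cong[OF this, of "subst ?A"]
    have "subst ?A g * subst ?A (pair a \<theta>) = linear_form ?za ^ Suc D * subst ?A (pair a \<psi>)"
      using subst_tens_kills[OF a1 u D0_dvd[OF \<eta>(1) a]]
      by (simp only: subst_simps subst_power za add_0)
    then have "linear_form ?za ^ Suc D dvd subst ?A g * subst ?A (pair a \<theta>)" by simp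
    ultimately have "linear_form ?za ^ Suc D dvd subst ?A (pair a \<theta>)"
      using linear_form_power_dvd_cancel[OF za0] by blast
    then obtain t where "subst ?A (pair a \<theta>) = linear_form ?za ^ Suc D * t" by (elim dvdE)
    moreover have "mhomogeneous (Suc D) (linear_form ?za ^ Suc D)"
      using mhomogeneous_power[OF mhomogeneous_linear_form, of "Suc D" ?za] by simp
    ultimately have "hcomp d (subst ?A (pair a \<theta>)) = 0" using d by (simp only: hcomp_mult) simp
    then have "subst ?A (hcomp d (pair a \<theta>)) = 0" by (simp add: hcomp_subst)
    then show ?thesis using linear_form_dvd_iff[OF a1 u, of "hcomp d (pair a \<theta>)"] by simp
  qed
  then have "linear_form a dvd pair a \<theta>'" if "a \<in> \<Lambda>" for a
    using that by (auto simp: \<theta>'_def pair_sum intro!: dvd_sum)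
  moreover have "\<theta>' \<in> Der0"
  proof -
    have "S \<subseteq> {..D} \<Longrightarrow> (\<Sum>d\<in>S. vhcomp d \<theta>) \<in> Der0" for S
      by (induction S rule: infinite_finite_induct)
        (use Der0_vhcomp[OF \<theta>(1)] in \<open>auto simp: Der0_def intro: Der_add\<close>)
    then show ?thesis unfolding \<theta>'_def by blast
  qed
  ultimately show ?thesis using eq by (auto simp: D0_def)
qed

lemma homogeneous_lift:
  assumes "j < m"
  shows "\<exists>\<theta> f d. \<theta> \<in> D0 \<and> vhom d \<theta> \<and> f \<in> fix_ring Q \<and> vsubst Q \<theta> = b j + f *s E"
proof -
  have "\<gamma> (Suc j) \<in> G" unfolding G_def using assms by (intro gspan_base) simp
  then obtain \<theta> where \<theta>: "\<theta> \<in> D0" "vsubst Q \<theta> = b j + corr j *s E"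
    using lift_G by (auto simp: \<gamma>_def)
  obtain d where d: "vhom d (b j)" using basis assms unfolding euler_basis_def by blast
  \<comment> \<open>The Euler derivation has degree 1, whence the shift; in degree 0 no Euler
    correction is left.\<close>
  define f where "f = (if 1 \<le> d then hcomp (d - 1) (corr j) else 0)"
  have "vsubst Q (vhcomp d \<theta>) = vhcomp d (b j) + vhcomp d (corr j *s E)"
    by (metis \<theta>(2) vhcomp_simps(1,4))
  also have "\<dots> = b j + f *s E"
    using vhcomp_scale_right[OF vhom_Euler, of d "corr j" Q] d by (simp add: f_def vhom_def)
  finally have "vsubst Q (vhcomp d \<theta>) = b j + f *s E" .
  moreover have "f \<in> fix_ring Q" using corr(1)[OF assms] by (auto simp: f_def intro: fix_ring_hcomp)
  ultimately show ?thesis using D0_vhcomp[OF \<theta>(1)] vhom_vhcomp by blast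
qed

lemma homogeneous_lift_B: "\<exists>\<theta> d. \<theta> \<in> D0 \<and> vhom d \<theta> \<and> vsubst Q \<theta> = B *s E"
proof -
  have "\<gamma> 0 \<in> G" unfolding G_def by (intro gspan_base) simp
  then obtain \<theta> where \<theta>: "\<theta> \<in> D0" "vsubst Q \<theta> = B *s E" using lift_G by (auto simp: \<gamma>_def)
  let ?d = "card \<Lambda> - card N + 1"
  have "vhom ?d (B *s E)" using vhom_scale[OF B_hom vhom_Euler] .
  then have "vsubst Q (vhcomp ?d \<theta>) = B *s E" by (metis \<theta>(2) vhcomp_simps(4) vhom_def)
  then show ?thesis using D0_vhcomp[OF \<theta>(1)] vhom_vhcomp by blast
qed

lemma zero_if_divisible_by_powers:
  assumes "\<And>k. linear_form z ^ k dvd f"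
  shows "f = 0"
proof -
  have "hcomp d f = 0" for d
  proof -
    obtain t where t: "f = linear_form z ^ Suc d * t" using assms[of "Suc d"] by (elim dvdE)
    have "mhomogeneous (Suc d) (linear_form z ^ Suc d)"
      using mhomogeneous_power[OF mhomogeneous_linear_form, of "Suc d" z] by simp
    then show ?thesis unfolding t by (simp only: hcomp_mult) simp
  qed
  then show ?thesis using sum_hcomp[of 0 f] by simp
qed

text \<open>The lifts together with \<open>\<theta>B\<close> generate \<open>D0\<close> modulo
  \<open>z\<close>, and induction on the degree, as in the graded Nakayama lemma, makes them
  generate \<open>D0\<close>. Adding the Euler derivation then gives all of
  \<open>DP\<close>.\<close>

theorem basis_lift: "\<exists>b'. euler_basis P DP (Suc m) b'"
proof -
  obtain \<theta>B dB where \<theta>B: "\<theta>B \<in> D0" "vhom dB \<theta>B" "vsubst Q \<theta>B = B *s E"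
    using homogeneous_lift_B by blast
  have "\<forall>j. \<exists>\<theta> f d. j < m \<longrightarrow> \<theta> \<in> D0 \<and> vhom d \<theta> \<and> f \<in> fix_ring Q \<and> vsubst Q \<theta> = b j + f *s E"
    using homogeneous_lift by blast
  then obtain T F dT where T': "\<forall>j. j < m \<longrightarrow> T j \<in> D0 \<and> vhom (dT j) (T j) \<and> F j \<in> fix_ring Q
      \<and> vsubst Q (T j) = b j + F j *s E"
    unfolding choice_iff by (elim exE)
  then have T: "\<And>j. j < m \<Longrightarrow> T j \<in> D0" "\<And>j. j < m \<Longrightarrow> vhom (dT j) (T j)"
    "\<And>j. j < m \<Longrightarrow> F j \<in> fix_ring Q" "\<And>j. j < m \<Longrightarrow> vsubst Q (T j) = b j + F j *s E" by blast+
  let ?t = "case_nat \<theta>B T"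
  let ?S = "gspan P (Suc m) ?t"
  have tD0: "?t j \<in> D0" if "j < Suc m" for j using \<theta>B T that by (auto split: nat.split)
  have SD0: "?S \<subseteq> D0" using tD0 by (auto simp: gspan_def intro!: D0_sum D0_scale simp del: sum.lessThan_Suc)
  have thom: "\<exists>d. vhom d (?t j)" if "j < Suc m" for j
    using \<theta>B T that by (cases j) auto
  have S_vhcomp: "vhcomp d \<sigma> \<in> ?S" if \<sigma>S: "\<sigma> \<in> ?S" for \<sigma> d
  proof -
    obtain c where c: "\<And>j. j < Suc m \<Longrightarrow> c j \<in> fix_ring P" "\<sigma> = (\<Sum>j<Suc m. c j *s ?t j)"
      using gspanD[OF \<sigma>S] by blast
    have "vhcomp d (c j *s ?t j) \<in> ?S" if j: "j < Suc m" for j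
    proof -
      obtain e where e: "vhom e (?t j)" using thom[OF j] by blast
      show ?thesis unfolding vhcomp_scale_right[OF e]
        using gspan_scale[OF fix_ring_hcomp[OF c(1)[OF j]] gspan_base[of j "Suc m" ?t P]] j
        by (simp add: gspan_0)
    qed
    then show ?thesis unfolding c(2) vhcomp_sum by (intro gspan_sum) simp
  qed
  have step: "\<exists>\<sigma>\<in>?S. \<exists>\<eta>\<in>D0. \<theta> = \<sigma> + linear_form z *s \<eta>" if \<theta>: "\<theta> \<in> D0" for \<theta>
  proof -
    have "vsubst Q \<theta> \<in> gspan Q (Suc m) (case_nat E b)"
      using D0_restrict[OF \<theta>] basis unfolding euler_basis_def by blast
    then obtain f c where f: "f \<in> fix_ring Q" and c: "\<forall>j<m. c j \<in> fix_ring Q"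
      and eq: "vsubst Q \<theta> = f *s E + (\<Sum>j<m. c j *s b j)"
      using gspan_case_natD[of "vsubst Q \<theta>" Q m E b] by blast
    define f' where "f' = f - (\<Sum>j<m. c j * F j)"
    define \<theta>1 where "\<theta>1 = \<theta> - (\<Sum>j<m. c j *s T j)"
    have f': "f' \<in> fix_ring Q"
      unfolding f'_def using f c T(3) by (auto intro!: fix_ring_diff fix_ring_mult fix_ring_sum)
    have \<theta>1: "\<theta>1 \<in> D0"
      unfolding \<theta>1_def using \<theta> T c fix_ring_Q_P by (auto intro!: D0_diff D0_sum D0_scale)
    have "vsubst Q (\<Sum>j<m. c j *s T j) = (\<Sum>j<m. c j *s (b j + F j *s E))"
      unfolding vsubst_sum using c T by (intro sum.cong refl) (simp add: vsubst_scale_Q del: vsubst_simps(3))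
    moreover have "f' *s E + (\<Sum>j<m. c j *s (b j + F j *s E)) = vsubst Q \<theta>"
      unfolding correction_sum eq by (simp add: f'_def)
    ultimately have r1: "vsubst Q \<theta>1 = f' *s E" unfolding \<theta>1_def by (simp add: algebra_simps)
    obtain q where "f' *s E = q *s (B *s E)" and q: "q \<in> fix_ring Q"
      using Euler_multiple_gspan[OF \<theta>1 r1 f'] unfolding gspan_single by blast
    then have "vsubst Q (\<theta>1 - q *s \<theta>B) = 0"
      using r1 \<theta>B by (simp add: vsubst_scale_Q del: vsubst_simps(3))
    moreover have "\<theta>1 - q *s \<theta>B \<in> D0" using \<theta>1 \<theta>B q fix_ring_Q_P by (auto intro!: D0_diff D0_scale)
    ultimately obtain \<eta> where \<eta>: "\<eta> \<in> D0" "\<theta>1 - q *s \<theta>B = linear_form z *s \<eta>" using D0_ker_restrict by blast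
    have "\<theta> = (q *s \<theta>B + (\<Sum>j<m. c j *s T j)) + linear_form z *s \<eta>"
      unfolding \<eta>(2)[symmetric] \<theta>1_def by simp
    moreover have "q *s \<theta>B + (\<Sum>j<m. c j *s T j) \<in> ?S"
      by (rule gspan_case_natI) (use q c fix_ring_Q_P in auto)
    ultimately show ?thesis using \<eta>(1) by blast
  qed
  have hom: "vhcomp d \<theta> \<in> ?S" if "\<theta> \<in> D0" for \<theta> d
    using that
  proof (induction d arbitrary: \<theta>)
    case 0
    obtain \<sigma> \<eta> where *: "\<sigma> \<in> ?S" "\<theta> = \<sigma> + linear_form z *s \<eta>" using step[OF 0] by blast
    have "vhcomp 0 \<theta> = vhcomp 0 \<sigma>"
      unfolding *(2) using vhcomp_scale_left[OF mhomogeneous_linear_form, of 0 z \<eta>] by simp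
    then show ?case using S_vhcomp *(1) by simp
  next
    case (Suc d)
    obtain \<sigma> \<eta> where *: "\<sigma> \<in> ?S" "\<eta> \<in> D0" "\<theta> = \<sigma> + linear_form z *s \<eta>" using step[OF Suc.prems] by blast
    have "vhcomp (Suc d) \<theta> = vhcomp (Suc d) \<sigma> + linear_form z *s vhcomp d \<eta>"
      unfolding *(3) using vhcomp_scale_left[OF mhomogeneous_linear_form, of "Suc d" z \<eta>] by simp
    then show ?case using S_vhcomp[OF *(1)] Suc.IH[OF *(2)] fix_ring_lf_z
      by (auto intro!: gspan_add gspan_scale)
  qed
  have D0S: "D0 \<subseteq> ?S"
  proof
    fix \<theta> assume \<theta>: "\<theta> \<in> D0"
    obtain D where D: "\<And>d. d > D \<Longrightarrow> vhcomp d \<theta> = 0" using der_bounded_degree by blast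
    have "(\<Sum>d\<le>D. vhcomp d \<theta>) \<in> ?S" by (intro gspan_sum hom[OF \<theta>])
    then show "\<theta> \<in> ?S" using sum_vhcomp[OF D] by simp
  qed
  have "DP \<subseteq> gspan P (Suc (Suc m)) (case_nat (Euler P) ?t)"
  proof
    fix \<theta> assume \<theta>: "\<theta> \<in> DP"
    then obtain f where f: "pair z \<theta> = linear_form z * f" by (auto simp: DP_def elim: dvdE)
    have \<theta>P: "\<theta> \<in> Der P" using \<theta> by (simp add: DP_def)
    have fP: "f \<in> fix_ring P"
      by (rule fix_ring_cancel[of "linear_form z"])
        (use f Der_fix_ring[OF \<theta>P, of z] fix_ring_lf_z z_nonzero in auto)
    have "\<theta> - f *s Euler P \<in> D0"
      using \<theta> f fP Euler_Der[OF P]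
      by (auto simp: D0_def Der0_def DP_def zP \<Lambda>P mult.commute intro!: Der_diff Der_scale' dvd_diff)
    then have S: "\<theta> - f *s Euler P \<in> ?S" using D0S by blast
    obtain c where c: "\<And>j. j < Suc m \<Longrightarrow> c j \<in> fix_ring P" "\<theta> - f *s Euler P = (\<Sum>j<Suc m. c j *s ?t j)"
      using gspanD[OF S] by blast
    have eq: "\<theta> = f *s Euler P + (\<Sum>j<Suc m. c j *s ?t j)" unfolding c(2)[symmetric] by simp
    show "\<theta> \<in> gspan P (Suc (Suc m)) (case_nat (Euler P) ?t)"
      by (subst eq) (rule gspan_case_natI[OF fP c(1)])
  qed
  moreover have "gindep P (Suc (Suc m)) (case_nat (Euler P) ?t)"
  proof (rule gindep_case_natI)
    fix f c assume f: "f \<in> fix_ring P" and c: "\<And>j. j < Suc m \<Longrightarrow> c j \<in> fix_ring P"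
      and eq: "f *s Euler P + (\<Sum>j<Suc m. c j *s ?t j) = 0"
    have "pair z (\<Sum>j<Suc m. c j *s ?t j) = 0"
      unfolding pair_sum using tD0 by (intro sum.neutral ballI) (simp add: D0_def Der0_def)
    then have "f * linear_form z = 0"
      using arg_cong[OF eq, of "pair z"] by (simp add: zP del: sum.lessThan_Suc)
    then have f0: "f = 0" using mpoly_mult_eq_0[of f "linear_form z"] z_nonzero by simp
    \<comment> \<open>On the hyperplane a relation becomes one among independent elements, so
      \<open>z\<close> divides every coefficient. Dividing by \<open>z\<close> gives a relation of
      the same kind, and the argument repeats without end.\<close>
    have div: "\<forall>j<Suc m. linear_form z ^ k dvd c j"
      if "\<And>j. j < Suc m \<Longrightarrow> c j \<in> fix_ring P" "(\<Sum>j<Suc m. c j *s ?t j) = 0" for c k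
      using that
    proof (induction k arbitrary: c)
      case (Suc k)
      have "vsubst Q (\<Sum>j<Suc m. c j *s ?t j) = subst Q (c 0) *s (B *s E) + (\<Sum>j<m. subst Q (c (Suc j)) *s (b j + F j *s E))"
        unfolding gsum_case_nat by (simp add: vsubst_sum \<theta>B T cong: sum.cong_simp)
      also have "\<dots> = (subst Q (c 0) * B + (\<Sum>j<m. subst Q (c (Suc j)) * F j)) *s E + (\<Sum>j<m. subst Q (c (Suc j)) *s b j)"
        using correction_sum[of "subst Q (c 0) * B" "\<lambda>j. subst Q (c (Suc j))" F] by (simp add: vector_smult_assoc)
      finally have A: "vsubst Q (\<Sum>j<Suc m. c j *s ?t j) = (subst Q (c 0) * B + (\<Sum>j<m. subst Q (c (Suc j)) * F j)) *s E + (\<Sum>j<m. subst Q (c (Suc j)) *s b j)" .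
      have "(subst Q (c 0) * B + (\<Sum>j<m. subst Q (c (Suc j)) * F j)) *s E + (\<Sum>j<m. subst Q (c (Suc j)) *s b j) = 0"
        using A[symmetric] unfolding Suc.prems(2) vsubst_simps .
      moreover have "subst Q (c 0) * B + (\<Sum>j<m. subst Q (c (Suc j)) * F j) \<in> fix_ring Q"
        using subst_Q_fix B_fix T(3) by (auto intro!: fix_ring_add fix_ring_mult fix_ring_sum)
      moreover have "gindep Q (Suc m) (case_nat E b)" using basis unfolding euler_basis_def by blast
      ultimately have *: "subst Q (c 0) * B + (\<Sum>j<m. subst Q (c (Suc j)) * F j) = 0"
        "\<forall>j<m. subst Q (c (Suc j)) = 0"
        using gindep_case_natD[of Q m E b _ "\<lambda>j. subst Q (c (Suc j))"] subst_Q_fix by blast+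
      then have "subst Q (c 0) * B = 0" by simp
      then have "subst Q (c 0) = 0" using mpoly_mult_eq_0[of "subst Q (c 0)" B] B_nonzero by simp
      then have "subst Q (c j) = 0" if "j < Suc m" for j using *(2) that by (cases j) auto
      then have "linear_form z dvd c j" if "j < Suc m" for j using z_dvd_iff Suc.prems(1) that by simp
      then have "\<forall>j. \<exists>e. j < Suc m \<longrightarrow> c j = linear_form z * e" unfolding dvd_def by blast
      then obtain e where e: "\<forall>j. j < Suc m \<longrightarrow> c j = linear_form z * e j"
        unfolding choice_iff by (elim exE)
      have eP: "e j \<in> fix_ring P" if "j < Suc m" for j
        by (rule fix_ring_cancel[of "linear_form z"])
          (use e Suc.prems(1)[OF that] that fix_ring_lf_z z_nonzero in auto)
      have "linear_form z *s (\<Sum>j<Suc m. e j *s ?t j) = (\<Sum>j<Suc m. c j *s ?t j)"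
        unfolding gsum_scale using e by (intro sum.cong) auto
      then have "linear_form z *s (\<Sum>j<Suc m. e j *s ?t j) = linear_form z *s 0"
        using Suc.prems(2) by simp
      then have "(\<Sum>j<Suc m. e j *s ?t j) = 0" by (rule der_scale_left_cancel) (simp add: z_nonzero)
      then have "\<forall>j<Suc m. linear_form z ^ k dvd e j" using Suc.IH eP by blast
      then show ?case using e unfolding power_Suc by (metis dvd_refl mult_dvd_mono)
    qed simp
    have "(\<Sum>j<Suc m. c j *s ?t j) = 0" using eq f0 by simp
    then have "\<forall>j<Suc m. linear_form z ^ k dvd c j" for k using div[of c, OF c] by blast
    then have "\<forall>j<Suc m. c j = 0" using zero_if_divisible_by_powers by blast
    then show "f = 0 \<and> (\<forall>j<Suc m. c j = 0)" using f0 by blast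
  qed
  moreover have "\<forall>j<Suc m. ?t j \<in> DP \<and> (\<exists>d. vhom d (?t j))"
    using tD0 thom by (auto simp: DP_def D0_def Der0_def simp del: less_Suc_eq)
  ultimately show ?thesis unfolding euler_basis_def by blast
qed

end

end

section \<open>From flats of codimension three to the hyperplane\<close>

definition in_span2 :: "'k::field ^ 'n::finite \<Rightarrow> 'k ^ 'n \<Rightarrow> 'k ^ 'n \<Rightarrow> bool" where
  "in_span2 x y v \<longleftrightarrow> (\<exists>c d. v = c *s x + d *s y)"

text \<open>Here \<open>p\<close> and \<open>q\<close> are the two components of a derivation in
  rank two. Subtracting \<open>g\<close> times the Euler derivation kills the first component; the
  second is then divisible by every form other than \<open>\<phi> i\<close>, as its coefficient
  \<open>d a\<close> is nonzero.\<close>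

lemma rank2_divisibility:
  fixes \<phi> :: "'i \<Rightarrow> 'k::field ^ 'n::finite"
  assumes "finite N" "i \<in> N" "\<And>a. a \<in> N \<Longrightarrow> \<phi> a \<noteq> 0"
    and dist: "\<And>a b. a \<in> N \<Longrightarrow> b \<in> N \<Longrightarrow> proportional (\<phi> a) (\<phi> b) \<Longrightarrow> a = b"
    and \<phi>: "\<And>a. a \<in> N \<Longrightarrow> \<phi> a = c a *s \<phi> i + d a *s y"
    and p: "linear_form (\<phi> i) dvd p"
    and dvd: "\<And>a. a \<in> N \<Longrightarrow> linear_form (\<phi> a) dvd mconst (c a) * p + mconst (d a) * q"
  shows "\<exists>g k. p = linear_form (\<phi> i) * g \<and> q = linear_form y * g + k * (\<Prod>a\<in>N - {i}. linear_form (\<phi> a))"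
proof -
  obtain g where g: "p = linear_form (\<phi> i) * g" using p by (elim dvdE)
  have "(\<Prod>a\<in>N - {i}. linear_form (\<phi> a)) dvd q - linear_form y * g"
  proof (rule prod_distinct_linear_forms_dvd)
    show "finite (N - {i})" using assms(1) by simp
    show "\<phi> a \<noteq> 0" if "a \<in> N - {i}" for a using assms(3) that by blast
    show "a = b" if "a \<in> N - {i}" "b \<in> N - {i}" "proportional (\<phi> a) (\<phi> b)" for a b
      using dist that by blast
    fix a assume a: "a \<in> N - {i}"
    have d: "d a \<noteq> 0"
    proof
      assume "d a = 0"
      then have "\<phi> a = c a *s \<phi> i" using \<phi>[of a] a by simp
      moreover have "c a \<noteq> 0" using calculation assms(3)[of a] a by auto
      ultimately have "proportional (\<phi> i) (\<phi> a)" unfolding proportional_def by blast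
      then show False using dist[of i a] a assms(2) by auto
    qed
    have "linear_form (\<phi> a) = mconst (c a) * linear_form (\<phi> i) + mconst (d a) * linear_form y"
      using \<phi>[of a] a by (metis DiffD1 linear_form_add linear_form_scale)
    then have "mconst (c a) * p + mconst (d a) * q - linear_form (\<phi> a) * g = mconst (d a) * (q - linear_form y * g)"
      unfolding g by (simp add: algebra_simps)
    moreover have "linear_form (\<phi> a) dvd mconst (c a) * p + mconst (d a) * q - linear_form (\<phi> a) * g"
      using dvd[of a] a by (intro dvd_diff) auto
    ultimately have "linear_form (\<phi> a) dvd mconst (d a) * (q - linear_form y * g)" by simp
    then have "linear_form (\<phi> a) dvd mconst (inverse (d a)) * (mconst (d a) * (q - linear_form y * g))"
      by (rule dvd_mult)
    then show "linear_form (\<phi> a) dvd q - linear_form y * g"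
      using d by (simp flip: mult.assoc mconst_mult)
  qed
  then obtain k where "q - linear_form y * g = (\<Prod>a\<in>N - {i}. linear_form (\<phi> a)) * k" by (elim dvdE)
  then have "q = linear_form y * g + k * (\<Prod>a\<in>N - {i}. linear_form (\<phi> a))" by (simp add: algebra_simps)
  with g show ?thesis by blast
qed

section \<open>Localization at a flat of codimension two in the hyperplane\<close>

context arr_reps
begin

text \<open>Intended for rank three, where \<open>E\<close> and the derivation in the second clause
  generate the logarithmic derivations of the restriction (\<open>DQ_generators\<close>). Both the
  generator up to Euler multiples and \<open>B *s E\<close> have to lift.\<close>

definition lifts :: "'a ^ 'b \<Rightarrow> 'a ^ 'b \<Rightarrow> bool" where
  "lifts i e \<longleftrightarrow> (\<exists>\<theta>\<in>D0. vsubst Q \<theta> = B *s E) \<and>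
     (\<exists>\<theta>\<in>D0. \<exists>f\<in>fix_ring Q. vsubst Q \<theta> = (\<Prod>a\<in>N - {i}. linear_form (res a)) *s cvec e + f *s E)"

end

text \<open>\<open>res i\<close> and \<open>x2\<close> are independent coordinates on the hyperplane
  with dual vectors \<open>e1\<close> and \<open>e2\<close>. The flat is their common kernel
  there.\<close>

locale arr_flat = arr_reps +
  fixes i x2 e1 e2 :: "'a ^ 'b"
  assumes i: "i \<in> N" and x2Q: "x2 v* Q = x2" and e1: "Q *v e1 = e1" and e2: "Q *v e2 = e2"
    and dual: "dot (res i) e1 = 1" "dot (res i) e2 = 0" "dot x2 e1 = 0" "dot x2 e2 = 1"
begin

definition x1 :: "'a ^ 'b" where "x1 = res i"

text \<open>The projection along the flat onto the span of \<open>e1\<close>, \<open>e2\<close> and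
  \<open>w\<close>. On this complement the hyperplanes through the flat form an arrangement in three
  dimensions.\<close>

definition P3 :: "'a ^ 'b ^ 'b" where "P3 = tens e1 x1 + tens e2 x2 + tens w z"

definition \<Lambda>U :: "('a ^ 'b) set" where "\<Lambda>U = {a \<in> \<Lambda>. in_span2 x1 x2 (res a)}"

abbreviation NU :: "('a ^ 'b) set" where "NU \<equiv> N \<inter> \<Lambda>U"

lemma i\<Lambda>: "i \<in> \<Lambda>" using i N_sub by blast

lemma x1Q: "x1 v* Q = x1" by (simp add: x1_def res_Q \<Lambda>P i\<Lambda>)

lemma dual': "dot x1 e1 = 1" "dot x1 e2 = 0" "dot x2 e1 = 0" "dot x2 e2 = 1"
  using dual by (simp_all add: x1_def)

lemma Qw: "Q *v w = 0"
  by (simp add: Q_def matrix_vector_diff Pw tens_mult_vector zw)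

lemma dual_w: "dot x1 w = 0" "dot x2 w = 0" "dot z e1 = 0" "dot z e2 = 0"
proof -
  show "dot x1 w = 0" by (metis x1Q dot_vector_matrix Qw dot_zero_right)
  show "dot x2 w = 0" by (metis x2Q dot_vector_matrix Qw dot_zero_right)
  show "dot z e1 = 0" by (metis e1 dot_vector_matrix zQ dot_zero_left)
  show "dot z e2 = 0" by (metis e2 dot_vector_matrix zQ dot_zero_left)
qed

lemma vector_matrix_P3: "a v* P3 = dot a e1 *s x1 + dot a e2 *s x2 + dot a w *s z"
  by (simp add: P3_def vector_matrix_plus vector_matrix_tens)

lemma res_dot_e: "a v* P = a \<Longrightarrow> dot (res a) e1 = dot a e1" "a v* P = a \<Longrightarrow> dot (res a) e2 = dot a e2"
  by (simp_all add: res_def dual_w)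

lemma \<Lambda>U_P3: "a \<in> \<Lambda>U \<Longrightarrow> a v* P3 = a"
proof -
  assume a: "a \<in> \<Lambda>U"
  then obtain c d where cd: "res a = c *s x1 + d *s x2" by (auto simp: \<Lambda>U_def in_span2_def)
  have "a v* P = a" using a \<Lambda>P by (simp add: \<Lambda>U_def)
  then have "dot a e1 = c" "dot a e2 = d" using res_dot_e[of a] by (simp_all add: cd dual')
  then show ?thesis unfolding vector_matrix_P3 using cd by (simp add: res_def algebra_simps)
qed

lemma P3_proj: "P3 ** P3 = P3" "P3 *v w = w" "z v* P3 = z" "P ** P3 = P3" "P3 ** P = P3" "P3 ** Q = P3 - tens w z"
proof -
  have x: "x1 v* P3 = x1" "x2 v* P3 = x2" "z v* P3 = z"
    by (simp_all add: vector_matrix_P3 dual' dual_w zw)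
  show "z v* P3 = z" by (rule x(3))
  have x1P: "x1 v* P = x1" by (simp add: x1_def res_def diff_vector_matrix scale_vector_matrix zP \<Lambda>P i\<Lambda>)
  have x2P: "x2 v* P = x2"
  proof -
    have "(x2 v* Q) v* P = x2 v* Q" by (simp only: vector_matrix_assoc QP)
    then show ?thesis by (simp only: x2Q)
  qed
  have dotP: "dot (a v* P) w = dot a w" "dot (a v* P) e1 = dot a e1" "dot (a v* P) e2 = dot a e2" for a
  proof -
    have "P *v e1 = e1" by (metis e1 PQ matrix_vector_mul_assoc)
    moreover have "P *v e2 = e2" by (metis e2 PQ matrix_vector_mul_assoc)
    ultimately show "dot (a v* P) w = dot a w" "dot (a v* P) e1 = dot a e1" "dot (a v* P) e2 = dot a e2"
      by (simp_all add: dot_vector_matrix Pw)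
  qed
  have "(a v* P3) v* P3 = a v* P3" for a
    by (simp only: vector_matrix_P3[of a] add_vector_matrix scale_vector_matrix x)
  then show "P3 ** P3 = P3" by (intro matrix_eqI_covector) (simp only: vector_matrix_assoc[symmetric])
  have "(a v* P3) v* P = a v* P3" for a
    by (simp only: vector_matrix_P3[of a] add_vector_matrix scale_vector_matrix x1P x2P zP)
  then show "P3 ** P = P3" by (intro matrix_eqI_covector) (simp only: vector_matrix_assoc[symmetric])
  have "(a v* P) v* P3 = a v* P3" for a
    by (simp only: vector_matrix_P3 dotP)
  then show "P ** P3 = P3" by (intro matrix_eqI_covector) (simp only: vector_matrix_assoc[symmetric])
  have "(a v* P3) v* Q = a v* (P3 - tens w z)" for a
  proof -
    have "(a v* P3) v* Q = dot a e1 *s x1 + dot a e2 *s x2 + dot a w *s 0"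
      by (simp only: vector_matrix_P3[of a] add_vector_matrix scale_vector_matrix x1Q x2Q zQ)
    then show ?thesis by (simp add: vector_matrix_diff vector_matrix_tens vector_matrix_P3)
  qed
  then show "P3 ** Q = P3 - tens w z" by (intro matrix_eqI_covector) (simp only: vector_matrix_assoc[symmetric])
  show "P3 *v w = w"
    by (simp add: P3_def matrix_vector_plus tens_mult_vector dual_w zw)
qed

sublocale L: arr_reps P3 w z \<Lambda>U NU
proof
  show "P3 ** P3 = P3" "P3 *v w = w" "z v* P3 = z" by (rule P3_proj)+
  show "dot z w = 1" by (rule zw)
  show "finite \<Lambda>U" using fin by (simp add: \<Lambda>U_def)
  show "NU \<subseteq> \<Lambda>U" by blast
  fix a assume a: "a \<in> \<Lambda>U"
  show "a v* P3 = a" using a by (rule \<Lambda>U_P3)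
  have a\<Lambda>: "a \<in> \<Lambda>" using a by (simp add: \<Lambda>U_def)
  show "a \<noteq> c *s z" for c using a\<Lambda> by (rule \<Lambda>z)
  show "b \<in> \<Lambda>U \<Longrightarrow> proportional a b \<Longrightarrow> a = b" for b using a\<Lambda> \<Lambda>_distinct by (auto simp: \<Lambda>U_def)
  obtain b where b: "b \<in> N" "proportional (res a) (res b)" using N_rep[OF a\<Lambda>] by blast
  then obtain c where "res b = c *s res a" by (auto simp: proportional_def)
  moreover obtain u v where "res a = u *s x1 + v *s x2" using a by (auto simp: \<Lambda>U_def in_span2_def)
  ultimately have "res b = (c * u) *s x1 + (c * v) *s x2" by (simp add: vector_add_ldistrib vector_smult_assoc)
  then have "b \<in> NU" using b(1) N_sub by (auto simp: \<Lambda>U_def in_span2_def)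
  then show "\<exists>b\<in>NU. proportional (arr_setup.res w z a) (arr_setup.res w z b)" using b(2) by blast
qed (use N_distinct in blast)

lemma L_Q: "L.Q = P3 ** Q"
  by (simp add: L.Q_def P3_proj)

lemma vector_matrix_LQ: "a v* L.Q = dot a e1 *s x1 + dot a e2 *s x2"
  by (simp add: L.Q_def vector_matrix_diff vector_matrix_tens vector_matrix_P3)

lemma fix_ring_P3_P: "f \<in> fix_ring P3 \<Longrightarrow> f \<in> fix_ring P"
proof -
  assume "f \<in> fix_ring P3"
  then have "subst P f = subst P (subst P3 f)" by (simp add: fix_ring_def)
  then show ?thesis using \<open>f \<in> fix_ring P3\<close> by (simp add: fix_ring_def subst_subst P3_proj)
qed

lemma Der_P3_P: "\<theta> \<in> Der P3 \<Longrightarrow> \<theta> \<in> Der P"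
proof -
  assume \<theta>: "\<theta> \<in> Der P3"
  have "pair (a v* P) \<theta> = pair a \<theta>" for a
  proof -
    have "pair (a v* P) \<theta> = pair ((a v* P) v* P3) \<theta>" by (rule Der_pair[OF \<theta>, symmetric])
    also have "\<dots> = pair a \<theta>" by (simp only: vector_matrix_assoc P3_proj Der_pair[OF \<theta>])
    finally show ?thesis .
  qed
  moreover have "subst P (pair a \<theta>) = pair a \<theta>" for a
    using fix_ring_P3_P[of "pair a \<theta>"] Der_subst[OF \<theta>] by (simp add: fix_ring_def)
  ultimately show ?thesis by (simp add: Der_def)
qed

lemma vsubst_LQ: "\<theta> \<in> Der P3 \<Longrightarrow> vsubst L.Q \<theta> = vsubst Q \<theta>"
proof -
  assume \<theta>: "\<theta> \<in> Der P3"
  show ?thesis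
    by (rule der_eqI) (metis L_Q pair_vsubst subst_subst Der_subst[OF \<theta>])
qed

lemma fix_ring_LQ_Q: "f \<in> fix_ring L.Q \<Longrightarrow> f \<in> fix_ring Q"
proof -
  assume f: "f \<in> fix_ring L.Q"
  then have "f \<in> fix_ring P3" by (rule L.fix_ring_Q_P)
  then have "subst Q f = subst Q (subst P3 f)" by (simp add: fix_ring_def)
  also have "\<dots> = subst L.Q f" by (simp add: subst_subst L_Q)
  finally show ?thesis using f by (simp add: fix_ring_def)
qed

text \<open>The product over the hyperplanes that do not contain the flat, restricted to the
  hyperplane of \<open>z\<close>; \<open>outer'\<close> is the same product before
  restriction.\<close>

definition outer :: "('a, 'b) mpoly" where "outer = (\<Prod>a\<in>\<Lambda> - \<Lambda>U. linear_form (res a))"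

definition outer' :: "('a, 'b) mpoly" where "outer' = (\<Prod>a\<in>\<Lambda> - \<Lambda>U. linear_form a)"

lemma outer'_fix: "outer' \<in> fix_ring P"
  unfolding outer'_def by (intro fix_ring_prod fix_ring_linear_form \<Lambda>P) auto

lemma outer_fix: "outer \<in> fix_ring Q"
  unfolding outer_def by (intro fix_ring_prod fix_ring_linear_form res_Q \<Lambda>P) auto

lemma subst_outer': "subst Q outer' = outer"
  unfolding outer'_def outer_def subst_prod by (intro prod.cong) (auto simp: vector_matrix_Q' \<Lambda>P)

lemma vsubst_outer': "vsubst Q (outer' *s \<theta>) = outer *s vsubst Q \<theta>"
  by (simp add: subst_outer')

lemma outer'_D0:
  assumes "\<theta> \<in> Der0" "\<And>a. a \<in> \<Lambda>U \<Longrightarrow> linear_form a dvd pair a \<theta>"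
  shows "outer' *s \<theta> \<in> D0"
proof -
  have "linear_form a dvd outer' * pair a \<theta>" if a: "a \<in> \<Lambda>" for a
  proof (cases "a \<in> \<Lambda>U")
    case False
    then have "linear_form a dvd outer'" unfolding outer'_def using a fin by (intro dvd_prodI) auto
    then show ?thesis by simp
  qed (use assms in simp)
  then show ?thesis using Der0_scale[OF outer'_fix assms(1)] by (simp add: D0_def)
qed

lemma L_D0_D0: "\<theta> \<in> L.D0 \<Longrightarrow> outer' *s \<theta> \<in> D0"
  by (rule outer'_D0) (auto simp: L.D0_def L.Der0_def Der0_def Der_P3_P)

text \<open>On the forms of \<open>\<Lambda>U\<close> a derivation of the hyperplane is determined
  by its values on \<open>x1\<close> and \<open>x2\<close>. The difference
  \<open>\<phi> - flat_part \<phi>\<close> kills these forms, so only the forms outside the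
  localization restrict it, and \<open>outer'\<close> clears them.\<close>

definition flat_part :: "('a, 'b) der \<Rightarrow> ('a, 'b) der" where
  "flat_part \<phi> = pair x1 \<phi> *s cvec e1 + pair x2 \<phi> *s cvec e2"

lemma flat_part_Der: "\<phi> \<in> Der Q \<Longrightarrow> flat_part \<phi> \<in> Der Q"
  unfolding flat_part_def by (intro Der_add Der_scale' Der_fix_ring Der_cvec e1 e2)

lemma flat_part_rest:
  assumes \<phi>: "\<phi> \<in> Der Q" and a: "a \<in> \<Lambda>U"
  shows "pair a \<phi> = pair a (flat_part \<phi>)"
proof -
  have "pair a \<phi> = pair (dot a e1 *s x1 + dot a e2 *s x2 + dot a w *s z) \<phi>"
    using \<Lambda>U_P3[OF a] by (metis vector_matrix_P3)
  moreover have "pair z \<phi> = 0" using Der_Q_Der0[OF \<phi>] by (simp add: Der0_def)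
  ultimately show ?thesis by (simp add: flat_part_def mult.commute)
qed

lemma outer_rest:
  assumes \<phi>: "\<phi> \<in> Der Q"
  shows "outer' *s (\<phi> - flat_part \<phi>) \<in> D0" "vsubst Q (outer' *s (\<phi> - flat_part \<phi>)) = outer *s (\<phi> - flat_part \<phi>)"
proof -
  have D: "\<phi> - flat_part \<phi> \<in> Der Q" using \<phi> flat_part_Der Der_diff by blast
  show "outer' *s (\<phi> - flat_part \<phi>) \<in> D0"
    by (rule outer'_D0) (use Der_Q_Der0[OF D] flat_part_rest[OF \<phi>] in auto)
  show "vsubst Q (outer' *s (\<phi> - flat_part \<phi>)) = outer *s (\<phi> - flat_part \<phi>)"
    by (simp only: vsubst_outer' vsubst_Q_id[OF D])
qed

lemma L_E: "L.E = linear_form x1 *s cvec e1 + linear_form x2 *s cvec e2"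
  by (rule der_eqI) (simp add: vector_matrix_LQ linear_form_add linear_form_scale mult.commute)

lemma flat_part_E: "flat_part E = L.E"
  by (simp add: flat_part_def L_E x1Q x2Q)

lemma i\<Lambda>U: "i \<in> NU"
proof -
  have "res i = 1 *s x1 + 0 *s x2" by (simp add: x1_def)
  then show ?thesis using i i\<Lambda> unfolding \<Lambda>U_def in_span2_def by blast
qed

abbreviation prodU :: "('a, 'b) mpoly" where "prodU \<equiv> (\<Prod>a\<in>NU - {i}. linear_form (res a))"

lemma prodU_fix: "prodU \<in> fix_ring Q" and prodU_nonzero: "prodU \<noteq> 0"
proof -
  show "prodU \<in> fix_ring Q"
    using N_sub by (intro fix_ring_prod fix_ring_linear_form res_Q \<Lambda>P) auto
  show "prodU \<noteq> 0"
    using fin N_sub res_nonzero by (intro mpoly_prod_nonzero) (auto intro: finite_subset)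
qed

lemma flat_part_generators:
  assumes \<phi>: "\<phi> \<in> Der Q" "\<And>a. a \<in> NU \<Longrightarrow> linear_form (res a) dvd pair (res a) \<phi>"
  shows "\<exists>g\<in>fix_ring Q. \<exists>k\<in>fix_ring Q. flat_part \<phi> = g *s L.E + k *s (prodU *s cvec e2)"
proof -
  have res_eq: "res a = dot a e1 *s x1 + dot a e2 *s x2" if "a \<in> NU" for a
    using L.vector_matrix_Q'[of a] \<Lambda>U_P3[of a] that by (simp add: vector_matrix_LQ)
  have "\<exists>g k. pair x1 \<phi> = linear_form (res i) * g \<and> pair x2 \<phi> = linear_form x2 * g + k * prodU"
  proof (rule rank2_divisibility[where c = "\<lambda>a. dot a e1" and d = "\<lambda>a. dot a e2"])
    show "finite NU" using fin by (simp add: \<Lambda>U_def)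
    show "i \<in> NU" by (rule i\<Lambda>U)
    show "linear_form (res i) dvd pair x1 \<phi>" using \<phi>(2)[OF i\<Lambda>U] by (simp add: x1_def)
    fix a assume a: "a \<in> NU"
    show "res a \<noteq> 0" using a res_nonzero by (simp add: \<Lambda>U_def)
    show "res a = dot a e1 *s res i + dot a e2 *s x2" using res_eq[OF a] by (simp add: x1_def)
    show "linear_form (res a) dvd mconst (dot a e1) * pair x1 \<phi> + mconst (dot a e2) * pair x2 \<phi>"
      using \<phi>(2)[OF a] res_eq[OF a] by simp
  qed (use N_distinct in blast)
  then obtain g k where gk: "pair x1 \<phi> = linear_form x1 * g" "pair x2 \<phi> = linear_form x2 * g + k * prodU"
    by (auto simp: x1_def)
  have x1R: "linear_form x1 \<in> fix_ring Q" "linear_form x2 \<in> fix_ring Q"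
    by (simp_all add: fix_ring_linear_form x1Q x2Q)
  have g: "g \<in> fix_ring Q"
    by (rule fix_ring_cancel[of "linear_form x1"])
      (use gk(1) Der_fix_ring[OF \<phi>(1), of x1] x1R res_nonzero[OF i\<Lambda>] in \<open>auto simp: x1_def\<close>)
  have "prodU * k = pair x2 \<phi> - linear_form x2 * g" using gk(2) by (simp add: mult.commute)
  then have "prodU * k \<in> fix_ring Q"
    using Der_fix_ring[OF \<phi>(1), of x2] x1R g by (simp add: fix_ring_diff fix_ring_mult)
  then have k: "k \<in> fix_ring Q" using fix_ring_cancel prodU_fix prodU_nonzero by blast
  have "flat_part \<phi> = g *s L.E + k *s (prodU *s cvec e2)"
    unfolding flat_part_def L_E gk by (rule der_eqI) (simp add: algebra_simps)
  then show ?thesis using g k by blast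
qed

text \<open>\<open>\<phi>\<close> is split into its flat part, a combination of the local Euler
  derivation and \<open>prodU *s cvec e2\<close>, and a rest. The local lifts treat the first, the
  factor \<open>outer\<close> the second. Local and global Euler derivations also differ only by a
  rest of this kind.\<close>

theorem local_lift:
  assumes "L.lifts i e2"
  shows "\<phi> \<in> DQ \<Longrightarrow> \<exists>f\<in>fix_ring Q. \<exists>\<theta>\<in>D0. vsubst Q \<theta> = outer *s \<phi> + f *s E"
    and "\<exists>\<theta>\<in>D0. vsubst Q \<theta> = outer *s (B *s E)"
proof -
  obtain \<theta>a where \<theta>a: "\<theta>a \<in> L.D0" "vsubst L.Q \<theta>a = L.B *s L.E" using assms by (auto simp: L.lifts_def)
  obtain \<theta>b fb where \<theta>b: "\<theta>b \<in> L.D0" "fb \<in> fix_ring L.Q" "vsubst L.Q \<theta>b = prodU *s cvec e2 + fb *s L.E"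
    using assms by (auto simp: L.lifts_def)
  have DerL: "\<theta>a \<in> Der P3" "\<theta>b \<in> Der P3" using \<theta>a \<theta>b by (auto simp: L.D0_def L.Der0_def)
  have fb: "fb \<in> fix_ring Q" using \<theta>b(2) by (rule fix_ring_LQ_Q)
  note rE = outer_rest[OF E_Der, unfolded flat_part_E]
  have va: "vsubst Q (outer' *s \<theta>a) = outer *s (L.B *s L.E)"
    using \<theta>a(2) vsubst_LQ[OF DerL(1)] by (simp only: vsubst_outer')
  have vb: "vsubst Q (outer' *s \<theta>b) = outer *s (prodU *s cvec e2 + fb *s L.E)"
    using \<theta>b(3) vsubst_LQ[OF DerL(2)] by (simp only: vsubst_outer')
  show "\<exists>f\<in>fix_ring Q. \<exists>\<theta>\<in>D0. vsubst Q \<theta> = outer *s \<phi> + f *s E" if \<phi>: "\<phi> \<in> DQ"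
  proof -
    have \<phi>D: "\<phi> \<in> Der Q" using \<phi> by (simp add: DQ_def)
    obtain g k where gk: "g \<in> fix_ring Q" "k \<in> fix_ring Q" "flat_part \<phi> = g *s L.E + k *s (prodU *s cvec e2)"
      using flat_part_generators[OF \<phi>D] \<phi> by (auto simp: DQ_def \<Lambda>U_def)
    note r\<phi> = outer_rest[OF \<phi>D]
    \<comment> \<open>Chosen so that the terms with the local Euler derivation \<open>L.E\<close>
      cancel: \<open>g\<close> comes from the flat part and \<open>k * fb\<close> from the lift of
      the second generator.\<close>
    define c where "c = g - k * fb"
    have c: "c \<in> fix_ring Q" unfolding c_def by (intro fix_ring_diff fix_ring_mult gk fb)
    define \<theta> where "\<theta> = outer' *s (\<phi> - flat_part \<phi>) + k *s (outer' *s \<theta>b) - c *s (outer' *s (E - L.E))"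
    have "\<theta> \<in> D0"
      unfolding \<theta>_def
      by (intro D0_diff[OF D0_add[OF r\<phi>(1)]] D0_scale[OF _ L_D0_D0[OF \<theta>b(1)]] D0_scale[OF _ rE(1)]
          fix_ring_Q_P gk(2) c)
    moreover have "vsubst Q \<theta> = outer *s (\<phi> - flat_part \<phi>) + k *s (outer *s (prodU *s cvec e2 + fb *s L.E)) - c *s (outer *s (E - L.E))"
      unfolding \<theta>_def vsubst_simps(1,2) r\<phi>(2) vsubst_scale_Q[OF gk(2)] vsubst_scale_Q[OF c] vb rE(2) ..
    moreover have "\<dots> = outer *s \<phi> + (- (outer * c)) *s E"
      unfolding gk(3) c_def by (rule der_eqI) (simp add: algebra_simps)
    moreover have "- (outer * c) \<in> fix_ring Q" by (intro fix_ring_uminus fix_ring_mult outer_fix c)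
    ultimately show ?thesis by metis
  qed
  define Br where "Br = (\<Prod>a\<in>(\<Lambda> - N) - \<Lambda>U. linear_form (res a))"
  have Br: "Br \<in> fix_ring Q" unfolding Br_def by (intro fix_ring_prod fix_ring_linear_form res_Q \<Lambda>P) auto
  have LB: "L.B \<in> fix_ring Q" using L.B_fix fix_ring_LQ_Q by blast
  have "B = L.B * Br"
  proof -
    have "\<Lambda> - N = (\<Lambda>U - NU) \<union> ((\<Lambda> - N) - \<Lambda>U)" by (auto simp: \<Lambda>U_def)
    then show ?thesis unfolding B_def L.B_def Br_def
      using fin by (subst prod.union_disjoint[symmetric]) (auto simp: \<Lambda>U_def)
  qed
  then have "outer *s (B *s E) = Br *s (outer *s (L.B *s L.E)) + (Br * L.B) *s (outer *s (E - L.E))"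
    by (intro der_eqI) (simp add: algebra_simps)
  also have "\<dots> = vsubst Q (Br *s (outer' *s \<theta>a) + (Br * L.B) *s (outer' *s (E - L.E)))"
    unfolding vsubst_simps(1) vsubst_scale_Q[OF Br] vsubst_scale_Q[OF fix_ring_mult[OF Br LB]] va rE(2) ..
  finally have "vsubst Q (Br *s (outer' *s \<theta>a) + (Br * L.B) *s (outer' *s (E - L.E))) = outer *s (B *s E)" ..
  moreover have "Br *s (outer' *s \<theta>a) + (Br * L.B) *s (outer' *s (E - L.E)) \<in> D0"
    by (intro D0_add D0_scale[OF _ L_D0_D0[OF \<theta>a(1)]] D0_scale[OF _ rE(1)] fix_ring_Q_P fix_ring_mult Br LB)
  ultimately show "\<exists>\<theta>\<in>D0. vsubst Q \<theta> = outer *s (B *s E)" by blast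
qed

end

lemma in_span2_left: "in_span2 u v u"
proof -
  have "u = 1 *s u + 0 *s v" by simp
  then show ?thesis unfolding in_span2_def by blast
qed

lemma in_span2_proportional:
  assumes "proportional u u'" "proportional v v'" "in_span2 u v y"
  shows "in_span2 u' v' y"
proof -
  obtain c d where "u = c *s u'" "v = d *s v'"
    using proportional_sym[OF assms(1)] proportional_sym[OF assms(2)] by (auto simp: proportional_def)
  moreover obtain s t where "y = s *s u + t *s v" using assms(3) by (auto simp: in_span2_def)
  ultimately have "y = (s * c) *s u' + (t * d) *s v'" by (simp add: vector_smult_assoc)
  then show ?thesis unfolding in_span2_def by blast
qed

lemma indep3I:
  assumes "indep2 u v" "\<not> in_span2 u v w"
  shows "indep3 u v w"
  unfolding indep3_def
proof (intro allI impI)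
  fix c d e assume eq: "c *s u + d *s v + e *s w = 0"
  have "e = 0"
  proof (rule ccontr)
    assume e: "e \<noteq> 0"
    have "w = (- c / e) *s u + (- d / e) *s v"
      unfolding vec_eq_iff
    proof
      fix i
      have "c * u $ i + d * v $ i + e * w $ i = 0" using eq by (simp add: vec_eq_iff)
      then have "e * w $ i = - (c * u $ i) - d * v $ i" by (simp add: algebra_simps eq_neg_iff_add_eq_0)
      then show "w $ i = ((- c / e) *s u + (- d / e) *s v) $ i" using e by (simp add: field_simps)
    qed
    then show False using assms(2) unfolding in_span2_def by blast
  qed
  then have "c *s u + d *s v = 0" using eq by simp
  then show "c = 0 \<and> d = 0 \<and> e = 0" using assms(1) \<open>e = 0\<close> unfolding indep2_def by blast
qed

context arr_flat
begin

definition flat_lifts :: bool where "flat_lifts \<longleftrightarrow> L.lifts i e2"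

end

section \<open>The ideal annihilating the obstructions\<close>

context arr_reps
begin

lemma exists_flat:
  assumes "i \<in> N" "x2 v* Q = x2" "indep2 (res i) x2"
  shows "\<exists>e1 e2. arr_flat P w z \<Lambda> N i x2 e1 e2"
proof -
  obtain e1 e2 where e: "dot (res i) e1 = 1" "dot (res i) e2 = 0" "dot x2 e1 = 0" "dot x2 e2 = 1"
    using exists_dual_pair[OF assms(3)] by blast
  have i: "res i v* Q = res i" using assms(1) N_sub by (intro res_Q \<Lambda>P) auto
  have "dot (res i) (Q *v e) = dot (res i) e" "dot x2 (Q *v e) = dot x2 e" for e
    using i assms(2) by (simp_all flip: dot_vector_matrix)
  then have "arr_flat P w z \<Lambda> N i x2 (Q *v e1) (Q *v e2)"
    using e assms by unfold_locales (simp_all add: matrix_vector_mul_assoc QQ)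
  then show ?thesis by blast
qed

text \<open>Membership of \<open>g\<close> in the annihilator of two obstructions: that of lifting
  members of \<open>DQ\<close> up to Euler multiples and that of lifting
  \<open>B *s E\<close>.\<close>

definition killing :: "('a, 'b) mpoly \<Rightarrow> bool" where
  "killing g \<longleftrightarrow> (\<forall>\<phi>\<in>DQ. \<exists>f\<in>fix_ring Q. \<exists>\<theta>\<in>D0. vsubst Q \<theta> = g *s \<phi> + f *s E) \<and>
     (\<exists>\<theta>\<in>D0. vsubst Q \<theta> = g *s (B *s E))"

lemma killing_mult:
  assumes g: "killing g" and h: "h \<in> fix_ring Q"
  shows "killing (h * g)"
  unfolding killing_def
proof (intro conjI ballI)
  fix \<phi> assume "\<phi> \<in> DQ"
  then obtain f \<theta> where *: "f \<in> fix_ring Q" "\<theta> \<in> D0" "vsubst Q \<theta> = g *s \<phi> + f *s E"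
    using g unfolding killing_def by blast
  have "vsubst Q (h *s \<theta>) = (h * g) *s \<phi> + (h * f) *s E"
    unfolding vsubst_scale_Q[OF h] *(3) by (rule der_eqI) (simp add: algebra_simps)
  moreover have "h *s \<theta> \<in> D0" using D0_scale fix_ring_Q_P h *(2) by blast
  ultimately show "\<exists>f\<in>fix_ring Q. \<exists>\<theta>\<in>D0. vsubst Q \<theta> = (h * g) *s \<phi> + f *s E"
    using fix_ring_mult[OF h *(1)] by blast
next
  obtain \<theta> where *: "\<theta> \<in> D0" "vsubst Q \<theta> = g *s (B *s E)" using g unfolding killing_def by blast
  have "vsubst Q (h *s \<theta>) = (h * g) *s (B *s E)"
    unfolding vsubst_scale_Q[OF h] *(2) by (rule der_eqI) (simp add: algebra_simps)
  moreover have "h *s \<theta> \<in> D0" using D0_scale fix_ring_Q_P h *(1) by blast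
  ultimately show "\<exists>\<theta>\<in>D0. vsubst Q \<theta> = (h * g) *s (B *s E)" by blast
qed

lemma killing_flat:
  assumes "arr_flat P w z \<Lambda> N i x2 e1 e2" "arr_flat.flat_lifts w z \<Lambda> N i x2 e1 e2"
  shows "killing (\<Prod>a\<in>{a \<in> \<Lambda>. \<not> in_span2 (res i) x2 (res a)}. linear_form (res a))"
proof -
  interpret F: arr_flat P w z \<Lambda> N i x2 e1 e2 by fact
  have eq: "{a \<in> \<Lambda>. \<not> in_span2 (res i) x2 (res a)} = \<Lambda> - F.\<Lambda>U"
    by (auto simp: F.\<Lambda>U_def F.x1_def)
  show ?thesis
    unfolding killing_def eq F.outer_def[symmetric]
    using F.local_lift assms(2) unfolding F.flat_lifts_def by blast
qed

text \<open>The products \<open>\<Prod>a. res a\<close> over the hyperplanes not containing a flat generate an ideal which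
  contains a product of ideals \<open>J c\<close>, one for each choice \<open>c\<close> of a factor for every flat, where
  \<open>J c\<close> is generated by the chosen factors. No flat of codimension two in \<open>H\<close> lies on all of them.\<close>

lemma exists_killing_deep:
  assumes N2: "i0 \<in> N" "j0 \<in> N" "i0 \<noteq> j0"
    and kill: "\<And>i j. i \<in> N \<Longrightarrow> j \<in> N \<Longrightarrow> i \<noteq> j \<Longrightarrow>
      killing (\<Prod>a\<in>{a \<in> \<Lambda>. \<not> in_span2 (res i) (res j) (res a)}. linear_form (res a))"
  shows "\<exists>I. deep Q I \<and> (\<forall>g\<in>I. killing g)"
proof -
  define U where "U = {(i, j). i \<in> N \<and> j \<in> N \<and> i \<noteq> j}"
  define F where "F p = {a \<in> \<Lambda>. \<not> in_span2 (res (fst p)) (res (snd p)) (res a)}" for p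
  define C where "C = Pi\<^sub>E U F"
  define J where "J c = {linear_form (res (c p)) | p. p \<in> U}" for c
  have finN: "finite N" using fin N_sub finite_subset by blast
  have finU: "finite U" by (rule finite_subset[of _ "N \<times> N"]) (use finN in \<open>auto simp: U_def\<close>)
  have finC: "finite C" unfolding C_def using finU fin by (intro finite_PiE) (auto simp: F_def)
  have resQ: "res a v* Q = res a" if "a \<in> \<Lambda>" for a using that res_Q \<Lambda>P by blast
  have deepJ: "deep Q (J c)" if c: "c \<in> C" for c
  proof -
    have cF: "c p \<in> F p" if "p \<in> U" for p using c that by (auto simp: C_def)
    have c\<Lambda>: "c p \<in> \<Lambda>" if "p \<in> U" for p using cF[OF that] by (simp add: F_def)
    \<comment> \<open>Three independent chosen factors are found in turn: \<open>b1\<close> for an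
      arbitrary pair, \<open>b2\<close> for a pair containing the class of \<open>b1\<close>,
      \<open>b3\<close> for the classes of \<open>b1\<close> and \<open>b2\<close>. A factor chosen
      for a pair always lies outside the span of the pair.\<close>
    define b1 where "b1 = c (i0, j0)"
    have p0: "(i0, j0) \<in> U" using N2 by (simp add: U_def)
    obtain i1 where i1: "i1 \<in> N" "proportional (res b1) (res i1)" using N_rep c\<Lambda>[OF p0] by (auto simp: b1_def)
    obtain j1 where j1: "j1 \<in> N" "j1 \<noteq> i1" using N2 by metis
    have p1: "(i1, j1) \<in> U" using i1 j1 by (simp add: U_def)
    define b2 where "b2 = c (i1, j1)"
    have b2: "\<not> in_span2 (res i1) (res j1) (res b2)" using cF[OF p1] by (simp add: F_def b2_def)
    obtain i2 where i2: "i2 \<in> N" "proportional (res b2) (res i2)" using N_rep c\<Lambda>[OF p1] by (auto simp: b2_def)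
    have "i1 \<noteq> i2"
    proof
      assume "i1 = i2"
      then obtain d where "res b2 = d *s res i1 + 0 *s res j1"
        using proportional_sym[OF i2(2)] by (auto simp: proportional_def)
      then show False using b2 unfolding in_span2_def by blast
    qed
    then have p2: "(i1, i2) \<in> U" using i1 i2 by (simp add: U_def)
    define b3 where "b3 = c (i1, i2)"
    have b3: "\<not> in_span2 (res i1) (res i2) (res b3)" using cF[OF p2] by (simp add: F_def b3_def)
    have b\<Lambda>: "b1 \<in> \<Lambda>" "b2 \<in> \<Lambda>" "b3 \<in> \<Lambda>" using c\<Lambda> p0 p1 p2 by (auto simp: b1_def b2_def b3_def)
    have "\<not> proportional (res b1) (res b2)"
      using \<open>i1 \<noteq> i2\<close> N_distinct[OF i1(1) i2(1)] i1(2) i2(2) proportional_sym proportional_trans by blast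
    then have "indep2 (res b1) (res b2)" using res_nonzero b\<Lambda> by (intro indep2I) auto
    moreover have "\<not> in_span2 (res b1) (res b2) (res b3)"
      using b3 in_span2_proportional[OF i1(2) i2(2)] by blast
    ultimately have "indep3 (res b1) (res b2) (res b3)" by (rule indep3I)
    then have "deep Q {linear_form (res b1), linear_form (res b2), linear_form (res b3)}"
      using resQ b\<Lambda> QQ by (intro deep_triple) auto
    moreover have "{linear_form (res b1), linear_form (res b2), linear_form (res b3)} \<subseteq> J c"
      unfolding J_def b1_def b2_def b3_def using p0 p1 p2 by blast
    moreover have "J c \<subseteq> fix_ring Q" unfolding J_def using c\<Lambda> resQ fix_ring_linear_form by blast
    ultimately show ?thesis by (rule deep_superset)
  qed
  define I where "I = {(\<Prod>c\<in>C. s c) | s. \<forall>c\<in>C. s c \<in> J c}"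
  have deepI: "deep Q I" unfolding I_def by (rule deep_prod[OF finC QQ deepJ])
  have "killing g" if g: "g \<in> I" for g
  proof -
    obtain s where s: "g = (\<Prod>c\<in>C. s c)" "\<forall>c\<in>C. s c \<in> J c" using g by (auto simp: I_def)
    have "\<forall>c. \<exists>p. c \<in> C \<longrightarrow> p \<in> U \<and> s c = linear_form (res (c p))" using s(2) unfolding J_def by blast
    then obtain pc where pc: "\<forall>c. c \<in> C \<longrightarrow> pc c \<in> U \<and> s c = linear_form (res (c (pc c)))"
      unfolding choice_iff by blast
    \<comment> \<open>If every \<open>p\<close> had a factor \<open>A p\<close> never taken from it,
      the choice function \<open>c = A\<close> would take exactly that factor at
      \<open>pc c\<close>. So some \<open>p\<close> has all its factors occurring in
      \<open>g\<close>, which makes its product a divisor of \<open>g\<close>.\<close>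
    have "\<exists>p\<in>U. \<forall>a\<in>F p. \<exists>c\<in>C. pc c = p \<and> c p = a"
    proof (rule ccontr)
      assume "\<not> ?thesis"
      then have "\<forall>p. \<exists>a. p \<in> U \<longrightarrow> a \<in> F p \<and> (\<forall>c\<in>C. \<not> (pc c = p \<and> c p = a))" by blast
      then obtain A where A: "\<forall>p. p \<in> U \<longrightarrow> A p \<in> F p \<and> (\<forall>c\<in>C. \<not> (pc c = p \<and> c p = A p))"
        unfolding choice_iff by blast
      define c where "c = restrict A U"
      have cC: "c \<in> C" unfolding c_def C_def using A by auto
      then have "pc c \<in> U" using pc by blast
      moreover from this have "c (pc c) = A (pc c)" by (simp add: c_def)
      ultimately show False using A cC by blast
    qed
    then obtain p where p: "p \<in> U" and pa: "\<forall>a\<in>F p. \<exists>c\<in>C. pc c = p \<and> c p = a" by (elim bexE)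
    have "\<forall>a. \<exists>c. a \<in> F p \<longrightarrow> c \<in> C \<and> pc c = p \<and> c p = a"
    proof
      fix a show "\<exists>c. a \<in> F p \<longrightarrow> c \<in> C \<and> pc c = p \<and> c p = a"
        using pa by (cases "a \<in> F p") (fastforce dest: bspec)+
    qed
    then obtain K where K: "\<forall>a. a \<in> F p \<longrightarrow> K a \<in> C \<and> pc (K a) = p \<and> K a p = a"
      unfolding choice_iff by blast
    let ?o = "\<Prod>a\<in>F p. linear_form (res a)"
    have inj: "inj_on K (F p)" by (rule inj_onI) (metis K)
    have "?o = (\<Prod>a\<in>F p. s (K a))"
    proof (rule prod.cong)
      fix a assume a: "a \<in> F p"
      then have "K a \<in> C" "pc (K a) = p" "K a p = a" using K by blast+
      then show "linear_form (res a) = s (K a)" using pc by metis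
    qed simp
    also have "\<dots> = (\<Prod>c\<in>K ` F p. s c)" by (simp add: prod.reindex[OF inj])
    also have "\<dots> dvd g" unfolding s(1) using K finC by (intro prod_dvd_prod_subset) auto
    finally obtain h where h: "g = ?o * h" by (elim dvdE)
    have o: "?o \<in> fix_ring Q" using resQ by (intro fix_ring_prod fix_ring_linear_form) (auto simp: F_def)
    have "?o \<noteq> 0" using fin res_nonzero by (intro mpoly_prod_nonzero) (auto simp: F_def)
    moreover have "g \<in> fix_ring Q" using deep_subset[OF deepI] g by blast
    ultimately have "h \<in> fix_ring Q" using fix_ring_cancel[of ?o h Q] o h by simp
    moreover have "killing ?o" using kill[of "fst p" "snd p"] p by (auto simp: U_def F_def)
    ultimately show ?thesis using killing_mult[of ?o h] h by (simp add: mult.commute)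
  qed
  then show ?thesis using deepI by blast
qed

text \<open>With at least two hyperplanes in the restriction, \<open>exists_killing_deep\<close>
  supplies the ideal. With a single one, any independent \<open>x2\<close> completes
  \<open>res i\<close>; all of \<open>\<Lambda>\<close> is then local, the product of outside forms
  is empty, and 1 kills the obstructions.\<close>

theorem basis_step:
  assumes ne: "\<Lambda> \<noteq> {}" and basis: "euler_basis Q DQ m b"
    and lifts: "\<And>i x2 e1 e2. arr_flat P w z \<Lambda> N i x2 e1 e2 \<Longrightarrow>
      (\<exists>j\<in>N. x2 = res j \<and> j \<noteq> i) \<or> N = {i} \<Longrightarrow> arr_flat.flat_lifts w z \<Lambda> N i x2 e1 e2"
    and ex: "\<And>i. N = {i} \<Longrightarrow> \<exists>x2. x2 v* Q = x2 \<and> indep2 (res i) x2"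
  shows "\<exists>b'. euler_basis P DP (Suc m) b'"
proof -
  have "\<exists>I. deep Q I \<and> (\<forall>g\<in>I. killing g)"
  proof (cases "\<exists>i\<in>N. \<exists>j\<in>N. i \<noteq> j")
    case True
    then obtain i0 j0 where ij: "i0 \<in> N" "j0 \<in> N" "i0 \<noteq> j0" by blast
    show ?thesis
    proof (rule exists_killing_deep[OF ij])
      fix i j assume *: "i \<in> N" "j \<in> N" "i \<noteq> j"
      have "indep2 (res i) (res j)"
        using * N_sub N_distinct res_nonzero by (intro indep2I) blast+
      moreover have "res j v* Q = res j" using * N_sub by (intro res_Q \<Lambda>P) auto
      ultimately obtain e1 e2 where "arr_flat P w z \<Lambda> N i (res j) e1 e2"
        using exists_flat * by blast
      then show "killing (\<Prod>a\<in>{a \<in> \<Lambda>. \<not> in_span2 (res i) (res j) (res a)}. linear_form (res a))"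
        using killing_flat lifts * by blast
    qed
  next
    case False
    obtain i where i: "i \<in> N" using ne N_rep by blast
    with False have Ni: "N = {i}" by blast
    obtain x2 where x2: "x2 v* Q = x2" "indep2 (res i) x2" using ex[OF Ni] by blast
    obtain e1 e2 where fl: "arr_flat P w z \<Lambda> N i x2 e1 e2" using exists_flat[OF i x2] by blast
    have "in_span2 (res i) x2 (res a)" if "a \<in> \<Lambda>" for a
      using N_rep[OF that] Ni in_span2_proportional[OF _ proportional_refl in_span2_left] by auto
    then have "{a \<in> \<Lambda>. \<not> in_span2 (res i) x2 (res a)} = {}" by blast
    note empty = this
    have "N = {i}" by (rule Ni)
    then have "killing (\<Prod>a\<in>{a \<in> \<Lambda>. \<not> in_span2 (res i) x2 (res a)}. linear_form (res a))"
      using killing_flat[OF fl lifts[OF fl]] by blast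
    then have "killing 1" unfolding empty by simp
    then show ?thesis using deep_one by blast
  qed
  then obtain I where "deep Q I" "\<forall>g\<in>I. killing g" by blast
  then show ?thesis using basis_lift[OF ne basis] unfolding killing_def by blast
qed

end

section \<open>Dimensions of homogeneous parts\<close>

interpretation pv: vector_space "\<lambda>c (f :: ('k::field, 'n::finite) mpoly). mconst c * f"
  by unfold_locales (simp_all add: algebra_simps mconst_add mconst_mult)

interpretation dv: vector_space "\<lambda>c (\<theta> :: ('k::field, 'n::finite) der). mconst c *s \<theta>"
  by unfold_locales (simp_all add: vec_eq_iff algebra_simps mconst_add mconst_mult)

interpretation pp: vector_space_pair "\<lambda>c (f :: ('k::field, 'n::finite) mpoly). mconst c * f"
  "\<lambda>c (f :: ('k, 'n) mpoly). mconst c * f" ..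

interpretation dp: vector_space_pair "\<lambda>c (\<theta> :: ('k::field, 'n::finite) der). mconst c *s \<theta>"
  "\<lambda>c (f :: ('k, 'n) mpoly). mconst c * f" ..

interpretation dd: vector_space_pair "\<lambda>c (\<theta> :: ('k::field, 'n::finite) der). mconst c *s \<theta>"
  "\<lambda>c (\<theta> :: ('k, 'n) der). mconst c *s \<theta>" ..

interpretation pd: vector_space_pair "\<lambda>c (f :: ('k::field, 'n::finite) mpoly). mconst c * f"
  "\<lambda>c (\<theta> :: ('k, 'n) der). mconst c *s \<theta>" ..

lemma finite_monomials: "finite {m :: 'n::finite \<Rightarrow>\<^sub>0 nat. mono_deg m = k}"
proof -
  have "Poly_Mapping.lookup ` {m :: 'n \<Rightarrow>\<^sub>0 nat. mono_deg m = k} \<subseteq> {f. range f \<subseteq> {..k}}"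
  proof (rule image_subsetI)
    fix m :: "'n \<Rightarrow>\<^sub>0 nat" assume "m \<in> {m. mono_deg m = k}"
    then have "Poly_Mapping.lookup m i \<le> k" for i
      unfolding mono_deg_def using member_le_sum[of i UNIV "Poly_Mapping.lookup m"] by simp
    then show "Poly_Mapping.lookup m \<in> {f. range f \<subseteq> {..k}}" by auto
  qed
  moreover have "finite {f :: 'n \<Rightarrow> nat. range f \<subseteq> {..k}}"
    using finite_set_of_finite_funs[of "UNIV :: 'n set" "{..k}" 0] by (simp add: image_subset_iff Pi_def)
  ultimately have "finite (Poly_Mapping.lookup ` {m :: 'n \<Rightarrow>\<^sub>0 nat. mono_deg m = k})"
    using finite_subset by blast
  then show ?thesis by (rule finite_imageD) (rule inj_onI, simp add: poly_mapping_eqI)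
qed

lemma mhomogeneous_finite_span:
  "\<exists>S. finite S \<and> {f :: ('k::field, 'n::finite) mpoly. mhomogeneous k f} \<subseteq> pv.span S"
proof (intro exI conjI subsetI)
  let ?S = "(\<lambda>m. Poly_Mapping.single m 1) ` {m :: 'n \<Rightarrow>\<^sub>0 nat. mono_deg m = k} :: ('k, 'n) mpoly set"
  show "finite ?S" using finite_monomials by blast
  fix f :: "('k, 'n) mpoly" assume "f \<in> {f. mhomogeneous k f}"
  then have keys: "mono_deg m = k" if "m \<in> Poly_Mapping.keys f" for m
    using that by (simp add: mhomogeneous_def mono_deg_def)
  have "(\<Sum>m\<in>Poly_Mapping.keys f. mconst (Poly_Mapping.lookup f m) * Poly_Mapping.single m 1) \<in> pv.span ?S"
    using keys by (intro pv.span_sum pv.span_scale pv.span_base) auto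
  moreover have "(\<Sum>m\<in>Poly_Mapping.keys f. mconst (Poly_Mapping.lookup f m) * Poly_Mapping.single m 1) = f"
    using mpoly_sum_monomials[of f] by (simp add: mconst_def mult_single)
  ultimately show "f \<in> pv.span ?S" by simp
qed

lemma vhom_finite_span:
  "\<exists>S. finite S \<and> {\<theta> :: ('k::field, 'n::finite) der. vhom k \<theta>} \<subseteq> dv.span S"
proof -
  obtain S where S: "finite S" "{f :: ('k, 'n) mpoly. mhomogeneous k f} \<subseteq> pv.span S"
    using mhomogeneous_finite_span by blast
  let ?S = "(\<lambda>(f, i). f *s axis i 1) ` (S \<times> UNIV) :: ('k, 'n) der set"
  have "\<theta> \<in> dv.span ?S" if \<theta>: "vhom k \<theta>" for \<theta> :: "('k, 'n) der"
  proof -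
    have "f *s axis i 1 \<in> dv.span ?S" if "f \<in> pv.span S" for f i
    proof -
      interpret F: Vector_Spaces.linear "\<lambda>c f. mconst c * f" "\<lambda>c \<theta>. mconst c *s \<theta>"
        "\<lambda>f :: ('k, 'n) mpoly. f *s (axis i 1 :: ('k, 'n) der)"
        by unfold_locales (simp_all add: vector_sadd_rdistrib vector_smult_assoc)
      have "f *s axis i 1 \<in> dv.span ((\<lambda>f. f *s axis i 1) ` S)"
        using that F.span_image[of S] by blast
      moreover have "(\<lambda>f. f *s axis i 1) ` S \<subseteq> ?S" by auto
      ultimately show ?thesis using dv.span_mono by blast
    qed
    moreover have "\<theta> $ i \<in> pv.span S" for i
      using vhom_pair[OF \<theta>, of "axis i 1"] S(2) by auto
    ultimately have "(\<Sum>i\<in>UNIV. (\<theta> $ i) *s axis i 1) \<in> dv.span ?S" by (intro dv.span_sum) blast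
    then show ?thesis by (simp add: basis_expansion)
  qed
  then show ?thesis using S(1) by (intro exI[of _ ?S]) auto
qed

definition hpolys :: "'k::field ^ 'n ^ 'n \<Rightarrow> nat \<Rightarrow> ('k, 'n::finite) mpoly set" where
  "hpolys P k = {f \<in> fix_ring P. mhomogeneous k f}"

lemma hpolys_subspace: "pv.subspace (hpolys P k)"
  unfolding pv.subspace_def hpolys_def
  by (auto intro: fix_ring_add fix_ring_mult mhomogeneous_add mhomogeneous_mconst_mult)

lemma pv_dim_mono:
  assumes "X \<subseteq> Y" "Y \<subseteq> {f :: ('k::field, 'n::finite) mpoly. mhomogeneous k f}"
  shows "pv.dim X \<le> pv.dim Y"
proof -
  obtain S where "finite S" "{f :: ('k, 'n) mpoly. mhomogeneous k f} \<subseteq> pv.span S"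
    using mhomogeneous_finite_span by blast
  then show ?thesis using pv.dim_mono_finite[OF assms(1)] assms(2) by blast
qed

lemma pv_subspace_eq:
  assumes "X \<subseteq> Y" "Y \<subseteq> {f :: ('k::field, 'n::finite) mpoly. mhomogeneous k f}" "pv.subspace X"
    "pv.dim Y \<le> pv.dim X"
  shows "X = Y"
proof -
  obtain S where "finite S" "{f :: ('k, 'n) mpoly. mhomogeneous k f} \<subseteq> pv.span S"
    using mhomogeneous_finite_span by blast
  then show ?thesis using pv.subspace_eq_finite[OF assms(1,3)] assms(2,4) by blast
qed

lemma dv_dim_mono:
  assumes "X \<subseteq> Y" "Y \<subseteq> {\<theta> :: ('k::field, 'n::finite) der. vhom k \<theta>}"
  shows "dv.dim X \<le> dv.dim Y"
proof -
  obtain S where "finite S" "{\<theta> :: ('k, 'n) der. vhom k \<theta>} \<subseteq> dv.span S"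
    using vhom_finite_span by blast
  then show ?thesis using dv.dim_mono_finite[OF assms(1)] assms(2) by blast
qed

lemma dv_subspace_eq:
  assumes "X \<subseteq> Y" "Y \<subseteq> {\<theta> :: ('k::field, 'n::finite) der. vhom k \<theta>}" "dv.subspace X"
    "dv.dim Y \<le> dv.dim X"
  shows "X = Y"
proof -
  obtain S where "finite S" "{\<theta> :: ('k, 'n) der. vhom k \<theta>} \<subseteq> dv.span S"
    using vhom_finite_span by blast
  then show ?thesis using dv.subspace_eq_finite[OF assms(1,3)] assms(2,4) by blast
qed

lemma pp_rank_nullity:
  assumes "\<And>x y. F (x + y) = F x + F y" "\<And>c x. F (mconst c * x) = mconst c * F x"
    "pv.subspace X" "X \<subseteq> {f :: ('k::field, 'n::finite) mpoly. mhomogeneous k f}"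
  shows "pv.dim X = pv.dim {x \<in> X. F x = 0} + pv.dim (F ` X :: ('k, 'n) mpoly set)"
proof -
  obtain S where "finite S" "{f :: ('k, 'n) mpoly. mhomogeneous k f} \<subseteq> pv.span S"
    using mhomogeneous_finite_span by blast
  moreover have "Vector_Spaces.linear (\<lambda>c f. mconst c * f) (\<lambda>c f. mconst c * f) F"
    by unfold_locales (use assms in auto)
  ultimately show ?thesis using pp.rank_nullity_finite assms by blast
qed

lemma dp_rank_nullity:
  assumes "\<And>x y. F (x + y) = F x + F y" "\<And>c x. F (mconst c *s x) = mconst c * F x"
    "dv.subspace X" "X \<subseteq> {\<theta> :: ('k::field, 'n::finite) der. vhom k \<theta>}"
  shows "dv.dim X = dv.dim {x \<in> X. F x = 0} + pv.dim (F ` X :: ('k, 'n) mpoly set)"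
proof -
  obtain S where "finite S" "{\<theta> :: ('k, 'n) der. vhom k \<theta>} \<subseteq> dv.span S"
    using vhom_finite_span by blast
  moreover have "Vector_Spaces.linear (\<lambda>c \<theta>. mconst c *s \<theta>) (\<lambda>c f. mconst c * f) F"
    by unfold_locales (use assms in auto)
  ultimately show ?thesis using dp.rank_nullity_finite assms by blast
qed

lemma dd_rank_nullity:
  assumes "\<And>x y. F (x + y) = F x + F y" "\<And>c x. F (mconst c *s x) = mconst c *s F x"
    "dv.subspace X" "X \<subseteq> {\<theta> :: ('k::field, 'n::finite) der. vhom k \<theta>}"
  shows "dv.dim X = dv.dim {x \<in> X. F x = 0} + dv.dim (F ` X :: ('k, 'n) der set)"
proof -
  obtain S where "finite S" "{\<theta> :: ('k, 'n) der. vhom k \<theta>} \<subseteq> dv.span S"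
    using vhom_finite_span by blast
  moreover have "Vector_Spaces.linear (\<lambda>c \<theta>. mconst c *s \<theta>) (\<lambda>c \<theta>. mconst c *s \<theta>) F"
    by unfold_locales (use assms in auto)
  ultimately show ?thesis using dd.rank_nullity_finite assms by blast
qed

lemma pd_dim_image_le:
  assumes "\<And>x y. F (x + y) = F x + F y" "\<And>c x. F (mconst c * x) = mconst c *s F x"
    "pv.subspace X" "X \<subseteq> {f :: ('k::field, 'n::finite) mpoly. mhomogeneous k f}"
  shows "dv.dim (F ` X :: ('k, 'n) der set) \<le> pv.dim X"
proof -
  obtain S where "finite S" "{f :: ('k, 'n) mpoly. mhomogeneous k f} \<subseteq> pv.span S"
    using mhomogeneous_finite_span by blast
  moreover have "Vector_Spaces.linear (\<lambda>c f. mconst c * f) (\<lambda>c \<theta>. mconst c *s \<theta>) F"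
    by unfold_locales (use assms in auto)
  ultimately have "pv.dim X = pv.dim {x \<in> X. F x = 0} + dv.dim (F ` X)"
    using pd.rank_nullity_finite assms by blast
  then show ?thesis by simp
qed

lemma pv_dim_zero: "pv.dim {0 :: ('k::field, 'n::finite) mpoly} = 0"
  using pv.dim_le_card[of "{0}" "{}"] by simp

lemma dv_dim_zero: "dv.dim {0 :: ('k::field, 'n::finite) der} = 0"
  using dv.dim_le_card[of "{0}" "{}"] by simp

lemma pv_dim_mult_image:
  assumes "d \<noteq> 0" "pv.subspace X" "X \<subseteq> {f :: ('k::field, 'n::finite) mpoly. mhomogeneous k f}"
  shows "pv.dim ((\<lambda>f. d * f) ` X) = pv.dim X"
proof -
  have "{x \<in> X. d * x = 0} = {0}" using assms(1,2) mpoly_mult_eq_0 pv.subspace_0 by auto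
  then show ?thesis
    using pp_rank_nullity[of "\<lambda>f. d * f" X k] assms pv_dim_zero by (simp add: algebra_simps)
qed

lemma dv_dim_scale_image:
  assumes "d \<noteq> 0" "dv.subspace X" "X \<subseteq> {\<theta> :: ('k::field, 'n::finite) der. vhom k \<theta>}"
  shows "dv.dim ((\<lambda>\<theta>. d *s \<theta>) ` X) = dv.dim X"
proof -
  have "x = 0" if "d *s x = 0" for x :: "('k, 'n) der"
    using der_scale_left_cancel[of d x 0] that assms(1) by simp
  then have "{x \<in> X. d *s x = 0} = {0}" using assms(2) dv.subspace_0 by auto
  then show ?thesis
    using dd_rank_nullity[of "\<lambda>\<theta>. d *s \<theta>" X k] assms dv_dim_zero
    by (simp add: algebra_simps vector_add_ldistrib vector_smult_assoc)
qed

text \<open>Rank and nullity of the restriction to the kernel of \<open>z\<close>, whose own kernel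
  consists of the multiples of \<open>z\<close>; in degree 0 there are none but 0.\<close>

lemma dim_hpolys_step:
  assumes "P ** P = P" "P *v w = w" "z v* P = z" "dot z w = 1"
  shows "pv.dim (hpolys P k) = (if k = 0 then 0 else pv.dim (hpolys P (k - 1))) + pv.dim (hpolys (P - tens w z) k)"
proof -
  \<comment> \<open>Without further hyperplanes the locale still provides the restriction map and
    its kernel.\<close>
  interpret arr_setup P w z "{}" using assms by unfold_locales auto
  have "pv.dim (hpolys P k) = pv.dim {f \<in> hpolys P k. subst Q f = 0} + pv.dim (subst Q ` hpolys P k)"
    by (rule pp_rank_nullity[of _ _ k]) (auto simp: hpolys_def intro: hpolys_subspace[unfolded hpolys_def])
  moreover have "subst Q ` hpolys P k = hpolys Q k"
  proof (intro equalityI image_subsetI subsetI)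
    fix f assume "f \<in> hpolys P k"
    then show "subst Q f \<in> hpolys Q k" by (simp add: hpolys_def subst_Q_fix mhomogeneous_subst)
  next
    fix f assume f: "f \<in> hpolys Q k"
    then have "f \<in> hpolys P k" "f = subst Q f" using fix_ring_Q_P by (auto simp: hpolys_def fix_ring_def)
    then show "f \<in> subst Q ` hpolys P k" by blast
  qed
  moreover have "{f \<in> hpolys P k. subst Q f = 0}
      = (if k = 0 then {0} else (\<lambda>f. linear_form z * f) ` hpolys P (k - 1))" (is "?L = ?R")
  proof (intro equalityI subsetI)
    fix f assume f: "f \<in> ?L"
    then obtain g where g: "f = linear_form z * g" using z_dvd_iff by (auto simp: hpolys_def elim: dvdE)
    have zz: "linear_form z \<noteq> 0" using z_nonzero by simp
    have gP: "g \<in> fix_ring P"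
      using fix_ring_cancel[of "linear_form z" g P] f g fix_ring_lf_z zz by (simp add: hpolys_def)
    have "mhomogeneous k (linear_form z * g)" using f g by (simp add: hpolys_def)
    from mhomogeneous_cancel[OF mhomogeneous_linear_form zz this]
    show "f \<in> ?R" using g gP by (auto simp: hpolys_def)
  next
    fix f assume f: "f \<in> ?R"
    show "f \<in> ?L"
    proof (cases k)
      case 0
      then show ?thesis using f by (simp add: hpolys_def)
    next
      case (Suc j)
      then obtain g where g: "f = linear_form z * g" "g \<in> hpolys P j" using f by auto
      then show ?thesis
        using Suc fix_ring_mult[OF fix_ring_lf_z] mhomogeneous_mult[OF mhomogeneous_linear_form, of j g z]
        by (simp add: hpolys_def)
    qed
  qed
  moreover have "pv.dim ((\<lambda>f. linear_form z * f) ` hpolys P (k - 1)) = pv.dim (hpolys P (k - 1))"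
    by (rule pv_dim_mult_image[of _ _ "k - 1"]) (use z_nonzero hpolys_subspace in \<open>auto simp: hpolys_def\<close>)
  ultimately show ?thesis by (simp add: Q_def pv_dim_zero)
qed

text \<open>The zero matrix stands for the zero space, whose coordinate ring is the field. This
  starts the dimension recursion.\<close>

lemma dim_hpolys_0: "pv.dim (hpolys (0 :: 'k::field ^ 'n ^ 'n::finite) k) = (if k = 0 then 1 else 0)"
proof -
  have "a v* (0 :: 'k ^ 'n ^ 'n) = 0" for a by (simp add: vec_eq_iff vector_matrix_mult_def)
  then have s0: "subst (0 :: 'k ^ 'n ^ 'n) (linear_form a) = 0" for a by simp
  have "linear_form ((0 :: 'k ^ 'n ^ 'n) $ i) = 0" for i by simp
  then have pos: "subst (0 :: 'k ^ 'n ^ 'n) (Poly_Mapping.single m c) = (if m = 0 then mconst c else 0)" for m c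
  proof (cases "m = 0")
    case False
    then obtain i where "Poly_Mapping.lookup m i \<noteq> 0" by (metis lookup_zero poly_mapping_eqI)
    then have "(\<Prod>i\<in>UNIV. linear_form ((0 :: 'k ^ 'n ^ 'n) $ i) ^ Poly_Mapping.lookup m i) = 0"
      by (intro prod_zero bexI[of _ i]) (simp_all add: zero_power)
    then show ?thesis using False by (simp add: subst_def msubst_single)
  qed (simp add: subst_def msubst_single)
  have sub: "subst (0 :: 'k ^ 'n ^ 'n) f = mconst (Poly_Mapping.lookup f 0)" for f
    by (induction f rule: mpoly_induct) (auto simp: pos lookup_single when_def lookup_add mconst_add)
  show ?thesis
  proof (cases "k = 0")
    case True
    have "hpolys (0 :: 'k ^ 'n ^ 'n) 0 = pv.span {1}"
    proof (intro equalityI subsetI)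
      fix f :: "('k, 'n) mpoly" assume "f \<in> hpolys (0 :: 'k ^ 'n ^ 'n) 0"
      then have "f = mconst (Poly_Mapping.lookup f 0) * 1" using sub by (simp add: hpolys_def fix_ring_def)
      then show "f \<in> pv.span {1}" unfolding pv.span_singleton by blast
    next
      fix f :: "('k, 'n) mpoly" assume "f \<in> pv.span {1}"
      then show "f \<in> hpolys (0 :: 'k ^ 'n ^ 'n) 0" by (auto simp: pv.span_singleton hpolys_def)
    qed
    moreover have "pv.independent {1 :: ('k, 'n) mpoly}" by simp
    ultimately show ?thesis using True pv.dim_span_eq_card_independent[of "{1}"] by simp
  next
    case False
    have "hpolys (0 :: 'k ^ 'n ^ 'n) k = {0}"
    proof -
      have "f = 0" if "f \<in> hpolys (0 :: 'k ^ 'n ^ 'n) k" for f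
      proof -
        have "mconst (Poly_Mapping.lookup f 0) = f" using that sub by (simp add: hpolys_def fix_ring_def)
        then have "mhomogeneous 0 f" by (metis mhomogeneous_mconst)
        then show ?thesis using that False mhomogeneous_unique unfolding hpolys_def by blast
      qed
      then show ?thesis using pv.subspace_0[OF hpolys_subspace] by blast
    qed
    then show ?thesis using False by (simp add: pv_dim_zero)
  qed
qed

section \<open>Arrangements of rank three\<close>

lemma sum_truncated_diff: "2 * (\<Sum>j\<le>k. j - m) = (k - m) * (k - m + 1)" for k m :: nat
proof (induction k)
  case (Suc k)
  show ?case
  proof (cases "m \<le> k")
    case True
    then obtain d where "k = m + d" by (metis le_Suc_ex)
    then show ?thesis using Suc by (simp add: algebra_simps)
  next
    case False
    then have "k - m = 0" "Suc k - m = 0" by auto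
    then show ?thesis using Suc by simp
  qed
qed simp

text \<open>The nonzero terms start at \<open>j = h - 1\<close>, which is an index of the sum
  because \<open>h \<ge> 1\<close>; for \<open>h = 0\<close> a term at -1 would be missing from the
  triangular number.\<close>

lemma sum_truncated_diff': "h \<ge> 1 \<Longrightarrow> 2 * (\<Sum>j\<le>k. j + 2 - h) = (k + 2 - h) * (k + 3 - h)" for k h :: nat
proof (induction k)
  case 0
  then show ?case by (cases "h = 1") auto
next
  case (Suc k)
  show ?case
  proof (cases "h \<le> k + 2")
    case True
    then obtain d where "k + 2 = h + d" by (metis le_Suc_ex)
    then have *: "k + 2 - h = d" "k + 3 - h = d + 1" "Suc k + 2 - h = d + 1" "Suc k + 3 - h = d + 2" by auto
    show ?thesis using Suc unfolding sum.atMost_Suc * by (simp add: algebra_simps)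
  next
    case False
    then have "k + 2 - h = 0" "Suc k + 2 - h = 0" by auto
    then show ?thesis using Suc by simp
  qed
qed

lemma vhom_scale_cancel:
  assumes "mhomogeneous e g" "g \<noteq> 0" "vhom d (g *s \<theta>)"
  shows "(e \<le> d \<longrightarrow> vhom (d - e) \<theta>) \<and> (d < e \<longrightarrow> \<theta> = 0)"
  using mhomogeneous_cancel[OF assms(1,2)] vhom_pair[OF assms(3)]
  by (auto intro!: vhomI der_eq_0I)

text \<open>The ambient space is spanned by \<open>e1\<close>, \<open>e2\<close> and
  \<open>w\<close>, so the flat has become the zero space and every form is local.\<close>

locale arr_rank3 = arr_flat +
  assumes PP3: "P = P3"

lemma (in arr_flat) arr_rank3: "arr_rank3 P3 w z \<Lambda>U NU i x2 e1 e2"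
proof -
  have LQ: "L.Q *v v = dot x1 v *s e1 + dot x2 v *s e2" for v
    by (rule vector_eqI) (simp add: vector_matrix_LQ flip: dot_vector_matrix)
  have fl: "arr_flat P3 w z \<Lambda>U NU i x2 e1 e2"
    using i\<Lambda>U by unfold_locales (auto simp: vector_matrix_LQ dual' LQ dual)
  interpret F: arr_flat P3 w z \<Lambda>U NU i x2 e1 e2 by (rule fl)
  show ?thesis by unfold_locales (simp add: F.P3_def F.x1_def P3_def x1_def)
qed

section \<open>Rank three: upper bounds through the restriction\<close>

context arr_rank3
begin

lemma vector_matrix_P: "a v* P = dot a e1 *s x1 + dot a e2 *s x2 + dot a w *s z"
  using vector_matrix_P3 by (simp add: PP3)

lemma Q_expand: "a v* Q = dot a e1 *s x1 + dot a e2 *s x2"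
  by (simp add: vector_matrix_Q vector_matrix_P)

lemma res_expand: "a \<in> \<Lambda> \<Longrightarrow> res a = dot a e1 *s x1 + dot a e2 *s x2"
  using vector_matrix_Q'[OF \<Lambda>P] Q_expand by metis

lemma Pe: "P *v e1 = e1" "P *v e2 = e2"
  using PQ e1 e2 by (metis matrix_vector_mul_assoc)+

lemma Der0_expand: "\<theta> \<in> Der0 \<Longrightarrow> \<theta> = pair x1 \<theta> *s cvec e1 + pair x2 \<theta> *s cvec e2"
proof (rule der_eqI)
  fix a assume \<theta>: "\<theta> \<in> Der0"
  have "pair a \<theta> = pair (dot a e1 *s x1 + dot a e2 *s x2 + dot a w *s z) \<theta>"
    using \<theta> Der_pair[of \<theta> P a] by (simp only: vector_matrix_P) (simp add: Der0_def)
  then show "pair a \<theta> = pair a (pair x1 \<theta> *s cvec e1 + pair x2 \<theta> *s cvec e2)"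
    using \<theta> by (simp add: Der0_def mult.commute)
qed

lemma Der0_combine: "p \<in> fix_ring P \<Longrightarrow> q \<in> fix_ring P \<Longrightarrow> p *s cvec e1 + q *s cvec e2 \<in> Der0"
  by (auto simp: Der0_def dual_w intro!: Der_add Der_scale' Der_cvec Pe)

lemma pair_combine: "pair x1 (p *s cvec e1 + q *s cvec e2) = p" "pair x2 (p *s cvec e1 + q *s cvec e2) = q"
  by (simp_all add: dual')

text \<open>The set of forms is a parameter because the lower bound \<open>dim_HD_lower\<close> adds
  hyperplanes one by one.\<close>

definition D0of :: "('a ^ 'b) set \<Rightarrow> ('a, 'b) der set" where
  "D0of A = {\<theta> \<in> Der0. \<forall>a\<in>A. linear_form a dvd pair a \<theta>}"

definition HD :: "('a ^ 'b) set \<Rightarrow> nat \<Rightarrow> ('a, 'b) der set" where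
  "HD A k = {\<theta> \<in> D0of A. vhom k \<theta>}"

lemma D0of_\<Lambda>: "D0of \<Lambda> = D0"
  by (simp add: D0of_def D0_def)

lemma HD_subspace: "dv.subspace (HD A k)"
  unfolding dv.subspace_def HD_def D0of_def Der0_def
  using vhom_scale[OF mhomogeneous_mconst, of k]
  by (auto intro!: Der_add Der_scale' vhom_add)

lemma HD_vhom: "HD A k \<subseteq> {\<theta>. vhom k \<theta>}"
  by (auto simp: HD_def)

lemma dim_polys_Q: "pv.dim (hpolys Q k) = k + 1"
proof -
  have Qt: "Q = tens e1 x1 + tens e2 x2"
    by (rule matrix_eqI_covector) (simp add: Q_expand vector_matrix_plus vector_matrix_tens)
  have Q1: "Q - tens e2 x2 = tens e1 x1" by (simp add: Qt)
  have Q11: "tens e1 x1 ** tens e1 x1 = tens e1 x1"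
    by (rule matrix_eqI_covector) (simp add: vector_matrix_tens scale_vector_matrix dual' flip: vector_matrix_assoc)
  have d1: "pv.dim (hpolys (tens e1 x1) k) = 1" for k
  proof (induction k)
    case 0
    show ?case
      using dim_hpolys_step[OF Q11, of e1 x1 0]
      by (simp add: dim_hpolys_0 tens_mult_vector vector_matrix_tens dual')
  next
    case (Suc k)
    then show ?case
      using dim_hpolys_step[OF Q11, of e1 x1 "Suc k"]
      by (simp add: dim_hpolys_0 tens_mult_vector vector_matrix_tens dual')
  qed
  have step: "pv.dim (hpolys Q k) = (if k = 0 then 0 else pv.dim (hpolys Q (k - 1))) + 1" for k
    using dim_hpolys_step[OF QQ e2 x2Q dual'(4), of k] by (simp add: Q1 d1)
  show ?thesis by (induction k) (simp_all add: step)
qed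

lemma dim_polys_P: "2 * pv.dim (hpolys P k) = (k + 1) * (k + 2)"
proof -
  have "pv.dim (hpolys P k) = (if k = 0 then 0 else pv.dim (hpolys P (k - 1))) + (k + 1)" for k
    using dim_hpolys_step[OF P Pw zP zw, of k] dim_polys_Q by (simp add: Q_def)
  then show ?thesis by (induction k) simp_all
qed

text \<open>The recursion \<open>dim_hpolys_step\<close> holds for any invariant form; comparison
  with the one for \<open>z\<close> gives the dimension on the kernel of \<open>K\<close>.\<close>

lemma dim_polys_quotient:
  assumes "P *v u = u" "K v* P = K" "dot K u = 1"
  shows "pv.dim (hpolys (P - tens u K) k) = k + 1"
proof -
  have 1: "pv.dim (hpolys P k) = (if k = 0 then 0 else pv.dim (hpolys P (k - 1))) + pv.dim (hpolys (P - tens u K) k)"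
    by (rule dim_hpolys_step[OF P assms])
  have 2: "pv.dim (hpolys P k) = (if k = 0 then 0 else pv.dim (hpolys P (k - 1))) + (k + 1)"
    using dim_hpolys_step[OF P Pw zP zw, of k] dim_polys_Q by (simp add: Q_def)
  show ?thesis using 1 2 by simp
qed

lemma dim_HD_empty: "dv.dim (HD {} k) = 2 * pv.dim (hpolys P k)"
proof -
  have pairP: "pair a \<theta> \<in> hpolys P k" if "\<theta> \<in> HD {} k" for a \<theta>
    using that by (auto simp: HD_def D0of_def Der0_def hpolys_def Der_fix_ring vhom_pair)
  have comb: "p *s cvec e1 + q *s cvec e2 \<in> HD {} k" if "p \<in> hpolys P k" "q \<in> hpolys P k" for p q
    using that Der0_combine vhom_scale[OF _ vhom_cvec, of k]
    by (auto simp: HD_def D0of_def hpolys_def intro!: vhom_add)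
  have "dv.dim (HD {} k) = dv.dim {\<theta> \<in> HD {} k. pair x1 \<theta> = 0} + pv.dim (pair x1 ` HD {} k)"
    by (rule dp_rank_nullity[OF _ _ HD_subspace HD_vhom]) simp_all
  also have "pair x1 ` HD {} k = hpolys P k"
  proof (intro equalityI image_subsetI subsetI)
    fix p assume "p \<in> hpolys P k"
    then have "p *s cvec e1 + 0 *s cvec e2 \<in> HD {} k" by (intro comb) (auto simp: hpolys_def)
    then show "p \<in> pair x1 ` HD {} k" using pair_combine(1)[of p 0] by (metis imageI)
  qed (rule pairP)
  also have "dv.dim {\<theta> \<in> HD {} k. pair x1 \<theta> = 0} = dv.dim {\<theta> \<in> {\<theta> \<in> HD {} k. pair x1 \<theta> = 0}. pair x2 \<theta> = 0}
      + pv.dim (pair x2 ` {\<theta> \<in> HD {} k. pair x1 \<theta> = 0})"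
  proof (rule dp_rank_nullity)
    show "dv.subspace {\<theta> \<in> HD {} k. pair x1 \<theta> = 0}"
      using HD_subspace[of "{}" k] by (auto simp: dv.subspace_def)
    show "{\<theta> \<in> HD {} k. pair x1 \<theta> = 0} \<subseteq> {\<theta>. vhom k \<theta>}" using HD_vhom by blast
  qed simp_all
  also have "{\<theta> \<in> {\<theta> \<in> HD {} k. pair x1 \<theta> = 0}. pair x2 \<theta> = 0} = {0}"
  proof -
    have "\<theta> = 0" if "\<theta> \<in> HD {} k" "pair x1 \<theta> = 0" "pair x2 \<theta> = 0" for \<theta>
      using Der0_expand[of \<theta>] that by (simp add: HD_def D0of_def)
    then show ?thesis using dv.subspace_0[OF HD_subspace] by auto
  qed
  also have "pair x2 ` {\<theta> \<in> HD {} k. pair x1 \<theta> = 0} = hpolys P k"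
  proof (intro equalityI image_subsetI subsetI)
    fix q assume "q \<in> hpolys P k"
    then have "0 *s cvec e1 + q *s cvec e2 \<in> HD {} k" by (intro comb) (auto simp: hpolys_def)
    then show "q \<in> pair x2 ` {\<theta> \<in> HD {} k. pair x1 \<theta> = 0}"
      using pair_combine[of 0 q] by (intro image_eqI[of _ _ "0 *s cvec e1 + q *s cvec e2"]) auto
  qed (use pairP in auto)
  finally show ?thesis using dv_dim_zero by simp
qed

abbreviation prodN :: "('a, 'b) mpoly" where "prodN \<equiv> (\<Prod>a\<in>N - {i}. linear_form (res a))"

lemma \<Lambda>U_all: "\<Lambda>U = \<Lambda>"
  using res_expand unfolding \<Lambda>U_def in_span2_def by blast

lemma prodN: "prodN \<in> fix_ring Q" "prodN \<noteq> 0" "mhomogeneous (card N - 1) prodN"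
proof -
  have NN: "NU = N" using \<Lambda>U_all N_sub by blast
  show "prodN \<in> fix_ring Q" "prodN \<noteq> 0"
    using prodU_fix prodU_nonzero unfolding NN by auto
  have "finite N" using N_sub fin finite_subset by blast
  then have "mhomogeneous (\<Sum>a\<in>N - {i}. 1) prodN" by (intro mhomogeneous_prod) auto
  then show "mhomogeneous (card N - 1) prodN" using i by simp
qed

lemma DQ_generators:
  assumes "\<eta> \<in> DQ"
  shows "\<exists>g\<in>fix_ring Q. \<exists>k\<in>fix_ring Q. \<eta> = g *s E + k *s (prodN *s cvec e2)"
proof -
  have NN: "NU = N" using \<Lambda>U_all N_sub by blast
  have \<eta>: "\<eta> \<in> Der Q" "\<And>a. a \<in> NU \<Longrightarrow> linear_form (res a) dvd pair (res a) \<eta>"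
    using assms N_sub by (auto simp: DQ_def NN)
  have "flat_part \<eta> = \<eta>"
    using Der0_expand[OF Der_Q_Der0[OF \<eta>(1)]] by (simp add: flat_part_def)
  moreover have "L.E = E" by (simp add: L_E) (rule der_eqI, simp add: Q_expand linear_form_add linear_form_scale mult.commute)
  ultimately show ?thesis using flat_part_generators[OF \<eta>] unfolding NN by metis
qed

text \<open>The determinant of \<open>E\<close> and \<open>\<eta>\<close> in the coordinates
  \<open>x1\<close>, \<open>x2\<close>. It vanishes on Euler multiples and detects the coefficient
  of the second generator.\<close>

definition \<tau> :: "('a, 'b) der \<Rightarrow> ('a, 'b) mpoly" where
  "\<tau> \<eta> = linear_form x1 * pair x2 \<eta> - linear_form x2 * pair x1 \<eta>"

lemma \<tau>_generators: "\<tau> (g *s E + k *s (prodN *s cvec e2)) = linear_form x1 * prodN * k"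
  by (simp add: \<tau>_def x1Q x2Q dual' algebra_simps)

definition Y :: "nat \<Rightarrow> ('a, 'b) der set" where "Y j = vsubst Q ` HD \<Lambda> j"

text \<open>The largest kernel that \<open>\<tau>\<close> can have on \<open>Y j\<close>, by
  \<open>Euler_multiple\<close>. The threshold is the degree of \<open>B *s E\<close>.\<close>

definition A1 :: "nat \<Rightarrow> ('a, 'b) der set" where
  "A1 j = (if card \<Lambda> - card N + 1 \<le> j then (\<lambda>q. q *s (B *s E)) ` hpolys Q (j - (card \<Lambda> - card N + 1)) else {0})"

text \<open>The largest image that \<open>\<tau>\<close> can have on \<open>Y j\<close>. Its
  generator \<open>linear_form x1 * prodN\<close> has degree \<open>card N\<close>, while
  \<open>\<tau>\<close> raises degrees by one.\<close>

definition A2 :: "nat \<Rightarrow> ('a, 'b) mpoly set" where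
  "A2 j = (if card N \<le> j + 1 then (\<lambda>k. linear_form x1 * prodN * k) ` hpolys Q (j + 1 - card N) else {0})"

lemma N_pos: "card N \<ge> 1"
  using i N_sub fin by (metis Suc_leI card_gt_0_iff empty_iff finite_subset One_nat_def)

lemma Y_DQ: "\<eta> \<in> Y j \<Longrightarrow> \<eta> \<in> DQ" and Y_vhom: "\<eta> \<in> Y j \<Longrightarrow> vhom j \<eta>"
  using D0_restrict by (auto simp: Y_def HD_def D0of_\<Lambda> vhom_def)

lemma Y_subspace: "dv.subspace (Y j)"
  unfolding dv.subspace_def
proof (intro conjI ballI allI)
  note S = HD_subspace[of \<Lambda> j, unfolded dv.subspace_def]
  show "0 \<in> Y j" unfolding Y_def using S by (metis image_eqI vsubst_simps(4))
  show "x + y \<in> Y j" if "x \<in> Y j" "y \<in> Y j" for x y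
    using that S unfolding Y_def by (auto simp flip: vsubst_simps(1))
  show "mconst c *s x \<in> Y j" if x: "x \<in> Y j" for c x
  proof -
    obtain \<theta> where \<theta>: "\<theta> \<in> HD \<Lambda> j" "x = vsubst Q \<theta>" using x by (auto simp: Y_def)
    then have "mconst c *s x = vsubst Q (mconst c *s \<theta>)" by simp
    then show ?thesis using \<theta> S unfolding Y_def by blast
  qed
qed

lemma vhom_E_cancel: "vhom d (g *s E) \<Longrightarrow> (1 \<le> d \<longrightarrow> mhomogeneous (d - 1) g) \<and> (d < 1 \<longrightarrow> g = 0)"
proof -
  assume "vhom d (g *s E)"
  then have "mhomogeneous d (pair x1 (g *s E))" by (rule vhom_pair)
  then have "mhomogeneous d (linear_form x1 * g)" by (simp add: x1Q mult.commute)
  then show ?thesis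
    using mhomogeneous_cancel[OF mhomogeneous_linear_form, of x1 d g] res_nonzero[OF i\<Lambda>] by (simp add: x1_def)
qed

lemma kernel_sub: "{\<eta> \<in> Y j. \<tau> \<eta> = 0} \<subseteq> A1 j"
proof
  fix \<eta> assume "\<eta> \<in> {\<eta> \<in> Y j. \<tau> \<eta> = 0}"
  then have \<eta>: "\<eta> \<in> Y j" "\<tau> \<eta> = 0" by auto
  obtain g k where gk: "g \<in> fix_ring Q" "k \<in> fix_ring Q" "\<eta> = g *s E + k *s (prodN *s cvec e2)"
    using DQ_generators[OF Y_DQ[OF \<eta>(1)]] by blast
  have "linear_form x1 * prodN * k = 0" using \<eta>(2) unfolding gk(3) \<tau>_generators .
  then have "k = 0"
    using mpoly_mult_eq_0[of "linear_form x1 * prodN" k] mpoly_mult_eq_0[of "linear_form x1" prodN]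
      prodN(2) res_nonzero[OF i\<Lambda>] by (auto simp: x1_def)
  then have \<eta>g: "\<eta> = g *s E" using gk by simp
  obtain \<theta> where \<theta>: "\<theta> \<in> D0" "vsubst Q \<theta> = g *s E" using \<eta>(1) \<eta>g by (auto simp: Y_def HD_def D0of_\<Lambda>)
  obtain q where q: "g = B * q" using Euler_multiple[OF \<theta>] by (elim dvdE)
  have qQ: "q \<in> fix_ring Q" using fix_ring_cancel[of B q Q] q gk(1) B_fix B_nonzero by simp
  have hg: "(1 \<le> j \<longrightarrow> mhomogeneous (j - 1) (B * q)) \<and> (j < 1 \<longrightarrow> B * q = 0)"
    using vhom_E_cancel[of j g] Y_vhom[OF \<eta>(1)] \<eta>g q by simp
  let ?d = "card \<Lambda> - card N"
  show "\<eta> \<in> A1 j"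
  proof (cases "?d + 1 \<le> j")
    case True
    then have "mhomogeneous (j - 1 - ?d) q"
      using hg mhomogeneous_cancel[OF B_hom B_nonzero, of "j - 1" q] by simp
    then have "q \<in> hpolys Q (j - (?d + 1))" using qQ by (simp add: hpolys_def)
    moreover have "\<eta> = q *s (B *s E)" unfolding \<eta>g q by (simp add: vector_smult_assoc mult.commute)
    ultimately show ?thesis using True by (simp add: A1_def)
  next
    case False
    have "q = 0"
    proof (cases "1 \<le> j")
      case True
      then show ?thesis using hg False mhomogeneous_cancel[OF B_hom B_nonzero, of "j - 1" q] by simp
    next
      case False
      then show ?thesis using hg mpoly_mult_eq_0[of B q] B_nonzero by simp
    qed
    then show ?thesis using False \<eta>g q by (simp add: A1_def)
  qed
qed

lemma image_sub: "\<tau> ` Y j \<subseteq> A2 j"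
proof (rule image_subsetI)
  fix \<eta> assume \<eta>: "\<eta> \<in> Y j"
  obtain g k where gk: "g \<in> fix_ring Q" "k \<in> fix_ring Q" "\<eta> = g *s E + k *s (prodN *s cvec e2)"
    using DQ_generators[OF Y_DQ[OF \<eta>]] by blast
  have \<tau>: "\<tau> \<eta> = linear_form x1 * prodN * k" unfolding gk(3) by (rule \<tau>_generators)
  have "mhomogeneous (1 + j) (\<tau> \<eta>)"
    unfolding \<tau>_def by (intro mhomogeneous_diff mhomogeneous_mult mhomogeneous_linear_form vhom_pair Y_vhom[OF \<eta>])
  moreover have "mhomogeneous (1 + (card N - 1)) (linear_form x1 * prodN)"
    by (intro mhomogeneous_mult mhomogeneous_linear_form prodN)
  moreover have "linear_form x1 * prodN \<noteq> 0"
    using mpoly_mult_eq_0[of "linear_form x1" prodN] prodN(2) res_nonzero[OF i\<Lambda>] by (auto simp: x1_def)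
  ultimately have *: "(card N \<le> j + 1 \<longrightarrow> mhomogeneous (j + 1 - card N) k) \<and> (j + 1 < card N \<longrightarrow> k = 0)"
    using mhomogeneous_cancel[of "1 + (card N - 1)" "linear_form x1 * prodN" "1 + j" k] N_pos \<tau> by simp
  show "\<tau> \<eta> \<in> A2 j"
    unfolding \<tau> A2_def using * gk(2) by (auto simp: hpolys_def)
qed

lemma hpolys_hom: "hpolys R k \<subseteq> {f. mhomogeneous k f}"
  by (auto simp: hpolys_def)

lemma A1_bound: "dv.dim (A1 j) \<le> j - (card \<Lambda> - card N)" "A1 j \<subseteq> {\<theta>. vhom j \<theta>}"
proof -
  let ?d = "card \<Lambda> - card N"
  have BE: "vhom (?d + 1) (B *s E)" using vhom_scale[OF B_hom vhom_Euler] .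
  show "dv.dim (A1 j) \<le> j - ?d"
  proof (cases "?d + 1 \<le> j")
    case True
    have "dv.dim ((\<lambda>q. q *s (B *s E)) ` hpolys Q (j - (?d + 1))) \<le> pv.dim (hpolys Q (j - (?d + 1)))"
      by (rule pd_dim_image_le[OF _ _ hpolys_subspace hpolys_hom])
        (auto intro!: der_eqI simp: algebra_simps)
    then show ?thesis using True dim_polys_Q by (simp add: A1_def)
  qed (simp add: A1_def dv_dim_zero)
  show "A1 j \<subseteq> {\<theta>. vhom j \<theta>}"
    using vhom_scale[OF _ BE, of "j - (?d + 1)"] by (auto simp: A1_def hpolys_def)
qed

lemma A2_bound: "pv.dim (A2 j) \<le> j + 2 - card N" "A2 j \<subseteq> {f. mhomogeneous (j + 1) f}"
proof -
  have x: "linear_form x1 * prodN \<noteq> 0"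
    using mpoly_mult_eq_0[of "linear_form x1" prodN] prodN(2) res_nonzero[OF i\<Lambda>] by (auto simp: x1_def)
  have h: "mhomogeneous (1 + (card N - 1)) (linear_form x1 * prodN)"
    by (intro mhomogeneous_mult mhomogeneous_linear_form prodN)
  show "pv.dim (A2 j) \<le> j + 2 - card N"
  proof (cases "card N \<le> j + 1")
    case True
    then show ?thesis
      using pv_dim_mult_image[OF x hpolys_subspace hpolys_hom, of Q "j + 1 - card N"] dim_polys_Q
      by (simp add: A2_def)
  qed (simp add: A2_def pv_dim_zero)
  show "A2 j \<subseteq> {f. mhomogeneous (j + 1) f}"
    using mhomogeneous_mult[OF h, of "j + 1 - card N"] N_pos by (auto simp: A2_def hpolys_def)
qed

text \<open>Rank and nullity twice: for the restriction, whose kernel is \<open>z\<close> times the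
  part of degree \<open>j - 1\<close>, and for \<open>\<tau>\<close> on its image
  \<open>Y j\<close>.\<close>

lemma dim_HD_rec:
  "dv.dim (HD \<Lambda> j) = (if j = 0 then 0 else dv.dim (HD \<Lambda> (j - 1))) + (dv.dim {\<eta> \<in> Y j. \<tau> \<eta> = 0} + pv.dim (\<tau> ` Y j))"
proof -
  have "dv.dim (HD \<Lambda> j) = dv.dim {\<theta> \<in> HD \<Lambda> j. vsubst Q \<theta> = 0} + dv.dim (vsubst Q ` HD \<Lambda> j)"
    by (rule dd_rank_nullity[OF _ _ HD_subspace HD_vhom]) simp_all
  moreover have "dv.dim (Y j) = dv.dim {\<eta> \<in> Y j. \<tau> \<eta> = 0} + pv.dim (\<tau> ` Y j)"
    by (rule dp_rank_nullity[OF _ _ Y_subspace, of _ j]) (use Y_vhom in \<open>auto simp: \<tau>_def algebra_simps\<close>)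
  moreover have "{\<theta> \<in> HD \<Lambda> j. vsubst Q \<theta> = 0} = (if j = 0 then {0} else (\<lambda>\<theta>. linear_form z *s \<theta>) ` HD \<Lambda> (j - 1))"
    (is "?L = ?R")
  proof (intro equalityI subsetI)
    fix \<theta> assume \<theta>: "\<theta> \<in> ?L"
    then have "\<theta> \<in> D0" by (simp add: HD_def D0of_\<Lambda>)
    then obtain \<eta> where \<eta>: "\<eta> \<in> D0" "\<theta> = linear_form z *s \<eta>" using D0_ker_restrict \<theta> by blast
    have "vhom j (linear_form z *s \<eta>)" using \<theta> \<eta>(2) by (simp add: HD_def)
    from vhom_scale_cancel[OF mhomogeneous_linear_form _ this] z_nonzero
    show "\<theta> \<in> ?R" using \<eta> by (auto simp: HD_def D0of_\<Lambda>)
  next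
    fix \<theta> assume \<theta>: "\<theta> \<in> ?R"
    show "\<theta> \<in> ?L"
    proof (cases j)
      case 0
      then show ?thesis using \<theta> by (simp add: HD_def D0of_\<Lambda>)
    next
      case (Suc n)
      then obtain \<eta> where \<eta>: "\<eta> \<in> HD \<Lambda> n" "\<theta> = linear_form z *s \<eta>" using \<theta> by auto
      then have "vhom j \<theta>" using vhom_scale[OF mhomogeneous_linear_form, of n \<eta> z] Suc by (simp add: HD_def)
      then show ?thesis using \<eta> D0_scale[OF fix_ring_lf_z] by (simp add: HD_def D0of_\<Lambda>)
    qed
  qed
  moreover have "dv.dim ((\<lambda>\<theta>. linear_form z *s \<theta>) ` HD \<Lambda> (j - 1)) = dv.dim (HD \<Lambda> (j - 1))"
    by (rule dv_dim_scale_image[OF _ HD_subspace HD_vhom]) (simp add: z_nonzero)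
  ultimately show ?thesis by (simp add: Y_def dv_dim_zero)
qed

text \<open>The total by which kernel and image of \<open>\<tau>\<close> in degree \<open>j\<close>
  fall short of the bounds \<open>A1_bound\<close> and \<open>A2_bound\<close>.\<close>

definition slack :: "nat \<Rightarrow> nat" where
  "slack j = ((j - (card \<Lambda> - card N)) - dv.dim {\<eta> \<in> Y j. \<tau> \<eta> = 0}) + ((j + 2 - card N) - pv.dim (\<tau> ` Y j))"

lemma dims_le: "dv.dim {\<eta> \<in> Y j. \<tau> \<eta> = 0} \<le> j - (card \<Lambda> - card N)" "pv.dim (\<tau> ` Y j) \<le> j + 2 - card N"
  using dv_dim_mono[OF kernel_sub A1_bound(2)] A1_bound(1) pv_dim_mono[OF image_sub A2_bound(2)] A2_bound(1)
    order_trans by blast+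

lemma dim_HD_sum:
  "dv.dim (HD \<Lambda> k) + (\<Sum>j\<le>k. slack j) = (\<Sum>j\<le>k. j - (card \<Lambda> - card N)) + (\<Sum>j\<le>k. j + 2 - card N)"
proof -
  have step: "dv.dim (HD \<Lambda> j) + slack j = (if j = 0 then 0 else dv.dim (HD \<Lambda> (j - 1)))
      + ((j - (card \<Lambda> - card N)) + (j + 2 - card N))" for j
  proof -
    have gen: "a \<le> A \<Longrightarrow> b \<le> B \<Longrightarrow> d = p + (a + b) \<Longrightarrow> d + ((A - a) + (B - b)) = p + (A + B)"
      for a b A B d p :: nat by simp
    show ?thesis unfolding slack_def by (rule gen[OF dims_le[of j] dim_HD_rec[of j]])
  qed
  show ?thesis
  proof (induction k)
    case 0
    then show ?case using step[of 0] by simp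
  next
    case (Suc k)
    then show ?case using step[of "Suc k"] by simp
  qed
qed

text \<open>Two degrees matter: that of \<open>B *s E\<close>, and \<open>card N - 1\<close>, that
  of \<open>prodN *s cvec e2\<close>. Without slack there, kernel and image fill \<open>A1\<close>
  and \<open>A2\<close>, which contain the two elements wanted.\<close>

lemma lifts_if_no_slack:
  assumes "\<And>j. slack j = 0"
  shows "lifts i e2"
  unfolding lifts_def
proof
  let ?d = "card \<Lambda> - card N + 1"
  have "dv.dim (A1 ?d) \<le> dv.dim {\<eta> \<in> Y ?d. \<tau> \<eta> = 0}"
    using assms[of ?d] A1_bound(1)[of ?d] by (simp add: slack_def)
  moreover have "dv.subspace {\<eta> \<in> Y ?d. \<tau> \<eta> = 0}"
    using Y_subspace[of ?d] by (auto simp: dv.subspace_def \<tau>_def algebra_simps)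
  ultimately have "{\<eta> \<in> Y ?d. \<tau> \<eta> = 0} = A1 ?d"
    using dv_subspace_eq[OF kernel_sub A1_bound(2)] by blast
  moreover have "1 \<in> hpolys Q (?d - ?d)" by (simp add: hpolys_def)
  then have "1 *s (B *s E) \<in> A1 ?d" unfolding A1_def by (simp only: order_refl if_True image_eqI)
  ultimately have "B *s E \<in> Y ?d" by auto
  then show "\<exists>\<theta>\<in>D0. vsubst Q \<theta> = B *s E" by (auto simp: Y_def HD_def D0of_\<Lambda>)
next
  let ?j = "card N - 1"
  have j1: "?j + 1 = card N" using N_pos by simp
  have "?j + 2 - card N \<le> pv.dim (\<tau> ` Y ?j)"
    using assms[of ?j] unfolding slack_def by (simp only: add_is_0 diff_is_0_eq)
  then have "pv.dim (A2 ?j) \<le> pv.dim (\<tau> ` Y ?j)" using A2_bound(1) order_trans by blast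
  moreover have "pv.subspace (\<tau> ` Y ?j)"
  proof -
    have "Vector_Spaces.linear (\<lambda>c \<theta>. mconst c *s \<theta>) (\<lambda>c f. mconst c * f) \<tau>"
      by unfold_locales (simp_all add: \<tau>_def algebra_simps)
    then show ?thesis using dp.linear_subspace_image Y_subspace by blast
  qed
  ultimately have "\<tau> ` Y ?j = A2 ?j" using pv_subspace_eq[OF image_sub A2_bound(2)] by blast
  moreover have "1 \<in> hpolys Q (card N - card N)" by (simp add: hpolys_def)
  then have "linear_form x1 * prodN * 1 \<in> A2 ?j" unfolding A2_def j1 by (simp only: order_refl if_True image_eqI)
  ultimately have "linear_form x1 * prodN * 1 \<in> \<tau> ` Y ?j" by (simp only:)
  then obtain \<eta> where "linear_form x1 * prodN * 1 = \<tau> \<eta>" "\<eta> \<in> Y ?j" by (rule imageE)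
  note \<eta> = this(2) this(1)[symmetric]
  obtain g k where gk: "g \<in> fix_ring Q" "k \<in> fix_ring Q" "\<eta> = g *s E + k *s (prodN *s cvec e2)"
    using DQ_generators[OF Y_DQ[OF \<eta>(1)]] by blast
  have x: "linear_form x1 * prodN \<noteq> 0"
    using mpoly_mult_eq_0[of "linear_form x1" prodN] prodN(2) res_nonzero[OF i\<Lambda>] by (auto simp: x1_def)
  have "linear_form x1 * prodN * k = linear_form x1 * prodN * 1"
    using \<eta>(2) unfolding gk(3) \<tau>_generators .
  then have "k = 1" by (rule mpoly_mult_left_cancel[OF x])
  then have eq: "\<eta> = prodN *s cvec e2 + g *s E" using gk(3) by (simp add: add.commute)
  obtain \<theta> where \<theta>: "\<theta> \<in> D0" "\<eta> = vsubst Q \<theta>" using \<eta>(1) by (auto simp: Y_def HD_def D0of_\<Lambda>)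
  have "vsubst Q \<theta> = prodN *s cvec e2 + g *s E" using eq unfolding \<theta>(2) .
  then show "\<exists>\<theta>\<in>D0. \<exists>f\<in>fix_ring Q. vsubst Q \<theta> = prodN *s cvec e2 + f *s E"
    using \<theta>(1) gk(1) by blast
qed

end

text \<open>The index set \<open>EE\<close> stands for the flats of codimension two that do not lie on \<open>H\<close>.\<close>

locale arr_rank3_flats = arr_rank3 +
  fixes EE :: "'e set" and inc :: "'a ^ 'b \<Rightarrow> 'e \<Rightarrow> bool"
  assumes finEE: "finite EE"
    and inc_ex: "\<And>a b. a \<in> \<Lambda> \<Longrightarrow> b \<in> \<Lambda> \<Longrightarrow> a \<noteq> b \<Longrightarrow> \<not> in_span2 a b z \<Longrightarrow> \<exists>e\<in>EE. inc a e \<and> inc b e"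
    and inc_span: "\<And>e a b c. e \<in> EE \<Longrightarrow> a \<in> \<Lambda> \<Longrightarrow> b \<in> \<Lambda> \<Longrightarrow> a \<noteq> b \<Longrightarrow> inc a e \<Longrightarrow> inc b e \<Longrightarrow>
      c \<in> \<Lambda> \<Longrightarrow> inc c e \<Longrightarrow> in_span2 a b c"
    and inc_unique: "\<And>e e' a b. e \<in> EE \<Longrightarrow> e' \<in> EE \<Longrightarrow> a \<in> \<Lambda> \<Longrightarrow> b \<in> \<Lambda> \<Longrightarrow> a \<noteq> b \<Longrightarrow>
      inc a e \<Longrightarrow> inc b e \<Longrightarrow> inc a e' \<Longrightarrow> inc b e' \<Longrightarrow> e = e'"
    and inc_closed: "\<And>e a b c. e \<in> EE \<Longrightarrow> a \<in> \<Lambda> \<Longrightarrow> b \<in> \<Lambda> \<Longrightarrow> a \<noteq> b \<Longrightarrow> inc a e \<Longrightarrow> inc b e \<Longrightarrow>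
      c \<in> \<Lambda> \<Longrightarrow> in_span2 a b c \<Longrightarrow> inc c e"
begin

text \<open>The sum of the Moebius values over the flats in \<open>EE\<close>, for the
  subarrangement \<open>A\<close>. Truncated subtraction gives 0 for a flat carrying no member or a
  single one.\<close>

definition defect :: "('a ^ 'b) set \<Rightarrow> nat" where
  "defect A = (\<Sum>e\<in>EE. card {a \<in> A. inc a e} - 1)"

text \<open>Adding the hyperplane \<open>K\<close> imposes the condition that \<open>\<theta>(K)\<close> vanishes on \<open>K\<close>; but the
  restriction of \<open>\<theta>(K)\<close> to \<open>K\<close> is already divisible by a product of linear forms.\<close>

lemma dim_HD_insert:
  assumes A: "A \<subseteq> \<Lambda>" and K: "K \<in> \<Lambda>" "K \<notin> A" and k: "card \<Lambda> \<le> k"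
  shows "dv.dim (HD A k) + card A \<le> dv.dim (HD (insert K A) k)
      + (k + 1) + card {e \<in> EE. inc K e \<and> (\<exists>a\<in>A. inc a e)}"
proof -
  have finA: "finite A" using A fin finite_subset by blast
  obtain u0 where u0: "dot K u0 = 1" using exists_dual_vector[OF \<Lambda>_nonzero[OF K(1)]] by blast
  define u where "u = P *v u0"
  have u: "dot K u = 1" "P *v u = u"
    using u0 \<Lambda>P[OF K(1)] by (simp_all add: u_def matrix_vector_mul_assoc P flip: dot_vector_matrix)
  \<comment> \<open>The roles change: restriction is now to the kernel of \<open>K\<close>, and
    \<open>z\<close> counts among the other forms.\<close>
  interpret K: arr_setup P u K "insert z A"
  proof
    fix a c assume "a \<in> insert z A"
    then show "a v* P = a" using zP \<Lambda>P A by auto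
    show "a \<noteq> c *s K"
    proof
      assume eq: "a = c *s K"
      have "a \<noteq> 0" using \<open>a \<in> insert z A\<close> z_nonzero \<Lambda>_nonzero A by auto
      then have c: "c \<noteq> 0" using eq by auto
      then have "proportional K a" using eq unfolding proportional_def by blast
      show False
      proof (cases "a = z")
        case True
        then have "proportional z K" using \<open>proportional K a\<close> proportional_sym by blast
        then show False using \<Lambda>z[OF K(1)] unfolding proportional_def by blast
      next
        case False
        then show False using \<open>a \<in> insert z A\<close> \<open>proportional K a\<close> \<Lambda>_distinct A K by blast
      qed
    qed
  next
    fix a b assume *: "a \<in> insert z A" "b \<in> insert z A" "proportional a b"
    have zA: "\<not> proportional z x" if "x \<in> A" for x
      using \<Lambda>z A that unfolding proportional_def by blast
    show "a = b" using * zA proportional_sym \<Lambda>_distinct A by blast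
  qed (use P u \<Lambda>P[OF K(1)] finA in auto)
  \<comment> \<open>The flats on \<open>K\<close> that already carry a member of \<open>A\<close>.
    One member per flat is set aside in \<open>M\<close>; the other forms, restricted to
    \<open>K\<close>, will divide the restriction of \<open>pair K \<theta>\<close>.\<close>
  define new where "new = {e \<in> EE. inc K e \<and> (\<exists>a\<in>A. inc a e)}"
  have "\<forall>e. \<exists>a. e \<in> new \<longrightarrow> a \<in> A \<and> inc a e" by (auto simp: new_def)
  then obtain r where r: "\<forall>e. e \<in> new \<longrightarrow> r e \<in> A \<and> inc (r e) e" unfolding choice_iff by blast
  define M where "M = r ` new"
  have MA: "M \<subseteq> A" using r by (auto simp: M_def)
  have "inj_on r new"
  proof (rule inj_onI)
    fix e e' assume e: "e \<in> new" "e' \<in> new" "r e = r e'"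
    have "r e \<in> \<Lambda>" "r e \<noteq> K" using r e A K by blast+
    moreover have "inc (r e) e" "inc (r e) e'" using r e by metis+
    ultimately show "e = e'" using inc_unique[of e e' "r e" K] e(1,2) K(1) by (simp add: new_def)
  qed
  then have cardM: "card M = card new" by (simp add: M_def card_image)
  define BK where "BK = (\<Prod>a\<in>A - M. linear_form (K.res a))"
  have BK_fix: "BK \<in> fix_ring K.Q"
    unfolding BK_def by (intro fix_ring_prod fix_ring_linear_form K.res_Q K.\<Lambda>P) auto
  have BK_nonzero: "BK \<noteq> 0" unfolding BK_def using finA K.res_nonzero by (intro mpoly_prod_nonzero) auto
  let ?d = "card A - card M"
  have BK_hom: "mhomogeneous ?d BK"
  proof -
    have "mhomogeneous (\<Sum>a\<in>A - M. 1) BK" unfolding BK_def using finA by (intro mhomogeneous_prod) auto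
    then show ?thesis using MA finA by (simp add: card_Diff_subset finite_subset)
  qed
  have BK_dvd: "BK dvd subst K.Q (pair K \<theta>)" if \<theta>: "\<theta> \<in> HD A k" for \<theta>
    unfolding BK_def
  proof (rule prod_linear_forms_dvd)
    show "finite (A - M)" using finA by simp
    show "K.res s \<noteq> 0" if "s \<in> A - M" for s using that K.res_nonzero by blast
    fix s assume s: "s \<in> A - M"
    let ?C = "{t \<in> A - M. proportional (K.res s) (K.res t)}"
    have \<theta>dvd: "linear_form a dvd pair a \<theta>" if "a \<in> insert z A" for a
      using \<theta> that by (auto simp: HD_def D0of_def Der0_def)
    \<comment> \<open>A reference form with the same restriction to \<open>K\<close> as
      \<open>s\<close>: \<open>z\<close> itself if it is in that class, otherwise the member of
      \<open>M\<close> set aside for the flat of \<open>s\<close> and \<open>K\<close>.\<close>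
    have "\<exists>\<alpha>\<in>insert z A. \<alpha> \<notin> A - M \<and> proportional (K.res \<alpha>) (K.res s)"
    proof (cases "proportional (K.res z) (K.res s)")
      case True
      then show ?thesis using \<Lambda>z[of z 1] A by auto
    next
      case False
      have s\<Lambda>: "s \<in> \<Lambda>" "s \<noteq> K" using s A K by auto
      have resK: "K.res (c *s s + d *s K) = c *s K.res s" for c d
        by (simp add: K.res_def vec_eq_iff K.zw algebra_simps)
      have "\<not> in_span2 s K z"
      proof
        assume "in_span2 s K z"
        then obtain c d where "z = c *s s + d *s K" by (auto simp: in_span2_def)
        then have eq: "K.res z = c *s K.res s" using resK by simp
        then have "c \<noteq> 0" using K.res_nonzero[of z] by auto
        then have "proportional (K.res s) (K.res z)" using eq unfolding proportional_def by blast
        then show False using False proportional_sym by blast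
      qed
      then obtain e where e: "e \<in> EE" "inc s e" "inc K e" using inc_ex[of s K] s\<Lambda> K(1) by blast
      then have enew: "e \<in> new" using s by (auto simp: new_def)
      define b where "b = r e"
      have b: "b \<in> A" "inc b e" "b \<in> M" using r enew by (auto simp: b_def M_def)
      have "in_span2 s K b" using inc_span[OF e(1) s\<Lambda>(1) K(1) s\<Lambda>(2) e(2,3)] b A by blast
      then obtain c d where "b = c *s s + d *s K" by (auto simp: in_span2_def)
      then have eq: "K.res b = c *s K.res s" using resK by simp
      then have "c \<noteq> 0" using K.res_nonzero[of b] b by auto
      then have "proportional (K.res s) (K.res b)" using eq unfolding proportional_def by blast
      then show ?thesis using b proportional_sym by blast
    qed
    then obtain \<alpha> where \<alpha>: "\<alpha> \<in> insert z A" "\<alpha> \<notin> A - M" "proportional (K.res \<alpha>) (K.res s)" by blast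
    obtain g where g: "pair \<alpha> \<theta> = linear_form \<alpha> * g" using \<theta>dvd[OF \<alpha>(1)] by (elim dvdE)
    \<comment> \<open>On the kernel of \<open>K\<close> this agrees with
      \<open>pair K \<theta>\<close>. For \<open>t = c *s \<alpha> + d *s K\<close> one gets
      \<open>pair t \<theta> - linear_form t * g = mconst d * f\<close>, so each such
      \<open>t\<close> divides \<open>f\<close> before restricting, and the divisors multiply
      up.\<close>
    define f where "f = pair K \<theta> - linear_form K * g"
    have "(\<Prod>t\<in>?C. linear_form t) dvd f"
    proof (rule prod_distinct_linear_forms_dvd)
      show "finite ?C" using finA by simp
      show "t \<noteq> 0" if "t \<in> ?C" for t using that \<Lambda>_nonzero A by blast
      show "t = t'" if "t \<in> ?C" "t' \<in> ?C" "proportional t t'" for t t' using that \<Lambda>_distinct A by blast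
      fix t assume t: "t \<in> ?C"
      have "proportional (K.res \<alpha>) (K.res t)" using \<alpha>(3) t proportional_trans by blast
      then obtain c d where cd: "c \<noteq> 0" "t = c *s \<alpha> + d *s K" using K.proportional_res by blast
      have d: "d \<noteq> 0"
      proof
        assume "d = 0"
        then have "proportional \<alpha> t" using cd unfolding proportional_def by auto
        then have "\<alpha> = t" using K.\<Lambda>_distinct \<alpha>(1) t by blast
        then show False using \<alpha>(2) t by blast
      qed
      have "pair t \<theta> - linear_form t * g = mconst d * f"
        unfolding cd(2) f_def by (simp add: g linear_form_add linear_form_scale algebra_simps)
      moreover have "linear_form t dvd pair t \<theta> - linear_form t * g"
        using \<theta>dvd[of t] t by (intro dvd_diff) auto
      ultimately have "linear_form t dvd mconst d * f" by simp
      then have "linear_form t dvd mconst (inverse d) * (mconst d * f)" by (rule dvd_mult)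
      then show "linear_form t dvd f" using d by (simp flip: mult.assoc mconst_mult)
    qed
    then have "subst K.Q (\<Prod>t\<in>?C. linear_form t) dvd subst K.Q f" by (rule subst_dvd)
    moreover have "subst K.Q f = subst K.Q (pair K \<theta>)" by (simp add: f_def)
    moreover have "subst K.Q (\<Prod>t\<in>?C. linear_form t) = (\<Prod>t\<in>?C. linear_form (K.res t))"
      unfolding subst_prod by (intro prod.cong) (auto simp: K.vector_matrix_Q' K.\<Lambda>P)
    moreover have "linear_form (K.res s) ^ card ?C dvd (\<Prod>t\<in>?C. linear_form (K.res t))"
      unfolding prod_constant[symmetric] by (intro prod_dvd_prod) (auto intro: proportional_dvd)
    ultimately show "linear_form (K.res s) ^ card ?C dvd subst K.Q (pair K \<theta>)"
      by (auto intro: dvd_trans)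
  qed
  have cardA: "card A \<le> k" using k card_mono[OF fin A] by simp
  have img: "(\<lambda>\<theta>. subst K.Q (pair K \<theta>)) ` HD A k \<subseteq> (\<lambda>f. BK * f) ` hpolys K.Q (k - ?d)"
  proof (rule image_subsetI)
    fix \<theta> assume \<theta>: "\<theta> \<in> HD A k"
    obtain q where q: "subst K.Q (pair K \<theta>) = BK * q" using BK_dvd[OF \<theta>] by (elim dvdE)
    have "q \<in> fix_ring K.Q"
      using fix_ring_cancel[of BK q K.Q] K.subst_Q_fix[of "pair K \<theta>"] q BK_fix BK_nonzero by simp
    moreover have "mhomogeneous k (BK * q)"
      unfolding q[symmetric] using \<theta> by (auto simp: HD_def intro!: mhomogeneous_subst vhom_pair)
    then have "mhomogeneous (k - ?d) q" using mhomogeneous_cancel[OF BK_hom BK_nonzero, of k q] cardA by simp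
    ultimately show "subst K.Q (pair K \<theta>) \<in> (\<lambda>f. BK * f) ` hpolys K.Q (k - ?d)"
      unfolding q by (auto simp: hpolys_def)
  qed
  have "pv.dim ((\<lambda>\<theta>. subst K.Q (pair K \<theta>)) ` HD A k) \<le> pv.dim ((\<lambda>f. BK * f) ` hpolys K.Q (k - ?d))"
    by (rule pv_dim_mono[OF img, of "?d + (k - ?d)"])
      (auto simp: hpolys_def intro: mhomogeneous_mult[OF BK_hom])
  also have "\<dots> = k - ?d + 1"
    using pv_dim_mult_image[OF BK_nonzero hpolys_subspace hpolys_hom] dim_polys_quotient[OF u(2) K.zP u(1)]
    by (simp add: K.Q_def)
  finally have 1: "pv.dim ((\<lambda>\<theta>. subst K.Q (pair K \<theta>)) ` HD A k) \<le> k - ?d + 1" .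
  have 2: "dv.dim (HD A k) = dv.dim {\<theta> \<in> HD A k. subst K.Q (pair K \<theta>) = 0}
      + pv.dim ((\<lambda>\<theta>. subst K.Q (pair K \<theta>)) ` HD A k)"
    by (rule dp_rank_nullity[OF _ _ HD_subspace HD_vhom]) simp_all
  have 3: "{\<theta> \<in> HD A k. subst K.Q (pair K \<theta>) = 0} = HD (insert K A) k"
    using K.z_dvd_iff by (auto simp: HD_def D0of_def Der0_def Der_fix_ring)
  have "card M \<le> card A" using MA finA by (rule card_mono[rotated])
  then show ?thesis using 1 2[unfolded 3] cardA cardM[unfolded new_def] by linarith
qed

lemma defect_insert:
  assumes "finite A" "K \<notin> A"
  shows "defect (insert K A) = defect A + card {e \<in> EE. inc K e \<and> (\<exists>a\<in>A. inc a e)}"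
proof -
  have "card {a \<in> insert K A. inc a e} - 1
      = card {a \<in> A. inc a e} - 1 + (if inc K e \<and> (\<exists>a\<in>A. inc a e) then 1 else 0)" for e
  proof (cases "inc K e")
    case True
    then have "{a \<in> insert K A. inc a e} = insert K {a \<in> A. inc a e}" by auto
    then have "card {a \<in> insert K A. inc a e} = card {a \<in> A. inc a e} + 1" using assms by simp
    moreover have "(\<exists>a\<in>A. inc a e) \<longleftrightarrow> card {a \<in> A. inc a e} \<noteq> 0" using assms(1) by auto
    ultimately show ?thesis using True by auto
  next
    case False
    then have "{a \<in> insert K A. inc a e} = {a \<in> A. inc a e}" by auto
    then show ?thesis using False by simp
  qed
  then have "defect (insert K A) = defect A + (\<Sum>e\<in>EE. if inc K e \<and> (\<exists>a\<in>A. inc a e) then 1 else 0)"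
    unfolding defect_def by (simp add: sum.distrib)
  then show ?thesis using finEE by (simp add: sum.If_cases Int_def)
qed

text \<open>Adding a hyperplane to \<open>A\<close> loses at most \<open>k + 1 - card A\<close>
  dimensions plus the number of flats it shares with \<open>A\<close>. The sizes
  \<open>card A\<close> add up to the triangular number, the flats to the defect by
  \<open>defect_insert\<close>.\<close>

lemma dim_HD_lower:
  assumes "A \<subseteq> \<Lambda>" "card \<Lambda> \<le> k"
  shows "2 * pv.dim (hpolys P k) + \<Sum>{..<card A} \<le> dv.dim (HD A k) + card A * (k + 1) + defect A"
proof -
  have "finite A" using assms(1) fin finite_subset by blast
  then show ?thesis using assms(1)
  proof (induction A rule: finite_induct)
    case empty
    then show ?case using dim_HD_empty by simp
  next
    case (insert K A)
    then show ?case
      using dim_HD_insert[of A K k] assms(2) defect_insert[of A K] by simp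
  qed
qed

text \<open>For \<open>k\<close> at least \<open>card \<Lambda> + card N\<close> the subtractions do
  not truncate, and \<open>dim_HD_sum\<close> is compared with \<open>dim_HD_lower\<close>. The
  defect then bounds the local product plus all slack up to degree \<open>k\<close>. Since
  \<open>k\<close> is arbitrary, equality with the product removes the slack in every
  degree.\<close>

theorem rank3_defect:
  shows "(card N - 1) * (card \<Lambda> + 1 - card N) \<le> defect \<Lambda>"
    and "defect \<Lambda> = (card N - 1) * (card \<Lambda> + 1 - card N) \<Longrightarrow> lifts i e2"
proof -
  have NL: "card N \<le> card \<Lambda>" using N_sub fin by (simp add: card_mono)
  have main: "(card N - 1) * (card \<Lambda> + 1 - card N) + (\<Sum>j\<le>k. slack j) \<le> defect \<Lambda>"
    if k: "k \<ge> card \<Lambda> + card N" for k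
  proof -
    define h n c D S where "h = int (card N)" and "n = int (card \<Lambda>)" and "c = int (defect \<Lambda>)"
      and "D = int (dv.dim (HD \<Lambda> k))" and "S = int (\<Sum>j\<le>k. slack j)"
    obtain d where d: "card \<Lambda> = card N + d" using NL by (metis le_Suc_ex)
    obtain e where e: "k = card \<Lambda> + card N + e" using k by (metis le_Suc_ex)
    have tri: "2 * \<Sum>{..<m} = m * (m - 1)" for m :: nat
    proof (induction m)
      case (Suc m)
      then show ?case by (cases m) (simp_all add: lessThan_Suc algebra_simps)
    qed simp
    have "2 * (2 * pv.dim (hpolys P k)) + 2 * \<Sum>{..<card \<Lambda>}
        \<le> 2 * dv.dim (HD \<Lambda> k) + 2 * (card \<Lambda> * (k + 1)) + 2 * defect \<Lambda>"
      using dim_HD_lower[of \<Lambda> k] k by simp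
    then have L: "2 * ((k + 1) * (k + 2)) + card \<Lambda> * (card \<Lambda> - 1)
        \<le> 2 * dv.dim (HD \<Lambda> k) + 2 * (card \<Lambda> * (k + 1)) + 2 * defect \<Lambda>"
      unfolding dim_polys_P tri .
    have "2 * dv.dim (HD \<Lambda> k) + 2 * (\<Sum>j\<le>k. slack j)
        = 2 * (\<Sum>j\<le>k. j - (card \<Lambda> - card N)) + 2 * (\<Sum>j\<le>k. j + 2 - card N)"
      using dim_HD_sum[of k] by simp
    then have U: "2 * dv.dim (HD \<Lambda> k) + 2 * (\<Sum>j\<le>k. slack j)
        = (k - (card \<Lambda> - card N)) * (k - (card \<Lambda> - card N) + 1) + (k + 2 - card N) * (k + 3 - card N)"
      unfolding sum_truncated_diff sum_truncated_diff'[OF N_pos] .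
    have L': "2 * ((int k + 1) * (int k + 2)) + n * (n - 1) \<le> 2 * D + 2 * (n * (int k + 1)) + 2 * c"
    proof -
      have "1 \<le> card \<Lambda>" using NL N_pos by linarith
      then have "int (card \<Lambda> * (card \<Lambda> - 1)) = n * (n - 1)" by (simp add: n_def of_nat_diff)
      moreover have "int (2 * ((k + 1) * (k + 2))) = 2 * ((int k + 1) * (int k + 2))" by (simp add: algebra_simps)
      moreover have "int (2 * (card \<Lambda> * (k + 1))) = 2 * (n * (int k + 1))" by (simp add: n_def algebra_simps)
      moreover have "int (2 * ((k + 1) * (k + 2))) + int (card \<Lambda> * (card \<Lambda> - 1))
          \<le> 2 * D + int (2 * (card \<Lambda> * (k + 1))) + 2 * c"
        using L unfolding D_def c_def by linarith
      ultimately show ?thesis by linarith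
    qed
    have U': "2 * D + 2 * S = (int k - n + h) * (int k - n + h + 1) + (int k + 2 - h) * (int k + 3 - h)"
    proof -
      have "int (k - (card \<Lambda> - card N)) = int k - n + h" "int (k + 2 - card N) = int k + 2 - h"
        "int (k + 3 - card N) = int k + 3 - h"
        unfolding n_def h_def using d e by auto
      moreover have gen: "2 * x + 2 * y = a * (a + 1) + b * b' \<Longrightarrow>
          2 * int x + 2 * int y = int a * (int a + 1) + int b * int b'" for x y a b b' :: nat
        by (drule arg_cong[of _ _ int]) (simp add: algebra_simps)
      ultimately show ?thesis using gen[OF U] unfolding D_def S_def by simp
    qed
    \<comment> \<open>Over the integers all terms containing \<open>k\<close> cancel between the two
      estimates.\<close>
    have "2 * ((h - 1) * (n + 1 - h) + S) \<le> 2 * c"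
      using L' U' by (simp add: algebra_simps)
    moreover have "int ((card N - 1) * (card \<Lambda> + 1 - card N)) = (h - 1) * (n + 1 - h)"
      unfolding h_def n_def using NL N_pos by (simp add: of_nat_diff)
    ultimately have "int ((card N - 1) * (card \<Lambda> + 1 - card N) + (\<Sum>j\<le>k. slack j)) \<le> int (defect \<Lambda>)"
      unfolding S_def c_def by simp
    then show ?thesis by (simp only: of_nat_le_iff)
  qed
  show "(card N - 1) * (card \<Lambda> + 1 - card N) \<le> defect \<Lambda>"
    using main[of "card \<Lambda> + card N"] by simp
  assume eq: "defect \<Lambda> = (card N - 1) * (card \<Lambda> + 1 - card N)"
  have "slack j = 0" for j
  proof -
    have "(\<Sum>j\<le>card \<Lambda> + card N + j. slack j) = 0" using main[of "card \<Lambda> + card N + j"] eq by simp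
    then show ?thesis by simp
  qed
  then show "lifts i e2" by (rule lifts_if_no_slack)
qed

end

section \<open>The characteristic polynomial and the second Betti number\<close>

definition codim2_flats :: "('k::field ^ 'n) set set \<Rightarrow> ('k ^ 'n) set set" where
  "codim2_flats A = {K \<inter> K' | K K'. K \<in> A \<and> K' \<in> A \<and> K \<noteq> K'}"

text \<open>The Moebius function at a flat \<open>X\<close> of codimension two is \<open>|A\<^sub>X| - 1\<close>, so this is the
  third coefficient of the characteristic polynomial, counted from the top.\<close>

definition betti2 :: "('k::field ^ 'n) set set \<Rightarrow> int" where
  "betti2 A = (\<Sum>X\<in>codim2_flats A. int (card {K \<in> A. X \<subseteq> K}) - 1)"

lemma finite_codim2_flats: "finite A \<Longrightarrow> finite (codim2_flats A)"
proof -
  assume "finite A"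
  moreover have "codim2_flats A \<subseteq> (\<lambda>(K, K'). K \<inter> K') ` (A \<times> A)" by (auto simp: codim2_flats_def)
  ultimately show ?thesis using finite_subset by blast
qed

section \<open>Top coefficients of the characteristic polynomial\<close>

context
  fixes W :: "('k::field ^ 'n::finite) set" and A :: "('k ^ 'n) set set"
  assumes arr: "central_arrangement W A"
begin

lemma arrD:
  shows W_subspace: "vec.subspace W" and A_finite: "finite A"
    and A_subspace: "K \<in> A \<Longrightarrow> vec.subspace K" and A_sub: "K \<in> A \<Longrightarrow> K \<subseteq> W"
    and A_dim: "K \<in> A \<Longrightarrow> vec.dim K + 1 = vec.dim W"
  using arr by (auto simp: central_arrangement_def)

lemma hyperplane_eq: "K \<in> A \<Longrightarrow> K' \<in> A \<Longrightarrow> K \<subseteq> K' \<Longrightarrow> K = K'"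
  using vec.subspace_dim_equal[of K K'] A_subspace A_dim[of K] A_dim[of K'] by simp

lemma lattice_subspace: "X \<in> int_lattice W A \<Longrightarrow> vec.subspace X"
  unfolding int_lattice_def using W_subspace A_subspace
  by (auto intro!: vec.subspace_inter vec.subspace_Inter)

lemma lattice_sub: "X \<in> int_lattice W A \<Longrightarrow> X \<subseteq> W"
  by (auto simp: int_lattice_def)

lemma W_lattice: "W \<in> int_lattice W A"
  unfolding int_lattice_def by (intro CollectI exI[of _ "{}"]) simp

lemma A_lattice: "K \<in> A \<Longrightarrow> K \<in> int_lattice W A"
  unfolding int_lattice_def by (intro CollectI exI[of _ "{K}"]) (use A_sub in auto)

lemma lattice_cases:
  assumes X: "X \<in> int_lattice W A"
  shows "X = W \<or> (\<exists>K\<in>A. X \<subseteq> K)"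
  using X A_sub unfolding int_lattice_def by blast

lemma lattice_cases2:
  assumes X: "X \<in> int_lattice W A"
  shows "X = W \<or> X \<in> A \<or> (\<exists>K\<in>A. \<exists>K'\<in>A. K \<noteq> K' \<and> X \<subseteq> K \<inter> K')"
proof -
  obtain B where B: "B \<subseteq> A" "X = W \<inter> \<Inter>B" using X by (auto simp: int_lattice_def)
  consider "B = {}" | K where "B = {K}" | K K' where "K \<in> B" "K' \<in> B" "K \<noteq> K'" by blast
  then show ?thesis
  proof cases
    case 1
    then show ?thesis using B by simp
  next
    case 2
    then have "X = K" using B A_sub[of K] by auto
    then show ?thesis using 2 B by simp
  next
    case 3
    then show ?thesis using B by blast
  qed
qed

text \<open>Two distinct hyperplanes have sum \<open>W\<close>, and the dimension formula
  applies.\<close>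

lemma dim_inter:
  assumes "K \<in> A" "K' \<in> A" "K \<noteq> K'"
  shows "vec.dim (K \<inter> K') + 2 = vec.dim W"
proof -
  let ?S = "{x + y |x y. x \<in> K \<and> y \<in> K'}"
  have S: "vec.subspace ?S" using vec.subspace_sums A_subspace assms by blast
  have SW: "?S \<subseteq> W"
  proof
    fix v assume "v \<in> ?S"
    then obtain x y where "v = x + y" "x \<in> W" "y \<in> W" using A_sub assms by blast
    then show "v \<in> W" using W_subspace vec.subspace_add by simp
  qed
  have KS: "K \<subseteq> ?S"
  proof
    fix x assume "x \<in> K"
    moreover have "0 \<in> K'" using A_subspace assms(2) vec.subspace_0 by blast
    ultimately show "x \<in> ?S" by force
  qed
  have K'S: "K' \<subseteq> ?S"
  proof
    fix x assume "x \<in> K'"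
    moreover have "0 \<in> K" using A_subspace assms(1) vec.subspace_0 by blast
    ultimately show "x \<in> ?S" by force
  qed
  have "vec.dim ?S \<noteq> vec.dim K"
  proof
    assume "vec.dim ?S = vec.dim K"
    then have "K = ?S" using vec.subspace_dim_equal[of K ?S] S KS A_subspace assms(1) by simp
    then have "K' \<subseteq> K" using K'S by simp
    then show False using hyperplane_eq assms by blast
  qed
  moreover have "vec.dim K \<le> vec.dim ?S" using KS by (rule vec.dim_subset)
  moreover have "vec.dim ?S \<le> vec.dim W" using SW by (rule vec.dim_subset)
  ultimately have "vec.dim ?S = vec.dim W" using A_dim[OF assms(1)] by simp
  then show ?thesis
    using vec.dim_sums_Int[of K K'] A_subspace assms A_dim[OF assms(1)] A_dim[OF assms(2)] by simp
qed

lemma codim2_lattice: "X \<in> codim2_flats A \<Longrightarrow> X \<in> int_lattice W A"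
proof -
  assume "X \<in> codim2_flats A"
  then obtain K K' where "X = K \<inter> K'" "K \<in> A" "K' \<in> A" by (auto simp: codim2_flats_def)
  then show ?thesis
    unfolding int_lattice_def using A_sub by (intro CollectI exI[of _ "{K, K'}"]) auto
qed

lemma lattice_dim0: "{X \<in> int_lattice W A. vec.dim X = vec.dim W} = {W}"
proof -
  have "X = W" if "X \<in> int_lattice W A" "vec.dim X = vec.dim W" for X
    using vec.subspace_dim_equal[of X W] that lattice_subspace lattice_sub W_subspace by simp
  then show ?thesis using W_lattice by blast
qed

lemma lattice_dim1: "{X \<in> int_lattice W A. vec.dim X + 1 = vec.dim W} = A"
proof (intro equalityI subsetI)
  fix X assume "X \<in> {X \<in> int_lattice W A. vec.dim X + 1 = vec.dim W}"
  then have X: "X \<in> int_lattice W A" "vec.dim X + 1 = vec.dim W" by auto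
  then have "X \<noteq> W" by auto
  then obtain K where "K \<in> A" "X \<subseteq> K" using lattice_cases X(1) by blast
  then have "X = K" using vec.subspace_dim_equal[of X K] lattice_subspace X A_subspace A_dim[of K] by simp
  then show "X \<in> A" using \<open>K \<in> A\<close> by simp
qed (use A_lattice A_dim in auto)

lemma lattice_dim2: "{X \<in> int_lattice W A. vec.dim X + 2 = vec.dim W} = codim2_flats A"
proof (intro equalityI subsetI)
  fix X assume "X \<in> {X \<in> int_lattice W A. vec.dim X + 2 = vec.dim W}"
  then have X: "X \<in> int_lattice W A" "vec.dim X + 2 = vec.dim W" by auto
  then have "X \<noteq> W" "X \<notin> A" using A_dim by force+
  then obtain K K' where K: "K \<in> A" "K' \<in> A" "K \<noteq> K'" "X \<subseteq> K \<inter> K'" using lattice_cases2 X(1) by blast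
  then have "X = K \<inter> K'"
    using vec.subspace_dim_equal[of X "K \<inter> K'"] lattice_subspace[OF X(1)] X(2) K dim_inter[OF K(1-3)]
      vec.subspace_inter[OF A_subspace[OF K(1)] A_subspace[OF K(2)]] by simp
  then show "X \<in> codim2_flats A" using K by (auto simp: codim2_flats_def)
next
  fix X assume X: "X \<in> codim2_flats A"
  then show "X \<in> {X \<in> int_lattice W A. vec.dim X + 2 = vec.dim W}"
    using codim2_lattice[OF X] dim_inter by (auto simp: codim2_flats_def)
qed

lemma moebius_W: "moebius W A W = 1"
  by (subst moebius.simps) simp

lemma moebius_hyperplane: "K \<in> A \<Longrightarrow> moebius W A K = -1"
proof -
  assume K: "K \<in> A"
  have "{Y \<in> int_lattice W A. K \<subset> Y} = {W}"
  proof (intro equalityI subsetI)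
    fix Y assume "Y \<in> {Y \<in> int_lattice W A. K \<subset> Y}"
    then have Y: "Y \<in> int_lattice W A" "K \<subset> Y" by auto
    have "\<not> Y \<subseteq> K'" if "K' \<in> A" for K' using hyperplane_eq[OF K that] Y(2) by blast
    then show "Y \<in> {W}" using lattice_cases[OF Y(1)] by blast
  next
    fix Y assume "Y \<in> {W}"
    moreover have "K \<noteq> W" using A_dim[OF K] by auto
    ultimately show "Y \<in> {Y \<in> int_lattice W A. K \<subset> Y}" using W_lattice A_sub[OF K] by auto
  qed
  moreover have "K \<noteq> W" using A_dim[OF K] by auto
  ultimately show ?thesis by (subst moebius.simps) (simp add: A_finite moebius_W)
qed

text \<open>Strictly above \<open>X\<close> there are only \<open>W\<close> and the hyperplanes
  through \<open>X\<close>, with values 1 and -1.\<close>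

lemma moebius_codim2:
  assumes X: "X \<in> codim2_flats A"
  shows "moebius W A X = int (card {K \<in> A. X \<subseteq> K}) - 1"
proof -
  obtain K1 K2 where K12: "X = K1 \<inter> K2" "K1 \<in> A" "K2 \<in> A" "K1 \<noteq> K2" using X by (auto simp: codim2_flats_def)
  have dX: "vec.dim X + 2 = vec.dim W" using dim_inter K12 by blast
  have XW: "X \<subset> W" using dX K12 A_sub by auto
  have "{Y \<in> int_lattice W A. X \<subset> Y} = insert W {K \<in> A. X \<subseteq> K}"
  proof (intro equalityI subsetI)
    fix Y assume "Y \<in> {Y \<in> int_lattice W A. X \<subset> Y}"
    then have Y: "Y \<in> int_lattice W A" "X \<subset> Y" by auto
    have "\<not> Y \<subseteq> K \<inter> K'" if "K \<in> A" "K' \<in> A" "K \<noteq> K'" for K K'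
    proof
      assume "Y \<subseteq> K \<inter> K'"
      then have "X \<subset> K \<inter> K'" using Y(2) by blast
      moreover have "vec.dim (K \<inter> K') \<le> vec.dim X" using dim_inter that dX by fastforce
      ultimately show False
        using vec.subspace_dim_equal[of X "K \<inter> K'"] lattice_subspace[OF codim2_lattice[OF X]] A_subspace that
          vec.subspace_inter by blast
    qed
    then show "Y \<in> insert W {K \<in> A. X \<subseteq> K}" using lattice_cases2[OF Y(1)] Y(2) by blast
  next
    fix Y assume Y: "Y \<in> insert W {K \<in> A. X \<subseteq> K}"
    show "Y \<in> {Y \<in> int_lattice W A. X \<subset> Y}"
    proof (cases "Y = W")
      case True
      then show ?thesis using W_lattice XW by simp
    next
      case False
      then have "Y \<in> A" "X \<subseteq> Y" using Y by auto
      moreover have "X \<noteq> Y" using dX A_dim[OF \<open>Y \<in> A\<close>] by auto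
      ultimately show ?thesis using A_lattice by auto
    qed
  qed
  moreover have "W \<notin> {K \<in> A. X \<subseteq> K}" using A_dim[of W] by auto
  ultimately have "moebius W A X = - (1 + (\<Sum>K\<in>{K \<in> A. X \<subseteq> K}. moebius W A K))"
    using XW A_finite moebius_W by (subst moebius.simps) auto
  also have "(\<Sum>K\<in>{K \<in> A. X \<subseteq> K}. moebius W A K) = (\<Sum>K\<in>{K \<in> A. X \<subseteq> K}. -1)"
    using moebius_hyperplane by (intro sum.cong) auto
  finally show ?thesis by simp
qed

lemma coeff_charpoly:
  "coeff (arr_charpoly W A) d = (\<Sum>X\<in>{X \<in> int_lattice W A. vec.dim X = d}. moebius W A X)"
proof -
  have "coeff (arr_charpoly W A) d = (\<Sum>X\<in>int_lattice W A. if vec.dim X = d then moebius W A X else 0)"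
    by (simp add: arr_charpoly_def coeff_sum)
  then show ?thesis
    by (simp add: sum.If_cases finite_int_lattice A_finite Int_def)
qed

lemma charpoly_coeffs:
  shows "coeff (arr_charpoly W A) (vec.dim W) = 1"
    and "vec.dim W = d + 1 \<Longrightarrow> coeff (arr_charpoly W A) d = - int (card A)"
    and "vec.dim W = d + 2 \<Longrightarrow> coeff (arr_charpoly W A) d = betti2 A"
    and "d > vec.dim W \<Longrightarrow> coeff (arr_charpoly W A) d = 0"
proof -
  show "coeff (arr_charpoly W A) (vec.dim W) = 1"
    unfolding coeff_charpoly lattice_dim0 by (simp add: moebius_W)
  show "coeff (arr_charpoly W A) d = - int (card A)" if "vec.dim W = d + 1"
  proof -
    have "{X \<in> int_lattice W A. vec.dim X = d} = A" using lattice_dim1 that by auto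
    then show ?thesis unfolding coeff_charpoly using moebius_hyperplane by simp
  qed
  show "coeff (arr_charpoly W A) d = betti2 A" if "vec.dim W = d + 2"
  proof -
    have "{X \<in> int_lattice W A. vec.dim X = d} = codim2_flats A" using lattice_dim2 that by auto
    then show ?thesis unfolding coeff_charpoly betti2_def using moebius_codim2 by simp
  qed
  show "coeff (arr_charpoly W A) d = 0" if "d > vec.dim W"
  proof -
    have "vec.dim X \<le> vec.dim W" if "X \<in> int_lattice W A" for X
      using lattice_sub[OF that] by (rule vec.dim_subset)
    then have empty: "{X \<in> int_lattice W A. vec.dim X = d} = {}" using that by fastforce
    show ?thesis unfolding coeff_charpoly empty by (rule sum.empty)
  qed
qed

end

text \<open>The degrees force a quotient \<open>[:s, t:]\<close>; the two top coefficients give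
  \<open>t = 1\<close> and \<open>s = int (card A') - int (card A)\<close>, and the third is the
  claim. Dimension at least three ensures that \<open>betti2 A'\<close> is a coefficient of the
  divisor.\<close>

lemma betti2_of_charpoly_dvd:
  assumes "central_arrangement W A" "central_arrangement H A'" "vec.dim H + 1 = vec.dim W" "vec.dim W \<ge> 3"
    and dvd: "arr_charpoly H A' dvd arr_charpoly W A"
  shows "betti2 A = betti2 A' + int (card A') * (int (card A) - int (card A'))"
proof -
  obtain d where d: "vec.dim W = d + 3" using assms(4) by (metis add.commute le_Suc_ex)
  have dH: "vec.dim H = d + 2" using assms(3) d by simp
  define p q where "p = arr_charpoly H A'" and "q = arr_charpoly W A"
  obtain r where r: "q = p * r" using dvd by (auto simp: p_def q_def elim: dvdE)
  note P = charpoly_coeffs[OF assms(2), folded p_def] and Q = charpoly_coeffs[OF assms(1), folded q_def]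
  have p: "coeff p (d + 2) = 1" "coeff p (d + 1) = - int (card A')" "coeff p d = betti2 A'"
    using P(1) P(2)[of "d + 1"] P(3)[of d] dH by simp_all
  have q: "coeff q (d + 3) = 1" "coeff q (d + 2) = - int (card A)" "coeff q (d + 1) = betti2 A"
    using Q(1) Q(2)[of "d + 2"] Q(3)[of "d + 1"] d by simp_all
  have degp: "degree p = d + 2"
    using p(1) P(4) dH by (intro antisym degree_le le_degree) auto
  have degq: "degree q = d + 3"
    using q(1) Q(4) d by (intro antisym degree_le le_degree) auto
  have "p \<noteq> 0" "r \<noteq> 0" using degp degq r by auto
  then have "degree r = 1" using degree_mult_eq[of p r] degp degq r by simp
  then obtain s t where st: "r = [:s, t:]" using degree1_coeffs[of r] by blast
  have q_eq: "q = smult s p + pCons 0 (smult t p)" unfolding r st by (simp add: mult_poly_0_right)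
  have coeffs: "coeff q (Suc k) = s * coeff p (Suc k) + t * coeff p k" for k
    unfolding q_eq by simp
  have "coeff q (Suc (d + 2)) = s * coeff p (Suc (d + 2)) + t * coeff p (d + 2)" by (rule coeffs)
  then have t: "t = 1" using p q P(4)[of "d + 3"] dH by (simp add: numeral_3_eq_3)
  have "coeff q (Suc (d + 1)) = s * coeff p (Suc (d + 1)) + t * coeff p (d + 1)" by (rule coeffs)
  then have s: "s = int (card A') - int (card A)" using p q t by simp
  have "coeff q (Suc d) = s * coeff p (Suc d) + t * coeff p d" by (rule coeffs)
  then show ?thesis using p q t s by (simp add: algebra_simps)
qed

section \<open>Comparison of local and global Betti numbers\<close>

text \<open>\<open>A\<close> is the arrangement without \<open>H\<close>, \<open>R\<close> its restriction to \<open>H\<close>, and the elements of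
  \<open>Y\<close> are the flats of codimension two in \<open>H\<close>.\<close>

lemma double_counting:
  fixes A :: "'a set" and R :: "'r set" and Y :: "'y set" and \<rho> :: "'a \<Rightarrow> 'r" and below :: "'y \<Rightarrow> 'r \<Rightarrow> bool"
  assumes "finite A" "finite R" "finite Y" "\<And>a. a \<in> A \<Longrightarrow> \<rho> a \<in> R"
    and uniq: "\<And>r s. r \<in> R \<Longrightarrow> s \<in> R \<Longrightarrow> r \<noteq> s \<Longrightarrow> \<exists>!y. y \<in> Y \<and> below y r \<and> below y s"
  shows "(\<Sum>y\<in>Y. card {a \<in> A. below y (\<rho> a)} * (card {r \<in> R. below y r} - 1)) = card A * (card R - 1)"
proof -
  \<comment> \<open>By \<open>uniq\<close>, the members of \<open>R\<close> other than
    \<open>\<rho> a\<close> are partitioned according to the unique \<open>y\<close> they share with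
    \<open>\<rho> a\<close>.\<close>
  have inner: "(\<Sum>y\<in>{y \<in> Y. below y (\<rho> a)}. card {r \<in> R. below y r} - 1) = card R - 1" if a: "a \<in> A" for a
  proof -
    have "card (R - {\<rho> a}) = (\<Sum>y\<in>{y \<in> Y. below y (\<rho> a)}. card {r \<in> R - {\<rho> a}. below y r})"
    proof -
      have U: "R - {\<rho> a} = (\<Union>y\<in>{y \<in> Y. below y (\<rho> a)}. {r \<in> R - {\<rho> a}. below y r})"
        using uniq[OF assms(4)[OF a]] by blast
      have "card (\<Union>y\<in>{y \<in> Y. below y (\<rho> a)}. {r \<in> R - {\<rho> a}. below y r})
          = (\<Sum>y\<in>{y \<in> Y. below y (\<rho> a)}. card {r \<in> R - {\<rho> a}. below y r})"
      proof (rule card_UN_disjoint)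
        show "\<forall>y\<in>{y \<in> Y. below y (\<rho> a)}. \<forall>y'\<in>{y \<in> Y. below y (\<rho> a)}. y \<noteq> y' \<longrightarrow>
            {r \<in> R - {\<rho> a}. below y r} \<inter> {r \<in> R - {\<rho> a}. below y' r} = {}"
          using uniq[OF assms(4)[OF a]] by blast
      qed (use assms(2,3) in auto)
      then show ?thesis unfolding U[symmetric] .
    qed
    also have "\<dots> = (\<Sum>y\<in>{y \<in> Y. below y (\<rho> a)}. card {r \<in> R. below y r} - 1)"
    proof (rule sum.cong)
      fix y assume y: "y \<in> {y \<in> Y. below y (\<rho> a)}"
      have "{r \<in> R - {\<rho> a}. below y r} = {r \<in> R. below y r} - {\<rho> a}" by auto
      then show "card {r \<in> R - {\<rho> a}. below y r} = card {r \<in> R. below y r} - 1"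
        using y assms(4)[OF a] by simp
    qed simp
    finally show ?thesis using assms(4)[OF a] by simp
  qed
  have "(\<Sum>y\<in>Y. card {a \<in> A. below y (\<rho> a)} * (card {r \<in> R. below y r} - 1))
      = (\<Sum>y\<in>Y. \<Sum>a\<in>A. if below y (\<rho> a) then card {r \<in> R. below y r} - 1 else 0)"
    using assms(1) by (simp add: sum.If_cases Int_def)
  also have "\<dots> = (\<Sum>a\<in>A. \<Sum>y\<in>Y. if below y (\<rho> a) then card {r \<in> R. below y r} - 1 else 0)"
    by (rule sum.swap)
  also have "\<dots> = (\<Sum>a\<in>A. card R - 1)"
    using inner assms(3) by (intro sum.cong) (simp_all add: sum.If_cases Int_def)
  finally show ?thesis by simp
qed

section \<open>Hyperplanes and their forms\<close>

definition pspace :: "'k::field ^ 'n ^ 'n \<Rightarrow> ('k ^ 'n::finite) set" where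
  "pspace P = {v. P *v v = v}"

text \<open>Invariance under \<open>P\<close> selects, for each linear function on the range of
  \<open>P\<close>, the covector vanishing on the kernel of \<open>P\<close>; this makes forms
  unique up to a scalar.\<close>

definition form_of :: "'k::field ^ 'n ^ 'n \<Rightarrow> ('k ^ 'n::finite) set \<Rightarrow> 'k ^ 'n \<Rightarrow> bool" where
  "form_of P K a \<longleftrightarrow> a v* P = a \<and> {v \<in> pspace P. dot a v = 0} = K"

definition log_der_on :: "'k::field ^ 'n ^ 'n \<Rightarrow> ('k ^ 'n::finite) set set \<Rightarrow> ('k, 'n) der set" where
  "log_der_on P A = {\<theta> \<in> Der P. \<forall>K\<in>A. \<forall>a. form_of P K a \<longrightarrow> linear_form a dvd pair a \<theta>}"

lemma pspace_mult: "P ** P = P \<Longrightarrow> P *v v \<in> pspace P"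
  by (simp add: pspace_def matrix_vector_mul_assoc)

lemma dot_invariant: "a v* P = a \<Longrightarrow> dot a (P *v v) = dot a v"
  by (simp flip: dot_vector_matrix)

lemma invariant_eqI:
  assumes "P ** P = P" "a v* P = a" "b v* P = b" "\<And>v. v \<in> pspace P \<Longrightarrow> dot a v = dot b v"
  shows "a = b"
proof (rule covector_eqI)
  fix v
  have "dot a (P *v v) = dot b (P *v v)" using assms(4) pspace_mult[OF assms(1)] by blast
  then show "dot a v = dot b v" using dot_invariant assms(2,3) by metis
qed

text \<open>A linear map \<open>g\<close> that kills \<open>K\<close> and fixes some
  \<open>w0\<close> outside it is followed by a covector with value 1 at \<open>w0\<close>;
  composing with \<open>P\<close> makes the result invariant.\<close>

lemma exists_form:
  assumes P: "P ** P = P" and K: "vec.subspace K" "K \<subseteq> pspace P" "vec.dim K + 1 = vec.dim (pspace P)"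
  shows "\<exists>a. form_of P K a"
proof -
  let ?W = "pspace P"
  obtain B where B: "B \<subseteq> K" "vec.independent B" "K \<subseteq> vec.span B" "card B = vec.dim K"
    using vec.basis_exists by blast
  have "\<not> ?W \<subseteq> K" using K(3) vec.dim_subset[of ?W K] by auto
  then obtain w0 where w0: "w0 \<in> ?W" "w0 \<notin> K" by blast
  have spanB: "vec.span B = K" using B(1,3) K(1) vec.span_minimal by blast
  then have ind: "vec.independent (insert w0 B)" using w0 B(2) by (simp add: vec.independent_insertI)
  obtain g where g: "Vector_Spaces.linear (*s) (*s) g" "\<forall>x\<in>insert w0 B. g x = (if x = w0 then w0 else 0)"
    using vec.linear_independent_extend[OF ind, of "\<lambda>x. if x = w0 then w0 else 0"] by blast
  have gw: "g w0 = w0" using g(2) by simp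
  have gB: "\<And>x. x \<in> B \<Longrightarrow> g x = 0" using g(2) w0 B(1) by auto
  have gK: "g x = 0" if "x \<in> K" for x
    using vec.linear_eq_0_on_span[OF g(1) gB] that spanB by blast
  have "w0 \<noteq> 0" using w0 K(1) vec.subspace_0 by blast
  then obtain a0 where a0: "dot a0 w0 = 1" using exists_dual_covector by blast
  define a where "a = (a0 v* matrix g) v* P"
  have dot_a: "dot a v = dot a0 (g v)" if "v \<in> ?W" for v
    using that by (simp add: a_def dot_vector_matrix matrix_works[OF g(1)] pspace_def)
  have "a v* P = a" by (simp only: a_def vector_matrix_assoc matrix_mul_assoc[symmetric] P)
  moreover have "{v \<in> ?W. dot a v = 0} = K"
  proof (intro equalityI subsetI)
    fix v assume v: "v \<in> {v \<in> ?W. dot a v = 0}"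
    have finB: "finite B" using vec.finiteI_independent[OF B(2)] .
    have "w0 \<notin> B" using w0 B(1) by blast
    then have "card (insert w0 B) = vec.dim ?W" using finB B(4) K(3) by simp
    moreover have "insert w0 B \<subseteq> ?W" using w0 B(1) K(2) by blast
    ultimately have "?W \<subseteq> vec.span (insert w0 B)" using vec.card_ge_dim_independent[OF _ ind] by simp
    then obtain k where k: "v - k *s w0 \<in> K" using v vec.span_breakdown_eq spanB by blast
    have "g v = g (v - k *s w0) + k *s g w0"
      using vec.linear_diff[OF g(1)] vec.linear_scale[OF g(1)] by simp
    then have "g v = k *s w0" using gK[OF k] gw by simp
    then have "k = 0" using v dot_a[of v] a0 by simp
    then show "v \<in> K" using k by simp
  next
    fix v assume "v \<in> K"
    then show "v \<in> {v \<in> ?W. dot a v = 0}" using K(2) dot_a gK by auto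
  qed
  ultimately show ?thesis unfolding form_of_def by blast
qed

lemma form_nonzero: "form_of P K a \<Longrightarrow> K \<noteq> pspace P \<Longrightarrow> a \<noteq> 0"
  by (auto simp: form_of_def)

lemma form_unique:
  assumes P: "P ** P = P" and ab: "form_of P K a" "form_of P K b" and K: "K \<noteq> pspace P"
  shows "proportional a b"
proof -
  obtain w0 where w0: "w0 \<in> pspace P" "w0 \<notin> K" using ab(1) K unfolding form_of_def by blast
  have a0: "dot a w0 \<noteq> 0" and b0: "dot b w0 \<noteq> 0" using w0 ab unfolding form_of_def by blast+
  have inv: "a v* P = a" "b v* P = b" using ab by (auto simp: form_of_def)
  define c where "c = dot b w0 / dot a w0"
  have "b = c *s a"
  proof (rule invariant_eqI[OF P])
    show "b v* P = b" "(c *s a) v* P = c *s a" using inv by (simp_all add: scale_vector_matrix)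
    fix v assume v: "v \<in> pspace P"
    define t where "t = dot a v / dot a w0"
    have "v - t *s w0 \<in> pspace P" using v w0 by (simp add: pspace_def vec.diff vec.scale)
    moreover have "dot a (v - t *s w0) = 0" using a0 by (simp add: t_def)
    ultimately have "v - t *s w0 \<in> K" using ab(1) unfolding form_of_def by blast
    then have "dot b (v - t *s w0) = 0" using ab(2) unfolding form_of_def by blast
    then have "dot b v = t * dot b w0" by simp
    then show "dot b v = dot (c *s a) v" using a0 by (simp add: t_def c_def)
  qed
  moreover have "c \<noteq> 0" using a0 b0 by (simp add: c_def)
  ultimately show ?thesis unfolding proportional_def by blast
qed

lemma form_dvd_cong:
  assumes "proportional a b" "linear_form a dvd pair a \<theta>"
  shows "linear_form b dvd pair b \<theta>"
proof -
  obtain c where c: "c \<noteq> 0" "b = c *s a" using assms(1) by (auto simp: proportional_def)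
  have "linear_form b dvd linear_form a" using proportional_dvd[OF proportional_sym[OF assms(1)]] .
  also have "linear_form a dvd mconst c * pair a \<theta>" using assms(2) by simp
  also have "mconst c * pair a \<theta> = pair b \<theta>" using c by simp
  finally show ?thesis .
qed

text \<open>Subtracting its components along dual vectors moves any \<open>v\<close> into the common
  kernel of \<open>a\<close> and \<open>b\<close>, so \<open>c\<close> is determined by its values
  on those two vectors.\<close>

lemma kernel_in_span2:
  assumes P: "P ** P = P" and inv: "a v* P = a" "b v* P = b" "c v* P = c" and ind: "indep2 a b"
    and ker: "\<And>v. v \<in> pspace P \<Longrightarrow> dot a v = 0 \<Longrightarrow> dot b v = 0 \<Longrightarrow> dot c v = 0"
  shows "in_span2 a b c"
proof -
  obtain d1 d2 where d: "dot a d1 = 1" "dot a d2 = 0" "dot b d1 = 0" "dot b d2 = 1"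
    using exists_dual_pair[OF ind] by blast
  define e1 e2 where "e1 = P *v d1" and "e2 = P *v d2"
  have e: "dot a e1 = 1" "dot a e2 = 0" "dot b e1 = 0" "dot b e2 = 1" "e1 \<in> pspace P" "e2 \<in> pspace P"
    unfolding e1_def e2_def dot_invariant[OF inv(1)] dot_invariant[OF inv(2)]
    by (rule d pspace_mult[OF P])+
  have "c = dot c e1 *s a + dot c e2 *s b"
  proof (rule invariant_eqI[OF P])
    show "c v* P = c" "(dot c e1 *s a + dot c e2 *s b) v* P = dot c e1 *s a + dot c e2 *s b"
      using inv by (simp_all add: add_vector_matrix scale_vector_matrix)
    fix v assume v: "v \<in> pspace P"
    let ?v = "v - dot a v *s e1 - dot b v *s e2"
    have "?v \<in> pspace P" using v e by (simp add: pspace_def vec.diff vec.scale)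
    then have "dot c ?v = 0" by (rule ker) (simp_all add: e)
    then show "dot c v = dot (dot c e1 *s a + dot c e2 *s b) v" by (simp add: algebra_simps)
  qed
  then show ?thesis unfolding in_span2_def by blast
qed

text \<open>Cramer's rule: independence of \<open>a\<close> and \<open>b\<close> makes the
  determinant \<open>D\<close> nonzero, so \<open>u\<close> and \<open>v\<close> can be recovered
  from them.\<close>

lemma in_span2_exchange:
  assumes ind: "indep2 a b" and a: "in_span2 u v a" and b: "in_span2 u v b" and c: "in_span2 u v c"
  shows "in_span2 a b c"
proof -
  obtain a1 a2 where a: "a = a1 *s u + a2 *s v" using a by (auto simp: in_span2_def)
  obtain b1 b2 where b: "b = b1 *s u + b2 *s v" using b by (auto simp: in_span2_def)
  obtain c1 c2 where c: "c = c1 *s u + c2 *s v" using c by (auto simp: in_span2_def)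
  define D where "D = a1 * b2 - a2 * b1"
  have 1: "b2 *s a + (- a2) *s b = D *s u" "(- b1) *s a + a1 *s b = D *s v"
    unfolding a b D_def by (simp_all add: vec_eq_iff algebra_simps)
  have D: "D \<noteq> 0"
  proof
    assume D0: "D = 0"
    then have "b2 *s a + (- a2) *s b = 0" "(- b1) *s a + a1 *s b = 0" using 1 by simp_all
    then have "b2 = 0 \<and> - a2 = 0" "- b1 = 0 \<and> a1 = 0" using ind unfolding indep2_def by blast+
    then have "a = 0" using a by simp
    then show False using indep2_nonzero[OF ind] by blast
  qed
  have u: "u = (b2 / D) *s a + (- a2 / D) *s b" and v: "v = (- b1 / D) *s a + (a1 / D) *s b"
  proof -
    have "inverse D *s (D *s u) = inverse D *s (b2 *s a + (- a2) *s b)"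
      "inverse D *s (D *s v) = inverse D *s ((- b1) *s a + a1 *s b)" by (simp_all only: 1)
    then show "u = (b2 / D) *s a + (- a2 / D) *s b" "v = (- b1 / D) *s a + (a1 / D) *s b"
      using D by (simp_all add: vector_add_ldistrib vector_smult_assoc divide_inverse mult.commute)
  qed
  have "c = (c1 * (b2 / D) + c2 * (- b1 / D)) *s a + (c1 * (- a2 / D) + c2 * (a1 / D)) *s b"
    unfolding c by (subst u, subst v) (simp add: vec_eq_iff algebra_simps)
  then show ?thesis unfolding in_span2_def by blast
qed

text \<open>Allows the flag to be descended one hyperplane at a time, each restriction being taken
  inside the previous one.\<close>

lemma restriction_restriction:
  assumes "Y \<subseteq> X"
  shows "restriction (restriction A X) Y = restriction A Y"
proof (intro equalityI subsetI)
  fix Z assume "Z \<in> restriction (restriction A X) Y"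
  then show "Z \<in> restriction A Y" using assms unfolding restriction_def localization_def by blast
next
  fix Z assume "Z \<in> restriction A Y"
  then obtain K where K: "K \<in> A" "\<not> Y \<subseteq> K" "Z = K \<inter> Y" by (auto simp: restriction_def localization_def)
  have "K \<inter> X \<in> restriction A X" using K assms by (auto simp: restriction_def localization_def)
  moreover have "\<not> Y \<subseteq> K \<inter> X" "Z = (K \<inter> X) \<inter> Y" using K assms by auto
  ultimately show "Z \<in> restriction (restriction A X) Y"
    unfolding restriction_def[of "restriction A X"] localization_def by blast
qed

section \<open>From sets of hyperplanes to linear forms\<close>

locale arr_hyp =
  fixes P :: "'k::field ^ 'n ^ 'n::finite" and A :: "('k ^ 'n) set set" and H :: "('k ^ 'n) set"
  assumes P: "P ** P = P" and arr: "central_arrangement (pspace P) A" and H: "H \<in> A"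
begin

abbreviation W where "W \<equiv> pspace P"

definition \<alpha> :: "('k ^ 'n) set \<Rightarrow> 'k ^ 'n" where "\<alpha> K = (SOME a. form_of P K a)"

lemma \<alpha>: "K \<in> A \<Longrightarrow> form_of P K (\<alpha> K)"
  unfolding \<alpha>_def
  using exists_form[OF P] A_subspace[OF arr] A_sub[OF arr] A_dim[OF arr] by (metis someI_ex)

lemma \<alpha>P: "K \<in> A \<Longrightarrow> \<alpha> K v* P = \<alpha> K"
  and \<alpha>_iff: "K \<in> A \<Longrightarrow> v \<in> W \<Longrightarrow> v \<in> K \<longleftrightarrow> dot (\<alpha> K) v = 0"
  using \<alpha> unfolding form_of_def by blast+

lemma AW: "K \<in> A \<Longrightarrow> K \<noteq> W" using A_dim[OF arr, of W] by auto

lemma \<alpha>_nonzero: "K \<in> A \<Longrightarrow> \<alpha> K \<noteq> 0" using form_nonzero \<alpha> AW by blast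

lemma \<alpha>_proportional: "K \<in> A \<Longrightarrow> K' \<in> A \<Longrightarrow> proportional (\<alpha> K) (\<alpha> K') \<Longrightarrow> K = K'"
proof -
  assume K: "K \<in> A" "K' \<in> A" "proportional (\<alpha> K) (\<alpha> K')"
  then obtain c where c: "c \<noteq> 0" "\<alpha> K' = c *s \<alpha> K" by (auto simp: proportional_def)
  have "v \<in> K \<longleftrightarrow> v \<in> K'" if "v \<in> W" for v
    using \<alpha>_iff[OF K(1) that] \<alpha>_iff[OF K(2) that] c by simp
  then show "K = K'" using A_sub[OF arr K(1)] A_sub[OF arr K(2)] by blast
qed

lemma \<alpha>_inj: "inj_on \<alpha> A"
  by (rule inj_onI) (metis \<alpha>_proportional proportional_refl)

definition z :: "'k ^ 'n" where "z = \<alpha> H"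

definition w :: "'k ^ 'n" where "w = (SOME w. w \<in> W \<and> dot z w = 1)"

definition \<Lambda> :: "('k ^ 'n) set" where "\<Lambda> = \<alpha> ` (A - {H})"

text \<open>A section of the map from \<open>K\<close> to \<open>K \<inter> H\<close>; it supplies
  the representatives that \<open>arr_reps\<close> asks for.\<close>

definition pick :: "('k ^ 'n) set \<Rightarrow> ('k ^ 'n) set" where
  "pick X = (SOME K. K \<in> A - {H} \<and> K \<inter> H = X)"

abbreviation RH where "RH \<equiv> restriction A H"

definition N :: "('k ^ 'n) set" where "N = \<alpha> ` pick ` RH"

lemma w: "w \<in> W" "dot z w = 1"
proof -
  obtain u where u: "dot z u = 1" using exists_dual_vector \<alpha>_nonzero[OF H] by (auto simp: z_def)
  have "P *v u \<in> W \<and> dot z (P *v u) = 1"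
    using u pspace_mult[OF P] dot_invariant[OF \<alpha>P[OF H]] by (simp add: z_def)
  then have "w \<in> W \<and> dot z w = 1" unfolding w_def by (rule someI)
  then show "w \<in> W" "dot z w = 1" by auto
qed

lemma RH_eq: "RH = (\<lambda>K. K \<inter> H) ` (A - {H})"
proof -
  have "A - localization A H = A - {H}"
    using hyperplane_eq[OF arr H] H by (auto simp: localization_def)
  then show ?thesis by (simp add: restriction_def)
qed

lemma pick: "X \<in> RH \<Longrightarrow> pick X \<in> A - {H}" "X \<in> RH \<Longrightarrow> pick X \<inter> H = X"
proof -
  have "X \<in> RH \<Longrightarrow> pick X \<in> A - {H} \<and> pick X \<inter> H = X"
    unfolding pick_def by (rule someI_ex) (auto simp: RH_eq)
  then show "X \<in> RH \<Longrightarrow> pick X \<in> A - {H}" "X \<in> RH \<Longrightarrow> pick X \<inter> H = X" by auto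
qed

sublocale S0: arr_setup P w z \<Lambda>
proof
  show "P ** P = P" by (rule P)
  show "P *v w = w" using w by (simp add: pspace_def)
  show "z v* P = z" using \<alpha>P[OF H] by (simp add: z_def)
  show "dot z w = 1" by (rule w)
  show "finite \<Lambda>" using A_finite[OF arr] by (simp add: \<Lambda>_def)
  show "a v* P = a" if "a \<in> \<Lambda>" for a using that \<alpha>P by (auto simp: \<Lambda>_def)
  show "a \<noteq> c *s z" if a: "a \<in> \<Lambda>" for a c
  proof
    assume eq: "a = c *s z"
    obtain K where K: "K \<in> A" "K \<noteq> H" "a = \<alpha> K" using a by (auto simp: \<Lambda>_def)
    then have "c \<noteq> 0" using eq \<alpha>_nonzero[OF K(1)] by auto
    moreover have "\<alpha> K = c *s \<alpha> H" using eq K(3) by (simp add: z_def)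
    ultimately have "proportional (\<alpha> H) (\<alpha> K)" unfolding proportional_def by blast
    then show False using \<alpha>_proportional[OF H K(1)] K(2) by blast
  qed
  show "a = b" if "a \<in> \<Lambda>" "b \<in> \<Lambda>" "proportional a b" for a b
    using that \<alpha>_proportional by (auto simp: \<Lambda>_def)
qed

lemma pspace_Q: "pspace S0.Q = H"
proof (intro equalityI subsetI)
  fix v assume v: "v \<in> pspace S0.Q"
  then have Qv: "S0.Q *v v = v" by (simp add: pspace_def)
  have "P *v (S0.Q *v v) = S0.Q *v v" by (simp only: matrix_vector_mul_assoc S0.PQ)
  then have vW: "v \<in> W" by (simp add: pspace_def Qv)
  have "dot z (S0.Q *v v) = 0" by (simp flip: dot_vector_matrix)
  then have "dot z v = 0" by (simp only: Qv)
  then show "v \<in> H" using \<alpha>_iff[OF H vW] by (simp add: z_def)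
next
  fix v assume v: "v \<in> H"
  then have vW: "v \<in> W" using A_sub[OF arr H] by blast
  have "dot z v = 0" using \<alpha>_iff[OF H vW] v by (simp add: z_def)
  then show "v \<in> pspace S0.Q"
    using vW by (simp add: pspace_def S0.Q_def matrix_vector_diff tens_mult_vector)
qed

lemma H_dot: "v \<in> H \<Longrightarrow> dot z v = 0" "v \<in> H \<Longrightarrow> v \<in> W"
  using \<alpha>_iff[OF H] A_sub[OF arr H] by (auto simp: z_def)

lemma res_dot: "v \<in> H \<Longrightarrow> dot (S0.res a) v = dot a v"
  by (simp add: S0.res_def H_dot)

lemma res_form: "K \<in> A - {H} \<Longrightarrow> form_of S0.Q (K \<inter> H) (S0.res (\<alpha> K))"
  unfolding form_of_def pspace_Q
  using S0.res_Q \<alpha>P \<alpha>_iff H_dot res_dot by auto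

lemma RH_neq: "K \<in> A - {H} \<Longrightarrow> K \<inter> H \<noteq> H"
  using hyperplane_eq[OF arr H] by blast

lemma res_proportional:
  assumes "K \<in> A - {H}" "K' \<in> A - {H}"
  shows "proportional (S0.res (\<alpha> K)) (S0.res (\<alpha> K')) \<longleftrightarrow> K \<inter> H = K' \<inter> H"
proof
  assume "proportional (S0.res (\<alpha> K)) (S0.res (\<alpha> K'))"
  then obtain c where "c \<noteq> 0" "S0.res (\<alpha> K') = c *s S0.res (\<alpha> K)" by (auto simp: proportional_def)
  then show "K \<inter> H = K' \<inter> H"
    using res_form[OF assms(1)] res_form[OF assms(2)] by (auto simp: form_of_def)
next
  assume eq: "K \<inter> H = K' \<inter> H"
  show "proportional (S0.res (\<alpha> K)) (S0.res (\<alpha> K'))"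
    using form_unique[OF S0.QQ res_form[OF assms(1)] res_form[OF assms(2), folded eq]]
      RH_neq[OF assms(1)] by (simp add: pspace_Q)
qed

sublocale S: arr_reps P w z \<Lambda> N
proof
  show "N \<subseteq> \<Lambda>" using pick by (auto simp: N_def \<Lambda>_def)
  fix a assume "a \<in> \<Lambda>"
  then obtain K where K: "K \<in> A - {H}" "a = \<alpha> K" by (auto simp: \<Lambda>_def)
  have X: "K \<inter> H \<in> RH" using K by (auto simp: RH_eq)
  then have "proportional (S0.res a) (S0.res (\<alpha> (pick (K \<inter> H))))"
    using res_proportional[OF K(1) pick(1)[OF X]] pick(2)[OF X] K(2) by simp
  then show "\<exists>b\<in>N. proportional (S0.res a) (S0.res b)" using X by (auto simp: N_def)
next
  fix a b assume "a \<in> N" "b \<in> N" "proportional (S0.res a) (S0.res b)"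
  then obtain X X' where X: "X \<in> RH" "X' \<in> RH" "a = \<alpha> (pick X)" "b = \<alpha> (pick X')"
    "proportional (S0.res (\<alpha> (pick X))) (S0.res (\<alpha> (pick X')))" by (auto simp: N_def)
  then have "X = X'" using res_proportional pick by metis
  then show "a = b" using X by simp
qed

lemma finite_RH: "finite RH"
  using A_finite[OF arr] by (simp add: RH_eq)

lemma inj_pick: "inj_on (\<alpha> \<circ> pick) RH"
proof (rule inj_onI)
  fix X X' assume X: "X \<in> RH" "X' \<in> RH" "(\<alpha> \<circ> pick) X = (\<alpha> \<circ> pick) X'"
  then have "pick X = pick X'" using inj_onD[OF \<alpha>_inj] pick(1) by (metis DiffD1 comp_apply)
  then show "X = X'" using pick(2) X by metis
qed

lemma central_RH: "central_arrangement H RH"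
  unfolding central_arrangement_def
proof (intro conjI ballI)
  show "vec.subspace H" by (rule A_subspace[OF arr H])
  show "finite RH" by (rule finite_RH)
  fix X assume "X \<in> RH"
  then obtain K where K: "K \<in> A" "K \<noteq> H" "X = K \<inter> H" by (auto simp: RH_eq)
  show "vec.subspace X" using K A_subspace[OF arr] H by (simp add: vec.subspace_inter)
  show "X \<subseteq> H" using K by blast
  show "vec.dim X + 1 = vec.dim H" using dim_inter[OF arr K(1) H K(2)] A_dim[OF arr H] K(3) by simp
qed

lemma DP_eq: "S.DP = log_der_on P A"
proof -
  have iff: "(\<forall>a. form_of P K a \<longrightarrow> linear_form a dvd pair a \<theta>) \<longleftrightarrow> linear_form (\<alpha> K) dvd pair (\<alpha> K) \<theta>"
    if "K \<in> A" for K \<theta>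
    using \<alpha>[OF that] form_unique[OF P \<alpha>[OF that] _ AW[OF that]] form_dvd_cong by blast
  have "A = insert H (A - {H})" using H by blast
  then have "(\<forall>K\<in>A. linear_form (\<alpha> K) dvd pair (\<alpha> K) \<theta>) \<longleftrightarrow>
      linear_form z dvd pair z \<theta> \<and> (\<forall>a\<in>\<Lambda>. linear_form a dvd pair a \<theta>)" for \<theta>
    unfolding \<Lambda>_def z_def by blast
  then show ?thesis unfolding S.DP_def log_der_on_def using iff by auto
qed

lemma DQ_eq: "S0.DQ = log_der_on S0.Q RH"
proof -
  have iff: "(\<forall>a. form_of S0.Q (K \<inter> H) a \<longrightarrow> linear_form a dvd pair a \<theta>) \<longleftrightarrow>
      linear_form (S0.res (\<alpha> K)) dvd pair (S0.res (\<alpha> K)) \<theta>" if K: "K \<in> A - {H}" for K \<theta>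
  proof -
    have "proportional (S0.res (\<alpha> K)) a" if "form_of S0.Q (K \<inter> H) a" for a
      using form_unique[OF S0.QQ res_form[OF K] that] RH_neq[OF K] by (simp add: pspace_Q)
    then show ?thesis using res_form[OF K] form_dvd_cong by blast
  qed
  have "(\<forall>X\<in>RH. \<forall>a. form_of S0.Q X a \<longrightarrow> linear_form a dvd pair a \<theta>) \<longleftrightarrow>
      (\<forall>a\<in>\<Lambda>. linear_form (S0.res a) dvd pair (S0.res a) \<theta>)" for \<theta>
    unfolding RH_eq \<Lambda>_def using iff by auto
  then show ?thesis unfolding S0.DQ_def log_der_on_def by auto
qed

end

text \<open>\<open>rank3_defect\<close> for the localization at the flat. Index set and incidence
  stay abstract, so that actual flats of the global arrangement can be inserted.\<close>

lemma (in arr_flat) flat_defect: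
  fixes EE :: "'e set" and inc :: "'a ^ 'b \<Rightarrow> 'e \<Rightarrow> bool"
  assumes "finite EE"
    and "\<And>a b. a \<in> \<Lambda>U \<Longrightarrow> b \<in> \<Lambda>U \<Longrightarrow> a \<noteq> b \<Longrightarrow> \<not> in_span2 a b z \<Longrightarrow> \<exists>e\<in>EE. inc a e \<and> inc b e"
    and "\<And>e a b c. e \<in> EE \<Longrightarrow> a \<in> \<Lambda>U \<Longrightarrow> b \<in> \<Lambda>U \<Longrightarrow> a \<noteq> b \<Longrightarrow> inc a e \<Longrightarrow> inc b e \<Longrightarrow>
      c \<in> \<Lambda>U \<Longrightarrow> inc c e \<Longrightarrow> in_span2 a b c"
    and "\<And>e e' a b. e \<in> EE \<Longrightarrow> e' \<in> EE \<Longrightarrow> a \<in> \<Lambda>U \<Longrightarrow> b \<in> \<Lambda>U \<Longrightarrow> a \<noteq> b \<Longrightarrow>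
      inc a e \<Longrightarrow> inc b e \<Longrightarrow> inc a e' \<Longrightarrow> inc b e' \<Longrightarrow> e = e'"
    and "\<And>e a b c. e \<in> EE \<Longrightarrow> a \<in> \<Lambda>U \<Longrightarrow> b \<in> \<Lambda>U \<Longrightarrow> a \<noteq> b \<Longrightarrow> inc a e \<Longrightarrow> inc b e \<Longrightarrow>
      c \<in> \<Lambda>U \<Longrightarrow> in_span2 a b c \<Longrightarrow> inc c e"
  shows "(card NU - 1) * (card \<Lambda>U + 1 - card NU) \<le> (\<Sum>e\<in>EE. card {a \<in> \<Lambda>U. inc a e} - 1)"
    and "(\<Sum>e\<in>EE. card {a \<in> \<Lambda>U. inc a e} - 1) = (card NU - 1) * (card \<Lambda>U + 1 - card NU) \<Longrightarrow> flat_lifts"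
proof -
  interpret R3: arr_rank3 P3 w z \<Lambda>U NU i x2 e1 e2 by (rule arr_rank3)
  interpret R: arr_rank3_flats P3 w z \<Lambda>U NU i x2 e1 e2 EE inc
    by unfold_locales (rule assms; assumption)+
  show "(card NU - 1) * (card \<Lambda>U + 1 - card NU) \<le> (\<Sum>e\<in>EE. card {a \<in> \<Lambda>U. inc a e} - 1)"
    using R.rank3_defect(1) unfolding R.defect_def .
  show "flat_lifts" if "(\<Sum>e\<in>EE. card {a \<in> \<Lambda>U. inc a e} - 1) = (card NU - 1) * (card \<Lambda>U + 1 - card NU)"
    unfolding flat_lifts_def using R.rank3_defect(2) that unfolding R.defect_def .
qed

text \<open>All restrictions are proportional, so any two members of \<open>\<Lambda>U\<close> have
  \<open>z\<close> in their span and no flat lies off the hyperplane. With an empty index set both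
  sides of the equality in \<open>flat_defect\<close> are 0, since
  \<open>card NU = 1\<close>.\<close>

lemma (in arr_flat) flat_lifts_single:
  assumes Ni: "N = {i}"
  shows flat_lifts
proof -
  have res_i: "proportional (res i) (res a)" if "a \<in> \<Lambda>" for a
    using N_rep[OF that] Ni proportional_sym by blast
  have span_z: "in_span2 a b z" if ab: "a \<in> \<Lambda>U" "b \<in> \<Lambda>U" "a \<noteq> b" for a b
  proof -
    have ab\<Lambda>: "a \<in> \<Lambda>" "b \<in> \<Lambda>" using ab(1,2) unfolding \<Lambda>U_def by blast+
    have "proportional (res a) (res b)"
      by (rule proportional_trans[OF proportional_sym[OF res_i[OF ab\<Lambda>(1)]] res_i[OF ab\<Lambda>(2)]])
    then obtain c d where cd: "c \<noteq> 0" "b = c *s a + d *s z" using proportional_res by blast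
    have "d \<noteq> 0"
    proof
      assume "d = 0"
      then have "proportional a b" using cd unfolding proportional_def by auto
      then show False using \<Lambda>_distinct ab\<Lambda> ab(3) by blast
    qed
    then have "z = (- c / d) *s a + (1 / d) *s b"
      unfolding cd(2) by (simp add: vec_eq_iff field_simps)
    then show ?thesis unfolding in_span2_def by blast
  qed
  have NU: "NU = {i}" using i\<Lambda>U Ni by blast
  show ?thesis
    by (rule flat_defect(2)[of "{} :: nat set" "\<lambda>_ _. False"]) (use span_z in \<open>auto simp: NU\<close>)
qed

section \<open>Counting flats of codimension two locally and globally\<close>

context arr_hyp
begin

definition off_flats :: "('k ^ 'n) set \<Rightarrow> ('k ^ 'n) set set" where
  "off_flats Y = {X \<in> codim2_flats A. \<not> X \<subseteq> H \<and> X \<inter> H = Y}"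

text \<open>The contribution to \<open>betti2 A\<close> of the flats off \<open>H\<close> with trace
  \<open>Y\<close> on \<open>H\<close>. Such flats lie in no way on \<open>H\<close>, so leaving
  \<open>H\<close> out of the count changes nothing.\<close>

definition off_defect :: "('k ^ 'n) set \<Rightarrow> nat" where
  "off_defect Y = (\<Sum>X\<in>off_flats Y. card {K \<in> A - {H}. X \<subseteq> K} - 1)"

definition below_RH :: "('k ^ 'n) set \<Rightarrow> nat" where "below_RH Y = card {Z \<in> RH. Y \<subseteq> Z}"

definition below_A :: "('k ^ 'n) set \<Rightarrow> nat" where "below_A Y = card {K \<in> A - {H}. Y \<subseteq> K \<inter> H}"

lemma \<alpha>_indep2: "K \<in> A \<Longrightarrow> K' \<in> A \<Longrightarrow> K \<noteq> K' \<Longrightarrow> indep2 (\<alpha> K) (\<alpha> K')"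
  using \<alpha>_proportional \<alpha>_nonzero by (intro indep2I) blast+

lemma subset_iff_in_span2:
  assumes K: "K1 \<in> A" "K2 \<in> A" "K1 \<noteq> K2" "K \<in> A"
  shows "K1 \<inter> K2 \<subseteq> K \<longleftrightarrow> in_span2 (\<alpha> K1) (\<alpha> K2) (\<alpha> K)"
proof
  assume sub: "K1 \<inter> K2 \<subseteq> K"
  show "in_span2 (\<alpha> K1) (\<alpha> K2) (\<alpha> K)"
    by (rule kernel_in_span2[OF P \<alpha>P \<alpha>P \<alpha>P \<alpha>_indep2]) (use K sub \<alpha>_iff in blast)+
next
  assume "in_span2 (\<alpha> K1) (\<alpha> K2) (\<alpha> K)"
  then obtain c d where cd: "\<alpha> K = c *s \<alpha> K1 + d *s \<alpha> K2" by (auto simp: in_span2_def)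
  show "K1 \<inter> K2 \<subseteq> K"
  proof
    fix v assume v: "v \<in> K1 \<inter> K2"
    then have "v \<in> W" using A_sub[OF arr K(1)] by blast
    then show "v \<in> K" using v \<alpha>_iff K cd by simp
  qed
qed

lemma codim2_eqI:
  assumes "X \<in> codim2_flats A" "K \<in> A" "K' \<in> A" "K \<noteq> K'" "X \<subseteq> K" "X \<subseteq> K'"
  shows "X = K \<inter> K'"
proof -
  have "vec.subspace X" using lattice_subspace[OF arr codim2_lattice[OF arr assms(1)]] .
  moreover have "vec.subspace (K \<inter> K')" using A_subspace[OF arr] assms(2,3) vec.subspace_inter by blast
  moreover have "vec.dim X + 2 = vec.dim W" using assms(1) dim_inter[OF arr] by (auto simp: codim2_flats_def)
  ultimately show ?thesis
    using vec.subspace_dim_equal[of X "K \<inter> K'"] dim_inter[OF arr assms(2-4)] assms(5,6) by simp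
qed

lemma H_subset_iff:
  assumes "K1 \<in> A" "K2 \<in> A" "K1 \<noteq> K2"
  shows "K1 \<inter> K2 \<subseteq> H \<longleftrightarrow> in_span2 (\<alpha> K1) (\<alpha> K2) z"
  using subset_iff_in_span2[OF assms H] by (simp add: z_def)

text \<open>The flats off \<open>H\<close> with trace \<open>Y\<close> are the flats of codimension
  two of the localization at \<open>Y\<close> that are not on \<open>H\<close>. They serve as the
  index set of \<open>flat_defect\<close>, a form being incident with a flat when it vanishes
  there.\<close>

lemma flat_local:
  assumes F: "arr_flat P w z \<Lambda> N i (S0.res j) e1 e2" and ij: "i \<in> N" "j \<in> N" "j \<noteq> i"
    and Y: "Y = {v \<in> H. dot i v = 0 \<and> dot j v = 0}"
  shows "(below_RH Y - 1) * (below_A Y + 1 - below_RH Y) \<le> off_defect Y"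
    and "off_defect Y = (below_RH Y - 1) * (below_A Y + 1 - below_RH Y) \<Longrightarrow>
      arr_flat.flat_lifts w z \<Lambda> N i (S0.res j) e1 e2"
proof -
  interpret F: arr_flat P w z \<Lambda> N i "S0.res j" e1 e2 by (rule F)
  have ij\<Lambda>: "i \<in> \<Lambda>" "j \<in> \<Lambda>" using ij S.N_sub by auto
  have ind: "indep2 (S0.res i) (S0.res j)"
    using ij S.N_distinct S0.res_nonzero ij\<Lambda> by (intro indep2I) blast+
  have U_iff: "\<alpha> K \<in> F.\<Lambda>U \<longleftrightarrow> Y \<subseteq> K" if K: "K \<in> A - {H}" for K
  proof
    assume "\<alpha> K \<in> F.\<Lambda>U"
    then obtain c d where cd: "S0.res (\<alpha> K) = c *s S0.res i + d *s S0.res j"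
      by (auto simp: F.\<Lambda>U_def in_span2_def F.x1_def)
    show "Y \<subseteq> K"
    proof
      fix v assume v: "v \<in> Y"
      then have vH: "v \<in> H" "dot i v = 0" "dot j v = 0" by (auto simp: Y)
      then have "dot (\<alpha> K) v = 0" using arg_cong[OF cd, of "\<lambda>a. dot a v"] by (simp add: res_dot)
      then show "v \<in> K" using \<alpha>_iff K H_dot(2)[OF vH(1)] by blast
    qed
  next
    assume sub: "Y \<subseteq> K"
    have "in_span2 (S0.res i) (S0.res j) (S0.res (\<alpha> K))"
    proof (rule kernel_in_span2[OF S0.QQ _ _ _ ind])
      show "S0.res i v* S0.Q = S0.res i" "S0.res j v* S0.Q = S0.res j" "S0.res (\<alpha> K) v* S0.Q = S0.res (\<alpha> K)"
        using S0.res_Q S0.\<Lambda>P ij\<Lambda> \<alpha>P K by auto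
      fix v assume v: "v \<in> pspace S0.Q" "dot (S0.res i) v = 0" "dot (S0.res j) v = 0"
      then have "v \<in> Y" by (simp add: Y pspace_Q res_dot)
      then show "dot (S0.res (\<alpha> K)) v = 0" using sub \<alpha>_iff K v(1) H_dot by (auto simp: pspace_Q res_dot)
    qed
    moreover have "\<alpha> K \<in> \<Lambda>" unfolding \<Lambda>_def using K by blast
    ultimately show "\<alpha> K \<in> F.\<Lambda>U" by (simp add: F.\<Lambda>U_def F.x1_def)
  qed
  have U_obtain: "\<exists>K\<in>A - {H}. a = \<alpha> K \<and> Y \<subseteq> K" if "a \<in> F.\<Lambda>U" for a
  proof -
    have "a \<in> \<Lambda>" using that by (simp add: F.\<Lambda>U_def)
    then obtain K where "K \<in> A - {H}" "a = \<alpha> K" unfolding \<Lambda>_def by blast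
    then show ?thesis using that U_iff by blast
  qed
  let ?inc = "\<lambda>a X. \<forall>v\<in>X. dot a v = 0"
  have inc_iff: "?inc (\<alpha> K) X \<longleftrightarrow> X \<subseteq> K" if "K \<in> A" "X \<in> codim2_flats A" for K X
  proof -
    have "X \<subseteq> W" using lattice_sub[OF arr codim2_lattice[OF arr that(2)]] .
    then show ?thesis using \<alpha>_iff[OF that(1)] by blast
  qed
  have off: "X \<in> codim2_flats A" "X \<inter> H = Y" "\<not> X \<subseteq> H" if "X \<in> off_flats Y" for X
    using that by (auto simp: off_flats_def)
  have fd1: "finite (off_flats Y)"
    using finite_codim2_flats[OF A_finite[OF arr]] by (simp add: off_flats_def)
  have fd2: "\<exists>e\<in>off_flats Y. ?inc a e \<and> ?inc b e"
    if ab: "a \<in> F.\<Lambda>U" "b \<in> F.\<Lambda>U" "a \<noteq> b" "\<not> in_span2 a b z" for a b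
  proof -
    obtain Ka Kb where K: "Ka \<in> A - {H}" "a = \<alpha> Ka" "Y \<subseteq> Ka" "Kb \<in> A - {H}" "b = \<alpha> Kb" "Y \<subseteq> Kb"
      using U_obtain ab by meson
    let ?X = "Ka \<inter> Kb"
    have ne: "Ka \<noteq> Kb" using K ab(3) by blast
    have X: "?X \<in> codim2_flats A" using K ne by (auto simp: codim2_flats_def)
    have XH: "\<not> ?X \<subseteq> H" using H_subset_iff[of Ka Kb] K ne ab(4) by simp
    \<comment> \<open>Hyperplanes with the same trace on \<open>H\<close> would meet inside
      \<open>H\<close>, whereas \<open>z\<close> is not in the span of \<open>a\<close> and
      \<open>b\<close>.\<close>
    have "\<not> proportional (S0.res a) (S0.res b)"
    proof
      assume "proportional (S0.res a) (S0.res b)"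
      then have eq: "Ka \<inter> H = Kb \<inter> H" using res_proportional K by simp
      have "Ka \<inter> H = Ka \<inter> Kb"
      proof (rule codim2_eqI)
        show "Ka \<inter> H \<in> codim2_flats A" using K H by (auto simp: codim2_flats_def)
      qed (use K ne eq in auto)
      then show False using XH by blast
    qed
    then have indr: "indep2 (S0.res a) (S0.res b)"
      using ab S0.res_nonzero by (intro indep2I) (auto simp: F.\<Lambda>U_def)
    have sp: "in_span2 (S0.res i) (S0.res j) (S0.res a)" "in_span2 (S0.res i) (S0.res j) (S0.res b)"
      using ab by (auto simp: F.\<Lambda>U_def F.x1_def)
    have sp': "in_span2 (S0.res i) (S0.res j) (S0.res i)" "in_span2 (S0.res i) (S0.res j) (S0.res j)"
    proof -
      have "S0.res j = 0 *s S0.res i + 1 *s S0.res j" by simp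
      then show "in_span2 (S0.res i) (S0.res j) (S0.res j)" unfolding in_span2_def by blast
    qed (rule in_span2_left)
    have i: "in_span2 (S0.res a) (S0.res b) (S0.res i)" and j: "in_span2 (S0.res a) (S0.res b) (S0.res j)"
      using in_span2_exchange[OF indr sp] sp' by blast+
    have "?X \<inter> H = Y"
    proof (intro equalityI subsetI)
      fix v assume v: "v \<in> ?X \<inter> H"
      then have "dot (S0.res a) v = 0" "dot (S0.res b) v = 0" using K \<alpha>_iff H_dot by (auto simp: res_dot)
      then have "dot (S0.res i) v = 0" "dot (S0.res j) v = 0" using i j by (auto simp: in_span2_def)
      then show "v \<in> Y" using v by (simp add: Y res_dot)
    next
      fix v assume v: "v \<in> Y"
      then have "v \<in> Ka" "v \<in> Kb" using K(3,6) by blast+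
      moreover have "v \<in> H" using v by (simp add: Y)
      ultimately show "v \<in> ?X \<inter> H" by blast
    qed
    then have "?X \<in> off_flats Y" using X XH by (simp add: off_flats_def)
    moreover have "?inc a ?X" "?inc b ?X" using inc_iff[OF _ X] K by auto
    ultimately show ?thesis by blast
  qed
  have fd3: "in_span2 a b c" if *: "e \<in> off_flats Y" "a \<in> F.\<Lambda>U" "b \<in> F.\<Lambda>U" "a \<noteq> b" "?inc a e" "?inc b e"
    "c \<in> F.\<Lambda>U" "?inc c e" for e a b c
  proof -
    obtain Ka Kb Kc where K: "Ka \<in> A - {H}" "a = \<alpha> Ka" "Kb \<in> A - {H}" "b = \<alpha> Kb" "Kc \<in> A - {H}" "c = \<alpha> Kc"
      using U_obtain *(2,3,7) by meson
    have "e = Ka \<inter> Kb" using codim2_eqI[OF off(1)[OF *(1)]] inc_iff[OF _ off(1)[OF *(1)]] K * by auto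
    moreover have "e \<subseteq> Kc" using inc_iff[OF _ off(1)[OF *(1)]] K * by auto
    ultimately show ?thesis using subset_iff_in_span2[of Ka Kb Kc] K *(4) by auto
  qed
  have fd4: "e = e'" if *: "e \<in> off_flats Y" "e' \<in> off_flats Y" "a \<in> F.\<Lambda>U" "b \<in> F.\<Lambda>U" "a \<noteq> b"
    "?inc a e" "?inc b e" "?inc a e'" "?inc b e'" for e e' a b
  proof -
    obtain Ka Kb where K: "Ka \<in> A - {H}" "a = \<alpha> Ka" "Kb \<in> A - {H}" "b = \<alpha> Kb"
      using U_obtain *(3,4) by meson
    have "e = Ka \<inter> Kb" using codim2_eqI[OF off(1)[OF *(1)]] inc_iff[OF _ off(1)[OF *(1)]] K * by auto
    moreover have "e' = Ka \<inter> Kb" using codim2_eqI[OF off(1)[OF *(2)]] inc_iff[OF _ off(1)[OF *(2)]] K * by auto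
    ultimately show ?thesis by simp
  qed
  have fd5: "?inc c e" if *: "e \<in> off_flats Y" "a \<in> F.\<Lambda>U" "b \<in> F.\<Lambda>U" "a \<noteq> b" "?inc a e" "?inc b e"
    "c \<in> F.\<Lambda>U" "in_span2 a b c" for e a b c
    using *(5,6,8) by (auto simp: in_span2_def)
  have fd: "(card F.NU - 1) * (card F.\<Lambda>U + 1 - card F.NU) \<le> (\<Sum>X\<in>off_flats Y. card {a \<in> F.\<Lambda>U. ?inc a X} - 1)"
    by (rule F.flat_defect(1)[of "off_flats Y" ?inc]) (fact fd1 fd2 fd3 fd4 fd5)+
  have fd': F.flat_lifts
    if "(\<Sum>X\<in>off_flats Y. card {a \<in> F.\<Lambda>U. ?inc a X} - 1) = (card F.NU - 1) * (card F.\<Lambda>U + 1 - card F.NU)"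
    by (rule F.flat_defect(2)[of "off_flats Y" ?inc]) (fact fd1 fd2 fd3 fd4 fd5 that)+
  have cardU: "card F.\<Lambda>U = below_A Y"
  proof -
    have "F.\<Lambda>U = \<alpha> ` {K \<in> A - {H}. Y \<subseteq> K \<inter> H}"
      using U_obtain U_iff by (auto simp: Y)
    then show ?thesis using card_image[OF inj_on_subset[OF \<alpha>_inj]] by (auto simp: below_A_def)
  qed
  have cardNU: "card F.NU = below_RH Y"
  proof -
    have "F.NU = (\<alpha> \<circ> pick) ` {Z \<in> RH. Y \<subseteq> Z}"
    proof (intro equalityI subsetI)
      fix a assume "a \<in> F.NU"
      then obtain Z where Z: "Z \<in> RH" "a = \<alpha> (pick Z)" "\<alpha> (pick Z) \<in> F.\<Lambda>U" by (auto simp: N_def)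
      then have "Y \<subseteq> pick Z" using U_iff pick(1) by blast
      then have "Y \<subseteq> Z" using pick(2)[OF Z(1)] by (auto simp: Y)
      then show "a \<in> (\<alpha> \<circ> pick) ` {Z \<in> RH. Y \<subseteq> Z}" using Z by auto
    next
      fix a assume "a \<in> (\<alpha> \<circ> pick) ` {Z \<in> RH. Y \<subseteq> Z}"
      then obtain Z where Z: "Z \<in> RH" "Y \<subseteq> Z" "a = \<alpha> (pick Z)" by auto
      then have "Y \<subseteq> pick Z" using pick(2) by blast
      then show "a \<in> F.NU" using Z U_iff pick(1) by (auto simp: N_def)
    qed
    then show ?thesis using card_image[OF inj_on_subset[OF inj_pick]] by (auto simp: below_RH_def)
  qed
  have defect: "(\<Sum>X\<in>off_flats Y. card {a \<in> F.\<Lambda>U. ?inc a X} - 1) = off_defect Y"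
    unfolding off_defect_def
  proof (rule sum.cong)
    fix X assume X: "X \<in> off_flats Y"
    have "{a \<in> F.\<Lambda>U. ?inc a X} = \<alpha> ` {K \<in> A - {H}. X \<subseteq> K}"
    proof (intro equalityI subsetI)
      fix a assume "a \<in> {a \<in> F.\<Lambda>U. ?inc a X}"
      then have a: "a \<in> F.\<Lambda>U" "?inc a X" by simp_all
      obtain K where K: "K \<in> A - {H}" "a = \<alpha> K" using U_obtain[OF a(1)] by blast
      have "X \<subseteq> K" using inc_iff[OF _ off(1)[OF X], of K] K a(2) by simp
      then show "a \<in> \<alpha> ` {K \<in> A - {H}. X \<subseteq> K}" using K by simp
    next
      fix a assume "a \<in> \<alpha> ` {K \<in> A - {H}. X \<subseteq> K}"
      then obtain K where K: "K \<in> A - {H}" "X \<subseteq> K" "a = \<alpha> K" by blast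
      then have "Y \<subseteq> K" using off(2)[OF X] by blast
      then show "a \<in> {a \<in> F.\<Lambda>U. ?inc a X}" using K U_iff inc_iff[OF _ off(1)[OF X]] by auto
    qed
    then show "card {a \<in> F.\<Lambda>U. ?inc a X} - 1 = card {K \<in> A - {H}. X \<subseteq> K} - 1"
      using card_image[OF inj_on_subset[OF \<alpha>_inj]] by auto
  qed simp
  show "(below_RH Y - 1) * (below_A Y + 1 - below_RH Y) \<le> off_defect Y"
    using fd unfolding defect cardU cardNU .
  assume "off_defect Y = (below_RH Y - 1) * (below_A Y + 1 - below_RH Y)"
  then show "F.flat_lifts"
    using fd' unfolding defect cardU cardNU by blast
qed

lemma RH_flat:
  assumes "Y \<in> codim2_flats RH"
  shows "\<exists>i j e1 e2. arr_flat P w z \<Lambda> N i (S0.res j) e1 e2 \<and> i \<in> N \<and> j \<in> N \<and> j \<noteq> i \<and>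
    Y = {v \<in> H. dot i v = 0 \<and> dot j v = 0}"
proof -
  obtain X X' where X: "X \<in> RH" "X' \<in> RH" "X \<noteq> X'" "Y = X \<inter> X'" using assms by (auto simp: codim2_flats_def)
  define i j where "i = \<alpha> (pick X)" and "j = \<alpha> (pick X')"
  have N: "i \<in> N" "j \<in> N" using X by (auto simp: N_def i_def j_def)
  have ne: "j \<noteq> i" using inj_onD[OF inj_pick] X by (auto simp: i_def j_def)
  have \<Lambda>: "i \<in> \<Lambda>" "j \<in> \<Lambda>" using N S.N_sub by auto
  have "indep2 (S0.res i) (S0.res j)"
    using N ne S.N_distinct S0.res_nonzero \<Lambda> by (intro indep2I) blast+
  moreover have "S0.res j v* S0.Q = S0.res j" using S0.res_Q S0.\<Lambda>P \<Lambda> by blast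
  ultimately obtain e1 e2 where F: "arr_flat P w z \<Lambda> N i (S0.res j) e1 e2" using S.exists_flat N by blast
  have "X = {v \<in> H. dot i v = 0}" "X' = {v \<in> H. dot j v = 0}"
    using pick X H_dot(2) \<alpha>_iff unfolding i_def j_def by blast+
  then have "Y = {v \<in> H. dot i v = 0 \<and> dot j v = 0}" using X(4) by blast
  then show ?thesis using F N ne by blast
qed

lemma below_RH_ge2: "Y \<in> codim2_flats RH \<Longrightarrow> below_RH Y \<ge> 2"
proof -
  assume "Y \<in> codim2_flats RH"
  then obtain X X' where X: "X \<in> RH" "X' \<in> RH" "X \<noteq> X'" "Y = X \<inter> X'" by (auto simp: codim2_flats_def)
  then have "{X, X'} \<subseteq> {Z \<in> RH. Y \<subseteq> Z}" by auto
  then have "card {X, X'} \<le> card {Z \<in> RH. Y \<subseteq> Z}" using finite_RH by (intro card_mono) auto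
  then show ?thesis using X(3) by (simp add: below_RH_def)
qed

lemma below_RH_le: "below_RH Y \<le> below_A Y"
proof -
  have "{Z \<in> RH. Y \<subseteq> Z} = (\<lambda>K. K \<inter> H) ` {K \<in> A - {H}. Y \<subseteq> K \<inter> H}" by (auto simp: RH_eq)
  then show ?thesis
    unfolding below_RH_def below_A_def using A_finite[OF arr] by (simp add: card_image_le)
qed

text \<open>A flat inside \<open>H\<close> has as Moebius value the number of other hyperplanes
  through it, and each hyperplane other than \<open>H\<close> is counted once in this way. The flats
  off \<open>H\<close> are grouped by their trace on \<open>H\<close>.\<close>

lemma betti2_split: "betti2 A = int (card A - 1) + (\<Sum>Y\<in>codim2_flats RH. int (off_defect Y))"
proof -
  let ?L = "codim2_flats A"
  let ?f = "\<lambda>X. int (card {K \<in> A. X \<subseteq> K}) - 1"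
  have finL: "finite ?L" using finite_codim2_flats[OF A_finite[OF arr]] .
  have onH: "{X \<in> ?L. X \<subseteq> H} = RH"
  proof (intro equalityI subsetI)
    fix X assume "X \<in> {X \<in> ?L. X \<subseteq> H}"
    then obtain K K' where K: "X = K \<inter> K'" "K \<in> A" "K' \<in> A" "K \<noteq> K'" "X \<subseteq> H" "X \<in> ?L"
      by (auto simp: codim2_flats_def)
    obtain K0 where K0: "K0 \<in> A" "K0 \<noteq> H" "X \<subseteq> K0" using K by blast
    have "X = K0 \<inter> H" by (rule codim2_eqI) (use K K0 H in auto)
    then show "X \<in> RH" using K0 by (auto simp: RH_eq)
  next
    fix X assume "X \<in> RH"
    then show "X \<in> {X \<in> ?L. X \<subseteq> H}" using H by (auto simp: RH_eq codim2_flats_def)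
  qed
  have "(\<Sum>X\<in>RH. ?f X) = (\<Sum>X\<in>RH. int (card {K \<in> A - {H}. K \<inter> H = X}))"
  proof (rule sum.cong)
    fix X assume X: "X \<in> RH"
    have XL: "X \<in> ?L" using X onH by blast
    have "{K \<in> A. X \<subseteq> K} = insert H {K \<in> A - {H}. K \<inter> H = X}"
    proof (intro equalityI subsetI)
      fix K assume K: "K \<in> {K \<in> A. X \<subseteq> K}"
      show "K \<in> insert H {K \<in> A - {H}. K \<inter> H = X}"
      proof (cases "K = H")
        case False
        have "X = K \<inter> H" by (rule codim2_eqI[OF XL]) (use K False H X in \<open>auto simp: RH_eq\<close>)
        then show ?thesis using K by auto
      qed simp
    next
      fix K assume "K \<in> insert H {K \<in> A - {H}. K \<inter> H = X}"
      then show "K \<in> {K \<in> A. X \<subseteq> K}" using H X by (auto simp: RH_eq)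
    qed
    then show "?f X = int (card {K \<in> A - {H}. K \<inter> H = X})"
      using A_finite[OF arr] by simp
  qed simp
  also have "\<dots> = int (card (A - {H}))"
    using sum.image_gen[of "A - {H}" "\<lambda>_. 1 :: int" "\<lambda>K. K \<inter> H"] A_finite[OF arr]
    by (simp add: RH_eq)
  finally have on: "(\<Sum>X\<in>RH. ?f X) = int (card A - 1)" using H by simp
  have img: "(\<lambda>X. X \<inter> H) ` {X \<in> ?L. \<not> X \<subseteq> H} \<subseteq> codim2_flats RH"
  proof (rule image_subsetI)
    fix X assume "X \<in> {X \<in> ?L. \<not> X \<subseteq> H}"
    then obtain K K' where K: "X = K \<inter> K'" "K \<in> A" "K' \<in> A" "K \<noteq> K'" "\<not> X \<subseteq> H" "X \<in> ?L"
      by (auto simp: codim2_flats_def)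
    then have KH: "K \<in> A - {H}" "K' \<in> A - {H}" by auto
    have "K \<inter> H \<noteq> K' \<inter> H"
    proof
      assume eq: "K \<inter> H = K' \<inter> H"
      have "K \<inter> H = K \<inter> K'"
      proof (rule codim2_eqI)
        show "K \<inter> H \<in> ?L" using KH H by (auto simp: codim2_flats_def)
        show "K \<inter> H \<subseteq> K'" using eq by blast
      qed (use K in blast)+
      then show False using K by blast
    qed
    moreover have "X \<inter> H = (K \<inter> H) \<inter> (K' \<inter> H)" using K(1) by blast
    moreover have "K \<inter> H \<in> RH" "K' \<inter> H \<in> RH" using KH by (auto simp: RH_eq)
    ultimately show "X \<inter> H \<in> codim2_flats RH" unfolding codim2_flats_def by blast
  qed
  have "(\<Sum>X\<in>{X \<in> ?L. \<not> X \<subseteq> H}. ?f X) = (\<Sum>Y\<in>codim2_flats RH. \<Sum>X\<in>{X \<in> {X \<in> ?L. \<not> X \<subseteq> H}. X \<inter> H = Y}. ?f X)"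
    by (rule sum.group[symmetric]) (use finL finite_codim2_flats[OF finite_RH] img in auto)
  also have "\<dots> = (\<Sum>Y\<in>codim2_flats RH. int (off_defect Y))"
  proof (rule sum.cong)
    fix Y assume "Y \<in> codim2_flats RH"
    have "{X \<in> {X \<in> ?L. \<not> X \<subseteq> H}. X \<inter> H = Y} = off_flats Y" by (auto simp: off_flats_def)
    moreover have "?f X = int (card {K \<in> A - {H}. X \<subseteq> K} - 1)" if X: "X \<in> off_flats Y" for X
    proof -
      have "{K \<in> A. X \<subseteq> K} = {K \<in> A - {H}. X \<subseteq> K}" using X by (auto simp: off_flats_def)
      moreover have "{K \<in> A. X \<subseteq> K} \<noteq> {}" using X by (auto simp: off_flats_def codim2_flats_def)
      then have "card {K \<in> A. X \<subseteq> K} \<ge> 1" using A_finite[OF arr] by (simp add: Suc_le_eq card_gt_0_iff)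
      ultimately show ?thesis by (simp add: of_nat_diff)
    qed
    ultimately show "(\<Sum>X\<in>{X \<in> {X \<in> ?L. \<not> X \<subseteq> H}. X \<inter> H = Y}. ?f X) = int (off_defect Y)"
      unfolding off_defect_def by (simp add: of_nat_sum)
  qed simp
  finally have offH: "(\<Sum>X\<in>{X \<in> ?L. \<not> X \<subseteq> H}. ?f X) = (\<Sum>Y\<in>codim2_flats RH. int (off_defect Y))" .
  have "betti2 A = (\<Sum>X\<in>{X \<in> ?L. X \<subseteq> H}. ?f X) + (\<Sum>X\<in>{X \<in> ?L. \<not> X \<subseteq> H}. ?f X)"
    unfolding betti2_def using finL by (subst sum.union_disjoint[symmetric]) (auto intro!: sum.cong)
  then show ?thesis using on offH onH by simp
qed

text \<open>The local inequalities add up to an inequality of Betti numbers, so that equality of the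
  latter forces each local equality.\<close>

lemma local_equality:
  assumes b: "betti2 A = betti2 RH + int (card RH) * (int (card A) - int (card RH))"
    and ne: "RH \<noteq> {}" and Y: "Y \<in> codim2_flats RH"
  shows "off_defect Y = (below_RH Y - 1) * (below_A Y + 1 - below_RH Y)"
proof -
  let ?L = "codim2_flats RH"
  have finL: "finite ?L" using finite_codim2_flats[OF finite_RH] .
  let ?g = "\<lambda>Y. (below_RH Y - 1) * (below_A Y + 1 - below_RH Y)"
  have uniq: "\<exists>!y. y \<in> ?L \<and> y \<subseteq> r \<and> y \<subseteq> s" if rs: "r \<in> RH" "s \<in> RH" "r \<noteq> s" for r s
  proof (rule ex1I)
    show "r \<inter> s \<in> ?L \<and> r \<inter> s \<subseteq> r \<and> r \<inter> s \<subseteq> s" using rs by (auto simp: codim2_flats_def)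
    fix y assume y: "y \<in> ?L \<and> y \<subseteq> r \<and> y \<subseteq> s"
    have "vec.subspace y" using lattice_subspace[OF central_RH codim2_lattice[OF central_RH]] y by blast
    moreover have "vec.subspace (r \<inter> s)" using A_subspace[OF central_RH] rs vec.subspace_inter by blast
    moreover have "vec.dim y + 2 = vec.dim H" using y dim_inter[OF central_RH] by (auto simp: codim2_flats_def)
    ultimately show "y = r \<inter> s"
      using vec.subspace_dim_equal[of y "r \<inter> s"] dim_inter[OF central_RH rs] y by simp
  qed
  have 1: "(\<Sum>Y\<in>?L. below_A Y * (below_RH Y - 1)) = (card A - 1) * (card RH - 1)"
    using double_counting[where A = "A - {H}" and R = RH and Y = ?L and \<rho> = "\<lambda>K. K \<inter> H" and below = "(\<subseteq>)"]
      uniq A_finite[OF arr] finite_RH finL H by (simp add: below_A_def below_RH_def RH_eq)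
  have 2: "(\<Sum>Y\<in>?L. below_RH Y * (below_RH Y - 1)) = card RH * (card RH - 1)"
    using double_counting[where A = RH and R = RH and Y = ?L and \<rho> = "\<lambda>r. r" and below = "(\<subseteq>)"]
      uniq finite_RH finL by (simp add: below_RH_def)
  have 3: "betti2 RH = (\<Sum>Y\<in>?L. int (below_RH Y) - 1)" by (simp add: betti2_def below_RH_def)
  \<comment> \<open>With \<open>h\<close> and \<open>n\<close> for the two counts,
    \<open>(h - 1) * (n + 1 - h)\<close> is \<open>n * (h - 1) - h * (h - 1) + (h - 1)\<close>, and
    the three parts are summed by 1, 2 and 3. The bounds on \<open>h\<close> exclude
    truncation.\<close>
  have g: "int (?g Y) = int (below_A Y * (below_RH Y - 1)) - int (below_RH Y * (below_RH Y - 1)) + (int (below_RH Y) - 1)"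
    if "Y \<in> ?L" for Y
  proof -
    have "2 \<le> below_RH Y" by (rule below_RH_ge2[OF that])
    then obtain p where p: "below_RH Y = 2 + p" using le_Suc_ex by blast
    obtain q where q: "below_A Y = 2 + p + q" using below_RH_le[of Y] p le_Suc_ex by metis
    show ?thesis unfolding p q by (simp add: algebra_simps)
  qed
  have "(\<Sum>Y\<in>?L. int (?g Y)) = (\<Sum>Y\<in>?L. int (below_A Y * (below_RH Y - 1)) - int (below_RH Y * (below_RH Y - 1)) + (int (below_RH Y) - 1))"
    using g by (rule sum.cong[OF refl])
  also have "\<dots> = int (\<Sum>Y\<in>?L. below_A Y * (below_RH Y - 1)) - int (\<Sum>Y\<in>?L. below_RH Y * (below_RH Y - 1)) + betti2 RH"
    unfolding 3 by (simp add: sum.distrib sum_subtractf)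
  also have "\<dots> = int ((card A - 1) * (card RH - 1)) - int (card RH * (card RH - 1)) + betti2 RH"
    unfolding 1 2 ..
  also have "\<dots> = betti2 A - int (card A - 1)"
  proof -
    have "card RH > 0" using ne finite_RH by (simp add: card_gt_0_iff)
    then obtain p where p: "card RH = Suc p" using gr0_implies_Suc by blast
    have "card A > 0" using H A_finite[OF arr] by (auto simp: card_gt_0_iff)
    then obtain q where q: "card A = Suc q" using gr0_implies_Suc by blast
    show ?thesis unfolding b p q by (simp add: algebra_simps)
  qed
  also have "\<dots> = (\<Sum>Y\<in>?L. int (off_defect Y))" using betti2_split by simp
  finally have sum_eq: "(\<Sum>Y\<in>?L. ?g Y) = (\<Sum>Y\<in>?L. off_defect Y)" by (simp only: of_nat_sum[symmetric] of_nat_eq_iff)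
  have le: "?g Y \<le> off_defect Y" if "Y \<in> ?L" for Y
  proof -
    obtain i j e1 e2 where "arr_flat P w z \<Lambda> N i (S0.res j) e1 e2" "i \<in> N" "j \<in> N" "j \<noteq> i"
      "Y = {v \<in> H. dot i v = 0 \<and> dot j v = 0}" using RH_flat[OF \<open>Y \<in> ?L\<close>] by blast
    then show ?thesis by (rule flat_local(1))
  qed
  show ?thesis using sum_mono_inv[OF sum_eq le Y finL] by simp
qed

theorem hyp_step:
  assumes b: "betti2 A = betti2 RH + int (card RH) * (int (card A) - int (card RH))"
    and ne: "RH \<noteq> {}" and dim: "vec.dim H \<ge> 2" and basis: "euler_basis S0.Q (log_der_on S0.Q RH) m B"
  shows "\<exists>B'. euler_basis P (log_der_on P A) (Suc m) B'"
proof -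
  have "\<exists>B'. euler_basis P S.DP (Suc m) B'"
  proof (rule S.basis_step)
    show "\<Lambda> \<noteq> {}" using ne by (auto simp: \<Lambda>_def RH_eq)
    show "euler_basis S0.Q S0.DQ m B" using basis by (simp add: DQ_eq)
    fix i x2 e1 e2
    assume F: "arr_flat P w z \<Lambda> N i x2 e1 e2" and cs: "(\<exists>j\<in>N. x2 = S0.res j \<and> j \<noteq> i) \<or> N = {i}"
    have i: "i \<in> N" by (rule arr_flat.i[OF F])
    show "arr_flat.flat_lifts w z \<Lambda> N i x2 e1 e2"
      using cs
    proof
      assume "\<exists>j\<in>N. x2 = S0.res j \<and> j \<noteq> i"
      then obtain j where j: "j \<in> N" "x2 = S0.res j" "j \<noteq> i" by blast
      define Y where "Y = {v \<in> H. dot i v = 0 \<and> dot j v = 0}"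
      obtain X X' where X: "X \<in> RH" "X' \<in> RH" "i = \<alpha> (pick X)" "j = \<alpha> (pick X')"
        using i j by (auto simp: N_def)
      have "X = {v \<in> H. dot i v = 0}" "X' = {v \<in> H. dot j v = 0}"
        using pick X H_dot(2) \<alpha>_iff by blast+
      then have "Y = X \<inter> X'" by (auto simp: Y_def)
      moreover have "X \<noteq> X'" using X j(3) by blast
      ultimately have "Y \<in> codim2_flats RH" using X by (auto simp: codim2_flats_def)
      then show ?thesis
        using flat_local(2)[OF F[unfolded j(2)] i j(1,3) Y_def] local_equality[OF b ne] j(2) by blast
    next
      assume Ni: "N = {i}"
      then show ?thesis by (rule arr_flat.flat_lifts_single[OF F])
    qed
  next
    fix i assume Ni: "N = {i}"
    have i\<Lambda>: "i \<in> \<Lambda>" using Ni S.N_sub by blast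
    have iQ: "S0.res i v* S0.Q = S0.res i" using S0.res_Q S0.\<Lambda>P i\<Lambda> by blast
    obtain X where X: "X \<in> RH" "i = \<alpha> (pick X)" using Ni by (auto simp: N_def)
    have "vec.dim X + 1 = vec.dim H" using A_dim[OF central_RH X(1)] .
    then have "vec.dim X \<noteq> 0" using dim by linarith
    then have "\<not> X \<subseteq> {0}" by (simp only: vec.dim_eq_0 not_False_eq_True)
    \<comment> \<open>\<open>res i\<close> vanishes on \<open>X\<close>, so a covector that is
      nonzero at a nonzero point of \<open>X\<close> gives the missing independent form.\<close>
    then obtain v where v: "v \<in> X" "v \<noteq> 0" by blast
    have vH: "v \<in> H" "v \<in> pick X" using v(1) pick(2)[OF X(1)] by blast+
    have iv: "dot (S0.res i) v = 0"
      using \<alpha>_iff[of "pick X" v] pick(1)[OF X(1)] vH H_dot X(2) by (simp add: res_dot)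
    obtain a where a: "dot a v = 1" using exists_dual_covector[OF v(2)] by blast
    let ?x = "a v* S0.Q"
    have "S0.Q *v v = v" using vH(1) pspace_Q unfolding pspace_def by blast
    then have xv: "dot ?x v = 1" using a by (simp add: dot_vector_matrix)
    have "indep2 (S0.res i) ?x"
    proof (rule indep2I)
      show "S0.res i \<noteq> 0" using S0.res_nonzero i\<Lambda> by blast
      show "?x \<noteq> 0" using xv by auto
      show "\<not> proportional (S0.res i) ?x" using xv iv by (auto simp: proportional_def)
    qed
    moreover have "?x v* S0.Q = ?x" by (simp add: vector_matrix_assoc S0.QQ)
    ultimately show "\<exists>x2. x2 v* S0.Q = x2 \<and> indep2 (S0.res i) x2" by blast
  qed
  then show ?thesis by (simp add: DP_eq)
qed

end

section \<open>Freeness along the flag\<close>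

lemma rank2_decomposition:
  assumes P: "P ** P = P" and dim: "vec.dim (pspace P) = 2" and x1: "x1 v* P = x1" "x1 \<noteq> 0"
  shows "\<exists>e1 e2 x2. P = tens e1 x1 + tens e2 x2 \<and> x2 v* P = x2 \<and> P *v e1 = e1 \<and> P *v e2 = e2 \<and>
    dot x1 e1 = 1 \<and> dot x1 e2 = 0 \<and> dot x2 e1 = 0 \<and> dot x2 e2 = 1"
proof -
  let ?W = "pspace P"
  obtain u where u: "dot x1 u = 1" using exists_dual_vector[OF x1(2)] by blast
  define e1 where "e1 = P *v u"
  have e1: "e1 \<in> ?W" "dot x1 e1 = 1"
    using pspace_mult[OF P] u dot_invariant[OF x1(1)] by (simp_all add: e1_def)
  have "\<not> ?W \<subseteq> vec.span {e1}"
  proof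
    assume "?W \<subseteq> vec.span {e1}"
    then have "vec.dim ?W \<le> card {e1}" by (rule vec.dim_le_card) simp
    then show False using dim by simp
  qed
  then obtain e where e: "e \<in> ?W" "e \<notin> vec.span {e1}" by blast
  define e2 where "e2 = e - dot x1 e *s e1"
  have e2: "e2 \<in> ?W" "dot x1 e2 = 0"
    using e e1 by (simp_all add: e2_def pspace_def vec.diff vec.scale)
  have e2_0: "e2 \<noteq> 0"
  proof
    assume "e2 = 0"
    then have "e = dot x1 e *s e1" by (simp add: e2_def)
    then show False using e(2) vec.span_scale[OF vec.span_base[of e1 "{e1}"]] by (metis singletonI)
  qed
  have e12: "e2 \<notin> vec.span {e1}"
  proof
    assume "e2 \<in> vec.span {e1}"
    then obtain k where "e2 = k *s e1" using vec.span_breakdown_eq[of e2 e1 "{}"] by auto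
    then show False using e2 e1(2) e2_0 by simp
  qed
  have "e1 \<noteq> 0" using e1(2) by auto
  then have ind: "vec.independent {e2, e1}" using e12 by (simp add: vec.independent_insert)
  have "e2 \<noteq> e1" using e1(2) e2(2) by auto
  then have "card {e2, e1} = 2" by simp
  then have span: "?W \<subseteq> vec.span {e2, e1}"
    using vec.card_ge_dim_independent[of "{e2, e1}" ?W] ind e1 e2 dim by simp
  obtain b where b: "dot b e2 = 1" using exists_dual_covector[OF e2_0] by blast
  define x2 where "x2 = (b - dot b e1 *s x1) v* P"
  have x2: "dot x2 e1 = 0" "dot x2 e2 = 1"
    using e1 e2 b by (simp_all add: x2_def dot_vector_matrix pspace_def)
  have x2P: "x2 v* P = x2" by (simp add: x2_def vector_matrix_assoc P)
  have expand: "P *v v = dot x1 v *s e1 + dot x2 v *s e2" for v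
  proof -
    have "P *v v \<in> vec.span {e2, e1}" using span pspace_mult[OF P] by blast
    then obtain c d where cd: "P *v v = d *s e1 + c *s e2"
      using vec.span_breakdown_eq[of "P *v v" e2 "{e1}"] vec.span_breakdown_eq[of _ e1 "{}"]
      by (auto simp: algebra_simps)
    have "dot x1 v = d"
      using arg_cong[OF cd, of "dot x1"] dot_invariant[OF x1(1)] e1 e2 by simp
    moreover have "dot x2 v = c"
      using arg_cong[OF cd, of "dot x2"] dot_invariant[OF x2P] x2 by simp
    ultimately show ?thesis using cd by simp
  qed
  have "P = tens e1 x1 + tens e2 x2"
    by (rule matrix_eqI_dot) (simp add: expand matrix_vector_plus tens_mult_vector)
  then show ?thesis using x2 x2P e1 e2 by (auto simp: pspace_def)
qed

text \<open>The start of the induction: in dimension two \<open>rank2_divisibility\<close> gives the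
  Euler derivation and the constant derivation along one line times the product of the other
  forms.\<close>

lemma rank2_log_der_free:
  fixes P :: "'a::field ^ 'b ^ 'b::finite"
  assumes P: "P ** P = P" and arr: "central_arrangement (pspace P) A" and dim: "vec.dim (pspace P) = 2"
    and ne: "A \<noteq> {}"
  shows "\<exists>b. euler_basis P (log_der_on P A) 1 b"
proof -
  have "\<forall>K. \<exists>a. K \<in> A \<longrightarrow> form_of P K a"
    using exists_form[OF P] A_subspace[OF arr] A_sub[OF arr] A_dim[OF arr] by blast
  then obtain \<alpha> where \<alpha>: "\<And>K. K \<in> A \<Longrightarrow> form_of P K (\<alpha> K)" by (elim choice[THEN exE]) blast
  have AW: "K \<noteq> pspace P" if "K \<in> A" for K using A_dim[OF arr that] by auto
  have \<alpha>0: "\<alpha> K \<noteq> 0" if "K \<in> A" for K using form_nonzero[OF \<alpha>[OF that] AW[OF that]] .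
  have \<alpha>P: "\<alpha> K v* P = \<alpha> K" if "K \<in> A" for K using \<alpha>[OF that] by (simp add: form_of_def)
  obtain K0 where K0: "K0 \<in> A" using ne by blast
  define x1 where "x1 = \<alpha> K0"
  obtain e1 e2 x2 where D: "P = tens e1 x1 + tens e2 x2" "x2 v* P = x2" "P *v e1 = e1" "P *v e2 = e2"
    "dot x1 e1 = 1" "dot x1 e2 = 0" "dot x2 e1 = 0" "dot x2 e2 = 1"
    using rank2_decomposition[OF P dim] \<alpha>P[OF K0] \<alpha>0[OF K0] unfolding x1_def by meson
  have aP: "a v* P = dot a e1 *s x1 + dot a e2 *s x2" for a
    by (subst D(1)) (simp add: vector_matrix_plus vector_matrix_tens)
  have x1P: "x1 v* P = x1" using \<alpha>P[OF K0] by (simp add: x1_def)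
  define B where "B = (\<Prod>K\<in>A - {K0}. linear_form (\<alpha> K))"
  have one: "(\<Sum>j<1. f j) = f 0" for f :: "nat \<Rightarrow> ('a, 'b) der" by simp
  have finA: "finite A" using A_finite[OF arr] .
  have B_fix: "B \<in> fix_ring P"
    unfolding B_def by (intro fix_ring_prod fix_ring_linear_form \<alpha>P) blast
  have B0: "B \<noteq> 0" unfolding B_def by (rule mpoly_prod_nonzero) (use finA \<alpha>0 in auto)
  have "mhomogeneous (\<Sum>K\<in>A - {K0}. 1) B"
    unfolding B_def by (rule mhomogeneous_prod) (use finA in auto)
  then have Bhom: "\<exists>d. vhom d (B *s cvec e2)" using vhom_scale[OF _ vhom_cvec] by blast
  have mem: "B *s cvec e2 \<in> log_der_on P A"
    unfolding log_der_on_def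
  proof (intro CollectI conjI ballI allI impI)
    show "B *s cvec e2 \<in> Der P" by (intro Der_scale' B_fix Der_cvec D)
    fix K a assume K: "K \<in> A" and a: "form_of P K a"
    have "linear_form (\<alpha> K) dvd pair (\<alpha> K) (B *s cvec e2)"
    proof (cases "K = K0")
      case True
      then show ?thesis using D(6) by (simp add: x1_def)
    next
      case False
      then have "linear_form (\<alpha> K) dvd B" unfolding B_def using K finA by (intro dvd_prodI) auto
      then show ?thesis by simp
    qed
    then show "linear_form a dvd pair a (B *s cvec e2)"
      using form_dvd_cong[OF form_unique[OF P \<alpha>[OF K] a AW[OF K]]] by blast
  qed
  have span: "\<theta> \<in> gspan P (Suc 1) (case_nat (Euler P) (\<lambda>_. B *s cvec e2))" if \<theta>: "\<theta> \<in> log_der_on P A" for \<theta>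
  proof -
    have \<theta>D: "\<theta> \<in> Der P" using \<theta> by (simp add: log_der_on_def)
    have dv: "linear_form (\<alpha> K) dvd pair (\<alpha> K) \<theta>" if "K \<in> A" for K
      using \<theta> \<alpha>[OF that] that unfolding log_der_on_def by blast
    have pairP: "pair a \<theta> = mconst (dot a e1) * pair x1 \<theta> + mconst (dot a e2) * pair x2 \<theta>" for a
      using Der_pair[OF \<theta>D, of a, symmetric] unfolding aP by simp
    have fixpair: "pair a \<theta> \<in> fix_ring P" for a using Der_subst[OF \<theta>D] by (simp add: fix_ring_def)
    have "\<exists>g k. pair x1 \<theta> = linear_form (\<alpha> K0) * g \<and>
        pair x2 \<theta> = linear_form x2 * g + k * (\<Prod>K\<in>A - {K0}. linear_form (\<alpha> K))"
    proof (rule rank2_divisibility[OF finA K0])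
      show "\<alpha> K \<noteq> 0" if "K \<in> A" for K by (rule \<alpha>0[OF that])
      show "K = K'" if "K \<in> A" "K' \<in> A" "proportional (\<alpha> K) (\<alpha> K')" for K K'
        using that \<alpha>[OF that(1)] \<alpha>[OF that(2)] by (auto simp: form_of_def proportional_def)
      show "\<alpha> K = dot (\<alpha> K) e1 *s \<alpha> K0 + dot (\<alpha> K) e2 *s x2" if "K \<in> A" for K
        using aP[of "\<alpha> K"] \<alpha>P[OF that] by (simp add: x1_def)
      show "linear_form (\<alpha> K0) dvd pair x1 \<theta>" using dv[OF K0] by (simp add: x1_def)
      show "linear_form (\<alpha> K) dvd mconst (dot (\<alpha> K) e1) * pair x1 \<theta> + mconst (dot (\<alpha> K) e2) * pair x2 \<theta>"
        if "K \<in> A" for K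
        using dv[OF that] by (simp only: pairP[symmetric])
    qed
    then obtain g k where gk: "pair x1 \<theta> = linear_form x1 * g" "pair x2 \<theta> = linear_form x2 * g + k * B"
      unfolding B_def x1_def by blast
    have g: "g \<in> fix_ring P"
      using fix_ring_cancel[of "linear_form x1" g P] fixpair[of x1] gk(1) fix_ring_linear_form[OF x1P] \<alpha>0[OF K0]
      by (simp add: x1_def)
    have "B * k = pair x2 \<theta> - linear_form x2 * g" using gk(2) by (simp add: mult.commute)
    moreover have "pair x2 \<theta> - linear_form x2 * g \<in> fix_ring P"
      by (intro fix_ring_diff fix_ring_mult fixpair fix_ring_linear_form D g)
    ultimately have "B * k \<in> fix_ring P" by simp
    then have k: "k \<in> fix_ring P" by (rule fix_ring_cancel[OF _ B_fix B0])
    have "\<theta> = g *s Euler P + (\<Sum>j<1::nat. k *s (B *s cvec e2))"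
    proof (rule der_eqI)
      fix a
      show "pair a \<theta> = pair a (g *s Euler P + (\<Sum>j<1::nat. k *s (B *s cvec e2)))"
        unfolding pairP[of a] gk one
        by (simp add: aP linear_form_add linear_form_scale algebra_simps)
    qed
    also have "\<dots> \<in> gspan P (Suc 1) (case_nat (Euler P) (\<lambda>_. B *s cvec e2))"
      by (rule gspan_case_natI) (use g k in auto)
    finally show ?thesis .
  qed
  have indep: "gindep P (Suc 1) (case_nat (Euler P) (\<lambda>_. B *s cvec e2))"
  proof (rule gindep_case_natI)
    fix f and c :: "nat \<Rightarrow> ('a, 'b) mpoly" assume "f *s Euler P + (\<Sum>j<1. c j *s (B *s cvec e2)) = 0"
    then have eq: "pair a (f *s Euler P + c 0 *s (B *s cvec e2)) = 0" for a unfolding one by simp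
    have "f * linear_form x1 = 0" using eq[of x1] x1P D(6) by simp
    then have f: "f = 0" using mpoly_mult_eq_0[of f "linear_form x1"] \<alpha>0[OF K0] by (simp add: x1_def)
    have "c 0 * B = 0" using eq[of x2] f D(8) by simp
    then show "f = 0 \<and> (\<forall>j<1. c j = 0)" using f B0 mpoly_mult_eq_0[of "c 0" B] by simp
  qed
  show ?thesis
    unfolding euler_basis_def
    by (rule exI[of _ "\<lambda>_. B *s cvec e2"]) (use mem Bhom span indep in auto)
qed

text \<open>The restriction to \<open>H\<close> is empty here, so it has no basis containing the
  Euler derivation to lift from. In dimension three a basis is written down directly: the Euler
  derivation and the two constant ones along \<open>H\<close>.\<close>

lemma (in arr_hyp) single_log_der_free:
  assumes A: "A = {H}" and dim: "vec.dim H = 2"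
  shows "\<exists>b. euler_basis P (log_der_on P A) 2 b"
proof -
  have "vec.dim H \<noteq> 0" using dim by linarith
  then have "\<not> H \<subseteq> {0}" by (simp only: vec.dim_eq_0 not_False_eq_True)
  then obtain v where v: "v \<in> H" "v \<noteq> 0" by blast
  obtain a where a: "dot a v = 1" using exists_dual_covector[OF v(2)] by blast
  define x1 where "x1 = a v* S0.Q"
  have "S0.Q *v v = v" using v(1) pspace_Q unfolding pspace_def by blast
  then have "dot x1 v = 1" using a by (simp add: x1_def dot_vector_matrix)
  then have x10: "x1 \<noteq> 0" by auto
  have x1Q: "x1 v* S0.Q = x1" by (simp add: x1_def vector_matrix_assoc S0.QQ)
  obtain e1 e2 x2 where D: "S0.Q = tens e1 x1 + tens e2 x2" "x2 v* S0.Q = x2" "S0.Q *v e1 = e1" "S0.Q *v e2 = e2"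
    "dot x1 e1 = 1" "dot x1 e2 = 0" "dot x2 e1 = 0" "dot x2 e2 = 1"
    using rank2_decomposition[OF S0.QQ _ x1Q x10] dim pspace_Q by metis
  have PQ: "P = S0.Q + tens w z" by (simp add: S0.Q_def)
  have aP: "a v* P = dot a e1 *s x1 + dot a e2 *s x2 + dot a w *s z" for a
    by (subst PQ, subst D(1)) (simp add: vector_matrix_plus vector_matrix_tens)
  have eH: "e1 \<in> H" "e2 \<in> H" using D(3,4) pspace_Q unfolding pspace_def by blast+
  have eP: "P *v e1 = e1" "P *v e2 = e2" using H_dot(2) eH unfolding pspace_def by blast+
  have ze: "dot z e1 = 0" "dot z e2 = 0" using H_dot(1) eH by blast+
  have zP: "z v* P = z" by (rule S0.zP)
  have z0: "z \<noteq> 0" using \<alpha>_nonzero[OF H] by (simp add: z_def)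
  have zx: "dot x1 w = 0" "dot x2 w = 0"
  proof -
    have "S0.Q *v w = 0" using w by (simp add: S0.Q_def matrix_vector_diff tens_mult_vector pspace_def)
    then show "dot x1 w = 0" "dot x2 w = 0"
      using dot_invariant[OF x1Q, of w] dot_invariant[OF D(2), of w] by (simp_all add: dot_def)
  qed
  have xP: "x1 v* P = x1" "x2 v* P = x2" using aP[of x1] aP[of x2] D zx by simp_all
  have L: "log_der_on P A = {\<theta> \<in> Der P. linear_form z dvd pair z \<theta>}"
  proof -
    have f: "form_of P H z" using \<alpha>[OF H] by (simp add: z_def)
    have "linear_form b dvd pair b \<theta>" if "form_of P H b" "linear_form z dvd pair z \<theta>" for b \<theta>
      using form_dvd_cong[OF form_unique[OF P f that(1) AW[OF H]] that(2)] .
    then show ?thesis unfolding log_der_on_def A using f by blast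
  qed
  define b where "b = case_nat (cvec e1) (\<lambda>_. cvec e2)"
  have sum2: "(\<Sum>j<2. c j *s b j) = c 0 *s cvec e1 + c 1 *s cvec e2" for c
    by (simp add: b_def numeral_2_eq_2)
  have "\<forall>j<2. b j \<in> log_der_on P A \<and> (\<exists>d. vhom d (b j))"
  proof (intro allI impI)
    fix j :: nat
    have "cvec e \<in> log_der_on P A \<and> (\<exists>d. vhom d (cvec e))" if "e \<in> {e1, e2}" for e
    proof
      show "\<exists>d. vhom d (cvec e)" by (rule exI, rule vhom_cvec)
    qed (use that Der_cvec eP ze in \<open>auto simp: L\<close>)
    then show "b j \<in> log_der_on P A \<and> (\<exists>d. vhom d (b j))" by (cases j) (simp_all add: b_def)
  qed
  moreover have "\<theta> \<in> gspan P (Suc 2) (case_nat (Euler P) b)" if \<theta>: "\<theta> \<in> log_der_on P A" for \<theta>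
  proof -
    have \<theta>D: "\<theta> \<in> Der P" using \<theta> by (simp add: L)
    obtain g where g: "pair z \<theta> = linear_form z * g" using \<theta> unfolding L by (auto elim: dvdE)
    have fixpair: "pair a \<theta> \<in> fix_ring P" for a using Der_subst[OF \<theta>D] by (simp add: fix_ring_def)
    have g_fix: "g \<in> fix_ring P"
      using fix_ring_cancel[of "linear_form z" g P] fixpair[of z] g fix_ring_linear_form[OF zP] z0 by simp
    define c where "c j = (if j = 0 then pair x1 \<theta> - g * linear_form x1 else pair x2 \<theta> - g * linear_form x2)"
      for j :: nat
    have c_fix: "c j \<in> fix_ring P" for j
      unfolding c_def using g_fix fixpair fix_ring_linear_form[OF xP(1)] fix_ring_linear_form[OF xP(2)]
      by (auto intro!: fix_ring_diff fix_ring_mult)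
    have "\<theta> = g *s Euler P + (\<Sum>j<2. c j *s b j)"
    proof (rule der_eqI)
      fix a
      have "pair a \<theta> = mconst (dot a e1) * pair x1 \<theta> + mconst (dot a e2) * pair x2 \<theta> + mconst (dot a w) * pair z \<theta>"
        using Der_pair[OF \<theta>D, of a, symmetric] unfolding aP by simp
      then show "pair a \<theta> = pair a (g *s Euler P + (\<Sum>j<2. c j *s b j))"
        unfolding g sum2 by (simp add: c_def aP linear_form_add linear_form_scale algebra_simps)
    qed
    also have "\<dots> \<in> gspan P (Suc 2) (case_nat (Euler P) b)"
      by (rule gspan_case_natI) (use g_fix c_fix in auto)
    finally show ?thesis .
  qed
  moreover have "gindep P (Suc 2) (case_nat (Euler P) b)"
  proof (rule gindep_case_natI)
    fix f c assume "f *s Euler P + (\<Sum>j<2. c j *s b j) = 0"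
    then have eq: "pair a (f *s Euler P + (c 0 *s cvec e1 + c 1 *s cvec e2)) = 0" for a unfolding sum2 by simp
    have "f * linear_form z = 0" using eq[of z] zP ze by simp
    then have f: "f = 0" using mpoly_mult_eq_0[of f "linear_form z"] z0 by simp
    have "c 0 = 0" "c 1 = 0" using eq[of x1] eq[of x2] f D by simp_all
    then show "f = 0 \<and> (\<forall>j<2. c j = 0)" using f by (auto simp: less_2_cases_iff)
  qed
  ultimately show ?thesis unfolding euler_basis_def by blast
qed

text \<open>Some hyperplane through \<open>Y\<close> does not contain \<open>X\<close>; its trace on
  \<open>X\<close> contains \<open>Y\<close> and has the same dimension.\<close>

lemma flat_in_restriction:
  assumes Y: "Y \<in> int_lattice UNIV A" and X: "vec.subspace X" and A: "\<And>K. K \<in> A \<Longrightarrow> vec.subspace K"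
    and YX: "Y \<subset> X" and dim: "vec.dim Y + 1 = vec.dim X"
  shows "Y \<in> restriction A X"
proof -
  obtain S where S: "S \<subseteq> A" "Y = \<Inter>S" using Y by (auto simp: int_lattice_def)
  then obtain K where K: "K \<in> S" "\<not> X \<subseteq> K" using YX by blast
  have KX: "vec.subspace (K \<inter> X)" using K S A X by (intro vec.subspace_inter) auto
  have Ys: "vec.subspace Y" unfolding S(2) using S(1) A by (intro vec.subspace_Inter) auto
  have "vec.dim (K \<inter> X) < vec.dim X"
  proof (rule ccontr)
    assume "\<not> vec.dim (K \<inter> X) < vec.dim X"
    then have "K \<inter> X = X" using vec.subspace_dim_equal[OF KX X] by simp
    then show False using K by blast
  qed
  then have "vec.dim (K \<inter> X) \<le> vec.dim Y" using dim by simp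
  moreover have "Y \<subseteq> K \<inter> X" using K S YX by blast
  ultimately have "Y = K \<inter> X" using vec.subspace_dim_equal[OF Ys KX] by simp
  then show ?thesis using K S by (auto simp: restriction_def localization_def)
qed

section \<open>Translation to the given notion of freeness and descent of the flag\<close>

lemma log_der_eq: "log_der A = log_der_on (mat 1) A"
proof -
  have "form_of (mat 1) K a \<longleftrightarrow> covector_kernel a = K" for K :: "('k::field ^ 'n::finite) set" and a
    by (simp add: form_of_def pspace_def covector_kernel_def dot_def)
  then show ?thesis
    by (simp add: log_der_def log_der_on_def der_apply_linear_form) blast
qed

text \<open>Freeness asks for a set of derivations; independence makes the indexed family injective,
  so that its image has the right cardinality.\<close>

lemma free_arrangementI:
  fixes \<gamma> :: "'i \<Rightarrow> ('k::field, 'n::finite) der"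
  assumes I: "finite I" "card I = CARD('n)" and hom: "\<And>i. i \<in> I \<Longrightarrow> \<exists>d. vhom d (\<gamma> i)"
    and ind: "\<And>c. (\<Sum>i\<in>I. c i *s \<gamma> i) = 0 \<Longrightarrow> \<forall>i\<in>I. c i = 0"
    and span: "\<And>\<theta>. \<theta> \<in> log_der A \<longleftrightarrow> (\<exists>c. \<theta> = (\<Sum>i\<in>I. c i *s \<gamma> i))"
  shows "free_arrangement A"
proof -
  interpret M: module "(*s) :: ('k, 'n) mpoly \<Rightarrow> ('k, 'n) der \<Rightarrow> ('k, 'n) der" by (rule module_vec)
  have inj: "inj_on \<gamma> I"
  proof (rule inj_onI, rule ccontr)
    fix i j assume ij: "i \<in> I" "j \<in> I" "\<gamma> i = \<gamma> j" "i \<noteq> j"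
    let ?c = "\<lambda>k. if k = i then 1 else if k = j then - 1 else 0 :: ('k, 'n) mpoly"
    have "(\<Sum>k\<in>I. ?c k *s \<gamma> k) = (\<Sum>k\<in>{i, j}. ?c k *s \<gamma> k)"
      by (rule sum.mono_neutral_right) (use I ij in auto)
    also have "\<dots> = 0" using ij by simp
    finally have "?c i = 0" using ind[of ?c] ij(1) by blast
    then show False by simp
  qed
  have reindex: "(\<Sum>v\<in>\<gamma> ` I. u v *s v) = (\<Sum>i\<in>I. u (\<gamma> i) *s \<gamma> i)" for u
    using sum.reindex[OF inj] by simp
  have "der_homogeneous (\<gamma> i)" if i: "i \<in> I" for i
  proof -
    obtain d where "vhom d (\<gamma> i)" using hom[OF i] by blast
    then have "mhomogeneous d (pair (axis j 1) (\<gamma> i))" for j by (rule vhom_pair)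
    then show ?thesis unfolding der_homogeneous_def by auto
  qed
  moreover have "card (\<gamma> ` I) = CARD('n)" using card_image[OF inj] I by simp
  moreover have "\<not> M.dependent (\<gamma> ` I)"
  proof -
    have "\<forall>i\<in>I. u (\<gamma> i) = 0" if "(\<Sum>i\<in>I. u (\<gamma> i) *s \<gamma> i) = 0" for u
      by (rule ind) (rule that)
    then show ?thesis unfolding M.dependent_finite[OF finite_imageI[OF I(1)]] reindex by blast
  qed
  moreover have "M.span (\<gamma> ` I) = log_der A"
  proof (intro equalityI subsetI)
    fix \<theta> assume "\<theta> \<in> M.span (\<gamma> ` I)"
    then obtain u where "\<theta> = (\<Sum>i\<in>I. u (\<gamma> i) *s \<gamma> i)"
      unfolding M.span_finite[OF finite_imageI[OF I(1)]] reindex by (elim rangeE)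
    then have "\<exists>c. \<theta> = (\<Sum>i\<in>I. c i *s \<gamma> i)" by (rule exI[of _ "\<lambda>i. u (\<gamma> i)"])
    then show "\<theta> \<in> log_der A" unfolding span .
  next
    fix \<theta> assume "\<theta> \<in> log_der A"
    then obtain c where "\<theta> = (\<Sum>i\<in>I. c i *s \<gamma> i)" using span by blast
    moreover have "(\<Sum>i\<in>I. c i *s \<gamma> i) \<in> M.span (\<gamma> ` I)"
      by (intro M.span_sum M.span_scale M.span_base imageI)
    ultimately show "\<theta> \<in> M.span (\<gamma> ` I)" by simp
  qed
  ultimately show ?thesis unfolding free_arrangement_def by blast
qed

lemma free_arrangement_empty: "free_arrangement ({} :: ('k::field ^ 'n::finite) set set)"
proof (rule free_arrangementI[where I = UNIV and \<gamma> = "\<lambda>i :: 'n. cvec (axis i 1)"])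
  have comp: "(\<Sum>i\<in>UNIV. c i *s cvec (axis i 1 :: 'k ^ 'n)) = (\<chi> i. c i)" for c :: "'n \<Rightarrow> ('k, 'n) mpoly"
    by (simp add: vec_eq_iff cvec_def axis_def if_distrib[of mconst] if_distrib[of "(*) _"] cong: if_cong)
  show "\<forall>i\<in>UNIV. c i = 0" if "(\<Sum>i\<in>UNIV. c i *s cvec (axis i 1 :: 'k ^ 'n)) = 0" for c
    using that unfolding comp by (simp add: vec_eq_iff)
  show "\<theta> \<in> log_der {} \<longleftrightarrow> (\<exists>c. \<theta> = (\<Sum>i\<in>UNIV. c i *s cvec (axis i 1 :: 'k ^ 'n)))" for \<theta>
  proof -
    have "\<theta> = (\<Sum>i\<in>UNIV. \<theta> $ i *s cvec (axis i 1))" unfolding comp by simp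
    then have "\<exists>c. \<theta> = (\<Sum>i\<in>UNIV. c i *s cvec (axis i 1 :: 'k ^ 'n))"
      by (rule exI[of _ "\<lambda>i. \<theta> $ i"])
    then show ?thesis by (simp add: log_der_def)
  qed
  show "\<exists>d. vhom d (cvec (axis i 1 :: 'k ^ 'n))" for i by (rule exI, rule vhom_cvec)
qed auto

lemma free_of_euler_basis:
  fixes A :: "('k::field ^ 'n::finite) set set"
  assumes b: "euler_basis (mat 1) (log_der A) m b" and m: "Suc m = CARD('n)"
  shows "free_arrangement A"
proof (rule free_arrangementI[where I = "{..<Suc m}" and \<gamma> = "case_nat (Euler (mat 1)) b"])
  let ?\<gamma> = "case_nat (Euler (mat 1)) b"
  have fix_all: "f \<in> fix_ring (mat 1)" for f :: "('k, 'n) mpoly" by (simp add: fix_ring_def)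
  show "\<exists>d. vhom d (?\<gamma> j)" if "j \<in> {..<Suc m}" for j
    using that b vhom_Euler unfolding euler_basis_def by (cases j) auto
  show "\<forall>j\<in>{..<Suc m}. c j = 0" if "(\<Sum>j<Suc m. c j *s ?\<gamma> j) = 0" for c
    using that b fix_all unfolding euler_basis_def gindep_def by blast
  have mem: "?\<gamma> j \<in> log_der A" if "j < Suc m" for j
    using that b by (cases j) (auto simp: euler_basis_def log_der_def der_apply_linear_form)
  show "\<theta> \<in> log_der A \<longleftrightarrow> (\<exists>c. \<theta> = (\<Sum>j<Suc m. c j *s ?\<gamma> j))" for \<theta>
  proof
    assume "\<theta> \<in> log_der A"
    then have "\<theta> \<in> gspan (mat 1) (Suc m) ?\<gamma>" using b unfolding euler_basis_def by blast
    then show "\<exists>c. \<theta> = (\<Sum>j<Suc m. c j *s ?\<gamma> j)" unfolding gspan_def by blast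
  next
    assume "\<exists>c. \<theta> = (\<Sum>j<Suc m. c j *s ?\<gamma> j)"
    then obtain c where c: "\<theta> = (\<Sum>j<Suc m. c j *s ?\<gamma> j)" by blast
    show "\<theta> \<in> log_der A"
      unfolding log_der_def
    proof (intro CollectI ballI allI impI)
      fix H a assume H: "H \<in> A" "covector_kernel a = H"
      have "linear_form a dvd c j * pair a (?\<gamma> j)" if "j < Suc m" for j
        using mem[OF that] H unfolding log_der_def der_apply_linear_form by (intro dvd_mult) blast
      then have "linear_form a dvd (\<Sum>j<Suc m. c j * pair a (?\<gamma> j))" by (intro dvd_sum) auto
      then show "linear_form a dvd der_apply \<theta> (linear_form a)"
        unfolding c der_apply_linear_form pair_sum by simp
    qed
  qed
qed (use m in auto)

text \<open>Induction from the two-dimensional \<open>X l\<close> upwards; \<open>P\<close> is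
  arbitrary because each step produces its own projection onto \<open>X (Suc i)\<close>. The
  restriction to \<open>X (Suc i)\<close> can be empty only if \<open>Suc i = l\<close>, as
  otherwise the next flat of the flag belongs to it; \<open>single_log_der_free\<close> covers that
  case.\<close>

lemma flag_log_der_free:
  fixes A :: "('k::field ^ 'n::finite) set set" and X :: "nat \<Rightarrow> ('k ^ 'n) set"
  assumes sub: "\<And>i. i \<le> l \<Longrightarrow> vec.subspace (X i)" and A: "\<And>K. K \<in> A \<Longrightarrow> vec.subspace K"
    and lat: "\<And>i. i \<le> l \<Longrightarrow> X i \<in> int_lattice UNIV A"
    and dim: "\<And>i. i \<le> l \<Longrightarrow> vec.dim (X i) + i = l + 2"
    and flag: "\<And>i. i < l \<Longrightarrow> X (Suc i) \<subset> X i"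
    and dvd: "\<And>i. i < l \<Longrightarrow> arr_charpoly (X (Suc i)) (restriction A (X (Suc i))) dvd
      arr_charpoly (X i) (restriction A (X i))"
    and "i \<le> l" "P ** P = P" "pspace P = X i" "central_arrangement (X i) (restriction A (X i))"
      "restriction A (X i) \<noteq> {}"
  shows "\<exists>b. euler_basis P (log_der_on P (restriction A (X i))) (Suc (l - i)) b"
  using assms(7-)
proof (induction i arbitrary: P rule: inc_induct)
  case base
  then show ?case using rank2_log_der_free[of P "restriction A (X l)"] dim[of l] by simp
next
  case (step i)
  let ?B = "\<lambda>i. restriction A (X i)"
  have next_flat: "X (Suc j) \<in> ?B j" if "j < l" for j
  proof (rule flat_in_restriction)
    show "X (Suc j) \<in> int_lattice UNIV A" "vec.subspace (X j)" "X (Suc j) \<subset> X j"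
      using that lat sub flag by simp_all
    show "vec.dim (X (Suc j)) + 1 = vec.dim (X j)" using dim[of j] dim[of "Suc j"] that by simp
  qed (rule A)
  have il: "i < l" using step.hyps by simp
  interpret H: arr_hyp P "?B i" "X (Suc i)"
    by unfold_locales (use step.prems next_flat[OF il] in simp_all)
  have R: "restriction (?B i) (X (Suc i)) = ?B (Suc i)"
    using flag[OF il] by (intro restriction_restriction) blast
  have central: "central_arrangement (X (Suc i)) (?B (Suc i))" using H.central_RH unfolding R .
  have dims: "vec.dim (X i) + i = l + 2" "vec.dim (X (Suc i)) + Suc i = l + 2"
    using dim[of i] dim[of "Suc i"] il by simp_all
  show ?case
  proof (cases "?B (Suc i) = {}")
    case True
    have "Suc i = l"
    proof (rule ccontr)
      assume "Suc i \<noteq> l"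
      then show False using next_flat[of "Suc i"] il True by simp
    qed
    moreover have "?B i = {X (Suc i)}"
      using True R H.RH_eq next_flat[OF il] by auto
    ultimately have "\<exists>b. euler_basis P (log_der_on P (?B i)) 2 b"
      using dims by (intro H.single_log_der_free) simp_all
    moreover have "Suc (l - i) = 2" using \<open>Suc i = l\<close> by auto
    ultimately show ?thesis by (simp only:)
  next
    case False
    have "\<exists>b. euler_basis H.S0.Q (log_der_on H.S0.Q (?B (Suc i))) (Suc (l - Suc i)) b"
      by (rule step.IH[OF H.S0.QQ H.pspace_Q central False])
    moreover have "Suc (l - Suc i) = l - i" using il by simp
    ultimately obtain b where b: "euler_basis H.S0.Q (log_der_on H.S0.Q (?B (Suc i))) (l - i) b" by auto
    have "betti2 (?B i) = betti2 (?B (Suc i)) + int (card (?B (Suc i))) * (int (card (?B i)) - int (card (?B (Suc i))))"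
      by (rule betti2_of_charpoly_dvd[OF step.prems(3) central _ _ dvd[OF il]]) (use dims il in simp_all)
    then show ?thesis
      by (rule H.hyp_step[unfolded R, OF _ False _ b]) (use dims il in simp)
  qed
qed

theorem theorem1p3:
  fixes A :: "('k::field ^ 'n::finite) set set"
    and X :: "nat \<Rightarrow> ('k ^ 'n) set"
  assumes "CARD('n) \<ge> 2"
    and "central_arrangement UNIV A"
    and "X 0 = UNIV"
    and "\<And>i. i < CARD('n) - 2 \<Longrightarrow> X (i + 1) \<subset> X i"
    and "\<And>i. i \<le> CARD('n) - 2 \<Longrightarrow> X i \<in> int_lattice_codim UNIV A i"
    and "\<And>i. i < CARD('n) - 2 \<Longrightarrow>
           arr_charpoly (X (i + 1)) (restriction A (X (i + 1))) dvd
           arr_charpoly (X i) (restriction A (X i))"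
  shows "free_arrangement A"
proof (cases "A = {}")
  case True
  then show ?thesis using free_arrangement_empty by simp
next
  case False
  note arr = assms(2)
  let ?l = "CARD('n) - 2"
  have lat: "X i \<in> int_lattice UNIV A" "vec.dim (X i) + i = CARD('n)" if "i \<le> ?l" for i
    using assms(5)[OF that] by (simp_all add: int_lattice_codim_def vec_dim_card del: vec.dim_UNIV)
  have R0: "restriction A UNIV = A"
  proof -
    have "K \<noteq> UNIV" if "K \<in> A" for K
    proof
      assume "K = UNIV"
      then show False using A_dim[OF arr that] by simp
    qed
    then show ?thesis by (auto simp: restriction_def localization_def)
  qed
  have "\<exists>b. euler_basis (mat 1) (log_der_on (mat 1) (restriction A (X 0))) (Suc (?l - 0)) b"
  proof (rule flag_log_der_free[where X = X and A = A and i = 0 and l = ?l])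
    show "vec.subspace (X i)" if "i \<le> ?l" for i using lattice_subspace[OF arr lat(1)[OF that]] .
    show "vec.subspace K" if "K \<in> A" for K using A_subspace[OF arr that] .
    show "vec.dim (X i) + i = ?l + 2" if "i \<le> ?l" for i using lat(2)[OF that] assms(1) by simp
    show "X (Suc i) \<subset> X i" if "i < ?l" for i using assms(4)[OF that] by simp
    show "arr_charpoly (X (Suc i)) (restriction A (X (Suc i))) dvd arr_charpoly (X i) (restriction A (X i))"
      if "i < ?l" for i using assms(6)[OF that] by simp
    show "pspace (mat 1) = X 0" using assms(3) by (simp add: pspace_def)
    show "central_arrangement (X 0) (restriction A (X 0))" "restriction A (X 0) \<noteq> {}"
      using arr False assms(3) R0 by simp_all
  qed (use lat in simp_all)
  then obtain b where "euler_basis (mat 1) (log_der A) (Suc ?l) b"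
    using R0 assms(3) by (auto simp: log_der_eq)
  then show ?thesis by (rule free_of_euler_basis) (use assms(1) in simp)
qed


end
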